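(* Let $\mathbb G$ be a Carnot group in exponential coordinates on $\mathbb{R}^n$ with horizontal vector fields $X_1,\dots,X_m$, and let $\Omega\subset\mathbb{R}^n$ be a bounded open set with $X$-Lipschitz boundary. If $u,\mathbf z$ satisfy condition (a) or (b) below, then $$\int_\Omega u\,\mathrm{div}_X(\mathbf z)\,d\mathcal L^n+\int_\Omega(\mathbf z,Xu)=\int_{\partial\Omega}[\mathbf z\cdot\nu]_X\,Tu\,d|\partial\Omega|_X.$$ If $u,\mathbf z$ satisfy condition (c), then $$\int_\Omega u\,d\,\mathrm{div}_X(\mathbf z)+\int_\Omega(\mathbf z,Xu)=\int_{\partial\Omega}[\mathbf z\cdot\nu]_X\,Tu\,d|\partial\Omega|_X.$$
   Context: Carnot group: finite-dimensional, connected, simply connected Lie group with stratified Lie algebra, identified with $\mathbb{R}^n$ by exponential coordinates relative to an adapted basis; $X_1,\dots,X_m$ span the first layer. $\mathrm{div}_Xg=\sum_jX_jg_j$. $BV_X(\Omega)$: $u\in L^1$ with horizontal gradient $Xu$ a finite Radon measure; $BV^c_X=BV_X\cap L^\infty\cap C$; $DM_X(\Omega)=\{\mathbf z\in L^\infty(\Omega;\mathbb{R}^m):\mathrm{div}_X\mathbf z$ finite measure$\}$. Conditions: (a) $u\in BV_X(\Omega)\cap L^\infty(\Omega)$, $\mathbf z\in DM_X(\Omega)$, $\mathrm{div}_X\mathbf z\in L^1(\Omega)$; (b) $u\in BV_X(\Omega)\cap L^q(\Omega)$, $\mathbf z\in DM_X(\Omega)$, $\mathrm{div}_X\mathbf z\in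 L^p(\Omega)$, $1<p\le n$, $1/p+1/q=1$; (c) $u\in BV^c_X(\Omega)$, $\mathbf z\in DM_X(\Omega)$. The pairing $(\mathbf z,Xu)$ is the Radon measure on $\Omega$ defined on $\varphi\in C_c^\infty(\Omega)$ by $\langle(\mathbf z,Xu),\varphi\rangle=-\int_\Omega u\varphi\,d(\mathrm{div}_X\mathbf z)-\int_\Omega u\,\mathbf z\cdot X\varphi\,d\mathcal L^n$. $|\partial\Omega|_X$ is the $X$-perimeter measure of $\Omega$, $\nu_\Omega$ the horizontal inner normal, $T$ the trace operator $BV_X(\Omega)\to L^1(\partial\Omega,|\partial\Omega|_X)$ (in the sense of Vittone, for $X$-Lipschitz domains). $[\mathbf z\cdot\nu]_X\in L^\infty(\partial\Omega,|\partial\Omega|_X)$ is the weak horizontal normal trace of $\mathbf z\in DM_X(\Omega)$: the unique function with $\int_\Omega v\,d(\mathrm{div}_X\mathbf z)+\int_\Omega\mathbf z\cdot Xv\,d\mathcal L^n=\int_{\partial\Omega}Tv\,[\mathbf z\cdot\nu]_X\,d|\partial\Omega|_X$ for all $v\in BV_X^c(\Omega)\cap W^{1,1}_X(\Omega)$; it equals $\mathbf z\cdot\nu_\Omega$ when $\mathbf z\in C^1(\overline\Omega;\mathbb{R}^m)$. *)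

theory Defs
  imports "HOL-Analysis.Analysis"
begin

definition pderiv_dir :: "('a::real_normed_vector \<Rightarrow> real) \<Rightarrow> 'a \<Rightarrow> 'a \<Rightarrow> real" where
  "pderiv_dir f b x = deriv (\<lambda>t. f (x + t *\<^sub>R b)) 0"

fun iter_pd :: "'a::real_normed_vector list \<Rightarrow> ('a \<Rightarrow> real) \<Rightarrow> 'a \<Rightarrow> real" where
  "iter_pd [] f = f"
| "iter_pd (b # bs) f = pderiv_dir (iter_pd bs f) b"

definition C_inf :: "('a::euclidean_space \<Rightarrow> real) \<Rightarrow> bool" where
  "C_inf f \<longleftrightarrow> (\<forall>bs. set bs \<subseteq> Basis \<longrightarrow>
      continuous_on UNIV (iter_pd bs f) \<and>
      (\<forall>b\<in>Basis. \<forall>x. (\<lambda>t. iter_pd bs f (x + t *\<^sub>R b)) differentiable (at 0)))"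

definition Hor :: "('n \<Rightarrow> nat) \<Rightarrow> 'n set" where
  "Hor deg = {i. deg i = 1}"

definition lfield :: "(real^'n \<Rightarrow> real^'n \<Rightarrow> real^'n) \<Rightarrow> real^'n \<Rightarrow> real^'n \<Rightarrow> real^'n" where
  "lfield gm x p = (\<chi> i. deriv (\<lambda>t. gm p (t *\<^sub>R x) $ i) 0)"

definition vbracket :: "(real^'n \<Rightarrow> real^'n) \<Rightarrow> (real^'n \<Rightarrow> real^'n) \<Rightarrow> real^'n \<Rightarrow> real^'n" where
  "vbracket A B p = (\<chi> i. (\<Sum>k\<in>UNIV. A p $ k * pderiv_dir (\<lambda>q. B q $ i) (axis k 1) p
                                  - B p $ k * pderiv_dir (\<lambda>q. A q $ i) (axis k 1) p))"

definition layer :: "(real^'n \<Rightarrow> real^'n \<Rightarrow> real^'n) \<Rightarrow> ('n \<Rightarrow> nat) \<Rightarrow> nat \<Rightarrow> (real^'n \<Rightarrow> real^'n) set" where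
  "layer gm deg k = {(\<lambda>p. \<Sum>i\<in>{i. deg i = k}. c i *\<^sub>R lfield gm (axis i 1) p) | c. True}"

definition bracket_layer :: "(real^'n \<Rightarrow> real^'n \<Rightarrow> real^'n) \<Rightarrow> ('n \<Rightarrow> nat) \<Rightarrow> nat \<Rightarrow> (real^'n \<Rightarrow> real^'n) set" where
  "bracket_layer gm deg k =
     {(\<lambda>p. \<Sum>ij\<in>{i. deg i = 1} \<times> {j. deg j = k}.
          c ij *\<^sub>R vbracket (lfield gm (axis (fst ij) 1)) (lfield gm (axis (snd ij) 1)) p) | c. True}"

text \<open>(R^n, gm) is a Carnot group written in exponential coordinates relative to an
  adapted basis e_i, the basis vector e_i lying in the layer of degree deg i:
  gm is a smooth associative law, rays t \<mapsto> tx are one-parameter subgroups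
  (exponential coordinates; 0 is the identity, -x the inverse), and the Lie algebra
  of left-invariant fields is stratified: V_(k+1) = [V_1,V_k] for all k \<ge> 1.\<close>
definition carnot_group :: "(real^'n \<Rightarrow> real^'n \<Rightarrow> real^'n) \<Rightarrow> ('n \<Rightarrow> nat) \<Rightarrow> bool" where
  "carnot_group gm deg \<longleftrightarrow>
     (\<forall>x y w. gm (gm x y) w = gm x (gm y w)) \<and>
     (\<forall>x s t. gm (s *\<^sub>R x) (t *\<^sub>R x) = (s + t) *\<^sub>R x) \<and>
     (\<forall>i. C_inf (\<lambda>(x, y). gm x y $ i)) \<and>
     (\<forall>i. 1 \<le> deg i) \<and>
     (\<forall>k\<ge>1. layer gm deg (Suc k) = bracket_layer gm deg k)"

definition Xop :: "(real^'n \<Rightarrow> real^'n \<Rightarrow> real^'n) \<Rightarrow> 'n \<Rightarrow> (real^'n \<Rightarrow> real) \<Rightarrow> real^'n \<Rightarrow> real" where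
  "Xop gm j f p = deriv (\<lambda>t. f (gm p (t *\<^sub>R axis j 1))) 0"

definition divX :: "(real^'n \<Rightarrow> real^'n \<Rightarrow> real^'n) \<Rightarrow> ('n \<Rightarrow> nat) \<Rightarrow> ('n \<Rightarrow> real^'n \<Rightarrow> real) \<Rightarrow> real^'n \<Rightarrow> real" where
  "divX gm deg g x = (\<Sum>j\<in>Hor deg. Xop gm j (g j) x)"

definition test_on :: "(real^'n) set \<Rightarrow> (real^'n \<Rightarrow> real) \<Rightarrow> bool" where
  "test_on \<Omega> \<phi> \<longleftrightarrow> C_inf \<phi> \<and> compact (closure {x. \<phi> x \<noteq> 0}) \<and> closure {x. \<phi> x \<noteq> 0} \<subseteq> \<Omega>"

definition hnorm :: "('n \<Rightarrow> nat) \<Rightarrow> real^'n \<Rightarrow> real" where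
  "hnorm deg x = (\<Sum>i\<in>UNIV. \<bar>x $ i\<bar> powr (1 / real (deg i)))"

definition horizontal_unit :: "('n \<Rightarrow> nat) \<Rightarrow> real^'n \<Rightarrow> bool" where
  "horizontal_unit deg v \<longleftrightarrow> norm v = 1 \<and> (\<forall>i. deg i \<noteq> 1 \<longrightarrow> v $ i = 0)"

text \<open>Component in the vertical subgroup W_v = {w. w\<bullet>v = 0} of x = w \<cdot> ((x\<bullet>v) v).\<close>
definition wproj :: "(real^'n \<Rightarrow> real^'n \<Rightarrow> real^'n) \<Rightarrow> real^'n \<Rightarrow> real^'n \<Rightarrow> real^'n" where
  "wproj gm v x = gm x (- (x \<bullet> v) *\<^sub>R v)"

definition intrinsic_lipschitz ::
  "(real^'n \<Rightarrow> real^'n \<Rightarrow> real^'n) \<Rightarrow> ('n \<Rightarrow> nat) \<Rightarrow> real^'n \<Rightarrow> (real^'n \<Rightarrow> real) \<Rightarrow> real \<Rightarrow> bool" where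
  "intrinsic_lipschitz gm deg v f L \<longleftrightarrow>
     (\<forall>w w'. w \<bullet> v = 0 \<longrightarrow> w' \<bullet> v = 0 \<longrightarrow>
        (let p = gm w (f w *\<^sub>R v); q = gm w' (f w' *\<^sub>R v); d = gm (- p) q
         in \<bar>d \<bullet> v\<bar> \<le> L * hnorm deg (wproj gm v d)))"

definition X_lipschitz_domain :: "(real^'n \<Rightarrow> real^'n \<Rightarrow> real^'n) \<Rightarrow> ('n \<Rightarrow> nat) \<Rightarrow> (real^'n) set \<Rightarrow> bool" where
  "X_lipschitz_domain gm deg \<Omega> \<longleftrightarrow>
     (\<forall>p\<in>frontier \<Omega>. \<exists>v U f L. horizontal_unit deg v \<and> open U \<and> p \<in> U \<and>
        intrinsic_lipschitz gm deg v f L \<and>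
        \<Omega> \<inter> U = {x\<in>U. x \<bullet> v > f (wproj gm v x)})"

definition Lp_on :: "(real^'n) set \<Rightarrow> real \<Rightarrow> (real^'n \<Rightarrow> real) \<Rightarrow> bool" where
  "Lp_on \<Omega> p f \<longleftrightarrow> f \<in> borel_measurable (lebesgue_on \<Omega>) \<and>
     integrable (lebesgue_on \<Omega>) (\<lambda>x. \<bar>f x\<bar> powr p)"

definition Linf_on :: "(real^'n) set \<Rightarrow> (real^'n \<Rightarrow> real) \<Rightarrow> bool" where
  "Linf_on \<Omega> f \<longleftrightarrow> f \<in> borel_measurable (lebesgue_on \<Omega>) \<and>
     (\<exists>C. AE x in lebesgue_on \<Omega>. \<bar>f x\<bar> \<le> C)"

text \<open>Finite (positive) Borel measure concentrated on Omega; a finite signed Radon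
  measure on Omega is represented as a difference P - N of two such measures.\<close>
definition fin_meas_on :: "(real^'n) set \<Rightarrow> (real^'n) measure \<Rightarrow> bool" where
  "fin_meas_on \<Omega> P \<longleftrightarrow> sets P = sets borel \<and> finite_measure P \<and> emeasure P (UNIV - \<Omega>) = 0"

text \<open>X_j u = P - N in the sense of distributions on Omega (X_j^* = -X_j on Carnot groups).\<close>
definition Xderiv_meas :: "(real^'n \<Rightarrow> real^'n \<Rightarrow> real^'n) \<Rightarrow> (real^'n) set \<Rightarrow> 'n \<Rightarrow> (real^'n \<Rightarrow> real)
    \<Rightarrow> (real^'n) measure \<Rightarrow> (real^'n) measure \<Rightarrow> bool" where
  "Xderiv_meas gm \<Omega> j u P N \<longleftrightarrow> fin_meas_on \<Omega> P \<and> fin_meas_on \<Omega> N \<and>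
     (\<forall>\<phi>. test_on \<Omega> \<phi> \<longrightarrow>
        (LINT x:\<Omega>|lebesgue. u x * Xop gm j \<phi> x) = - ((LINT x:\<Omega>|P. \<phi> x) - (LINT x:\<Omega>|N. \<phi> x)))"

definition BV_X :: "(real^'n \<Rightarrow> real^'n \<Rightarrow> real^'n) \<Rightarrow> ('n \<Rightarrow> nat) \<Rightarrow> (real^'n) set \<Rightarrow> (real^'n \<Rightarrow> real) \<Rightarrow> bool" where
  "BV_X gm deg \<Omega> u \<longleftrightarrow> integrable (lebesgue_on \<Omega>) u \<and>
     (\<forall>j\<in>Hor deg. \<exists>P N. Xderiv_meas gm \<Omega> j u P N)"

definition BVc_X :: "(real^'n \<Rightarrow> real^'n \<Rightarrow> real^'n) \<Rightarrow> ('n \<Rightarrow> nat) \<Rightarrow> (real^'n) set \<Rightarrow> (real^'n \<Rightarrow> real) \<Rightarrow> bool" where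
  "BVc_X gm deg \<Omega> u \<longleftrightarrow> BV_X gm deg \<Omega> u \<and> Linf_on \<Omega> u \<and> continuous_on \<Omega> u"

definition W11_X :: "(real^'n \<Rightarrow> real^'n \<Rightarrow> real^'n) \<Rightarrow> ('n \<Rightarrow> nat) \<Rightarrow> (real^'n) set \<Rightarrow> (real^'n \<Rightarrow> real)
    \<Rightarrow> ('n \<Rightarrow> real^'n \<Rightarrow> real) \<Rightarrow> bool" where
  "W11_X gm deg \<Omega> u h \<longleftrightarrow> integrable (lebesgue_on \<Omega>) u \<and>
     (\<forall>j\<in>Hor deg. integrable (lebesgue_on \<Omega>) (h j) \<and>
        (\<forall>\<phi>. test_on \<Omega> \<phi> \<longrightarrow>
           (LINT x:\<Omega>|lebesgue. u x * Xop gm j \<phi> x) = - (LINT x:\<Omega>|lebesgue. h j x * \<phi> x)))"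

definition divX_meas :: "(real^'n \<Rightarrow> real^'n \<Rightarrow> real^'n) \<Rightarrow> ('n \<Rightarrow> nat) \<Rightarrow> (real^'n) set \<Rightarrow> (real^'n \<Rightarrow> real^'n)
    \<Rightarrow> (real^'n) measure \<Rightarrow> (real^'n) measure \<Rightarrow> bool" where
  "divX_meas gm deg \<Omega> z Pd Nd \<longleftrightarrow> fin_meas_on \<Omega> Pd \<and> fin_meas_on \<Omega> Nd \<and>
     (\<forall>\<phi>. test_on \<Omega> \<phi> \<longrightarrow>
        (LINT x:\<Omega>|Pd. \<phi> x) - (LINT x:\<Omega>|Nd. \<phi> x)
          = - (LINT x:\<Omega>|lebesgue. (\<Sum>j\<in>Hor deg. z x $ j * Xop gm j \<phi> x)))"

definition divX_density :: "(real^'n \<Rightarrow> real^'n \<Rightarrow> real^'n) \<Rightarrow> ('n \<Rightarrow> nat) \<Rightarrow> (real^'n) set \<Rightarrow> (real^'n \<Rightarrow> real^'n)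
    \<Rightarrow> (real^'n \<Rightarrow> real) \<Rightarrow> bool" where
  "divX_density gm deg \<Omega> z f \<longleftrightarrow> f \<in> borel_measurable (lebesgue_on \<Omega>) \<and>
     (\<forall>\<phi>. test_on \<Omega> \<phi> \<longrightarrow>
        (LINT x:\<Omega>|lebesgue. f x * \<phi> x)
          = - (LINT x:\<Omega>|lebesgue. (\<Sum>j\<in>Hor deg. z x $ j * Xop gm j \<phi> x)))"

definition DM_X :: "(real^'n \<Rightarrow> real^'n \<Rightarrow> real^'n) \<Rightarrow> ('n \<Rightarrow> nat) \<Rightarrow> (real^'n) set \<Rightarrow> (real^'n \<Rightarrow> real^'n) \<Rightarrow> bool" where
  "DM_X gm deg \<Omega> z \<longleftrightarrow> (\<forall>j\<in>Hor deg. Linf_on \<Omega> (\<lambda>x. z x $ j)) \<and> (\<exists>Pd Nd. divX_meas gm deg \<Omega> z Pd Nd)"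

text \<open>Polar decomposition X chi_Omega = nu |d Omega|_X: Pper is the X-perimeter measure,
  nu the horizontal inner unit normal.\<close>
definition perimeter_measure :: "(real^'n \<Rightarrow> real^'n \<Rightarrow> real^'n) \<Rightarrow> ('n \<Rightarrow> nat) \<Rightarrow> (real^'n) set
    \<Rightarrow> (real^'n) measure \<Rightarrow> (real^'n \<Rightarrow> real^'n) \<Rightarrow> bool" where
  "perimeter_measure gm deg \<Omega> Pper \<nu> \<longleftrightarrow>
     sets Pper = sets borel \<and> finite_measure Pper \<and> emeasure Pper (UNIV - frontier \<Omega>) = 0 \<and>
     \<nu> \<in> borel_measurable borel \<and> (\<forall>x i. deg i \<noteq> 1 \<longrightarrow> \<nu> x $ i = 0) \<and>
     (AE x in Pper. norm (\<nu> x) = 1) \<and>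
     (\<forall>g. (\<forall>j\<in>Hor deg. test_on UNIV (g j)) \<longrightarrow>
        (LINT x:\<Omega>|lebesgue. divX gm deg g x) = - (LINT x|Pper. (\<Sum>j\<in>Hor deg. g j x * \<nu> x $ j)))"

definition is_trace :: "(real^'n \<Rightarrow> real^'n \<Rightarrow> real^'n) \<Rightarrow> ('n \<Rightarrow> nat) \<Rightarrow> (real^'n) set
    \<Rightarrow> (real^'n) measure \<Rightarrow> (real^'n \<Rightarrow> real^'n) \<Rightarrow> (real^'n \<Rightarrow> real) \<Rightarrow> (real^'n \<Rightarrow> real) \<Rightarrow> bool" where
  "is_trace gm deg \<Omega> Pper \<nu> u t \<longleftrightarrow>
     t \<in> borel_measurable Pper \<and> integrable Pper t \<and>
     (\<exists>PN. (\<forall>j\<in>Hor deg. Xderiv_meas gm \<Omega> j u (fst (PN j)) (snd (PN j))) \<and>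
        (\<forall>g. (\<forall>j\<in>Hor deg. test_on UNIV (g j)) \<longrightarrow>
           (LINT x:\<Omega>|lebesgue. u x * divX gm deg g x)
             = - (\<Sum>j\<in>Hor deg. (LINT x:\<Omega>|fst (PN j). g j x) - (LINT x:\<Omega>|snd (PN j). g j x))
               - (LINT x|Pper. t x * (\<Sum>j\<in>Hor deg. g j x * \<nu> x $ j))))"

definition weak_normal_trace :: "(real^'n \<Rightarrow> real^'n \<Rightarrow> real^'n) \<Rightarrow> ('n \<Rightarrow> nat) \<Rightarrow> (real^'n) set
    \<Rightarrow> (real^'n) measure \<Rightarrow> (real^'n \<Rightarrow> real^'n) \<Rightarrow> (real^'n \<Rightarrow> real^'n) \<Rightarrow> (real^'n \<Rightarrow> real) \<Rightarrow> bool" where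
  "weak_normal_trace gm deg \<Omega> Pper \<nu> z \<theta> \<longleftrightarrow>
     \<theta> \<in> borel_measurable Pper \<and> (\<exists>C. AE x in Pper. \<bar>\<theta> x\<bar> \<le> C) \<and>
     (\<forall>Pd Nd. divX_meas gm deg \<Omega> z Pd Nd \<longrightarrow>
        (\<forall>v h tv. BVc_X gm deg \<Omega> v \<and> W11_X gm deg \<Omega> v h \<and> is_trace gm deg \<Omega> Pper \<nu> v tv \<longrightarrow>
           (LINT x:\<Omega>|Pd. v x) - (LINT x:\<Omega>|Nd. v x)
             + (LINT x:\<Omega>|lebesgue. (\<Sum>j\<in>Hor deg. z x $ j * h j x))
           = (LINT x|Pper. tv x * \<theta> x)))"

text \<open>(z, Xu) = Pm - Nm as a finite signed measure on Omega; D g stands for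
  int_Omega g d(div_X z).\<close>
definition pairing_meas :: "(real^'n \<Rightarrow> real^'n \<Rightarrow> real^'n) \<Rightarrow> ('n \<Rightarrow> nat) \<Rightarrow> (real^'n) set
    \<Rightarrow> (real^'n \<Rightarrow> real) \<Rightarrow> (real^'n \<Rightarrow> real^'n) \<Rightarrow> ((real^'n \<Rightarrow> real) \<Rightarrow> real)
    \<Rightarrow> (real^'n) measure \<Rightarrow> (real^'n) measure \<Rightarrow> bool" where
  "pairing_meas gm deg \<Omega> u z D Pm Nm \<longleftrightarrow> fin_meas_on \<Omega> Pm \<and> fin_meas_on \<Omega> Nm \<and>
     (\<forall>\<phi>. test_on \<Omega> \<phi> \<longrightarrow>
        (LINT x:\<Omega>|Pm. \<phi> x) - (LINT x:\<Omega>|Nm. \<phi> x)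
          = - D (\<lambda>x. u x * \<phi> x)
            - (LINT x:\<Omega>|lebesgue. u x * (\<Sum>j\<in>Hor deg. z x $ j * Xop gm j \<phi> x)))"

end

theory Submission
  imports Defs "HOL-Computational_Algebra.Polynomial"
begin

text \<open>
  Write \<open>v = \<Sum>i. \<rho>\<^sub>i * (u \<zeta>\<^sub>i)\<close> with a partition of unity \<open>\<zeta>\<^sub>i\<close> of \<open>\<Omega>\<close> and Euclidean
  mollifiers at sufficiently small scales. Since the commutator of mollification with a smooth vector
  field is bounded on \<open>L\<^sup>1\<close> uniformly in the scale, \<open>v\<close> belongs to \<open>W\<^sup>1\<^sup>,\<^sup>1\<close>, and summing over \<open>i\<close> the
  identities satisfied by the test functions \<open>\<rho>\<^sub>i * (u \<zeta>\<^sub>i)\<close> and \<open>\<zeta>\<^sub>i\<close> shows that \<open>v\<close> has exactly the trace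
  of \<open>u\<close> and that the left-hand side of the Gauss--Green formula is the same for \<open>u\<close> and for \<open>v\<close>. No limit
  of approximations is needed.

  As \<open>v\<close> may be unbounded, the definition of the weak normal trace is applied to \<open>k sin (v / k)\<close>. Mollifying
  the extension of \<open>v\<close> by zero shows that the boundary functional of this truncation is dominated by
  \<open>g \<mapsto> \<integral> |Tu| |g \<cdot> \<nu>|\<close>, hence it is given by a trace \<open>s\<^sub>k\<close> with \<open>|s\<^sub>k| \<le> |Tu|\<close>. Then let \<open>k \<rightarrow> \<infinity>\<close>.
\<close>

text \<open>The normal trace of z is accessible only through \<open>BVc_X\<close> functions in
  \<open>W11_X\<close>, and the divergence of z may charge Lebesgue null sets, so L1 convergence of
  smooth approximations to u would not carry over to integrals against it. A single function v
  sidesteps this: the divergence and the pairing are only tested with functions of compact support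
  in \<open>\<Omega>\<close>, and the results are added. The series of derivatives converges because
  u times the derivative of the i-th partition function is subtracted from the i-th term; the sum is
  unchanged, since the partition functions sum to 1 and their derivatives cancel locally. The
  definition of a trace is linear in the function, so it says nothing directly about truncations.
  Mollification across the boundary restores the chain rule; the derivative then consists of an
  interior density, a commutator and the mollified boundary measure. The commutator is made small by
  cutting the test field off inside \<open>\<Omega>\<close>: it then sees only the mass of v near
  the boundary. Weak convergence of the truncated traces is enough at the end, because normal
  components of test fields are dense in L1 of the measure |Tu| d\<open>Pper\<close>.\<close>

section \<open>Functions with continuous iterated partial derivatives\<close>

text \<open>\<open>C_inf\<close> is phrased with iterated \<open>deriv\<close>, a total operator
  that says nothing until differentiability is known. Here every order comes with a witness for the
  derivative, so that sums, products and compositions follow by induction on \<open>n\<close>;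
  \<open>C_inf_iff_Ck\<close> carries them back to \<open>C_inf\<close>.\<close>

primrec Ck :: "nat \<Rightarrow> ('a::euclidean_space \<Rightarrow> real) \<Rightarrow> bool" where
  "Ck 0 f = continuous_on UNIV f"
| "Ck (Suc n) f = (continuous_on UNIV f \<and>
     (\<forall>b\<in>Basis. \<exists>f'. (\<forall>x. ((\<lambda>t. f (x + t *\<^sub>R b)) has_real_derivative f' x) (at 0)) \<and> Ck n f'))"

lemma Ck_continuous: "Ck n f \<Longrightarrow> continuous_on UNIV f"
  by (cases n) auto

lemma pderiv_dir_eqI:
  assumes "\<And>x. ((\<lambda>t. f (x + t *\<^sub>R b)) has_real_derivative f' x) (at 0)"
  shows "pderiv_dir f b = f'"
  using assms by (auto simp: pderiv_dir_def fun_eq_iff intro: DERIV_imp_deriv)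

lemma Ck_Suc_pderiv:
  assumes "Ck (Suc n) f" "b \<in> Basis"
  shows "((\<lambda>t. f (x + t *\<^sub>R b)) has_real_derivative pderiv_dir f b x) (at 0)"
    and "Ck n (pderiv_dir f b)"
proof -
  obtain f' where f': "\<And>x. ((\<lambda>t. f (x + t *\<^sub>R b)) has_real_derivative f' x) (at 0)" "Ck n f'"
    using assms by auto
  then have "pderiv_dir f b = f'"
    by (intro pderiv_dir_eqI)
  with f' show "((\<lambda>t. f (x + t *\<^sub>R b)) has_real_derivative pderiv_dir f b x) (at 0)"
    and "Ck n (pderiv_dir f b)" by auto
qed

lemma Ck_SucI:
  assumes "continuous_on UNIV f"
    and "\<And>b x. b \<in> Basis \<Longrightarrow> ((\<lambda>t. f (x + t *\<^sub>R b)) has_real_derivative f' b x) (at 0)"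
    and "\<And>b. b \<in> Basis \<Longrightarrow> Ck n (f' b)"
  shows "Ck (Suc n) f"
  using assms by auto

lemma Ck_Suc_D: "Ck (Suc n) f \<Longrightarrow> Ck n f"
proof (induction n arbitrary: f)
  case (Suc n)
  show ?case
    by (rule Ck_SucI[where f'="pderiv_dir f"])
      (use Suc in \<open>auto intro: Ck_Suc_pderiv Ck_continuous simp del: Ck.simps\<close>)
qed auto

lemma iter_pd_append: "iter_pd (bs @ cs) f = iter_pd bs (iter_pd cs f)"
  by (induction bs) auto

lemma C_inf_pderiv:
  assumes "C_inf f" "b \<in> Basis"
  shows "C_inf (pderiv_dir f b)"
  unfolding C_inf_def
proof (intro allI impI)
  fix bs :: "'a list" assume "set bs \<subseteq> Basis"
  then have *: "set (bs @ [b]) \<subseteq> Basis" using assms by auto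
  have "iter_pd (bs @ [b]) f = iter_pd bs (pderiv_dir f b)"
    by (simp add: iter_pd_append)
  with assms(1)[unfolded C_inf_def, rule_format, OF *]
  show "continuous_on UNIV (iter_pd bs (pderiv_dir f b)) \<and>
    (\<forall>c\<in>Basis. \<forall>x. (\<lambda>t. iter_pd bs (pderiv_dir f b) (x + t *\<^sub>R c)) differentiable at 0)"
    by simp
qed

lemma C_inf_imp_deriv:
  assumes "C_inf f" "b \<in> Basis"
  shows "((\<lambda>t. f (x + t *\<^sub>R b)) has_real_derivative pderiv_dir f b x) (at 0)"
proof -
  have "(\<lambda>t. f (x + t *\<^sub>R b)) differentiable at 0"
    using assms(1)[unfolded C_inf_def, rule_format, of "[]"] assms(2) by auto
  then show ?thesis
    unfolding pderiv_dir_def by (simp add: DERIV_deriv_iff_real_differentiable)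
qed

lemma C_inf_imp_continuous: "C_inf f \<Longrightarrow> continuous_on UNIV f"
  unfolding C_inf_def by (metis empty_subsetI iter_pd.simps(1) list.set(1))

lemma C_inf_imp_Ck: "C_inf f \<Longrightarrow> Ck n f"
proof (induction n arbitrary: f)
  case (Suc n)
  show ?case
    by (rule Ck_SucI[where f'="pderiv_dir f"])
      (use Suc in \<open>auto intro: C_inf_imp_deriv C_inf_pderiv C_inf_imp_continuous simp del: Ck.simps\<close>)
qed (auto intro: C_inf_imp_continuous)

lemma Ck_iter_pd: "Ck (length bs + n) f \<Longrightarrow> set bs \<subseteq> Basis \<Longrightarrow> Ck n (iter_pd bs f)"
proof (induction bs arbitrary: n)
  case (Cons b bs)
  have "Ck (Suc n) (iter_pd bs f)"
    by (rule Cons.IH) (use Cons.prems in \<open>auto simp del: Ck.simps\<close>)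
  then show ?case using Cons.prems by (auto intro: Ck_Suc_pderiv simp del: Ck.simps)
qed simp

text \<open>Each list of basis vectors uses up finitely many orders, and one further order gives the
  differentiability that \<open>C_inf\<close> asks for.\<close>

lemma C_inf_iff_Ck: "C_inf f \<longleftrightarrow> (\<forall>n. Ck n f)"
proof
  assume *: "\<forall>n. Ck n f"
  show "C_inf f"
    unfolding C_inf_def
  proof (intro allI impI conjI ballI)
    fix bs :: "'a list" and b x :: 'a
    assume bs: "set bs \<subseteq> Basis"
    have S: "Ck (Suc 0) (iter_pd bs f)"
      using * bs by (auto intro: Ck_iter_pd simp del: Ck.simps)
    then show "continuous_on UNIV (iter_pd bs f)" by (rule Ck_continuous)
    assume "b \<in> Basis"
    from Ck_Suc_pderiv(1)[OF S this, of x]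
    show "(\<lambda>t. iter_pd bs f (x + t *\<^sub>R b)) differentiable at 0"
      using real_differentiable_def by blast
  qed
qed (auto intro: C_inf_imp_Ck)

lemma Ck_const [simp]: "Ck n (\<lambda>x. c)"
proof (induction n arbitrary: c)
  case (Suc n)
  show ?case by (rule Ck_SucI[where f'="\<lambda>b x. 0"]) (use Suc in auto)
qed auto

lemma Ck_add: "Ck n f \<Longrightarrow> Ck n g \<Longrightarrow> Ck n (\<lambda>x. f x + g x)"
proof (induction n arbitrary: f g)
  case (Suc n)
  note d = Ck_Suc_pderiv[OF Suc.prems(1)] Ck_Suc_pderiv[OF Suc.prems(2)]
  show ?case
    by (rule Ck_SucI[where f'="\<lambda>b x. pderiv_dir f b x + pderiv_dir g b x"])
      (use Suc d in \<open>auto intro!: DERIV_add continuous_on_add intro: Ck_continuous simp del: Ck.simps\<close>)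
qed (auto intro: continuous_on_add)

lemma Ck_mult: "Ck n f \<Longrightarrow> Ck n g \<Longrightarrow> Ck n (\<lambda>x. f x * g x)"
proof (induction n arbitrary: f g)
  case (Suc n)
  note d = Ck_Suc_pderiv[OF Suc.prems(1)] Ck_Suc_pderiv[OF Suc.prems(2)]
  show ?case
  proof (rule Ck_SucI[where f'="\<lambda>b x. pderiv_dir f b x * g x + pderiv_dir g b x * f x"])
    show "continuous_on UNIV (\<lambda>x. f x * g x)"
      using Suc.prems by (intro continuous_on_mult Ck_continuous)
    fix b :: 'a assume b: "b \<in> Basis"
    show "((\<lambda>t. f (x + t *\<^sub>R b) * g (x + t *\<^sub>R b)) has_real_derivative
        pderiv_dir f b x * g x + pderiv_dir g b x * f x) (at 0)" for x
      using DERIV_mult[OF d(1)[OF b, of x] d(3)[OF b, of x]] by simp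
    show "Ck n (\<lambda>x. pderiv_dir f b x * g x + pderiv_dir g b x * f x)"
      using Suc.prems d b by (intro Ck_add Suc.IH) (auto intro: Ck_Suc_D simp del: Ck.simps)
  qed
qed (auto intro: continuous_on_mult)

lemma Ck_sum: "(\<And>i. i \<in> I \<Longrightarrow> Ck n (f i)) \<Longrightarrow> Ck n (\<lambda>x. \<Sum>i\<in>I. f i x)"
  by (induction I rule: infinite_finite_induct) (auto intro: Ck_add simp del: Ck.simps)

lemma Ck_inner_left: "Ck n (\<lambda>x. x \<bullet> c)"
proof (cases n)
  case (Suc m)
  show ?thesis unfolding Suc
    by (rule Ck_SucI[where f'="\<lambda>b x. b \<bullet> c"])
      (auto simp: inner_simps intro!: continuous_intros derivative_eq_intros simp del: Ck.simps)
qed (auto intro!: continuous_intros)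

lemma Ck_affine: "Ck n f \<Longrightarrow> Ck n (\<lambda>x. f (a + c *\<^sub>R x))"
proof (induction n arbitrary: f)
  case 0
  then show ?case
    by (auto intro!: continuous_intros intro: continuous_on_compose2)
next
  case (Suc n)
  show ?case
  proof (rule Ck_SucI[where f'="\<lambda>b x. c * pderiv_dir f b (a + c *\<^sub>R x)"])
    show "continuous_on UNIV (\<lambda>x. f (a + c *\<^sub>R x))"
      by (rule continuous_on_compose2[OF Ck_continuous[OF Suc.prems]]) (auto intro!: continuous_intros)
    fix b :: 'a assume b: "b \<in> Basis"
    show "((\<lambda>t. f (a + c *\<^sub>R (x + t *\<^sub>R b))) has_real_derivative c * pderiv_dir f b (a + c *\<^sub>R x)) (at 0)" for x
    proof -
      have "((\<lambda>t. f (a + c *\<^sub>R x + t *\<^sub>R b)) has_real_derivative pderiv_dir f b (a + c *\<^sub>R x)) (at (c * 0))"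
        using Ck_Suc_pderiv(1)[OF Suc.prems b] by simp
      then have "((\<lambda>t. f (a + c *\<^sub>R x + (c * t) *\<^sub>R b)) has_real_derivative pderiv_dir f b (a + c *\<^sub>R x) * c) (at 0)"
        by (rule DERIV_chain2[where g="\<lambda>t. c * t"]) (auto intro!: derivative_eq_intros)
      then show ?thesis by (simp add: scaleR_add_right add.assoc mult.commute[of c])
    qed
    show "Ck n (\<lambda>x. c * pderiv_dir f b (a + c *\<^sub>R x))"
      by (rule Ck_mult[OF Ck_const Suc.IH[OF Ck_Suc_pderiv(2)[OF Suc.prems b]]])
  qed
qed

text \<open>The chain rule replaces \<open>h\<close> by its derivative, so the induction has to
  range over a class \<open>F\<close> closed under differentiation. It is applied to the four
  functions generated by the sine and to \<open>range flat\<close>.\<close>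

lemma Ck_compose:
  assumes F: "\<And>h. h \<in> F \<Longrightarrow> \<exists>h'\<in>F. \<forall>t. (h has_real_derivative h' t) (at t)"
  shows "Ck n f \<Longrightarrow> h \<in> F \<Longrightarrow> Ck n (\<lambda>x. h (f x))"
proof (induction n arbitrary: h)
  case 0
  obtain h' where "\<forall>t. (h has_real_derivative h' t) (at t)" using F 0 by blast
  then have "continuous_on UNIV h" by (intro DERIV_continuous_on) auto
  with 0 show ?case by (auto intro: continuous_on_compose2)
next
  case (Suc n)
  obtain h' where h': "h' \<in> F" "\<And>t. (h has_real_derivative h' t) (at t)" using F Suc.prems by blast
  then have "continuous_on UNIV h" by (intro DERIV_continuous_on) auto
  note d = Ck_Suc_pderiv[OF Suc.prems(1)]
  show ?case
  proof (rule Ck_SucI[where f'="\<lambda>b x. h' (f x) * pderiv_dir f b x"])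
    show "continuous_on UNIV (\<lambda>x. h (f x))"
      using \<open>continuous_on UNIV h\<close> Ck_continuous[OF Suc.prems(1)] by (auto intro: continuous_on_compose2)
    fix b :: 'a assume b: "b \<in> Basis"
    show "((\<lambda>t. h (f (x + t *\<^sub>R b))) has_real_derivative h' (f x) * pderiv_dir f b x) (at 0)" for x
      by (rule DERIV_chain2[where f=h]) (use h' d(1)[OF b, of x] in auto)
    show "Ck n (\<lambda>x. h' (f x) * pderiv_dir f b x)"
      using d(2)[OF b] Suc h' by (intro Ck_mult) (auto intro: Ck_Suc_D simp del: Ck.simps)
  qed
qed

lemma C_inf_const [simp]: "C_inf (\<lambda>x. c)"
  and C_inf_add: "C_inf f \<Longrightarrow> C_inf g \<Longrightarrow> C_inf (\<lambda>x. f x + g x)"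
  and C_inf_mult: "C_inf f \<Longrightarrow> C_inf g \<Longrightarrow> C_inf (\<lambda>x. f x * g x)"
  and C_inf_sum: "(\<And>i. i \<in> I \<Longrightarrow> C_inf (F i)) \<Longrightarrow> C_inf (\<lambda>x. \<Sum>i\<in>I. F i x)"
  and C_inf_affine: "C_inf f \<Longrightarrow> C_inf (\<lambda>x. f (a + r *\<^sub>R x))"
  by (auto simp: C_inf_iff_Ck intro: Ck_add Ck_mult Ck_sum Ck_affine simp del: Ck.simps)

lemma C_inf_diff: "C_inf f \<Longrightarrow> C_inf g \<Longrightarrow> C_inf (\<lambda>x. f x - g x)"
  using C_inf_add[of f "\<lambda>x. - 1 * g x"] C_inf_mult[of "\<lambda>x. - 1" g] by simp

lemma C_inf_norm_sq: "C_inf (\<lambda>x::'a::euclidean_space. x \<bullet> x)"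
  using C_inf_sum[of Basis "\<lambda>b x::'a. (x \<bullet> b) * (x \<bullet> b)"]
  by (subst euclidean_inner) (auto simp: C_inf_iff_Ck intro!: Ck_mult Ck_inner_left Ck_sum simp del: Ck.simps)

lemma C_inf_sin_cos:
  assumes "C_inf f"
  shows "C_inf (\<lambda>x. sin (f x))" "C_inf (\<lambda>x. cos (f x))"
proof -
  let ?F = "{sin, cos, \<lambda>t. - sin t, \<lambda>t. - cos t} :: (real \<Rightarrow> real) set"
  have *: "\<exists>h'\<in>?F. \<forall>t. (h has_real_derivative h' t) (at t)" if "h \<in> ?F" for h
  proof -
    have "\<forall>t. (sin has_real_derivative cos t) (at t)" "\<forall>t. (cos has_real_derivative - sin t) (at t)"
      "\<forall>t. ((\<lambda>t. - sin t) has_real_derivative - cos t) (at t)"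
      "\<forall>t. ((\<lambda>t::real. - cos t) has_real_derivative sin t) (at t)"
      by (auto intro!: derivative_eq_intros)
    with that show ?thesis by (elim insertE) auto
  qed
  show "C_inf (\<lambda>x. sin (f x))" "C_inf (\<lambda>x. cos (f x))"
    using assms Ck_compose[OF *, where n = n and f = f for n] by (auto simp: C_inf_iff_Ck simp del: Ck.simps)
qed

section \<open>A smooth function that is flat at the origin\<close>

definition flat :: "real poly \<Rightarrow> real \<Rightarrow> real" where
  "flat p t = (if t > 0 then poly p (inverse t) * exp (- inverse t) else 0)"

lemma tendsto_poly_exp: "((\<lambda>s. poly p s * exp (- s)) \<longlongrightarrow> 0) (at_top :: real filter)"
proof (induction p)
  case (pCons a p)
  have 1: "((\<lambda>s::real. exp (- s)) \<longlongrightarrow> 0) at_top"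
    by (intro filterlim_compose[OF exp_at_bot] filterlim_uminus_at_bot_at_top)
  have mono: "((\<lambda>s::real. s ^ k * exp (- s)) \<longlongrightarrow> 0) at_top" for k
    using tendsto_power_div_exp_0[of k] by (simp add: exp_minus divide_inverse)
  have "((\<lambda>s. \<Sum>i\<le>degree (pCons a p). coeff (pCons a p) i * (s ^ i * exp (- s))) \<longlongrightarrow> (\<Sum>i\<le>degree (pCons a p). coeff (pCons a p) i * 0)) (at_top :: real filter)"
    by (intro tendsto_sum tendsto_mult tendsto_const mono)
  then show ?case
    by (simp add: poly_altdef sum_distrib_right mult.assoc del: coeff_pCons)
qed simp

text \<open>With s = 1/t one has d/dt = - s^2 d/ds, and p(s) exp(-s) has the s-derivative (p' -
  p)(s) exp(-s); this is the origin of \<open>[:0, 0, 1:]\<close> and of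
  \<open>p - pderiv p\<close>. The polynomial factor in \<open>flat\<close> is there to make the
  family closed under differentiation, as \<open>Ck_compose\<close> requires.\<close>

lemma DERIV_flat: "(flat p has_real_derivative flat ([:0, 0, 1:] * (p - pderiv p)) t) (at t)"
proof -
  consider "t > 0" | "t < 0" | "t = 0" by linarith
  then show ?thesis
  proof cases
    case 1
    have "((\<lambda>t. poly p (inverse t) * exp (- inverse t)) has_real_derivative flat ([:0, 0, 1:] * (p - pderiv p)) t) (at t)"
      using 1 by (auto intro!: derivative_eq_intros DERIV_chain2[OF poly_DERIV]
        simp: flat_def power2_eq_square algebra_simps)
    moreover have "\<forall>\<^sub>F s in nhds t. poly p (inverse s) * exp (- inverse s) = flat p s"
      by (rule eventually_mono[OF eventually_nhds_in_open[of "{0<..}" t]]) (use 1 in \<open>auto simp: flat_def\<close>)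
    ultimately show ?thesis by (subst (asm) DERIV_cong_ev) auto
  next
    case 2
    have "\<forall>\<^sub>F s in nhds t. 0 = flat p s"
      by (rule eventually_mono[OF eventually_nhds_in_open[of "{..<0}" t]]) (use 2 in \<open>auto simp: flat_def\<close>)
    moreover have "((\<lambda>_. 0) has_real_derivative flat ([:0, 0, 1:] * (p - pderiv p)) t) (at t)"
      using 2 by (auto simp: flat_def)
    ultimately show ?thesis by (subst (asm) DERIV_cong_ev) auto
  next
    case 3
    have "((\<lambda>h. flat p h / h) \<longlongrightarrow> 0) (at_right 0)"
    proof -
      \<comment> \<open>Division by h multiplies the polynomial in 1/h by its variable, hence
        \<open>[:0,1:] * p\<close>; the exponential then wins as 1/h tends to infinity.\<close>
      have "((\<lambda>h. poly ([:0,1:] * p) (inverse h) * exp (- inverse h)) \<longlongrightarrow> 0) (at_right (0::real))"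
        by (rule filterlim_compose[OF tendsto_poly_exp filterlim_inverse_at_top_right])
      moreover have "\<forall>\<^sub>F h in at_right 0. poly ([:0,1:] * p) (inverse h) * exp (- inverse h) = flat p h / h"
        by (auto simp: flat_def eventually_at_filter field_simps)
      ultimately show ?thesis by (simp cong: filterlim_cong)
    qed
    moreover have "((\<lambda>h. flat p h / h) \<longlongrightarrow> 0) (at_left 0)"
      by (rule tendsto_eventually) (auto simp: flat_def eventually_at_filter)
    ultimately have "((\<lambda>h. flat p h / h) \<longlongrightarrow> 0) (at 0)"
      by (rule filterlim_split_at[rotated])
    then show ?thesis by (simp add: DERIV_def 3) (simp add: flat_def)
  qed
qed

lemma C_inf_flat:
  assumes "C_inf f" shows "C_inf (\<lambda>x. flat p (f x))"
proof -
  have *: "\<exists>h'\<in>range flat. \<forall>t. (h has_real_derivative h' t) (at t)" if "h \<in> range flat" for h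
    using that DERIV_flat by (auto simp del: mult_pCons_left)
  show ?thesis
    using assms Ck_compose[OF *, where n = n and f = f for n] by (auto simp: C_inf_iff_Ck simp del: Ck.simps)
qed

section \<open>Mean value theorem and total differentiability\<close>

lemma Ck_pderiv_along:
  assumes "Ck (Suc n) f" "b \<in> Basis"
  shows "((\<lambda>t. f (x + t *\<^sub>R b)) has_real_derivative pderiv_dir f b (x + t *\<^sub>R b)) (at t)"
proof -
  have "((\<lambda>s. f ((x + t *\<^sub>R b) + s *\<^sub>R b)) has_real_derivative pderiv_dir f b (x + t *\<^sub>R b)) (at (t - t))"
    using Ck_Suc_pderiv(1)[OF assms] by simp
  then have "((\<lambda>s. f ((x + t *\<^sub>R b) + (s - t) *\<^sub>R b)) has_real_derivative pderiv_dir f b (x + t *\<^sub>R b) * 1) (at t)"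
    by (rule DERIV_chain2) (auto intro!: derivative_eq_intros)
  then show ?thesis by (simp add: algebra_simps)
qed

lemma Ck_mvt:
  assumes "Ck (Suc n) f" "b \<in> Basis"
  obtains s where "\<bar>s\<bar> \<le> \<bar>c\<bar>" "f (x + c *\<^sub>R b) - f x = c * pderiv_dir f b (x + s *\<^sub>R b)"
proof -
  note D = Ck_pderiv_along[OF assms, of x]
  consider "c = 0" | "c > 0" | "c < 0" by linarith
  then show ?thesis
  proof cases
    case 1 then show ?thesis by (intro that[of 0]) auto
  next
    case 2
    from MVT2[OF 2 D] obtain s where "0 < s" "s < c" "f (x + c *\<^sub>R b) - f (x + 0 *\<^sub>R b) = (c - 0) * pderiv_dir f b (x + s *\<^sub>R b)"
      by blast
    then show ?thesis by (intro that[of s]) auto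
  next
    case 3
    from MVT2[OF 3 D] obtain s where "c < s" "s < 0" "f (x + 0 *\<^sub>R b) - f (x + c *\<^sub>R b) = (0 - c) * pderiv_dir f b (x + s *\<^sub>R b)"
      by blast
    then show ?thesis by (intro that[of s]) (auto simp: algebra_simps)
  qed
qed

text \<open>The coordinates are changed one at a time; on each segment the mean value theorem
  produces a partial derivative at a point near \<open>x\<close>, which continuity compares with its
  value at \<open>x\<close>. The total derivative is what the chain rule along the curves of the
  group law needs (\<open>Xop_DERIV\<close>).\<close>

lemma Ck_has_derivative:
  fixes f :: "'a::euclidean_space \<Rightarrow> real"
  assumes f: "Ck (Suc n) f"
  shows "(f has_derivative (\<lambda>h. \<Sum>b\<in>Basis. (h \<bullet> b) * pderiv_dir f b x)) (at x)"
proof -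
  have step: "\<forall>e>0. \<exists>d>0. \<forall>y c. norm (y - x) < d \<and> (\<Sum>b\<in>S. \<bar>c b\<bar>) < d \<longrightarrow>
      \<bar>f (y + (\<Sum>b\<in>S. c b *\<^sub>R b)) - f y - (\<Sum>b\<in>S. c b * pderiv_dir f b x)\<bar> \<le> e * (\<Sum>b\<in>S. \<bar>c b\<bar>)"
    if "S \<subseteq> Basis" for S
    using finite_subset[OF that finite_Basis] that
  proof (induction S)
    case empty
    then show ?case by (auto intro: exI[of _ 1])
  next
    case (insert a S)
    show ?case
    proof (intro allI impI)
      fix e :: real assume e: "e > 0"
      obtain d1 where d1: "d1 > 0" "\<And>y c. norm (y - x) < d1 \<Longrightarrow> (\<Sum>b\<in>S. \<bar>c b\<bar>) < d1 \<Longrightarrow>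
          \<bar>f (y + (\<Sum>b\<in>S. c b *\<^sub>R b)) - f y - (\<Sum>b\<in>S. c b * pderiv_dir f b x)\<bar> \<le> e * (\<Sum>b\<in>S. \<bar>c b\<bar>)"
        using insert.IH insert.prems e by (auto dest!: spec[of _ e])
      have a: "a \<in> Basis" using insert by auto
      have "isCont (pderiv_dir f a) x"
        using Ck_continuous[OF Ck_Suc_pderiv(2)[OF f a]] by (simp add: continuous_on_eq_continuous_at)
      then obtain d2 where d2: "d2 > 0" "\<And>y. dist y x < d2 \<Longrightarrow> \<bar>pderiv_dir f a y - pderiv_dir f a x\<bar> < e"
        using e unfolding continuous_at_eps_delta dist_real_def by blast
      \<comment> \<open>Half of \<open>d2\<close>, because the distance of the intermediate point
        from \<open>x\<close> is bounded by \<open>norm (y - x)\<close> plus the full sum of the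
        increments, two quantities each below \<open>d\<close>.\<close>
      define d where "d = min d1 (d2 / 2)"
      show "\<exists>d>0. \<forall>y c. norm (y - x) < d \<and> (\<Sum>b\<in>insert a S. \<bar>c b\<bar>) < d \<longrightarrow>
        \<bar>f (y + (\<Sum>b\<in>insert a S. c b *\<^sub>R b)) - f y - (\<Sum>b\<in>insert a S. c b * pderiv_dir f b x)\<bar>
          \<le> e * (\<Sum>b\<in>insert a S. \<bar>c b\<bar>)"
      proof (intro exI[of _ d] conjI allI impI; (elim conjE)?)
        show "0 < d" using d1 d2 by (simp add: d_def)
        fix y c assume y: "norm (y - x) < d" and c: "(\<Sum>b\<in>insert a S. \<bar>c b\<bar>) < d"
        have cS: "(\<Sum>b\<in>S. \<bar>c b\<bar>) + \<bar>c a\<bar> < d" using c insert by simp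
        have nn: "0 \<le> (\<Sum>b\<in>S. \<bar>c b\<bar>)" by (simp add: sum_nonneg)
        define y' where "y' = y + (\<Sum>b\<in>S. c b *\<^sub>R b)"
        have "norm (\<Sum>b\<in>S. c b *\<^sub>R b) \<le> (\<Sum>b\<in>S. \<bar>c b\<bar>)"
          by (rule order_trans[OF norm_sum]) (use insert in \<open>auto intro!: sum_mono\<close>)
        then have y': "norm (y' - x) \<le> norm (y - x) + (\<Sum>b\<in>S. \<bar>c b\<bar>)"
          unfolding y'_def using norm_triangle_ineq[of "y - x" "\<Sum>b\<in>S. c b *\<^sub>R b"] by (simp add: algebra_simps)
        obtain s where s: "\<bar>s\<bar> \<le> \<bar>c a\<bar>" "f (y' + c a *\<^sub>R a) - f y' = c a * pderiv_dir f a (y' + s *\<^sub>R a)"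
          using Ck_mvt[OF f a] by blast
        have "dist (y' + s *\<^sub>R a) x \<le> norm (y' - x) + \<bar>s\<bar>"
          using norm_triangle_ineq[of "y' - x" "s *\<^sub>R a"] a by (simp add: dist_norm algebra_simps)
        also have "\<dots> < d2" using y' y cS s nn by (simp add: d_def)
        finally have "\<bar>pderiv_dir f a (y' + s *\<^sub>R a) - pderiv_dir f a x\<bar> \<le> e" using d2 by (simp add: less_imp_le)
        then have "\<bar>c a * pderiv_dir f a (y' + s *\<^sub>R a) - c a * pderiv_dir f a x\<bar> \<le> e * \<bar>c a\<bar>"
          by (simp add: right_diff_distrib[symmetric] abs_mult mult.commute[of e] mult_left_mono)
        moreover have "\<bar>f y' - f y - (\<Sum>b\<in>S. c b * pderiv_dir f b x)\<bar> \<le> e * (\<Sum>b\<in>S. \<bar>c b\<bar>)"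
          unfolding y'_def by (rule d1) (use y cS nn in \<open>auto simp: d_def\<close>)
        moreover have eq: "y + (\<Sum>b\<in>insert a S. c b *\<^sub>R b) = y' + c a *\<^sub>R a"
          using insert.hyps by (simp add: y'_def algebra_simps)
        moreover have "(\<Sum>b\<in>insert a S. c b * pderiv_dir f b x) = c a * pderiv_dir f a x + (\<Sum>b\<in>S. c b * pderiv_dir f b x)"
          "e * (\<Sum>b\<in>insert a S. \<bar>c b\<bar>) = e * \<bar>c a\<bar> + e * (\<Sum>b\<in>S. \<bar>c b\<bar>)"
          using insert.hyps by (simp_all add: distrib_left)
        ultimately show "\<bar>f (y + (\<Sum>b\<in>insert a S. c b *\<^sub>R b)) - f y - (\<Sum>b\<in>insert a S. c b * pderiv_dir f b x)\<bar>
          \<le> e * (\<Sum>b\<in>insert a S. \<bar>c b\<bar>)"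
          unfolding eq using s(2) by linarith
      qed
    qed
  qed
  show ?thesis
    unfolding has_derivative_at_alt
  proof (intro conjI allI impI)
    show "bounded_linear (\<lambda>h. \<Sum>b\<in>Basis. (h \<bullet> b) * pderiv_dir f b x)"
      by (intro bounded_linear_sum bounded_linear_mult_const bounded_linear_inner_left)
    fix e :: real assume e: "e > 0"
    \<comment> \<open>The dimension enters because \<open>step\<close> measures increments by the
      sum of the absolute coordinates, which is at most \<open>N\<close> times the Euclidean
      norm.\<close>
    define N where "N = real DIM('a)"
    have N: "N > 0" by (simp add: N_def)
    obtain d where d: "d > 0" "\<And>c. (\<Sum>b\<in>(Basis::'a set). \<bar>c b\<bar>) < d \<Longrightarrow>
      \<bar>f (x + (\<Sum>b\<in>Basis. c b *\<^sub>R b)) - f x - (\<Sum>b\<in>Basis. c b * pderiv_dir f b x)\<bar> \<le> e / N * (\<Sum>b\<in>Basis. \<bar>c b\<bar>)"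
    proof -
      have "e / N > 0" using e N by simp
      from step[OF order_refl, rule_format, OF this] obtain d where "d > 0" and
        d: "\<And>y c. norm (y - x) < d \<and> (\<Sum>b\<in>Basis. \<bar>c b\<bar>) < d \<Longrightarrow>
          \<bar>f (y + (\<Sum>b\<in>Basis. c b *\<^sub>R b)) - f y - (\<Sum>b\<in>Basis. c b * pderiv_dir f b x)\<bar> \<le> e / N * (\<Sum>b\<in>Basis. \<bar>c b\<bar>)"
        by blast
      with d[of x] show ?thesis by (intro that[of d]) auto
    qed
    show "\<exists>d>0. \<forall>y. norm (y - x) < d \<longrightarrow>
      norm (f y - f x - (\<Sum>b\<in>Basis. ((y - x) \<bullet> b) * pderiv_dir f b x)) \<le> e * norm (y - x)"
    proof (intro exI[of _ "d / N"] conjI allI impI)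
      show "0 < d / N" using d N by simp
      fix y assume y: "norm (y - x) < d / N"
      have l1: "(\<Sum>b\<in>Basis. \<bar>(y - x) \<bullet> b\<bar>) \<le> N * norm (y - x)"
        unfolding N_def using sum_bounded_above[of Basis "\<lambda>b. \<bar>(y - x) \<bullet> b\<bar>" "norm (y - x)"]
        by (simp add: Basis_le_norm)
      also have "\<dots> < d" using y N by (simp add: field_simps)
      finally have "\<bar>f (x + (\<Sum>b\<in>Basis. ((y - x) \<bullet> b) *\<^sub>R b)) - f x - (\<Sum>b\<in>Basis. ((y - x) \<bullet> b) * pderiv_dir f b x)\<bar>
          \<le> e / N * (\<Sum>b\<in>Basis. \<bar>(y - x) \<bullet> b\<bar>)" by (rule d)
      also have "\<dots> \<le> e / N * (N * norm (y - x))"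
        using e N by (intro mult_left_mono l1) auto
      finally show "norm (f y - f x - (\<Sum>b\<in>Basis. ((y - x) \<bullet> b) * pderiv_dir f b x)) \<le> e * norm (y - x)"
        using N by (simp add: euclidean_representation)
    qed
  qed
qed

section \<open>Convolution and mollifiers\<close>

lemma pderiv_dir_eq_0:
  assumes "open U" "x \<in> U" "\<And>y. y \<in> U \<Longrightarrow> f y = c"
  shows "pderiv_dir f b x = 0"
proof -
  have "((\<lambda>t. x + t *\<^sub>R b) \<longlongrightarrow> x + 0 *\<^sub>R b) (nhds 0)"
    by (intro tendsto_intros filterlim_ident)
  then have "\<forall>\<^sub>F t in nhds 0. x + t *\<^sub>R b \<in> U"
    using assms(1,2) by (auto dest: topological_tendstoD)
  then have ev: "\<forall>\<^sub>F t in nhds 0. f (x + t *\<^sub>R b) = c"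
    by (rule eventually_mono) (use assms in auto)
  have "((\<lambda>t. f (x + t *\<^sub>R b)) has_real_derivative 0) (at 0)"
    by (subst DERIV_cong_ev[OF refl ev refl]) simp
  then show ?thesis by (simp add: pderiv_dir_def DERIV_imp_deriv)
qed

lemma pderiv_dir_cong_open:
  assumes "open U" "x \<in> U" "\<And>y. y \<in> U \<Longrightarrow> f y = g y"
  shows "pderiv_dir f b x = pderiv_dir g b x"
proof -
  have "((\<lambda>t. x + t *\<^sub>R b) \<longlongrightarrow> x + 0 *\<^sub>R b) (nhds 0)"
    by (intro tendsto_intros filterlim_ident)
  then have "\<forall>\<^sub>F t in nhds 0. x + t *\<^sub>R b \<in> U"
    using assms(1,2) by (auto dest: topological_tendstoD)
  then have ev: "\<forall>\<^sub>F t in nhds 0. f (x + t *\<^sub>R b) = g (x + t *\<^sub>R b)"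
    by (rule eventually_mono) (use assms in auto)
  show ?thesis unfolding pderiv_dir_def by (rule deriv_cong_ev[OF ev refl])
qed

lemma continuous_cball_support_bounded:
  fixes f :: "'a::euclidean_space \<Rightarrow> real"
  assumes "continuous_on UNIV f" "\<And>x. R < norm x \<Longrightarrow> f x = 0"
  obtains B where "B \<ge> 0" "\<And>x. \<bar>f x\<bar> \<le> B"
proof -
  have "compact (f ` cball 0 R)"
    using assms by (intro compact_continuous_image) (auto intro: continuous_on_subset)
  then obtain B where B: "\<And>x. x \<in> cball 0 R \<Longrightarrow> \<bar>f x\<bar> \<le> B"
    using compact_imp_bounded bounded_iff by (metis imageI real_norm_def)
  show ?thesis
  proof (rule that[of "max B 0"])
    fix x show "\<bar>f x\<bar> \<le> max B 0"
      using B[of x] assms(2)[of x] by (cases "norm x \<le> R") (auto simp: not_le)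
  qed auto
qed

lemma nn_integral_lborel_affine:
  fixes f :: "'a::euclidean_space \<Rightarrow> ennreal"
  assumes [measurable]: "f \<in> borel_measurable borel" and c: "c \<noteq> 0"
  shows "(\<integral>\<^sup>+x. f x \<partial>lborel) = ennreal (\<bar>c\<bar> ^ DIM('a)) * (\<integral>\<^sup>+x. f (t + c *\<^sub>R x) \<partial>lborel)"
  by (subst lborel_affine[OF c, of t])
     (simp add: nn_integral_density nn_integral_distr nn_integral_cmult ennreal_power)

lemma integral_lborel_affine:
  fixes f :: "'a::euclidean_space \<Rightarrow> real"
  assumes [measurable]: "f \<in> borel_measurable borel" and c: "c \<noteq> 0"
  shows "(\<integral>x. f x \<partial>lborel) = \<bar>c\<bar> ^ DIM('a) * (\<integral>x. f (t + c *\<^sub>R x) \<partial>lborel)"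
  by (subst lborel_affine[OF c, of t])
     (simp add: integral_density integral_distr ennreal_power)

lemma integrable_lborel_affine:
  fixes f :: "'a::euclidean_space \<Rightarrow> real"
  assumes f: "integrable lborel f" and c: "c \<noteq> 0"
  shows "integrable lborel (\<lambda>x. f (t + c *\<^sub>R x))"
proof -
  have [measurable]: "f \<in> borel_measurable borel" using f by auto
  show ?thesis
    using f unfolding integrable_iff_bounded
    by (subst (asm) nn_integral_lborel_affine[where c=c and t=t]) (use c in \<open>auto simp: ennreal_mult_less_top\<close>)
qed

lemma integrable_continuous_support:
  fixes f :: "'a::euclidean_space \<Rightarrow> real"
  assumes "continuous_on UNIV f" "\<And>x. R < norm x \<Longrightarrow> f x = 0"
  shows "integrable lborel f"
proof -
  have "integrable lborel (\<lambda>x. indicator (cball 0 R) x *\<^sub>R f x)"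
    using borel_integrable_compact[of "cball 0 R" f] assms(1) by (auto simp: indicator_def of_bool_def if_distrib intro: continuous_on_subset cong: if_cong)
  also have "(\<lambda>x. indicator (cball 0 R) x *\<^sub>R f x) = f"
    using assms(2) by (fastforce simp: indicator_def not_le)
  finally show ?thesis .
qed

definition conv :: "('a::euclidean_space \<Rightarrow> real) \<Rightarrow> ('a \<Rightarrow> real) \<Rightarrow> 'a \<Rightarrow> real" where
  "conv \<eta> w x = (\<integral>y. \<eta> (x - y) * w y \<partial>lborel)"

lemma conv_integrable:
  fixes \<eta> :: "'a::euclidean_space \<Rightarrow> real"
  assumes "continuous_on UNIV \<eta>" "\<And>x. \<bar>\<eta> x\<bar> \<le> B" "integrable lborel w"
  shows "integrable lborel (\<lambda>y. \<eta> (x - y) * w y)"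
proof (rule Bochner_Integration.integrable_bound)
  show "integrable lborel (\<lambda>y. B * w y)" using assms by auto
  have [measurable]: "\<eta> \<in> borel_measurable borel" by (rule borel_measurable_continuous_onI[OF assms(1)])
  show "(\<lambda>y. \<eta> (x - y) * w y) \<in> borel_measurable lborel" using assms(3) by measurable
  have "B \<ge> 0" using assms(2)[of 0] by linarith
  then show "AE y in lborel. norm (\<eta> (x - y) * w y) \<le> norm (B * w y)"
    using assms(2) by (auto simp: abs_mult intro!: mult_right_mono)
qed

lemma conv_continuous:
  fixes \<eta> :: "'a::euclidean_space \<Rightarrow> real"
  assumes \<eta>: "continuous_on UNIV \<eta>" "\<And>x. \<bar>\<eta> x\<bar> \<le> B" and w: "integrable lborel w"
  shows "continuous_on UNIV (conv \<eta> w)"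
proof (rule continuous_on_sequentiallyI)
  fix X :: "nat \<Rightarrow> 'a" and a assume X: "X \<longlonglongrightarrow> a"
  have [measurable]: "\<eta> \<in> borel_measurable borel" by (rule borel_measurable_continuous_onI[OF \<eta>(1)])
  have [measurable]: "w \<in> borel_measurable borel" using w by auto
  have B: "B \<ge> 0" using assms(2)[of 0] by linarith
  show "(\<lambda>n. conv \<eta> w (X n)) \<longlonglongrightarrow> conv \<eta> w a"
    unfolding conv_def
  proof (rule integral_dominated_convergence[where w="\<lambda>y. B * \<bar>w y\<bar>"])
    show "integrable lborel (\<lambda>y. B * \<bar>w y\<bar>)" using w by auto
    show "AE y in lborel. (\<lambda>n. \<eta> (X n - y) * w y) \<longlonglongrightarrow> \<eta> (a - y) * w y"
    proof (rule AE_I2)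
      fix y
      have "(\<lambda>n. X n - y) \<longlonglongrightarrow> a - y" by (intro tendsto_intros X)
      then have "(\<lambda>n. \<eta> (X n - y)) \<longlonglongrightarrow> \<eta> (a - y)"
        using \<eta>(1) by (auto intro: continuous_on_tendsto_compose)
      then show "(\<lambda>n. \<eta> (X n - y) * w y) \<longlonglongrightarrow> \<eta> (a - y) * w y" by (intro tendsto_intros)
    qed
    show "AE y in lborel. norm (\<eta> (X n - y) * w y) \<le> B * \<bar>w y\<bar>" for n
      using \<eta>(2) by (auto simp: abs_mult intro!: mult_right_mono)
  qed auto
qed

text \<open>By the mean value theorem the difference quotients of \<open>\<eta>\<close> are bounded
  uniformly, so dominated convergence works for every integrable \<open>w\<close>.\<close>

lemma conv_DERIV:
  fixes \<eta> :: "'a::euclidean_space \<Rightarrow> real"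
  assumes \<eta>: "Ck (Suc n) \<eta>" "\<And>x. R < norm x \<Longrightarrow> \<eta> x = 0" and w: "integrable lborel w" and b: "b \<in> Basis"
  shows "((\<lambda>t. conv \<eta> w (x + t *\<^sub>R b)) has_real_derivative conv (pderiv_dir \<eta> b) w x) (at 0)"
proof -
  have cd: "continuous_on UNIV (pderiv_dir \<eta> b)" "continuous_on UNIV \<eta>"
    using Ck_Suc_pderiv(2)[OF \<eta>(1) b] \<eta>(1) by (auto intro: Ck_continuous simp del: Ck.simps)
  have "pderiv_dir \<eta> b x = 0" if "R < norm x" for x
    by (rule pderiv_dir_eq_0[of "- cball 0 R" _ _ 0]) (use that \<eta>(2) in auto)
  then obtain B where B: "B \<ge> 0" "\<And>x. \<bar>pderiv_dir \<eta> b x\<bar> \<le> B"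
    using continuous_cball_support_bounded[OF cd(1)] by metis
  obtain B0 where B0: "\<And>x. \<bar>\<eta> x\<bar> \<le> B0"
    using continuous_cball_support_bounded[OF cd(2) \<eta>(2)] by metis
  have [measurable]: "\<eta> \<in> borel_measurable borel" "pderiv_dir \<eta> b \<in> borel_measurable borel"
     by (intro borel_measurable_continuous_onI cd)+
  have [measurable]: "w \<in> borel_measurable borel" using w by auto
  note int = conv_integrable[OF cd(2) B0 w]
  show ?thesis
    unfolding DERIV_def tendsto_at_iff_sequentially
  proof (intro allI impI)
    fix X :: "nat \<Rightarrow> real" assume X0: "\<forall>i. X i \<in> UNIV - {0}" and X: "X \<longlonglongrightarrow> 0"
    have eq: "(conv \<eta> w (x + (0 + X i) *\<^sub>R b) - conv \<eta> w (x + 0 *\<^sub>R b)) / X i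
      = (\<integral>y. (\<eta> (x - y + X i *\<^sub>R b) - \<eta> (x - y)) / X i * w y \<partial>lborel)" for i
    proof -
      have "conv \<eta> w (x + (0 + X i) *\<^sub>R b) - conv \<eta> w (x + 0 *\<^sub>R b)
        = (\<integral>y. \<eta> (x + X i *\<^sub>R b - y) * w y - \<eta> (x - y) * w y \<partial>lborel)"
        unfolding conv_def by (subst Bochner_Integration.integral_diff[OF int int]) auto
      also have "\<dots> / X i = (\<integral>y. (\<eta> (x + X i *\<^sub>R b - y) * w y - \<eta> (x - y) * w y) / X i \<partial>lborel)"
        by simp
      also have "\<dots> = (\<integral>y. (\<eta> (x - y + X i *\<^sub>R b) - \<eta> (x - y)) / X i * w y \<partial>lborel)"
        by (intro Bochner_Integration.integral_cong) (auto simp: algebra_simps diff_divide_distrib)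
      finally show ?thesis .
    qed
    have "(\<lambda>i. \<integral>y. (\<eta> (x - y + X i *\<^sub>R b) - \<eta> (x - y)) / X i * w y \<partial>lborel) \<longlonglongrightarrow> conv (pderiv_dir \<eta> b) w x"
      unfolding conv_def
    proof (rule integral_dominated_convergence[where w="\<lambda>y. B * \<bar>w y\<bar>"])
      show "integrable lborel (\<lambda>y. B * \<bar>w y\<bar>)" using w by auto
      show "AE y in lborel. (\<lambda>i. (\<eta> (x - y + X i *\<^sub>R b) - \<eta> (x - y)) / X i * w y) \<longlonglongrightarrow> pderiv_dir \<eta> b (x - y) * w y"
      proof (rule AE_I2)
        fix y
        have "((\<lambda>h. (\<eta> (x - y + (0 + h) *\<^sub>R b) - \<eta> (x - y + 0 *\<^sub>R b)) / h) \<longlongrightarrow> pderiv_dir \<eta> b (x - y)) (at 0)"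
          using Ck_Suc_pderiv(1)[OF \<eta>(1) b, of "x - y"] unfolding DERIV_def .
        then have "(\<lambda>i. (\<eta> (x - y + X i *\<^sub>R b) - \<eta> (x - y)) / X i) \<longlonglongrightarrow> pderiv_dir \<eta> b (x - y)"
          unfolding tendsto_at_iff_sequentially using X X0 by (auto simp: o_def)
        then show "(\<lambda>i. (\<eta> (x - y + X i *\<^sub>R b) - \<eta> (x - y)) / X i * w y) \<longlonglongrightarrow> pderiv_dir \<eta> b (x - y) * w y"
          by (intro tendsto_intros)
      qed
      show "AE y in lborel. norm ((\<eta> (x - y + X i *\<^sub>R b) - \<eta> (x - y)) / X i * w y) \<le> B * \<bar>w y\<bar>" for i
      proof (rule AE_I2)
        fix y
        obtain s where "\<eta> (x - y + X i *\<^sub>R b) - \<eta> (x - y) = X i * pderiv_dir \<eta> b (x - y + s *\<^sub>R b)"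
          using Ck_mvt[OF \<eta>(1) b] by blast
        then have "(\<eta> (x - y + X i *\<^sub>R b) - \<eta> (x - y)) / X i = pderiv_dir \<eta> b (x - y + s *\<^sub>R b)"
          using X0 by simp
        then show "norm ((\<eta> (x - y + X i *\<^sub>R b) - \<eta> (x - y)) / X i * w y) \<le> B * \<bar>w y\<bar>"
          using B(2) by (simp add: abs_mult mult_right_mono)
      qed
    qed auto
    then show "((\<lambda>h. (conv \<eta> w (x + (0 + h) *\<^sub>R b) - conv \<eta> w (x + 0 *\<^sub>R b)) / h) \<circ> X) \<longlonglongrightarrow> conv (pderiv_dir \<eta> b) w x"
      unfolding o_def eq .
  qed
qed

lemma conv_Ck:
  fixes \<eta> :: "'a::euclidean_space \<Rightarrow> real"
  assumes "Ck n \<eta>" "\<And>x. R < norm x \<Longrightarrow> \<eta> x = 0" and w: "integrable lborel w"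
  shows "Ck n (conv \<eta> w)"
  using assms(1,2)
proof (induction n arbitrary: \<eta>)
  case 0
  then have c: "continuous_on UNIV \<eta>" by simp
  obtain B0 where "\<And>x. \<bar>\<eta> x\<bar> \<le> B0"
    using continuous_cball_support_bounded[OF c 0(2)] by metis
  then show ?case using conv_continuous[OF c _ w, of B0] by simp
next
  case (Suc n)
  have c: "continuous_on UNIV \<eta>" using Suc.prems(1) by (rule Ck_continuous)
  obtain B0 where B0: "\<And>x. \<bar>\<eta> x\<bar> \<le> B0"
    using continuous_cball_support_bounded[OF c Suc.prems(2)] by metis
  show ?case
  proof (rule Ck_SucI[where f'="\<lambda>b. conv (pderiv_dir \<eta> b) w"])
    show "continuous_on UNIV (conv \<eta> w)" using conv_continuous[OF c B0 w] .
    fix b :: 'a assume b: "b \<in> Basis"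
    show "((\<lambda>t. conv \<eta> w (x + t *\<^sub>R b)) has_real_derivative conv (pderiv_dir \<eta> b) w x) (at 0)" for x
      by (rule conv_DERIV[OF Suc.prems w b])
    show "Ck n (conv (pderiv_dir \<eta> b) w)"
    proof (rule Suc.IH)
      show "Ck n (pderiv_dir \<eta> b)" by (rule Ck_Suc_pderiv(2)[OF Suc.prems(1) b])
      show "pderiv_dir \<eta> b x = 0" if "R < norm x" for x
        by (rule pderiv_dir_eq_0[of "- cball 0 R" _ _ 0]) (use that Suc.prems(2) in auto)
    qed
  qed
qed

lemma C_inf_conv:
  assumes "C_inf \<eta>" "\<And>x. R < norm x \<Longrightarrow> \<eta> x = 0" "integrable lborel w"
  shows "C_inf (conv \<eta> w)"
  using assms conv_Ck unfolding C_inf_iff_Ck by blast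

lemma pderiv_conv:
  assumes "C_inf \<eta>" "\<And>x. R < norm x \<Longrightarrow> \<eta> x = 0" "integrable lborel w" "b \<in> Basis"
  shows "pderiv_dir (conv \<eta> w) b = conv (pderiv_dir \<eta> b) w"
  by (rule pderiv_dir_eqI, rule conv_DERIV[OF C_inf_imp_Ck]) (use assms in auto)

text \<open>Schur's test in L1: Tonelli exchanges the integrals and the bound on the columns of the
  kernel comes out. The bound is demanded only where \<open>w y \<noteq> 0\<close>, so a kernel that
  is controlled merely for \<open>y\<close> in a bounded set is admissible. The second measure is
  kept general, because it will also be a derivative measure of u or the perimeter measure.\<close>

lemma nn_integral_kernel_le:
  fixes K :: "'a \<Rightarrow> 'b \<Rightarrow> real" and w :: "'b \<Rightarrow> real"
  assumes L: "sigma_finite_measure L" and M: "sigma_finite_measure M"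
    and K[measurable]: "(\<lambda>(x, y). K x y) \<in> borel_measurable (L \<Otimes>\<^sub>M M)"
    and w[measurable]: "w \<in> borel_measurable M"
    and C: "\<And>y. y \<in> space M \<Longrightarrow> w y \<noteq> 0 \<Longrightarrow> (\<integral>\<^sup>+x. ennreal \<bar>K x y\<bar> \<partial>L) \<le> C"
  shows "(\<integral>\<^sup>+x. (\<integral>\<^sup>+y. ennreal \<bar>K x y * w y\<bar> \<partial>M) \<partial>L) \<le> C * (\<integral>\<^sup>+y. ennreal \<bar>w y\<bar> \<partial>M)"
    and "(\<integral>\<^sup>+x. ennreal \<bar>\<integral>y. K x y * w y \<partial>M\<bar> \<partial>L) \<le> C * (\<integral>\<^sup>+y. ennreal \<bar>w y\<bar> \<partial>M)"
proof -
  interpret L: sigma_finite_measure L by fact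
  interpret M: sigma_finite_measure M by fact
  interpret P: pair_sigma_finite L M by standard
  have "(\<integral>\<^sup>+x. (\<integral>\<^sup>+y. ennreal \<bar>K x y * w y\<bar> \<partial>M) \<partial>L) = (\<integral>\<^sup>+y. (\<integral>\<^sup>+x. ennreal \<bar>K x y * w y\<bar> \<partial>L) \<partial>M)"
    by (rule P.Fubini'[symmetric]) measurable
  also have "\<dots> \<le> (\<integral>\<^sup>+y. C * ennreal \<bar>w y\<bar> \<partial>M)"
  proof (rule nn_integral_mono)
    fix y assume y: "y \<in> space M"
    have "(\<integral>\<^sup>+x. ennreal \<bar>K x y * w y\<bar> \<partial>L) = (\<integral>\<^sup>+x. ennreal \<bar>K x y\<bar> * ennreal \<bar>w y\<bar> \<partial>L)"
      by (simp add: abs_mult ennreal_mult)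
    also have "\<dots> = (\<integral>\<^sup>+x. ennreal \<bar>K x y\<bar> \<partial>L) * ennreal \<bar>w y\<bar>"
      using y by (subst nn_integral_multc) auto
    also have "\<dots> \<le> C * ennreal \<bar>w y\<bar>"
      using C[OF y] by (cases "w y = 0") (auto intro: mult_right_mono)
    finally show "(\<integral>\<^sup>+x. ennreal \<bar>K x y * w y\<bar> \<partial>L) \<le> C * ennreal \<bar>w y\<bar>" .
  qed
  also have "\<dots> = C * (\<integral>\<^sup>+y. ennreal \<bar>w y\<bar> \<partial>M)" by (rule nn_integral_cmult) measurable
  finally show 1: "(\<integral>\<^sup>+x. (\<integral>\<^sup>+y. ennreal \<bar>K x y * w y\<bar> \<partial>M) \<partial>L) \<le> C * (\<integral>\<^sup>+y. ennreal \<bar>w y\<bar> \<partial>M)" .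
  \<comment> \<open>A Bochner integral of a non-integrable function is 0, so the estimate survives
    without any integrability of the sections.\<close>
  have "ennreal \<bar>\<integral>y. K x y * w y \<partial>M\<bar> \<le> (\<integral>\<^sup>+y. ennreal \<bar>K x y * w y\<bar> \<partial>M)" for x
  proof (cases "integrable M (\<lambda>y. K x y * w y)")
    case True
    then show ?thesis using integral_norm_bound_ennreal by fastforce
  qed (simp add: not_integrable_integral_eq)
  with 1 show "(\<integral>\<^sup>+x. ennreal \<bar>\<integral>y. K x y * w y \<partial>M\<bar> \<partial>L) \<le> C * (\<integral>\<^sup>+y. ennreal \<bar>w y\<bar> \<partial>M)"
    by (meson nn_integral_mono order_trans)
qed

section \<open>Translation invariance and the standard mollifier\<close>

lemma nn_integral_lborel_diff:
  fixes f :: "'a::euclidean_space \<Rightarrow> ennreal"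
  assumes [measurable]: "f \<in> borel_measurable borel"
  shows "(\<integral>\<^sup>+x. f (x - y) \<partial>lborel) = (\<integral>\<^sup>+x. f x \<partial>lborel)"
    and "(\<integral>\<^sup>+x. f (y - x) \<partial>lborel) = (\<integral>\<^sup>+x. f x \<partial>lborel)"
  using nn_integral_lborel_affine[OF assms, of 1 "- y"] nn_integral_lborel_affine[OF assms, of "- 1" y]
  by simp_all

lemma integral_lborel_diff:
  fixes f :: "'a::euclidean_space \<Rightarrow> real"
  assumes [measurable]: "f \<in> borel_measurable borel"
  shows "(\<integral>x. f (x - y) \<partial>lborel) = (\<integral>x. f x \<partial>lborel)"
    and "(\<integral>x. f (y - x) \<partial>lborel) = (\<integral>x. f x \<partial>lborel)"
  using integral_lborel_affine[OF assms, of 1 "- y"] integral_lborel_affine[OF assms, of "- 1" y]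
  by simp_all

text \<open>The classical kernel exp(-1/(1 - |x|^2)) on the open unit ball, extended by 0 and not
  yet normalised.\<close>

definition bump :: "'a::euclidean_space \<Rightarrow> real" where
  "bump x = flat 1 (1 - x \<bullet> x)"

lemma bump_C_inf: "C_inf (bump :: 'a::euclidean_space \<Rightarrow> real)"
  unfolding bump_def by (intro C_inf_flat C_inf_diff C_inf_norm_sq C_inf_const)

lemma bump_nonneg: "bump x \<ge> 0"
  by (simp add: bump_def flat_def)

lemma bump_eq_0: "1 \<le> norm x \<Longrightarrow> bump x = 0"
  by (simp add: bump_def flat_def not_less norm_le_square power2_eq_square[symmetric] dot_square_norm)

lemma bump_integrable: "integrable lborel (bump :: 'a::euclidean_space \<Rightarrow> real)"
  by (rule integrable_continuous_support[where R=1])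
    (auto intro: C_inf_imp_continuous bump_C_inf bump_eq_0)

lemma bump_integral_pos: "0 < (\<integral>x. bump (x::'a::euclidean_space) \<partial>lborel)"
proof -
  have "0 \<le> (\<integral>x. bump (x::'a) \<partial>lborel)" by (intro integral_nonneg_AE) (simp add: bump_nonneg)
  moreover have "(\<integral>x. bump (x::'a) \<partial>lborel) \<noteq> 0"
  proof
    assume "(\<integral>x. bump (x::'a) \<partial>lborel) = 0"
    then have ae: "AE x::'a in lborel. bump x = 0"
      by (subst (asm) integral_nonneg_eq_0_iff_AE[OF bump_integrable]) (auto simp: bump_nonneg)
    have "AE x::'a in lborel. x \<notin> ball 0 1"
      using ae by eventually_elim (auto simp: bump_def flat_def norm_eq_sqrt_inner)
    then have "emeasure lborel (ball (0::'a) 1) = 0"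
      by (subst (asm) AE_iff_measurable[where N="ball 0 1"]) auto
    then show False using content_ball_pos[of 1 "0::'a"] by (simp add: measure_def)
  qed
  ultimately show ?thesis by linarith
qed

text \<open>The summand 0 keeps the argument in the affine form of \<open>C_inf_affine\<close> and
  \<open>integral_lborel_affine\<close>.\<close>

definition mol :: "real \<Rightarrow> 'a::euclidean_space \<Rightarrow> real" where
  "mol \<epsilon> x = bump (0 + (1 / \<epsilon>) *\<^sub>R x) * (1 / (\<epsilon> ^ DIM('a) * (\<integral>x. bump (x::'a) \<partial>lborel)))"

lemma mol_C_inf: "C_inf (mol \<epsilon>)"
  unfolding mol_def by (rule C_inf_mult[OF C_inf_affine[OF bump_C_inf] C_inf_const])

lemma mol_measurable [measurable]: "mol \<epsilon> \<in> borel_measurable borel"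
  by (intro borel_measurable_continuous_onI C_inf_imp_continuous mol_C_inf)

lemma mol_nonneg: "\<epsilon> > 0 \<Longrightarrow> mol \<epsilon> x \<ge> 0"
  using bump_integral_pos[where 'a='a] by (auto simp: mol_def bump_nonneg)

lemma mol_eq_0: "\<epsilon> > 0 \<Longrightarrow> \<epsilon> \<le> norm x \<Longrightarrow> mol \<epsilon> x = 0"
  by (auto simp: mol_def intro: bump_eq_0)

lemma mol_integrable: "\<epsilon> > 0 \<Longrightarrow> integrable lborel (mol \<epsilon>)"
  by (rule integrable_continuous_support[where R=\<epsilon>])
    (auto intro: C_inf_imp_continuous mol_C_inf mol_eq_0)

lemma mol_integral:
  assumes "\<epsilon> > 0" shows "(\<integral>x. mol \<epsilon> (x::'a::euclidean_space) \<partial>lborel) = 1"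
proof -
  let ?I = "\<integral>x. bump (x::'a) \<partial>lborel"
  have [measurable]: "(bump::'a \<Rightarrow> real) \<in> borel_measurable borel" using bump_integrable by auto
  have "?I = \<bar>1 / \<epsilon>\<bar> ^ DIM('a) * (\<integral>x. bump (0 + (1 / \<epsilon>) *\<^sub>R (x::'a)) \<partial>lborel)"
    by (rule integral_lborel_affine) (use assms in auto)
  then have "(\<integral>x. bump (0 + (1 / \<epsilon>) *\<^sub>R (x::'a)) \<partial>lborel) = \<epsilon> ^ DIM('a) * ?I"
    using assms by (simp add: power_divide field_simps)
  then show ?thesis
    unfolding mol_def using assms bump_integral_pos[where 'a='a] by simp
qed

lemma mol_nn_integral:
  assumes "\<epsilon> > 0" shows "(\<integral>\<^sup>+x. ennreal \<bar>mol \<epsilon> (x::'a::euclidean_space)\<bar> \<partial>lborel) = 1"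
proof -
  have "(\<integral>\<^sup>+x. ennreal (mol \<epsilon> (x::'a)) \<partial>lborel) = ennreal (\<integral>x. mol \<epsilon> (x::'a) \<partial>lborel)"
    using assms by (intro nn_integral_eq_integral mol_integrable) (auto simp: mol_nonneg)
  then show ?thesis using assms by (simp add: mol_integral mol_nonneg)
qed

lemma mol_pderiv:
  fixes b x :: "'a::euclidean_space"
  assumes b: "b \<in> Basis"
  shows "pderiv_dir (mol \<epsilon>) b x
    = 1 / \<epsilon> * pderiv_dir bump b ((1 / \<epsilon>) *\<^sub>R x) * (1 / (\<epsilon> ^ DIM('a) * (\<integral>x. bump (x::'a) \<partial>lborel)))"
proof -
  have "((\<lambda>t. bump ((1 / \<epsilon>) *\<^sub>R x + t *\<^sub>R b)) has_real_derivative pderiv_dir bump b ((1 / \<epsilon>) *\<^sub>R x)) (at (1 / \<epsilon> * 0))"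
    using C_inf_imp_deriv[OF bump_C_inf b] by simp
  then have "((\<lambda>t. bump ((1 / \<epsilon>) *\<^sub>R x + (1 / \<epsilon> * t) *\<^sub>R b)) has_real_derivative pderiv_dir bump b ((1 / \<epsilon>) *\<^sub>R x) * (1 / \<epsilon>)) (at 0)"
    by (rule DERIV_chain2[where g="\<lambda>t. 1 / \<epsilon> * t"]) (rule derivative_eq_intros refl | simp)+
  from DERIV_cmult_right[OF this, of "1 / (\<epsilon> ^ DIM('a) * (\<integral>x. bump (x::'a) \<partial>lborel))"]
  show ?thesis unfolding pderiv_dir_def[of "mol \<epsilon>"]
    by (intro DERIV_imp_deriv) (simp add: mol_def scaleR_add_right mult.commute)
qed

text \<open>The dilation preserves L1 norms and differentiation contributes the factor
  1/\<open>\<epsilon>\<close>. Summing over the basis gives one constant for all directions. The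
  singular factor is later compensated by the Lipschitz bound for the coefficients in
  \<open>comm_kernel_bound\<close>.\<close>

lemma mol_pderiv_nn_integral:
  obtains C where "C \<ge> 0" "\<And>\<epsilon> b. \<epsilon> > 0 \<Longrightarrow> b \<in> Basis \<Longrightarrow>
     (\<integral>\<^sup>+x. ennreal \<bar>pderiv_dir (mol \<epsilon>) b (x::'a::euclidean_space)\<bar> \<partial>lborel) \<le> ennreal (C / \<epsilon>)"
proof -
  let ?I = "\<integral>x. bump (x::'a) \<partial>lborel"
  have I: "?I > 0" by (rule bump_integral_pos)
  define c where "c b = (\<integral>x. \<bar>pderiv_dir bump b (x::'a)\<bar> \<partial>lborel)" for b
  have c0: "c b \<ge> 0" for b unfolding c_def by (intro integral_nonneg_AE) auto
  define C where "C = (\<Sum>b\<in>Basis. c b) / ?I"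
  show ?thesis
  proof (rule that[of C])
    show "C \<ge> 0" using c0 I by (auto simp: C_def intro!: divide_nonneg_pos sum_nonneg)
    fix \<epsilon> :: real and b :: 'a assume \<epsilon>: "\<epsilon> > 0" and b: "b \<in> Basis"
    have cont: "continuous_on UNIV (pderiv_dir (bump::'a \<Rightarrow> real) b)"
      by (intro C_inf_imp_continuous C_inf_pderiv bump_C_inf b)
    have [measurable]: "pderiv_dir (bump::'a \<Rightarrow> real) b \<in> borel_measurable borel"
      by (intro borel_measurable_continuous_onI cont)
    have int: "integrable lborel (pderiv_dir (bump::'a \<Rightarrow> real) b)"
      by (rule integrable_continuous_support[OF cont, of 1])
        (rule pderiv_dir_eq_0[of "- cball 0 1" _ _ 0], auto intro: bump_eq_0)
    have nn: "(\<integral>\<^sup>+x. ennreal \<bar>pderiv_dir bump b (x::'a)\<bar> \<partial>lborel) = ennreal (c b)"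
      unfolding c_def using int by (intro nn_integral_eq_integral) auto
    have "ennreal (c b) = ennreal (\<bar>1 / \<epsilon>\<bar> ^ DIM('a)) * (\<integral>\<^sup>+x. ennreal \<bar>pderiv_dir bump b (0 + (1 / \<epsilon>) *\<^sub>R (x::'a))\<bar> \<partial>lborel)"
      unfolding nn[symmetric] by (rule nn_integral_lborel_affine) (use \<epsilon> in auto)
    then have "ennreal (\<epsilon> ^ DIM('a)) * ennreal (c b) = (ennreal (\<epsilon> ^ DIM('a)) * ennreal (\<bar>1 / \<epsilon>\<bar> ^ DIM('a))) * (\<integral>\<^sup>+x. ennreal \<bar>pderiv_dir bump b ((1 / \<epsilon>) *\<^sub>R (x::'a))\<bar> \<partial>lborel)"
      by (simp add: mult.assoc)
    also have "ennreal (\<epsilon> ^ DIM('a)) * ennreal (\<bar>1 / \<epsilon>\<bar> ^ DIM('a)) = 1"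
      using \<epsilon> by (simp add: ennreal_mult[symmetric] power_divide)
    finally have s: "(\<integral>\<^sup>+x. ennreal \<bar>pderiv_dir bump b ((1 / \<epsilon>) *\<^sub>R (x::'a))\<bar> \<partial>lborel) = ennreal (\<epsilon> ^ DIM('a) * c b)"
      using \<epsilon> c0[of b] by (simp add: ennreal_mult)
    have "(\<integral>\<^sup>+x. ennreal \<bar>pderiv_dir (mol \<epsilon>) b (x::'a)\<bar> \<partial>lborel)
      = (\<integral>\<^sup>+x. ennreal (1 / \<epsilon> * (1 / (\<epsilon> ^ DIM('a) * ?I))) * ennreal \<bar>pderiv_dir bump b ((1 / \<epsilon>) *\<^sub>R (x::'a))\<bar> \<partial>lborel)"
      using \<epsilon> I b by (intro nn_integral_cong, subst mol_pderiv[OF b]) (auto simp: abs_mult ennreal_mult[symmetric] field_simps)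
    also have "\<dots> = ennreal (1 / \<epsilon> * (1 / (\<epsilon> ^ DIM('a) * ?I))) * ennreal (\<epsilon> ^ DIM('a) * c b)"
      by (subst nn_integral_cmult) (auto simp: s)
    also have "\<dots> = ennreal (1 / \<epsilon> * (1 / (\<epsilon> ^ DIM('a) * ?I)) * (\<epsilon> ^ DIM('a) * c b))"
      using \<epsilon> I c0[of b] by (intro ennreal_mult[symmetric]) auto
    also have "1 / \<epsilon> * (1 / (\<epsilon> ^ DIM('a) * ?I)) * (\<epsilon> ^ DIM('a) * c b) = c b / ?I / \<epsilon>"
      using \<epsilon> I by (simp add: field_simps)
    also have "c b \<le> (\<Sum>b\<in>Basis. c b)"
      using b c0 by (intro member_le_sum) auto
    then have "ennreal (c b / ?I / \<epsilon>) \<le> ennreal (C / \<epsilon>)"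
      unfolding C_def using \<epsilon> I by (intro ennreal_leI divide_right_mono) auto
    finally show "(\<integral>\<^sup>+x. ennreal \<bar>pderiv_dir (mol \<epsilon>) b (x::'a)\<bar> \<partial>lborel) \<le> ennreal (C / \<epsilon>)" .
  qed
qed

section \<open>Test functions\<close>

lemma test_onI:
  assumes "C_inf \<phi>" "compact K" "K \<subseteq> \<Omega>" "\<And>x. x \<notin> K \<Longrightarrow> \<phi> x = 0"
  shows "test_on \<Omega> \<phi>"
proof -
  have sub: "closure {x. \<phi> x \<noteq> 0} \<subseteq> K"
    using assms by (intro closure_minimal) (auto intro: compact_imp_closed)
  then have "K \<inter> closure {x. \<phi> x \<noteq> 0} = closure {x. \<phi> x \<noteq> 0}" by auto
  moreover have "compact (K \<inter> closure {x. \<phi> x \<noteq> 0})" by (intro compact_Int_closed assms closed_closure)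
  ultimately show ?thesis
    unfolding test_on_def using assms sub by auto
qed

lemma test_on_C_inf: "test_on \<Omega> \<phi> \<Longrightarrow> C_inf \<phi>"
  by (simp add: test_on_def)

lemma test_on_continuous: "test_on \<Omega> \<phi> \<Longrightarrow> continuous_on UNIV \<phi>"
  by (simp add: test_on_C_inf C_inf_imp_continuous)

lemma test_on_measurable: "test_on \<Omega> \<phi> \<Longrightarrow> \<phi> \<in> borel_measurable borel"
  by (intro borel_measurable_continuous_onI test_on_continuous)

lemma test_onE:
  assumes "test_on \<Omega> \<phi>"
  obtains K where "compact K" "K \<subseteq> \<Omega>" "\<And>x. x \<notin> K \<Longrightarrow> \<phi> x = 0"
  using assms closure_subset[of "{x. \<phi> x \<noteq> 0}"] unfolding test_on_def by blast

lemma test_on_eq_0: "test_on \<Omega> \<phi> \<Longrightarrow> x \<notin> \<Omega> \<Longrightarrow> \<phi> x = 0"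
  by (metis test_onE subsetD)

lemma test_on_mono: "test_on A \<phi> \<Longrightarrow> A \<subseteq> B \<Longrightarrow> test_on B \<phi>"
  by (auto simp: test_on_def)

lemma test_on_support:
  assumes "test_on \<Omega> \<phi>"
  obtains R where "\<And>x. R < norm x \<Longrightarrow> \<phi> x = 0"
proof -
  obtain K where K: "compact K" "\<And>x. x \<notin> K \<Longrightarrow> \<phi> x = 0" using assms test_onE by metis
  obtain R where "\<And>x. x \<in> K \<Longrightarrow> norm x \<le> R" using compact_imp_bounded[OF K(1)] bounded_iff by metis
  with K that show ?thesis by (metis not_le)
qed

lemma test_on_bounded:
  assumes "test_on \<Omega> \<phi>"
  obtains B where "B \<ge> 0" "\<And>x. \<bar>\<phi> x\<bar> \<le> B"
  using test_on_support[OF assms] continuous_cball_support_bounded[OF test_on_continuous[OF assms]] by metis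

lemma test_on_mult:
  assumes "test_on \<Omega> \<phi>" "C_inf \<psi>" shows "test_on \<Omega> (\<lambda>x. \<phi> x * \<psi> x)"
proof -
  obtain K where "compact K" "K \<subseteq> \<Omega>" "\<And>x. x \<notin> K \<Longrightarrow> \<phi> x = 0" using assms test_onE by metis
  then show ?thesis
    using assms by (intro test_onI[of _ K]) (auto intro: C_inf_mult test_on_C_inf)
qed

lemma test_on_add:
  assumes "test_on \<Omega> \<phi>" "test_on \<Omega> \<psi>" shows "test_on \<Omega> (\<lambda>x. \<phi> x + \<psi> x)"
proof -
  obtain K K' where "compact K" "K \<subseteq> \<Omega>" "\<And>x. x \<notin> K \<Longrightarrow> \<phi> x = 0"
    "compact K'" "K' \<subseteq> \<Omega>" "\<And>x. x \<notin> K' \<Longrightarrow> \<psi> x = 0" using assms test_onE by metis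
  then show ?thesis
    using assms by (intro test_onI[of _ "K \<union> K'"]) (auto intro: C_inf_add test_on_C_inf)
qed

lemma test_on_0: "test_on \<Omega> (\<lambda>x. 0)"
  by (rule test_onI[of _ "{}"]) auto

lemma test_on_cmult: "test_on \<Omega> \<phi> \<Longrightarrow> test_on \<Omega> (\<lambda>x. c * \<phi> x)"
  using test_on_mult[of \<Omega> \<phi> "\<lambda>x. c"] by (simp add: mult.commute)

lemma test_on_diff: "test_on \<Omega> \<phi> \<Longrightarrow> test_on \<Omega> \<psi> \<Longrightarrow> test_on \<Omega> (\<lambda>x. \<phi> x - \<psi> x)"
  using test_on_add[of \<Omega> \<phi> "\<lambda>x. - 1 * \<psi> x"] test_on_cmult[of \<Omega> \<psi> "- 1"] by simp

lemma test_on_sum: "(\<And>i. i \<in> I \<Longrightarrow> test_on \<Omega> (\<phi> i)) \<Longrightarrow> test_on \<Omega> (\<lambda>x. \<Sum>i\<in>I. \<phi> i x)"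
  by (induction I rule: infinite_finite_induct) (auto intro: test_on_add test_on_0)

lemma test_on_integrable:
  assumes "test_on \<Omega> \<phi>" "finite_measure M" "sets M = sets borel"
  shows "integrable M \<phi>"
proof -
  obtain B where "\<And>x. \<bar>\<phi> x\<bar> \<le> B" using test_on_bounded[OF assms(1)] by metis
  then show ?thesis
    using assms(2) test_on_measurable[OF assms(1)]
    by (intro finite_measure.integrable_const_bound[of M _ B]) (auto simp: measurable_cong_sets[OF assms(3) refl])
qed

section \<open>Mollification, smooth cutoffs and density of test functions\<close>

lemma conv_mol_integrable:
  "\<epsilon> > 0 \<Longrightarrow> integrable lborel w \<Longrightarrow> integrable lborel (\<lambda>y. mol \<epsilon> (x - y) * w y)"
proof -
  assume e: "\<epsilon> > 0" and w: "integrable lborel w"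
  obtain B where "\<And>x. \<bar>mol \<epsilon> (x::'a)\<bar> \<le> B"
    using continuous_cball_support_bounded[OF C_inf_imp_continuous[OF mol_C_inf], of \<epsilon> \<epsilon>] mol_eq_0[OF e]
    by (metis less_imp_le)
  then show ?thesis by (rule conv_integrable[OF C_inf_imp_continuous[OF mol_C_inf] _ w])
qed

lemma conv_mol_C_inf: "\<epsilon> > 0 \<Longrightarrow> integrable lborel w \<Longrightarrow> C_inf (conv (mol \<epsilon>) w)"
  by (rule C_inf_conv[where R=\<epsilon>]) (auto intro: mol_C_inf mol_eq_0)

lemma conv_mol_eq_0:
  assumes "\<epsilon> > 0" "\<And>y. norm (x - y) < \<epsilon> \<Longrightarrow> w y = 0"
  shows "conv (mol \<epsilon>) w x = 0"
proof -
  have "(\<lambda>y. mol \<epsilon> (x - y) * w y) = (\<lambda>y. 0)"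
  proof
    fix y show "mol \<epsilon> (x - y) * w y = 0"
      using assms mol_eq_0[OF assms(1), of "x - y"] by (cases "norm (x - y) < \<epsilon>") auto
  qed
  then show ?thesis by (simp add: conv_def)
qed

lemma test_on_conv_mol:
  assumes "\<epsilon> > 0" "integrable lborel w" "compact S" "\<And>y. y \<notin> S \<Longrightarrow> w y = 0"
    and "\<And>x y. y \<in> S \<Longrightarrow> norm (x - y) \<le> \<epsilon> \<Longrightarrow> x \<in> \<Omega>"
  shows "test_on \<Omega> (conv (mol \<epsilon>) w)"
proof (rule test_onI)
  let ?K = "{a + b |a b. a \<in> S \<and> b \<in> cball 0 \<epsilon>}"
  show "C_inf (conv (mol \<epsilon>) w)" by (rule conv_mol_C_inf) fact+
  show "compact ?K" by (intro compact_sums assms compact_cball)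
  show "?K \<subseteq> \<Omega>" using assms(5) by force
  fix x assume x: "x \<notin> ?K"
  show "conv (mol \<epsilon>) w x = 0"
  proof (rule conv_mol_eq_0[OF assms(1)])
    fix y assume "norm (x - y) < \<epsilon>"
    moreover have "x = y + (x - y)" by simp
    ultimately have "y \<notin> S" using x by (smt (verit) mem_Collect_eq mem_cball_0)
    then show "w y = 0" by (rule assms)
  qed
qed

lemma integral_mol_shift: "\<epsilon> > 0 \<Longrightarrow> (\<integral>y. mol \<epsilon> (x - y) \<partial>lborel) = 1"
  by (subst integral_lborel_diff) (auto simp: mol_integral)

lemma integrable_mol_shift: "\<epsilon> > 0 \<Longrightarrow> integrable lborel (\<lambda>y. mol \<epsilon> (x - y))"
  using integrable_lborel_affine[OF mol_integrable, of \<epsilon> "- 1" x] by simp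

text \<open>The mollifier is a probability density, so an average of values within \<open>e\<close>
  of \<open>c\<close> is itself within \<open>e\<close> of \<open>c\<close>. The case
  \<open>e = 0\<close> is included and says that local constants are reproduced exactly;
  \<open>smooth_urysohn\<close> relies on it.\<close>

lemma conv_mol_close:
  assumes e: "\<epsilon> > 0" and \<phi>: "integrable lborel \<phi>" and c: "\<And>y. norm (x - y) < \<epsilon> \<Longrightarrow> \<bar>\<phi> y - c\<bar> \<le> e"
  shows "\<bar>conv (mol \<epsilon>) \<phi> x - c\<bar> \<le> e"
proof -
  have i: "integrable lborel (\<lambda>y. mol \<epsilon> (x - y) * \<phi> y)" "integrable lborel (\<lambda>y. mol \<epsilon> (x - y) * c)"
    "integrable lborel (\<lambda>y. mol \<epsilon> (x - y) * e)"
    using conv_mol_integrable[OF e \<phi>] integrable_mol_shift[OF e] by auto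
  have "conv (mol \<epsilon>) \<phi> x - c = (\<integral>y. mol \<epsilon> (x - y) * \<phi> y - mol \<epsilon> (x - y) * c \<partial>lborel)"
    using e by (subst Bochner_Integration.integral_diff[OF i(1,2)]) (simp add: conv_def integral_mol_shift)
  also have "\<bar>\<dots>\<bar> \<le> (\<integral>y. mol \<epsilon> (x - y) * e \<partial>lborel)"
  proof (rule integral_abs_bound_integral)
    fix y
    show "\<bar>mol \<epsilon> (x - y) * \<phi> y - mol \<epsilon> (x - y) * c\<bar> \<le> mol \<epsilon> (x - y) * e"
      using c[of y] mol_nonneg[OF e, of "x - y"] mol_eq_0[OF e, of "x - y"]
      by (cases "norm (x - y) < \<epsilon>") (auto simp: right_diff_distrib[symmetric] abs_mult intro: mult_left_mono)
  qed (use i in auto)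
  also have "\<dots> = e" using e by (simp add: integral_mol_shift)
  finally show ?thesis .
qed

lemma uniformly_continuous_support:
  fixes \<phi> :: "'a::euclidean_space \<Rightarrow> real"
  assumes c: "continuous_on UNIV \<phi>" and R: "\<And>x. R < norm x \<Longrightarrow> \<phi> x = 0" and e: "e > 0"
  obtains \<delta> where "\<delta> > 0" "\<And>x y. norm (x - y) < \<delta> \<Longrightarrow> \<bar>\<phi> x - \<phi> y\<bar> \<le> e"
proof -
  \<comment> \<open>For two points at distance less than 1, either both lie in the ball of radius
    \<open>R + 2\<close>, or both lie outside the ball of radius \<open>R\<close>, where
    \<open>\<phi>\<close> is 0.\<close>
  have "uniformly_continuous_on (cball 0 (R + 2)) \<phi>"
    using c by (intro compact_uniformly_continuous) (auto intro: continuous_on_subset)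
  then obtain d where d: "d > 0" "\<And>x y. x \<in> cball 0 (R + 2) \<Longrightarrow> y \<in> cball 0 (R + 2) \<Longrightarrow> dist y x < d \<Longrightarrow> dist (\<phi> y) (\<phi> x) < e"
    unfolding uniformly_continuous_on_def using e by meson
  show ?thesis
  proof (rule that[of "min d 1"])
    fix x y :: 'a assume xy: "norm (x - y) < min d 1"
    have n: "norm y \<le> norm x + norm (x - y)"
      using norm_triangle_sub[of y x] by (simp add: norm_minus_commute)
    have n': "norm x \<le> norm y + norm (x - y)"
      using norm_triangle_sub[of x y] by simp
    show "\<bar>\<phi> x - \<phi> y\<bar> \<le> e"
    proof (cases "norm x \<le> R + 1")
      case True
      then have "dist (\<phi> x) (\<phi> y) < e" using xy n by (intro d) (auto simp: dist_norm)
      then show ?thesis by (simp add: dist_real_def)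
    next
      case False
      then have "\<phi> x = 0" "\<phi> y = 0" using xy n' by (auto intro!: R)
      then show ?thesis using e by simp
    qed
  qed (use d in auto)
qed

lemma conv_mol_uniform:
  fixes \<phi> :: "'a::euclidean_space \<Rightarrow> real"
  assumes c: "continuous_on UNIV \<phi>" and R: "\<And>x. R < norm x \<Longrightarrow> \<phi> x = 0" and e: "e > 0"
  obtains \<delta> where "\<delta> > 0" "\<And>\<epsilon> x. 0 < \<epsilon> \<Longrightarrow> \<epsilon> < \<delta> \<Longrightarrow> \<bar>conv (mol \<epsilon>) \<phi> x - \<phi> x\<bar> \<le> e"
proof -
  obtain \<delta> where d: "\<delta> > 0" "\<And>x y. norm (x - y) < \<delta> \<Longrightarrow> \<bar>\<phi> x - \<phi> y\<bar> \<le> e"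
    using uniformly_continuous_support[OF c R e] by metis
  show ?thesis
  proof (rule that[OF d(1)])
    fix \<epsilon> x assume "0 < \<epsilon>" "\<epsilon> < \<delta>"
    then show "\<bar>conv (mol \<epsilon>) \<phi> x - \<phi> x\<bar> \<le> e"
      using integrable_continuous_support[OF c R] d(2)[of _ x]
      by (intro conv_mol_close) (auto simp: norm_minus_commute)
  qed
qed

lemma conv_mol_nonneg: "\<epsilon> > 0 \<Longrightarrow> (\<And>y. 0 \<le> f y) \<Longrightarrow> 0 \<le> conv (mol \<epsilon>) f x"
  unfolding conv_def by (intro integral_nonneg_AE) (auto simp: mol_nonneg)

lemma compact_open_thicken:
  fixes K :: "'a::euclidean_space set"
  assumes "compact K" "open V" "K \<subseteq> V"
  obtains d where "d > 0" "\<And>x y. y \<in> K \<Longrightarrow> norm (x - y) \<le> d \<Longrightarrow> x \<in> V"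
proof (cases "K = {}")
  case True then show ?thesis by (intro that[of 1]) auto
next
  case False
  obtain d where "d > 0" "(\<Union>x\<in>K. cball x d) \<subseteq> V"
    using compact_subset_open_imp_cball_epsilon_subset[OF assms] by blast
  then show ?thesis by (intro that[of d]) (auto simp: subset_iff dist_norm norm_minus_commute)
qed

text \<open>The indicator of the closed d/2-neighbourhood of \<open>K\<close> is mollified at scale
  d/4: the result is 1 up to distance d/4 from \<open>K\<close> and 0 beyond distance 3d/4, still
  inside \<open>V\<close>. That it is 1 on an open set \<open>U\<close>, and not merely on
  \<open>K\<close>, makes its derivatives vanish on \<open>K\<close>.\<close>

lemma smooth_urysohn:
  fixes K :: "(real^'n) set"
  assumes K: "compact K" "open V" "K \<subseteq> V"
  obtains \<phi> U where "test_on V \<phi>" "\<And>x. 0 \<le> \<phi> x" "\<And>x. \<phi> x \<le> 1"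
    "open U" "K \<subseteq> U" "\<And>x. x \<in> U \<Longrightarrow> \<phi> x = 1"
proof -
  obtain d where d: "d > 0" "\<And>x y. y \<in> K \<Longrightarrow> norm (x - y) \<le> d \<Longrightarrow> x \<in> V"
    using compact_open_thicken[OF K] by metis
  let ?S = "{a + b |a b. a \<in> K \<and> b \<in> cball 0 (d / 2)}"
  define \<phi> where "\<phi> = conv (mol (d / 4)) (indicator ?S)"
  have S: "compact ?S" by (intro compact_sums K compact_cball)
  have inS: "x \<in> ?S" if "y \<in> K" "norm (x - y) \<le> d / 2" for x y
    using that by (intro CollectI exI[of _ y] exI[of _ "x - y"]) auto
  have SI: "integrable lborel (indicator ?S :: real^'n \<Rightarrow> real)"
    using borel_compact[OF S] emeasure_compact_finite[OF S] by (intro integrable_real_indicator) (simp_all only: sets_lborel less_top)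
  show ?thesis
  proof (rule that[of \<phi> "\<Union>y\<in>K. ball y (d / 4)"])
    show "test_on V \<phi>" unfolding \<phi>_def
    proof (rule test_on_conv_mol[OF _ SI S])
      fix x y assume "y \<in> ?S" and xy: "norm (x - y) \<le> d / 4"
      then obtain a b where "y = a + b" "a \<in> K" "norm b \<le> d / 2" by auto
      moreover have "norm (x - a) \<le> norm (x - y) + norm b"
        using norm_triangle_ineq[of "x - y" b] \<open>y = a + b\<close> by simp
      ultimately show "x \<in> V" using xy d by (intro d(2)[of a]) auto
    qed (use d in \<open>auto simp: indicator_def\<close>)
    show "0 \<le> \<phi> x" for x unfolding \<phi>_def using d by (intro conv_mol_nonneg) auto
    show "\<phi> x \<le> 1" for x
    proof -
      have "\<phi> x \<le> (\<integral>y. mol (d / 4) (x - y) \<partial>lborel)"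
        unfolding \<phi>_def conv_def using d conv_mol_integrable[OF _ SI] integrable_mol_shift[of "d/4" x]
        by (intro integral_mono) (auto simp: indicator_def mol_nonneg)
      then show ?thesis using d by (simp add: integral_mol_shift)
    qed
    show "\<phi> x = 1" if x: "x \<in> (\<Union>y\<in>K. ball y (d / 4))" for x
    proof -
      obtain k where k: "k \<in> K" "x \<in> ball k (d / 4)" using x by blast
      then have k: "k \<in> K" "norm (x - k) < d / 4" by (auto simp: dist_norm norm_minus_commute)
      have "y \<in> ?S" if "norm (x - y) < d / 4" for y
      proof (rule inS[OF k(1)])
        show "norm (y - k) \<le> d / 2"
          using norm_triangle_ineq[of "y - x" "x - k"] that k(2) by (simp add: norm_minus_commute)
      qed
      then have "\<bar>conv (mol (d / 4)) (indicator ?S) x - 1\<bar> \<le> 0"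
        using d by (intro conv_mol_close SI) (auto simp del: mem_Collect_eq)
      then show ?thesis by (simp add: \<phi>_def)
    qed
  qed (use d in auto)
qed

text \<open>For an indicator, inner and outer regularity enclose the set between a compact and an
  open set of nearly equal measure, and a smooth Urysohn function fits in between; linear
  combinations and dominated limits give the rest.\<close>

lemma test_dense_L1:
  fixes f :: "real^'n \<Rightarrow> real"
  assumes M: "fin_meas_on U M" and U: "open U" and f: "integrable M f" and e: "e > 0"
  shows "\<exists>\<phi>. test_on U \<phi> \<and> (\<integral>x. \<bar>f x - \<phi> x\<bar> \<partial>M) < e"
proof -
  have sM: "sets M = sets borel" and [simp]: "finite_measure M" and M0: "emeasure M (UNIV - U) = 0"
    using M by (auto simp: fin_meas_on_def)
  interpret finite_measure M by fact
  have [measurable_cong]: "sets M = sets borel" by (rule sM)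
  have sp: "space M = UNIV" using sets_eq_imp_space_eq[OF sM] by simp
  note ti = test_on_integrable[OF _ \<open>finite_measure M\<close> sM]
  have AEU: "AE x in M. x \<in> U"
    using M0 U by (intro AE_I[where N="UNIV - U"]) (auto simp: sM sp intro: borel_open borel_closed)
  show ?thesis
    using f e
  proof (induction f arbitrary: e rule: integrable_induct)
    case (base A c)
    \<comment> \<open>\<open>M\<close> is concentrated on \<open>U\<close>, so intersecting with
      \<open>U\<close> changes nothing almost everywhere, while it allows the cutoff to be supported
      inside \<open>U\<close>.\<close>
    define A' where "A' = A \<inter> U"
    have A'[measurable]: "A' \<in> sets borel" using base sM U by (auto simp: A'_def)
    \<comment> \<open>The final error is at most 2 d |c|; the added 1 covers
      \<open>c = 0\<close>.\<close>
    define d where "d = e / (2 * (\<bar>c\<bar> + 1))"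
    have d: "d > 0" using base by (auto simp: d_def add_nonneg_pos)
    have dd: "ennreal d > 0" using d by simp
    have "emeasure M A' = (SUP K \<in> {K. K \<subseteq> A' \<and> compact K}. emeasure M K)"
      using sM A' by (intro inner_regular) auto
    then have "\<exists>K\<in>{K. K \<subseteq> A' \<and> compact K}. emeasure M A' < emeasure M K + d"
      by (rule SUP_approx_ennreal[OF d, rotated]) (auto intro: exI[of _ "{}"])
    then obtain K where K: "compact K" "K \<subseteq> A'" "emeasure M A' < emeasure M K + ennreal d" by blast
    have "emeasure M A' = (INF V \<in> {V. A' \<subseteq> V \<and> open V}. emeasure M V)"
      using sM A' by (intro outer_regular) auto
    moreover have "(INF V \<in> {V. A' \<subseteq> V \<and> open V}. emeasure M V) < emeasure M A' + ennreal d"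
      unfolding calculation[symmetric] using d
      by (simp add: emeasure_eq_measure ennreal_plus[symmetric] ennreal_less_iff del: ennreal_plus)
    ultimately obtain V where V: "A' \<subseteq> V" "open V" "emeasure M V < emeasure M A' + ennreal d"
      by (auto simp: INF_less_iff)
    have [measurable]: "K \<in> sets borel" "V \<in> sets borel" "U \<in> sets borel"
      using K V U by (auto intro: borel_compact borel_open)
    have KV: "K \<subseteq> V \<inter> U" using K V by (auto simp: A'_def)
    obtain \<phi> W where \<phi>: "test_on (V \<inter> U) \<phi>" "\<And>x. 0 \<le> \<phi> x" "\<And>x. \<phi> x \<le> 1" "K \<subseteq> W" "\<And>x. x \<in> W \<Longrightarrow> \<phi> x = 1"
      by (rule smooth_urysohn[OF K(1) _ KV]) (use V U in auto)
    have m: "measure M A' < measure M K + d" "measure M V < measure M A' + d"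
      using K V d by (auto simp: emeasure_eq_measure ennreal_plus[symmetric] ennreal_less_iff simp del: ennreal_plus)
    have "(\<integral>x. \<bar>indicator A x *\<^sub>R c - c * \<phi> x\<bar> \<partial>M) \<le> (\<integral>x. indicator (V - K) x * \<bar>c\<bar> \<partial>M)"
    proof (rule integral_mono_AE)
      show "integrable M (\<lambda>x. \<bar>indicator A x *\<^sub>R c - c * \<phi> x\<bar>)"
        using base ti[OF \<phi>(1)] by (intro integrable_abs Bochner_Integration.integrable_diff) auto
      show "integrable M (\<lambda>x. indicator (V - K) x * \<bar>c\<bar>)"
        by (intro integrable_mult_left integrable_real_indicator) (auto simp: less_top[symmetric])
      show "AE x in M. \<bar>indicator A x *\<^sub>R c - c * \<phi> x\<bar> \<le> indicator (V - K) x * \<bar>c\<bar>"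
        using AEU
      proof eventually_elim
        case (elim x)
        have "\<bar>indicator A x - \<phi> x\<bar> \<le> (indicator (V - K) x :: real)"
        proof (cases "x \<in> K")
          case True
          then have "x \<in> A" "\<phi> x = 1" using K \<phi> by (auto simp: A'_def)
          then show ?thesis by simp
        next
          case False
          show ?thesis
          proof (cases "x \<in> V")
            case True
            then show ?thesis using \<phi>(2,3)[of x] False by (auto simp: indicator_def)
          next
            case False
            then have "\<phi> x = 0" "x \<notin> A" using test_on_eq_0[OF \<phi>(1)] V(1) elim by (auto simp: A'_def)
            then show ?thesis by simp
          qed
        qed
        then have "\<bar>c\<bar> * \<bar>indicator A x - \<phi> x\<bar> \<le> \<bar>c\<bar> * indicator (V - K) x" by (rule mult_left_mono) simp
        then show ?case by (simp add: abs_mult[symmetric] algebra_simps)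
      qed
    qed
    also have "\<dots> = measure M (V - K) * \<bar>c\<bar>" by simp
    also have "measure M (V - K) = measure M V - measure M K"
      using KV by (intro finite_measure_Diff) auto
    also have "(measure M V - measure M K) * \<bar>c\<bar> \<le> (2 * d) * \<bar>c\<bar>"
      using m by (intro mult_right_mono) auto
    also have "\<dots> < e"
      using base by (simp add: d_def field_simps add_nonneg_pos)
    finally show ?case
      using test_on_mono[OF \<phi>(1), of U] by (intro exI[of _ "\<lambda>x. c * \<phi> x"]) (auto intro: test_on_cmult)
  next
    case (add f g)
    obtain \<phi> \<psi> where \<phi>: "test_on U \<phi>" "(\<integral>x. \<bar>f x - \<phi> x\<bar> \<partial>M) < e / 2" "test_on U \<psi>" "(\<integral>x. \<bar>g x - \<psi> x\<bar> \<partial>M) < e / 2"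
      using add(3)[of "e/2"] add(4)[of "e/2"] add(5) by auto
    have i: "integrable M (\<lambda>x. \<bar>f x - \<phi> x\<bar>)" "integrable M (\<lambda>x. \<bar>g x - \<psi> x\<bar>)"
      using add ti \<phi> by auto
    have "(\<integral>x. \<bar>f x + g x - (\<phi> x + \<psi> x)\<bar> \<partial>M) \<le> (\<integral>x. \<bar>f x - \<phi> x\<bar> + \<bar>g x - \<psi> x\<bar> \<partial>M)"
      using add ti[OF \<phi>(1)] ti[OF \<phi>(3)] i by (intro integral_mono) auto
    also have "\<dots> < e" using \<phi> by (subst Bochner_Integration.integral_add[OF i]) auto
    finally show ?case using \<phi> by (intro exI[of _ "\<lambda>x. \<phi> x + \<psi> x"]) (auto intro: test_on_add)
  next
    case (lim f s)
    have "(\<lambda>i. \<integral>x. \<bar>f x - s i x\<bar> \<partial>M) \<longlonglongrightarrow> (\<integral>x. 0 \<partial>M)"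
    \<comment> \<open>\<open>integrable_induct\<close> supplies approximations with
      \<open>\<bar>s i x\<bar> \<le> 2 * \<bar>f x\<bar>\<close>, whence the factor 3.\<close>
    proof (rule integral_dominated_convergence[where w="\<lambda>x. 3 * \<bar>f x\<bar>"])
      show "AE x in M. (\<lambda>i. \<bar>f x - s i x\<bar>) \<longlonglongrightarrow> 0"
      proof (rule AE_I2)
        fix x assume "x \<in> space M"
        then have "(\<lambda>i. \<bar>f x - s i x\<bar>) \<longlonglongrightarrow> \<bar>f x - f x\<bar>" by (intro tendsto_intros lim)
        then show "(\<lambda>i. \<bar>f x - s i x\<bar>) \<longlonglongrightarrow> 0" by simp
      qed
      show "AE x in M. norm \<bar>f x - s i x\<bar> \<le> 3 * \<bar>f x\<bar>" for i
        using lim(3)[of _ i] by (intro AE_I2) fastforce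
    qed (use lim in auto)
    then have "eventually (\<lambda>i. (\<integral>x. \<bar>f x - s i x\<bar> \<partial>M) < e / 2) sequentially"
      using lim.prems by (intro order_tendstoD(2)) auto
    then obtain i where i: "(\<integral>x. \<bar>f x - s i x\<bar> \<partial>M) < e / 2" by (auto simp: eventually_sequentially)
    obtain \<phi> where \<phi>: "test_on U \<phi>" "(\<integral>x. \<bar>s i x - \<phi> x\<bar> \<partial>M) < e / 2"
      using lim.IH[of "e/2" i] lim.prems by auto
    have ii: "integrable M (\<lambda>x. \<bar>f x - s i x\<bar>)" "integrable M (\<lambda>x. \<bar>s i x - \<phi> x\<bar>)"
      using lim ti \<phi> by auto
    have "(\<integral>x. \<bar>f x - \<phi> x\<bar> \<partial>M) \<le> (\<integral>x. \<bar>f x - s i x\<bar> + \<bar>s i x - \<phi> x\<bar> \<partial>M)"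
      using lim ti[OF \<phi>(1)] ii by (intro integral_mono) auto
    also have "\<dots> < e" using \<phi> i by (subst Bochner_Integration.integral_add[OF ii]) auto
    finally show ?case using \<phi> by auto
  qed
qed

lemma conv_mol_nn_integral_le:
  fixes w :: "'a::euclidean_space \<Rightarrow> real"
  assumes "\<epsilon> > 0" "w \<in> borel_measurable borel"
  shows "(\<integral>\<^sup>+x. ennreal \<bar>conv (mol \<epsilon>) w x\<bar> \<partial>lborel) \<le> (\<integral>\<^sup>+x. ennreal \<bar>w x\<bar> \<partial>lborel)"
proof -
  have "(\<integral>\<^sup>+x. ennreal \<bar>\<integral>y. mol \<epsilon> (x - y) * w y \<partial>lborel\<bar> \<partial>lborel) \<le> 1 * (\<integral>\<^sup>+x. ennreal \<bar>w x\<bar> \<partial>lborel)"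
  proof (rule nn_integral_kernel_le(2))
    show "(\<integral>\<^sup>+x. ennreal \<bar>mol \<epsilon> (x - y)\<bar> \<partial>lborel) \<le> 1" for y :: 'a
      using nn_integral_lborel_diff(1)[of "\<lambda>x. ennreal \<bar>mol \<epsilon> x\<bar>" y] mol_nn_integral[OF assms(1), where 'a='a] by simp
  qed (use assms in \<open>auto intro: sigma_finite_lborel\<close>)
  then show ?thesis by (simp add: conv_def)
qed

text \<open>Three errors of size e/3: replace \<open>w\<close> by a test function, mollify the test
  function, and go back. The two replacements are controlled because convolution with
  \<open>mol\<close> is an L1 contraction, the middle one because the convergence is uniform and
  takes place in a fixed ball.\<close>

lemma conv_mol_L1:
  fixes w :: "real^'n \<Rightarrow> real"
  assumes w: "integrable lborel w" and R: "\<And>x. R \<le> norm x \<Longrightarrow> w x = 0" and e: "e > 0"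
  obtains \<delta> where "\<delta> > 0"
    "\<And>\<epsilon>. 0 < \<epsilon> \<Longrightarrow> \<epsilon> < \<delta> \<Longrightarrow> (\<integral>\<^sup>+x. ennreal \<bar>conv (mol \<epsilon>) w x - w x\<bar> \<partial>lborel) \<le> ennreal e"
proof -
  have [measurable]: "w \<in> borel_measurable borel" using w by auto
  let ?B = "ball 0 R :: (real^'n) set"
  \<comment> \<open>\<open>test_dense_L1\<close> is stated for finite measures, so Lebesgue measure
    is first restricted to a ball outside of which \<open>w\<close> vanishes.\<close>
  define M where "M = density lborel (indicator ?B :: real^'n \<Rightarrow> ennreal)"
  have M: "fin_meas_on ?B M"
    unfolding fin_meas_on_def
  proof (intro conjI)
    show "sets M = sets borel" by (simp add: M_def)
    show "finite_measure M"
    proof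
      have "emeasure M UNIV = emeasure lborel ?B"
        unfolding M_def by (subst emeasure_density) (auto intro: borel_measurable_indicator)
      then show "emeasure M (space M) \<noteq> \<infinity>"
        using emeasure_bounded_finite[of ?B] by (simp add: M_def)
    qed
    have "emeasure M (UNIV - ?B) = (\<integral>\<^sup>+x. indicator ?B x * indicator (UNIV - ?B) x \<partial>lborel)"
      unfolding M_def by (subst emeasure_density) (auto intro: borel_measurable_indicator)
    also have "\<dots> = (\<integral>\<^sup>+x. 0 \<partial>(lborel :: (real^'n) measure))" by (intro nn_integral_cong) (auto simp: indicator_def)
    finally show "emeasure M (UNIV - ?B) = 0" by simp
  qed
  have Mint: "integral\<^sup>L M f = (\<integral>x. indicator ?B x * f x \<partial>lborel)"
    "integrable M f \<longleftrightarrow> integrable lborel (\<lambda>x. indicator ?B x * f x)"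
    if [measurable]: "f \<in> borel_measurable borel" for f :: "_ \<Rightarrow> real"
  proof -
    have [measurable]: "?B \<in> sets borel" by simp
    have M': "M = density lborel (\<lambda>x. ennreal (indicator ?B x))"
      by (simp add: M_def ennreal_indicator)
    show "integral\<^sup>L M f = (\<integral>x. indicator ?B x * f x \<partial>lborel)"
      unfolding M' by (subst integral_density) auto
    show "integrable M f \<longleftrightarrow> integrable lborel (\<lambda>x. indicator ?B x * f x)"
      unfolding M' by (subst integrable_density) auto
  qed
  have iB: "indicator ?B x * f x = f x" if "\<And>x. R \<le> norm x \<Longrightarrow> f x = 0" for f :: "_ \<Rightarrow> real" and x
    using that[of x] by (auto simp: indicator_def)
  have wM: "integrable M w" using w by (simp add: Mint iB R)
  obtain \<phi> where \<phi>: "test_on ?B \<phi>" "(\<integral>x. \<bar>w x - \<phi> x\<bar> \<partial>M) < e / 3"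
    using test_dense_L1[OF M _ wM, of "e/3"] e by auto
  have [measurable]: "\<phi> \<in> borel_measurable borel" using test_on_measurable[OF \<phi>(1)] .
  have \<phi>R: "\<phi> x = 0" if "R \<le> norm x" for x using test_on_eq_0[OF \<phi>(1)] that by auto
  have \<phi>c: "continuous_on UNIV \<phi>" by (rule test_on_continuous[OF \<phi>(1)])
  have \<phi>i: "integrable lborel \<phi>" by (rule integrable_continuous_support[OF \<phi>c, of R]) (auto intro: \<phi>R)
  have 1: "(\<integral>\<^sup>+x. ennreal \<bar>w x - \<phi> x\<bar> \<partial>lborel) \<le> ennreal (e / 3)"
  proof -
    have "(\<integral>\<^sup>+x. ennreal \<bar>w x - \<phi> x\<bar> \<partial>lborel) = ennreal (\<integral>x. \<bar>w x - \<phi> x\<bar> \<partial>lborel)"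
      using w \<phi>i by (intro nn_integral_eq_integral) auto
    also have "(\<integral>x. \<bar>w x - \<phi> x\<bar> \<partial>lborel) = (\<integral>x. \<bar>w x - \<phi> x\<bar> \<partial>M)"
      by (subst Mint) (auto intro!: Bochner_Integration.integral_cong iB[symmetric] simp: R \<phi>R)
    finally show ?thesis using \<phi>(2) by (simp add: ennreal_leI)
  qed
  define V where "V = measure lborel (cball 0 (R + 1) :: (real^'n) set)"
  have V: "V \<ge> 0" by (simp add: V_def)
  \<comment> \<open>For scales below 1 the error lives in the ball of radius \<open>R + 1\<close>,
    of volume \<open>V\<close>; a uniform error \<open>e'\<close> then contributes at most
    e/3.\<close>
  define e' where "e' = e / (3 * (V + 1))"
  have e': "e' > 0" using e V by (simp add: e'_def)
  obtain \<delta> where \<delta>: "\<delta> > 0" "\<And>\<epsilon> x. 0 < \<epsilon> \<Longrightarrow> \<epsilon> < \<delta> \<Longrightarrow> \<bar>conv (mol \<epsilon>) \<phi> x - \<phi> x\<bar> \<le> e'"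
    using conv_mol_uniform[OF \<phi>c _ e', of R] \<phi>R by (metis less_imp_le)
  show ?thesis
  proof (rule that[of "min \<delta> 1"])
    fix \<epsilon> :: real assume \<epsilon>: "0 < \<epsilon>" "\<epsilon> < min \<delta> 1"
    have [measurable]: "conv (mol \<epsilon>) f \<in> borel_measurable borel" if "integrable lborel f" for f :: "real^'n \<Rightarrow> real"
      using that \<epsilon> by (intro borel_measurable_continuous_onI C_inf_imp_continuous conv_mol_C_inf)
    note [measurable] = this[OF w] this[OF \<phi>i]
    have diff: "conv (mol \<epsilon>) (\<lambda>y. w y - \<phi> y) x = conv (mol \<epsilon>) w x - conv (mol \<epsilon>) \<phi> x" for x
      unfolding conv_def right_diff_distrib
      by (intro Bochner_Integration.integral_diff conv_mol_integrable w \<phi>i \<epsilon>)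
    have 2: "(\<integral>\<^sup>+x. ennreal \<bar>conv (mol \<epsilon>) w x - conv (mol \<epsilon>) \<phi> x\<bar> \<partial>lborel) \<le> ennreal (e / 3)"
      using conv_mol_nn_integral_le[OF \<epsilon>(1), of "\<lambda>y. w y - \<phi> y"] 1 by (simp add: diff)
    have "(\<integral>\<^sup>+x. ennreal \<bar>conv (mol \<epsilon>) \<phi> x - \<phi> x\<bar> \<partial>lborel) \<le> (\<integral>\<^sup>+x. ennreal e' * indicator (cball 0 (R + 1)) x \<partial>(lborel :: (real^'n) measure))"
    proof (rule nn_integral_mono)
      fix x :: "real^'n"
      show "ennreal \<bar>conv (mol \<epsilon>) \<phi> x - \<phi> x\<bar> \<le> ennreal e' * indicator (cball 0 (R + 1)) x"
      proof (cases "norm x \<le> R + 1")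
        case True
        then show ?thesis using \<delta>(2)[of \<epsilon> x] \<epsilon> by (auto intro: ennreal_leI)
      next
        case False
        have "\<phi> y = 0" if "norm (x - y) < \<epsilon>" for y
          using that False \<epsilon> norm_triangle_sub[of x y] by (intro \<phi>R) auto
        then have "conv (mol \<epsilon>) \<phi> x = 0" using \<epsilon> by (intro conv_mol_eq_0) auto
        then show ?thesis using \<phi>R[of x] False by simp
      qed
    qed
    also have "\<dots> = ennreal e' * emeasure lborel (cball 0 (R + 1) :: (real^'n) set)"
      by (subst nn_integral_cmult_indicator) auto
    also have "\<dots> = ennreal (e' * V)"
      using e' emeasure_compact_finite[OF compact_cball, of "0::real^'n" "R + 1"] unfolding V_def
      by (subst emeasure_eq_ennreal_measure) (auto simp: ennreal_mult)
    also have "\<dots> \<le> ennreal (e / 3)"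
      using e V by (intro ennreal_leI) (simp add: e'_def field_simps)
    finally have 3: "(\<integral>\<^sup>+x. ennreal \<bar>conv (mol \<epsilon>) \<phi> x - \<phi> x\<bar> \<partial>lborel) \<le> ennreal (e / 3)" .
    have "(\<integral>\<^sup>+x. ennreal \<bar>conv (mol \<epsilon>) w x - w x\<bar> \<partial>lborel) \<le>
      (\<integral>\<^sup>+x. (ennreal \<bar>conv (mol \<epsilon>) w x - conv (mol \<epsilon>) \<phi> x\<bar> + ennreal \<bar>conv (mol \<epsilon>) \<phi> x - \<phi> x\<bar>) + ennreal \<bar>w x - \<phi> x\<bar> \<partial>lborel)"
      by (intro nn_integral_mono) (auto simp: ennreal_plus[symmetric] intro!: ennreal_leI simp del: ennreal_plus)
    also have "\<dots> \<le> (ennreal (e / 3) + ennreal (e / 3)) + ennreal (e / 3)"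
      by (subst nn_integral_add, simp, simp, subst nn_integral_add) (auto intro!: add_mono 1 2 3)
    also have "\<dots> = ennreal e" using e by (simp add: ennreal_plus[symmetric] del: ennreal_plus)
    finally show "(\<integral>\<^sup>+x. ennreal \<bar>conv (mol \<epsilon>) w x - w x\<bar> \<partial>lborel) \<le> ennreal e" .
  qed (use \<delta> in auto)
qed

section \<open>Horizontal vector fields\<close>

lemma sum_Basis_vec: "(\<Sum>b\<in>(Basis::(real^'n) set). F b) = (\<Sum>k\<in>UNIV. F (axis k 1))"
proof -
  have B: "(Basis::(real^'n) set) = range (\<lambda>k. axis k 1)" by (auto simp: Basis_vec_def)
  have "inj (\<lambda>k::'n. axis k (1::real))" by (auto simp: inj_on_def axis_eq_axis)
  then show ?thesis unfolding B by (subst sum.reindex) auto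
qed

lemma axis_Basis: "axis k (1::real) \<in> Basis"
  by (auto simp: Basis_vec_def)

lemma Ck_slice: "Ck n f \<Longrightarrow> Ck n (\<lambda>p. f (p, c))"
proof (induction n arbitrary: f)
  case 0
  then show ?case by (auto intro!: continuous_intros intro: continuous_on_compose2)
next
  case (Suc n)
  show ?case
  proof (rule Ck_SucI[where f'="\<lambda>b p. pderiv_dir f (b, 0) (p, c)"])
    show "continuous_on UNIV (\<lambda>p. f (p, c))"
      by (rule continuous_on_compose2[OF Ck_continuous[OF Suc.prems]]) (auto intro!: continuous_intros)
    fix b :: 'a assume "b \<in> Basis"
    then have b: "(b, 0) \<in> (Basis :: ('a \<times> 'b) set)" by (auto simp: Basis_prod_def)
    show "((\<lambda>t. f (p + t *\<^sub>R b, c)) has_real_derivative pderiv_dir f (b, 0) (p, c)) (at 0)" for p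
      using Ck_Suc_pderiv(1)[OF Suc.prems b, of "(p, c)"] by simp
    show "Ck n (\<lambda>p. pderiv_dir f (b, 0) (p, c))"
      by (rule Suc.IH) (rule Ck_Suc_pderiv(2)[OF Suc.prems b])
  qed
qed

lemma C_inf_lipschitz:
  fixes f :: "'a::euclidean_space \<Rightarrow> real"
  assumes f: "C_inf f"
  obtains L where "L \<ge> 0" "\<And>x y. norm x \<le> R \<Longrightarrow> norm y \<le> R \<Longrightarrow> \<bar>f x - f y\<bar> \<le> L * norm (x - y)"
proof -
  have "\<exists>B. \<forall>x. norm x \<le> R \<longrightarrow> \<bar>pderiv_dir f b x\<bar> \<le> B" if "b \<in> Basis" for b
  proof -
    have "continuous_on UNIV (pderiv_dir f b)" by (intro C_inf_imp_continuous C_inf_pderiv f that)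
    then have "compact (pderiv_dir f b ` cball 0 R)"
      by (intro compact_continuous_image) (auto intro: continuous_on_subset)
    then show ?thesis using compact_imp_bounded bounded_iff
      by (metis imageI mem_cball_0 real_norm_def)
  qed
  then obtain B where B: "\<And>b x. b \<in> Basis \<Longrightarrow> norm x \<le> R \<Longrightarrow> \<bar>pderiv_dir f b x\<bar> \<le> B b" by metis
  define L where "L = (\<Sum>b\<in>Basis. \<bar>B b\<bar>)"
  show ?thesis
  proof (rule that[of L])
    show "L \<ge> 0" by (auto simp: L_def intro: sum_nonneg)
    fix x y :: 'a assume xy: "norm x \<le> R" "norm y \<le> R"
    have "norm (f x - f y) \<le> L * norm (x - y)"
    proof (rule differentiable_bound[of "cball 0 R"])
      show "(f has_derivative (\<lambda>h. \<Sum>b\<in>Basis. (h \<bullet> b) * pderiv_dir f b x)) (at x within cball 0 R)" for x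
        by (rule has_derivative_at_withinI[OF Ck_has_derivative[OF C_inf_imp_Ck[OF f]]])
      fix x :: 'a assume x: "x \<in> cball 0 R"
      show "onorm (\<lambda>h. \<Sum>b\<in>Basis. (h \<bullet> b) * pderiv_dir f b x) \<le> L"
      proof (rule onorm_bound)
        fix h :: 'a
        have "norm (\<Sum>b\<in>Basis. (h \<bullet> b) * pderiv_dir f b x) \<le> (\<Sum>b\<in>Basis. norm h * \<bar>B b\<bar>)"
          using x B by (intro order_trans[OF norm_sum] sum_mono) (force simp: abs_mult Basis_le_norm intro!: mult_mono)
        then show "norm (\<Sum>b\<in>Basis. (h \<bullet> b) * pderiv_dir f b x) \<le> L * norm h"
          by (simp add: L_def sum_distrib_left mult.commute)
      qed fact
    qed (use xy in auto)
    then show "\<bar>f x - f y\<bar> \<le> L * norm (x - y)" by simp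
  qed
qed

locale carnot =
  fixes gm :: "real^'n \<Rightarrow> real^'n \<Rightarrow> real^'n" and deg :: "'n \<Rightarrow> nat"
  assumes carnot: "carnot_group gm deg"
begin

text \<open>The k-th coordinate at p of the left-invariant field X_j, that is, of
  \<open>lfield gm (axis j 1)\<close>; thus X_j is the sum over k of \<open>coef j k\<close> times
  the k-th partial derivative.\<close>

definition coef :: "'n \<Rightarrow> 'n \<Rightarrow> real^'n \<Rightarrow> real" where
  "coef j k p = deriv (\<lambda>t. gm p (t *\<^sub>R axis j 1) $ k) 0"

lemma gm_0: "gm p 0 = p"
proof -
  have "gm (1 *\<^sub>R p) (0 *\<^sub>R p) = (1 + 0) *\<^sub>R p" using carnot unfolding carnot_group_def by blast
  then show ?thesis by simp
qed

lemma gm_C_inf: "C_inf (\<lambda>(x, y). gm x y $ k)"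
  using carnot unfolding carnot_group_def by blast

lemma snd_axis_Basis: "(0, axis j 1) \<in> (Basis :: ((real^'n) \<times> (real^'n)) set)"
  by (auto simp: Basis_prod_def axis_Basis)

lemma coef_eq: "coef j k p = pderiv_dir (\<lambda>(x, y). gm x y $ k) (0, axis j 1) (p, 0)"
  by (simp add: coef_def pderiv_dir_def)

lemma coef_C_inf: "C_inf (coef j k)"
proof -
  have "C_inf (pderiv_dir (\<lambda>(x, y). gm x y $ k) (0, axis j 1))"
    by (intro C_inf_pderiv gm_C_inf snd_axis_Basis)
  then show ?thesis
    unfolding C_inf_iff_Ck using Ck_slice[of _ _ 0] by (auto simp: coef_eq[abs_def] simp del: Ck.simps)
qed

lemma coef_measurable [measurable]: "coef j k \<in> borel_measurable borel"
  by (intro borel_measurable_continuous_onI C_inf_imp_continuous coef_C_inf)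

lemma coef_DERIV: "((\<lambda>t. gm p (t *\<^sub>R axis j 1) $ k) has_real_derivative coef j k p) (at 0)"
  using C_inf_imp_deriv[OF gm_C_inf snd_axis_Basis, of k "(p, 0)" j] by (simp add: coef_eq)

text \<open>\<open>Xop\<close> differentiates along the curve t -> p.(t e_j), which is not a
  straight line in coordinates. Its velocity at 0 is the vector of the \<open>coef j k p\<close>,
  and total differentiability of \<open>f\<close> allows the chain rule.\<close>

lemma Xop_DERIV:
  assumes f: "C_inf f"
  shows "((\<lambda>t. f (gm p (t *\<^sub>R axis j 1))) has_real_derivative (\<Sum>k\<in>UNIV. coef j k p * pderiv_dir f (axis k 1) p)) (at 0)"
proof -
  have c: "((\<lambda>t. gm p (t *\<^sub>R axis j 1)) has_derivative (\<lambda>t. t *\<^sub>R (\<chi> k. coef j k p))) (at 0)"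
  proof (subst has_derivative_componentwise_within, intro ballI)
    fix i :: "real^'n" assume "i \<in> Basis"
    then obtain k where k: "i = axis k 1" by (auto simp: Basis_vec_def)
    show "((\<lambda>t. gm p (t *\<^sub>R axis j 1) \<bullet> i) has_derivative (\<lambda>t. t *\<^sub>R (\<chi> k. coef j k p) \<bullet> i)) (at 0)"
      using coef_DERIV[of p j k] unfolding has_field_derivative_def k mult.commute[of "coef j k p", abs_def]
      by (simp add: inner_axis mult.commute[of "coef j k p"])
  qed
  have "(f has_derivative (\<lambda>h. \<Sum>b\<in>Basis. (h \<bullet> b) * pderiv_dir f b p)) (at (gm p (0 *\<^sub>R axis j 1)))"
    using Ck_has_derivative[OF C_inf_imp_Ck[OF f]] by (simp add: gm_0)
  from has_derivative_compose[OF c this]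
  have "((\<lambda>t. f (gm p (t *\<^sub>R axis j 1))) has_derivative (\<lambda>t. \<Sum>b\<in>Basis. (t *\<^sub>R (\<chi> k. coef j k p) \<bullet> b) * pderiv_dir f b p)) (at 0)" .
  moreover have "(\<lambda>t. \<Sum>b\<in>Basis. (t *\<^sub>R (\<chi> k. coef j k p) \<bullet> b) * pderiv_dir f b p)
      = (*) (\<Sum>k\<in>UNIV. coef j k p * pderiv_dir f (axis k 1) p)"
    unfolding sum_Basis_vec by (simp add: fun_eq_iff inner_axis mult.assoc mult.commute[of "sum _ _"] sum_distrib_left)
  ultimately show ?thesis
    unfolding has_field_derivative_def by simp
qed

lemma Xop_eq: "C_inf f \<Longrightarrow> Xop gm j f p = (\<Sum>k\<in>UNIV. coef j k p * pderiv_dir f (axis k 1) p)"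
  unfolding Xop_def by (intro DERIV_imp_deriv Xop_DERIV)

lemma Xop_has_deriv: "C_inf f \<Longrightarrow> ((\<lambda>t. f (gm p (t *\<^sub>R axis j 1))) has_real_derivative Xop gm j f p) (at 0)"
  using Xop_DERIV Xop_eq by simp

lemma Xop_C_inf: "C_inf f \<Longrightarrow> C_inf (Xop gm j f)"
proof -
  assume f: "C_inf f"
  have "Xop gm j f = (\<lambda>p. \<Sum>k\<in>UNIV. coef j k p * pderiv_dir f (axis k 1) p)"
    using Xop_eq[OF f] by (intro ext)
  then show ?thesis
    by (simp only:) (intro C_inf_sum C_inf_mult coef_C_inf C_inf_pderiv f axis_Basis)
qed

lemma Xop_mult:
  assumes "C_inf f" "C_inf g"
  shows "Xop gm j (\<lambda>x. f x * g x) p = f p * Xop gm j g p + g p * Xop gm j f p"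
proof -
  have "((\<lambda>t. f (gm p (t *\<^sub>R axis j 1)) * g (gm p (t *\<^sub>R axis j 1))) has_real_derivative
     f p * Xop gm j g p + g p * Xop gm j f p) (at 0)"
    using DERIV_mult[OF Xop_has_deriv[OF assms(1), of p j] Xop_has_deriv[OF assms(2), of p j]]
    by (simp add: gm_0 algebra_simps)
  then show ?thesis unfolding Xop_def[of gm j "\<lambda>x. f x * g x"] by (rule DERIV_imp_deriv)
qed

lemma Xop_compose:
  assumes "C_inf f" "(h has_real_derivative h') (at (f p))"
  shows "Xop gm j (\<lambda>x. h (f x)) p = h' * Xop gm j f p"
proof -
  have "((\<lambda>t. h (f (gm p (t *\<^sub>R axis j 1)))) has_real_derivative h' * Xop gm j f p) (at 0)"
    by (rule DERIV_chain2[OF _ Xop_has_deriv[OF assms(1)]]) (use assms(2) in \<open>simp add: gm_0\<close>)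
  then show ?thesis unfolding Xop_def[of gm j "\<lambda>x. h (f x)"] by (rule DERIV_imp_deriv)
qed

lemma Xop_sum:
  assumes "\<And>i. i \<in> I \<Longrightarrow> C_inf (f i)"
  shows "Xop gm j (\<lambda>x. \<Sum>i\<in>I. f i x) p = (\<Sum>i\<in>I. Xop gm j (f i) p)"
proof -
  have "((\<lambda>t. \<Sum>i\<in>I. f i (gm p (t *\<^sub>R axis j 1))) has_real_derivative (\<Sum>i\<in>I. Xop gm j (f i) p)) (at 0)"
    by (intro DERIV_sum Xop_has_deriv assms)
  then show ?thesis unfolding Xop_def[of gm j "\<lambda>x. \<Sum>i\<in>I. f i x"] by (rule DERIV_imp_deriv)
qed

lemma Xop_diff:
  assumes "C_inf f" "C_inf g"
  shows "Xop gm j (\<lambda>x. f x - g x) p = Xop gm j f p - Xop gm j g p"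
proof -
  have "((\<lambda>t. f (gm p (t *\<^sub>R axis j 1)) - g (gm p (t *\<^sub>R axis j 1))) has_real_derivative
     Xop gm j f p - Xop gm j g p) (at 0)"
    by (intro DERIV_diff Xop_has_deriv assms)
  then show ?thesis unfolding Xop_def[of gm j "\<lambda>x. f x - g x"] by (rule DERIV_imp_deriv)
qed

lemma Xop_cong_open:
  assumes "open U" "p \<in> U" "C_inf f" "C_inf g" "\<And>y. y \<in> U \<Longrightarrow> f y = g y"
  shows "Xop gm j f p = Xop gm j g p"
  using assms by (auto simp: Xop_eq intro!: sum.cong pderiv_dir_cong_open)

lemma Xop_const: "Xop gm j (\<lambda>x. c) p = 0"
  by (simp add: Xop_def)

lemma Xop_eq_0:
  assumes "open U" "p \<in> U" "C_inf f" "\<And>y. y \<in> U \<Longrightarrow> f y = c"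
  shows "Xop gm j f p = 0"
  using Xop_cong_open[OF assms(1,2,3), of "\<lambda>x. c"] assms by (simp add: Xop_const)

lemma test_on_Xop:
  assumes "test_on \<Omega> \<phi>" shows "test_on \<Omega> (Xop gm j \<phi>)"
proof -
  obtain K where K: "compact K" "K \<subseteq> \<Omega>" "\<And>x. x \<notin> K \<Longrightarrow> \<phi> x = 0" using assms test_onE by metis
  have "Xop gm j \<phi> x = 0" if "x \<notin> K" for x
    by (rule Xop_eq_0[of "- K"]) (use that K assms in \<open>auto intro: compact_imp_closed test_on_C_inf\<close>)
  with K assms show ?thesis by (intro test_onI[of _ K]) (auto intro: Xop_C_inf test_on_C_inf)
qed

text \<open>The kernel of the commutator of X_j with convolution by \<open>mol \<epsilon>\<close>:
  the field acts on the mollifier with its coefficients at \<open>x\<close>, minus the same with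
  coefficients at \<open>y\<close>.\<close>

definition comm_kernel :: "'n \<Rightarrow> real \<Rightarrow> real^'n \<Rightarrow> real^'n \<Rightarrow> real" where
  "comm_kernel j \<epsilon> x y = (\<Sum>k\<in>UNIV. (coef j k x - coef j k y) * pderiv_dir (mol \<epsilon>) (axis k 1) (x - y))"

lemma pderiv_mol_measurable [measurable]: "pderiv_dir (mol \<epsilon>) (axis k (1::real)) \<in> borel_measurable borel"
  by (intro borel_measurable_continuous_onI C_inf_imp_continuous C_inf_pderiv mol_C_inf axis_Basis)

lemma pderiv_mol_eq_0: "\<epsilon> > 0 \<Longrightarrow> \<epsilon> < norm x \<Longrightarrow> pderiv_dir (mol \<epsilon>) b x = 0"
  by (rule pderiv_dir_eq_0[of "- cball 0 \<epsilon>" _ _ 0]) (auto intro: mol_eq_0)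

lemma comm_kernel_measurable [measurable]: "(\<lambda>(x, y). comm_kernel j \<epsilon> x y) \<in> borel_measurable (borel \<Otimes>\<^sub>M borel)"
  unfolding comm_kernel_def by measurable

lemma comm_kernel_eq_0: "\<epsilon> > 0 \<Longrightarrow> \<epsilon> < norm (x - y) \<Longrightarrow> comm_kernel j \<epsilon> x y = 0"
  unfolding comm_kernel_def by (simp add: pderiv_mol_eq_0)

text \<open>Friedrichs' estimate: the kernel lives on |x - y| at most \<open>\<epsilon>\<close>,
  where the coefficients differ by at most a Lipschitz constant times \<open>\<epsilon>\<close>;
  this cancels the 1/\<open>\<epsilon>\<close> in the L1 norm of the derivative of the mollifier.
  With \<open>\<epsilon> \<le> 1\<close> all points involved stay in the ball of radius
  \<open>R + 1\<close>, so local Lipschitz constants do.\<close>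

lemma comm_kernel_bound:
  obtains C where "C \<ge> 0" "\<And>\<epsilon> y j. 0 < \<epsilon> \<Longrightarrow> \<epsilon> \<le> 1 \<Longrightarrow> norm y \<le> R \<Longrightarrow>
    (\<integral>\<^sup>+x. ennreal \<bar>comm_kernel j \<epsilon> x y\<bar> \<partial>lborel) \<le> ennreal C"
proof -
  have "\<exists>L\<ge>0. \<forall>x y. norm x \<le> R + 1 \<longrightarrow> norm y \<le> R + 1 \<longrightarrow> \<bar>coef j k x - coef j k y\<bar> \<le> L * norm (x - y)" for j k
    using C_inf_lipschitz[OF coef_C_inf, of "R + 1"] by metis
  then obtain L where L: "\<And>j k. L j k \<ge> 0" "\<And>j k x y. norm x \<le> R + 1 \<Longrightarrow> norm y \<le> R + 1 \<Longrightarrow>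
      \<bar>coef j k x - coef j k y\<bar> \<le> L j k * norm (x - y)" by metis
  obtain D where D: "D \<ge> 0" "\<And>\<epsilon> b. \<epsilon> > 0 \<Longrightarrow> b \<in> Basis \<Longrightarrow>
     (\<integral>\<^sup>+x. ennreal \<bar>pderiv_dir (mol \<epsilon>) b (x::real^'n)\<bar> \<partial>lborel) \<le> ennreal (D / \<epsilon>)"
    using mol_pderiv_nn_integral by blast
  define C where "C = (\<Sum>j\<in>UNIV. \<Sum>k\<in>UNIV. L j k * D)"
  show ?thesis
  proof (rule that[of C])
    show "C \<ge> 0" using L D by (auto simp: C_def intro!: sum_nonneg)
    fix \<epsilon> y j assume \<epsilon>: "0 < \<epsilon>" "\<epsilon> \<le> (1::real)" and y: "norm (y::real^'n) \<le> R"
    have "(\<integral>\<^sup>+x. ennreal \<bar>comm_kernel j \<epsilon> x y\<bar> \<partial>lborel)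
      \<le> (\<integral>\<^sup>+x. (\<Sum>k\<in>UNIV. ennreal (L j k * \<epsilon>) * ennreal \<bar>pderiv_dir (mol \<epsilon>) (axis k 1) (x - y)\<bar>) \<partial>lborel)"
    proof (rule nn_integral_mono)
      fix x :: "real^'n"
      have "\<bar>(coef j k x - coef j k y) * pderiv_dir (mol \<epsilon>) (axis k 1) (x - y)\<bar> \<le> L j k * \<epsilon> * \<bar>pderiv_dir (mol \<epsilon>) (axis k 1) (x - y)\<bar>" for k
      proof (cases "norm (x - y) \<le> \<epsilon>")
        case True
        have "norm x \<le> R + 1" using norm_triangle_sub[of x y] True y \<epsilon> by auto
        then have "\<bar>coef j k x - coef j k y\<bar> \<le> L j k * norm (x - y)" using y by (intro L) auto
        also have "\<dots> \<le> L j k * \<epsilon>" using True L by (intro mult_left_mono) auto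
        finally show ?thesis by (simp add: abs_mult mult_right_mono)
      next
        case False
        then show ?thesis using pderiv_mol_eq_0[OF \<epsilon>(1), of "x - y"] by simp
      qed
      then have "\<bar>comm_kernel j \<epsilon> x y\<bar> \<le> (\<Sum>k\<in>UNIV. L j k * \<epsilon> * \<bar>pderiv_dir (mol \<epsilon>) (axis k 1) (x - y)\<bar>)"
        unfolding comm_kernel_def by (intro order_trans[OF sum_abs] sum_mono)
      then show "ennreal \<bar>comm_kernel j \<epsilon> x y\<bar> \<le> (\<Sum>k\<in>UNIV. ennreal (L j k * \<epsilon>) * ennreal \<bar>pderiv_dir (mol \<epsilon>) (axis k 1) (x - y)\<bar>)"
        using L \<epsilon> by (simp add: ennreal_mult[symmetric] ennreal_leI)
    qed
    also have "\<dots> = (\<Sum>k\<in>UNIV. ennreal (L j k * \<epsilon>) * (\<integral>\<^sup>+x. ennreal \<bar>pderiv_dir (mol \<epsilon>) (axis k 1) (x::real^'n)\<bar> \<partial>lborel))"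
      by (subst nn_integral_sum) (auto simp: nn_integral_cmult intro!: sum.cong arg_cong2[where f="(*)"]
         nn_integral_lborel_diff(1)[of "\<lambda>x. ennreal \<bar>pderiv_dir (mol \<epsilon>) (axis _ 1) x\<bar>"])
    also have "\<dots> \<le> (\<Sum>k\<in>UNIV. ennreal (L j k * \<epsilon>) * ennreal (D / \<epsilon>))"
      using \<epsilon> by (intro sum_mono mult_left_mono D axis_Basis) auto
    also have "\<dots> = (\<Sum>k\<in>UNIV. ennreal (L j k * D))"
      using \<epsilon> L D by (intro sum.cong) (auto simp: ennreal_mult[symmetric])
    also have "\<dots> = ennreal (\<Sum>k\<in>UNIV. L j k * D)"
      using L D by (intro sum_ennreal) auto
    also have "\<dots> \<le> ennreal C"
      unfolding C_def using L D by (intro ennreal_leI member_le_sum[of j UNIV "\<lambda>j. \<Sum>k\<in>UNIV. L j k * D"]) (auto intro!: sum_nonneg)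
    finally show "(\<integral>\<^sup>+x. ennreal \<bar>comm_kernel j \<epsilon> x y\<bar> \<partial>lborel) \<le> ennreal C" .
  qed
qed

lemma mol_refl_C_inf: "C_inf (\<lambda>y. mol \<epsilon> (x - y))"
  using C_inf_affine[OF mol_C_inf, of \<epsilon> x "- 1"] by simp

lemma test_on_mol_refl:
  assumes "\<epsilon> > 0" shows "test_on UNIV (\<lambda>y. mol \<epsilon> (x - y))"
  by (rule test_onI[of _ "cball x \<epsilon>"]) (auto intro: mol_refl_C_inf simp: assms dist_norm intro!: mol_eq_0)

lemma Xop_mol_refl:
  "Xop gm j (\<lambda>y. mol \<epsilon> (x - y)) y = - (\<Sum>k\<in>UNIV. coef j k y * pderiv_dir (mol \<epsilon>) (axis k 1) (x - y))"
proof -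
  have "pderiv_dir (\<lambda>y. mol \<epsilon> (x - y)) (axis k 1) = (\<lambda>y. - pderiv_dir (mol \<epsilon>) (axis k (1::real)) (x - y))" for k
  proof (rule pderiv_dir_eqI)
    fix y
    have "((\<lambda>t. mol \<epsilon> (x - y + t *\<^sub>R axis k 1)) has_real_derivative pderiv_dir (mol \<epsilon>) (axis k 1) (x - y)) (at (- 0))"
      using C_inf_imp_deriv[OF mol_C_inf axis_Basis] by simp
    then have "((\<lambda>t. mol \<epsilon> (x - y + (- t) *\<^sub>R axis k 1)) has_real_derivative pderiv_dir (mol \<epsilon>) (axis k 1) (x - y) * - 1) (at 0)"
      by (rule DERIV_chain2[where g="\<lambda>t. - t"]) (rule derivative_eq_intros refl | simp)+
    then show "((\<lambda>t. mol \<epsilon> (x - (y + t *\<^sub>R axis k 1))) has_real_derivative - pderiv_dir (mol \<epsilon>) (axis k 1) (x - y)) (at 0)"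
      by (simp add: algebra_simps)
  qed
  then show ?thesis by (simp add: Xop_eq[OF mol_refl_C_inf] sum_negf)
qed

text \<open>Moving the derivative from the first to the second argument of the mollifier costs only the
  commutator kernel, whose \<open>L\<^sup>1\<close> norm is bounded uniformly in \<open>\<epsilon>\<close>.\<close>

lemma Xop_conv:
  assumes e: "\<epsilon> > 0" and w: "integrable lborel w"
  shows "Xop gm j (conv (mol \<epsilon>) w) x
      = (\<integral>y. comm_kernel j \<epsilon> x y * w y \<partial>lborel) - (\<integral>y. w y * Xop gm j (\<lambda>y. mol \<epsilon> (x - y)) y \<partial>lborel)"
    and "integrable lborel (\<lambda>y. comm_kernel j \<epsilon> x y * w y)"
    and "integrable lborel (\<lambda>y. w y * Xop gm j (\<lambda>y. mol \<epsilon> (x - y)) y)"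
proof -
  have i: "integrable lborel (\<lambda>y. pderiv_dir (mol \<epsilon>) (axis k 1) (x - y) * w y)" for k
  proof -
    have c: "continuous_on UNIV (pderiv_dir (mol \<epsilon>) (axis k (1::real)))"
      by (intro C_inf_imp_continuous C_inf_pderiv mol_C_inf axis_Basis)
    obtain B where "\<And>x. \<bar>pderiv_dir (mol \<epsilon>) (axis k (1::real)) x\<bar> \<le> B"
      using continuous_cball_support_bounded[OF c pderiv_mol_eq_0[OF e]] by metis
    then show ?thesis by (rule conv_integrable[OF c _ w])
  qed
  show i2: "integrable lborel (\<lambda>y. w y * Xop gm j (\<lambda>y. mol \<epsilon> (x - y)) y)"
  proof -
    have t: "test_on UNIV (Xop gm j (\<lambda>y. mol \<epsilon> (x - y)))" by (intro test_on_Xop test_on_mol_refl e)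
    obtain B where B: "B \<ge> 0" "\<And>y. \<bar>Xop gm j (\<lambda>y. mol \<epsilon> (x - y)) y\<bar> \<le> B" using test_on_bounded[OF t] by metis
    have [measurable]: "w \<in> borel_measurable borel" "Xop gm j (\<lambda>y. mol \<epsilon> (x - y)) \<in> borel_measurable borel"
      using w test_on_measurable[OF t] by auto
    show ?thesis
      by (rule Bochner_Integration.integrable_bound[where f="\<lambda>y. B * w y"])
        (use w B in \<open>auto simp: abs_mult mult.commute[of "\<bar>w _\<bar>"] intro!: mult_right_mono\<close>)
  qed
  \<comment> \<open>The coefficients at \<open>y\<close> are subtracted and added; with them the
    derivative of the mollifier is, up to sign, X_j of the reflected mollifier as a function of
    \<open>y\<close>.\<close>
  have eq: "comm_kernel j \<epsilon> x y * w y = (\<Sum>k\<in>UNIV. coef j k x * (pderiv_dir (mol \<epsilon>) (axis k 1) (x - y) * w y))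
      + w y * Xop gm j (\<lambda>y. mol \<epsilon> (x - y)) y" for y
    unfolding Xop_mol_refl comm_kernel_def
    by (simp add: left_diff_distrib sum_subtractf sum_distrib_left sum_distrib_right algebra_simps)
  have i1: "integrable lborel (\<lambda>y. \<Sum>k\<in>UNIV. coef j k x * (pderiv_dir (mol \<epsilon>) (axis k 1) (x - y) * w y))"
    by (intro Bochner_Integration.integrable_sum integrable_mult_right i)
  show "integrable lborel (\<lambda>y. comm_kernel j \<epsilon> x y * w y)"
    unfolding eq by (intro Bochner_Integration.integrable_add i1 i2)
  have "Xop gm j (conv (mol \<epsilon>) w) x = (\<Sum>k\<in>UNIV. coef j k x * conv (pderiv_dir (mol \<epsilon>) (axis k 1)) w x)"
    using e by (subst Xop_eq[OF conv_mol_C_inf[OF e w]], subst pderiv_conv[where R=\<epsilon>]) (auto intro: mol_C_inf mol_eq_0 w axis_Basis)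
  also have "\<dots> = (\<integral>y. (\<Sum>k\<in>UNIV. coef j k x * (pderiv_dir (mol \<epsilon>) (axis k 1) (x - y) * w y)) \<partial>lborel)"
    unfolding conv_def by (subst Bochner_Integration.integral_sum) (auto intro!: i)
  finally show "Xop gm j (conv (mol \<epsilon>) w) x
      = (\<integral>y. comm_kernel j \<epsilon> x y * w y \<partial>lborel) - (\<integral>y. w y * Xop gm j (\<lambda>y. mol \<epsilon> (x - y)) y \<partial>lborel)"
    unfolding eq by (subst Bochner_Integration.integral_add[OF i1 i2]) simp
qed

end

section \<open>Smooth functions with prescribed trace\<close>

lemma vec_nth_measurable [measurable]: "(\<lambda>x::real^'n. x $ j) \<in> borel_measurable borel"
  by (intro borel_measurable_continuous_onI continuous_intros)

text \<open>The estimates below produce a finite sum of extended nonnegative integrals; this turns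
  it into the summability of real norms on which termwise Bochner integration depends.\<close>

lemma sums_integral_nn:
  fixes f :: "nat \<Rightarrow> 'a \<Rightarrow> real"
  assumes [measurable]: "\<And>i. f i \<in> borel_measurable M"
    and s: "\<And>x. x \<in> space M \<Longrightarrow> summable (\<lambda>i. \<bar>f i x\<bar>)"
    and fin: "(\<Sum>i. \<integral>\<^sup>+x. ennreal \<bar>f i x\<bar> \<partial>M) < \<infinity>"
  shows "integrable M (f i)" "integrable M (\<lambda>x. \<Sum>i. f i x)"
    "(\<lambda>i. \<integral>x. f i x \<partial>M) sums (\<integral>x. (\<Sum>i. f i x) \<partial>M)"
proof -
  have fini: "(\<integral>\<^sup>+x. ennreal \<bar>f i x\<bar> \<partial>M) < \<infinity>" for i
    using fin ennreal_suminf_lessD by blast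
  show int: "integrable M (f i)" for i
    using fini[of i] by (intro integrableI_bounded) auto
  have eq: "(\<integral>\<^sup>+x. ennreal \<bar>f i x\<bar> \<partial>M) = ennreal (\<integral>x. \<bar>f i x\<bar> \<partial>M)" for i
    using int by (intro nn_integral_eq_integral) auto
  have "summable (\<lambda>i. \<integral>x. \<bar>f i x\<bar> \<partial>M)"
    by (rule summable_suminf_not_top) (use fin in \<open>auto simp: eq\<close>)
  then have su: "summable (\<lambda>i. \<integral>x. norm (f i x) \<partial>M)" by simp
  have ae: "AE x in M. summable (\<lambda>i. norm (f i x))" using s by auto
  show "integrable M (\<lambda>x. \<Sum>i. f i x)" by (rule integrable_suminf[OF int ae su])
  show "(\<lambda>i. \<integral>x. f i x \<partial>M) sums (\<integral>x. (\<Sum>i. f i x) \<partial>M)" by (rule sums_integral[OF int ae su])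
qed

lemma set_integral_lebesgue_eq:
  fixes F :: "real^'n \<Rightarrow> real"
  assumes "F \<in> borel_measurable borel" "\<And>x. x \<notin> \<Omega> \<Longrightarrow> F x = 0"
  shows "(LINT x:\<Omega>|lebesgue. F x) = (\<integral>x. F x \<partial>lborel)"
proof -
  have "(\<lambda>x. indicator \<Omega> x *\<^sub>R F x) = F" using assms(2) by (auto simp: indicator_def fun_eq_iff)
  then show ?thesis using assms(1) by (simp add: set_lebesgue_integral_def integral_completion)
qed

lemma fin_meas_on_AE:
  assumes "fin_meas_on \<Omega> P" "open \<Omega>" shows "AE x in P. x \<in> \<Omega>"
proof -
  have s: "sets P = sets borel" and z: "emeasure P (UNIV - \<Omega>) = 0" using assms by (auto simp: fin_meas_on_def)
  have "space P = UNIV" using sets_eq_imp_space_eq[OF s] by simp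
  moreover have "UNIV - \<Omega> \<in> sets P" using assms(2) by (simp add: s)
  ultimately show ?thesis using z by (intro AE_I[where N="UNIV - \<Omega>"]) auto
qed

lemma fin_meas_on_set_integral:
  fixes F :: "real^'n \<Rightarrow> real"
  assumes "fin_meas_on \<Omega> P" "open \<Omega>" "F \<in> borel_measurable borel"
  shows "(LINT x:\<Omega>|P. F x) = (\<integral>x. F x \<partial>P)"
proof -
  have s: "sets P = sets borel" using assms by (auto simp: fin_meas_on_def)
  have m: "F \<in> borel_measurable P" "\<Omega> \<in> sets P" using assms by (auto simp: measurable_cong_sets[OF s refl] s)
  have "(\<integral>x. indicator \<Omega> x *\<^sub>R F x \<partial>P) = (\<integral>x. F x \<partial>P)"
    by (rule integral_cong_AE) (use fin_meas_on_AE[OF assms(1,2)] m in auto)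
  then show ?thesis by (simp add: set_lebesgue_integral_def)
qed

text \<open>Each cutoff is supported in the interior of the next compact set, on which the next
  cutoff is already 1. Hence successive differences are nonnegative and vanish on the earlier
  compact sets. The open sets \<open>U i\<close> record where the cutoffs are locally
  constant.\<close>

lemma test_cutoffs:
  fixes \<Omega> :: "(real^'n) set"
  assumes "open \<Omega>"
  obtains C \<kappa> U where "\<And>i::nat. compact (C i)" "\<And>i. C i \<subseteq> \<Omega>" "\<And>i. C i \<subseteq> C (Suc i)"
    "\<And>K. compact K \<Longrightarrow> K \<subseteq> \<Omega> \<Longrightarrow> \<exists>N. \<forall>i\<ge>N. K \<subseteq> C i"
    "\<And>i. test_on (interior (C (Suc i))) (\<kappa> i)" "\<And>i x. 0 \<le> \<kappa> i x" "\<And>i x. \<kappa> i x \<le> 1"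
    "\<And>i. open (U i)" "\<And>i. C i \<subseteq> U i" "\<And>i x. x \<in> U i \<Longrightarrow> \<kappa> i x = 1"
proof -
  obtain C where C: "\<And>n::nat. compact (C n)" "\<And>n. C n \<subseteq> \<Omega>" "\<And>n. C n \<subseteq> interior (C (Suc n))"
    "\<And>K. \<lbrakk>compact K; K \<subseteq> \<Omega>\<rbrakk> \<Longrightarrow> \<exists>N. \<forall>n\<ge>N. K \<subseteq> C n"
    using open_Union_compact_subsets[OF assms] by metis
  define A where "A i \<phi> V \<longleftrightarrow> test_on (interior (C (Suc i))) \<phi> \<and> (\<forall>x. 0 \<le> \<phi> x) \<and> (\<forall>x. \<phi> x \<le> 1) \<and>
    open V \<and> C i \<subseteq> V \<and> (\<forall>x\<in>V. \<phi> x = 1)" for i \<phi> V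
  have "\<exists>\<phi> V. A i \<phi> V" for i
  proof (rule smooth_urysohn[OF C(1)[of i] open_interior C(3)[of i]])
    fix \<phi> V assume "test_on (interior (C (Suc i))) \<phi>" "\<And>x. 0 \<le> \<phi> x" "\<And>x. \<phi> x \<le> 1" "open V" "C i \<subseteq> V" "\<And>x. x \<in> V \<Longrightarrow> \<phi> x = 1"
    then have "A i \<phi> V" by (simp add: A_def)
    then show ?thesis by blast
  qed
  then obtain \<kappa> U where A: "\<And>i. A i (\<kappa> i) (U i)" by metis
  show ?thesis
    by (rule that[of C \<kappa> U]) (use C(1,2,4) order_trans[OF C(3) interior_subset] A in \<open>simp_all add: A_def\<close>)
qed

lemma test_mult_integrable:
  assumes f: "integrable lborel f" and \<phi>: "test_on A \<phi>"
  shows "integrable lborel (\<lambda>x. f x * \<phi> x)"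
proof -
  obtain B where B: "B \<ge> 0" "\<And>y. \<bar>\<phi> y\<bar> \<le> B" using test_on_bounded[OF \<phi>] by metis
  have [measurable]: "f \<in> borel_measurable borel" "\<phi> \<in> borel_measurable borel"
    using f test_on_measurable[OF \<phi>] by auto
  show ?thesis
    by (rule Bochner_Integration.integrable_bound[where f="\<lambda>y. B * f y"])
      (use f B in \<open>auto simp: abs_mult mult.commute[of "\<bar>f _\<bar>"] intro!: mult_right_mono\<close>)
qed

context carnot
begin

text \<open>Each requirement holds for all sufficiently small scales, and there are finitely many of
  them because the directions \<open>j\<close> are finite in number. The bound by 1 is the one under
  which \<open>comm_kernel_bound\<close> is uniform.\<close>

lemma exists_mollification_scale:
  assumes V: "open V" and \<zeta>: "test_on V \<zeta>" and u: "integrable lborel u" and e: "e > 0"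
  shows "\<exists>\<epsilon>. 0 < \<epsilon> \<and> \<epsilon> \<le> 1 \<and> test_on V (conv (mol \<epsilon>) (\<lambda>y. u y * \<zeta> y)) \<and>
    (\<forall>x. \<bar>conv (mol \<epsilon>) \<zeta> x - \<zeta> x\<bar> \<le> e) \<and>
    (\<forall>j. (\<integral>\<^sup>+x. ennreal \<bar>conv (mol \<epsilon>) (\<lambda>y. u y * Xop gm j \<zeta> y) x - u x * Xop gm j \<zeta> x\<bar> \<partial>lborel) \<le> ennreal e)"
proof -
  have um[measurable]: "u \<in> borel_measurable borel" using u by auto
  note prod = test_mult_integrable[OF u]
  obtain K where K: "compact K" "K \<subseteq> V" "\<And>x. x \<notin> K \<Longrightarrow> \<zeta> x = 0" using test_onE[OF \<zeta>] by metis
  obtain R where R: "\<And>x. R < norm x \<Longrightarrow> \<zeta> x = 0" using test_on_support[OF \<zeta>] by metis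
  obtain d1 where d1: "d1 > 0" "\<And>x y. y \<in> K \<Longrightarrow> norm (x - y) \<le> d1 \<Longrightarrow> x \<in> V"
    using compact_open_thicken[OF K(1) V K(2)] by metis
  obtain d2 where d2: "d2 > 0" "\<And>\<epsilon> x. 0 < \<epsilon> \<Longrightarrow> \<epsilon> < d2 \<Longrightarrow> \<bar>conv (mol \<epsilon>) \<zeta> x - \<zeta> x\<bar> \<le> e"
    using conv_mol_uniform[OF test_on_continuous[OF \<zeta>] R e] by metis
  define Q where "Q j \<epsilon> \<longleftrightarrow>
    (\<integral>\<^sup>+x. ennreal \<bar>conv (mol \<epsilon>) (\<lambda>y. u y * Xop gm j \<zeta> y) x - u x * Xop gm j \<zeta> x\<bar> \<partial>lborel) \<le> ennreal e" for j \<epsilon>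
  have "\<exists>\<delta>>0. \<forall>\<epsilon>. 0 < \<epsilon> \<longrightarrow> \<epsilon> < \<delta> \<longrightarrow> Q j \<epsilon>" for j
  proof -
    have t: "test_on V (Xop gm j \<zeta>)" by (rule test_on_Xop[OF \<zeta>])
    obtain R where "\<And>x. R < norm x \<Longrightarrow> Xop gm j \<zeta> x = 0" using test_on_support[OF t] by metis
    then have z: "u x * Xop gm j \<zeta> x = 0" if "R + 1 \<le> norm x" for x using that by simp
    show ?thesis unfolding Q_def by (rule conv_mol_L1[OF prod[OF t] z e]) blast+
  qed
  then obtain d3 where d3: "\<And>j. d3 j > 0" "\<And>j \<epsilon>. 0 < \<epsilon> \<Longrightarrow> \<epsilon> < d3 j \<Longrightarrow> Q j \<epsilon>" by metis
  \<comment> \<open>The least of all thresholds; halving it gives strict inequalities.\<close>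
  define m where "m = Min ({1, d1, d2} \<union> range d3)"
  define \<epsilon> where "\<epsilon> = m / 2"
  have pos: "0 < m" unfolding m_def using d1 d2 d3 by (subst Min_gr_iff) auto
  have le: "\<epsilon> < a" if "a \<in> {1, d1, d2} \<union> range d3" for a
  proof -
    have "m \<le> a" unfolding m_def using that by (intro Min_le) auto
    then show ?thesis using pos by (simp add: \<epsilon>_def)
  qed
  have e0: "\<epsilon> > 0" using pos by (simp add: \<epsilon>_def)
  show ?thesis
  proof (intro exI[of _ \<epsilon>] conjI allI)
    show "0 < \<epsilon>" "\<epsilon> \<le> 1" using e0 le[of 1] by auto
    show "test_on V (conv (mol \<epsilon>) (\<lambda>y. u y * \<zeta> y))"
      by (rule test_on_conv_mol[OF e0 prod[OF \<zeta>] K(1)]) (use K d1 le[of d1] in force)+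
    show "\<bar>conv (mol \<epsilon>) \<zeta> x - \<zeta> x\<bar> \<le> e" for x by (rule d2) (use e0 le[of d2] in auto)
    show "(\<integral>\<^sup>+x. ennreal \<bar>conv (mol \<epsilon>) (\<lambda>y. u y * Xop gm j \<zeta> y) x - u x * Xop gm j \<zeta> x\<bar> \<partial>lborel) \<le> ennreal e" for j
      by (rule d3(2)[unfolded Q_def]) (use e0 le[of "d3 j"] in auto)
  qed
qed

end

text \<open>Here \<open>u\<close> is a Borel function on the whole space that vanishes outside
  \<open>\<Omega>\<close>, so integrals over \<open>\<Omega>\<close> become integrals over the
  space. The signed measure X_j u is \<open>P j\<close> minus \<open>N j\<close>, and
  \<open>trace\<close> is the identity of \<open>is_trace\<close> for a field with the single
  component \<open>j\<close>.\<close>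

locale trace_setup = carnot gm deg for gm :: "real^'n \<Rightarrow> real^'n \<Rightarrow> real^'n" and deg +
  fixes \<Omega> :: "(real^'n) set" and Pper :: "(real^'n) measure" and \<nu> :: "real^'n \<Rightarrow> real^'n"
    and u Tu :: "real^'n \<Rightarrow> real" and P N :: "'n \<Rightarrow> (real^'n) measure"
  assumes op: "open \<Omega>" and bd: "bounded \<Omega>" and per: "perimeter_measure gm deg \<Omega> Pper \<nu>"
    and u_int: "integrable lborel u" and u_0: "\<And>x. x \<notin> \<Omega> \<Longrightarrow> u x = 0"
    and Tu_int: "integrable Pper Tu"
    and Xu: "\<And>j. j \<in> Hor deg \<Longrightarrow> Xderiv_meas gm \<Omega> j u (P j) (N j)"
    and trace: "\<And>j \<phi>. j \<in> Hor deg \<Longrightarrow> test_on UNIV \<phi> \<Longrightarrow>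
      (\<integral>x. u x * Xop gm j \<phi> x \<partial>lborel)
        = - ((\<integral>x. \<phi> x \<partial>P j) - (\<integral>x. \<phi> x \<partial>N j)) - (\<integral>x. Tu x * (\<phi> x * \<nu> x $ j) \<partial>Pper)"
begin

lemma u_measurable [measurable]: "u \<in> borel_measurable borel"
  using u_int by auto

lemma Pper_sets: "sets Pper = sets borel" and Pper_finite: "finite_measure Pper"
  and \<nu>_measurable [measurable]: "\<nu> \<in> borel_measurable borel"
  and \<nu>_norm: "AE x in Pper. norm (\<nu> x) = 1"
  using per by (auto simp: perimeter_measure_def)

lemma P_fin: "j \<in> Hor deg \<Longrightarrow> fin_meas_on \<Omega> (P j)" and N_fin: "j \<in> Hor deg \<Longrightarrow> fin_meas_on \<Omega> (N j)"
  using Xu unfolding Xderiv_meas_def by auto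

lemma frontier_AE: "AE x in Pper. x \<in> frontier \<Omega>"
proof -
  have "UNIV - frontier \<Omega> \<in> sets Pper" unfolding Pper_sets by (simp add: borel_closed)
  moreover have "space Pper = UNIV" using sets_eq_imp_space_eq[OF Pper_sets] by simp
  ultimately show ?thesis using per unfolding perimeter_measure_def
    by (intro AE_I[where N="UNIV - frontier \<Omega>"]) auto
qed

lemma test_integrable: "test_on A \<phi> \<Longrightarrow> integrable lborel \<phi>"
  using test_on_support integrable_continuous_support test_on_continuous by metis

lemma Xu_distr:
  assumes j: "j \<in> Hor deg" and \<phi>: "test_on \<Omega> \<phi>"
  shows "(\<integral>x. u x * Xop gm j \<phi> x \<partial>lborel) = - ((\<integral>x. \<phi> x \<partial>P j) - (\<integral>x. \<phi> x \<partial>N j))"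
proof -
  have [measurable]: "\<phi> \<in> borel_measurable borel" "Xop gm j \<phi> \<in> borel_measurable borel"
    using test_on_measurable[OF \<phi>] test_on_measurable[OF test_on_Xop[OF \<phi>]] by auto
  have "(LINT x:\<Omega>|lebesgue. u x * Xop gm j \<phi> x) = - ((LINT x:\<Omega>|P j. \<phi> x) - (LINT x:\<Omega>|N j. \<phi> x))"
    using Xu[OF j] \<phi> unfolding Xderiv_meas_def by blast
  moreover have "(LINT x:\<Omega>|lebesgue. u x * Xop gm j \<phi> x) = (\<integral>x. u x * Xop gm j \<phi> x \<partial>lborel)"
    by (rule set_integral_lebesgue_eq) (auto simp: u_0)
  ultimately show ?thesis
    using fin_meas_on_set_integral[OF P_fin[OF j] op] fin_meas_on_set_integral[OF N_fin[OF j] op] by simp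
qed

text \<open>Skew-adjointness of X_j inside \<open>\<Omega>\<close> is read off the divergence
  identity of the perimeter measure: that measure sits on the frontier, where a function with
  compact support in the open set \<open>\<Omega>\<close> is 0.\<close>

lemma integral_Xop_eq_0:
  assumes j: "j \<in> Hor deg" and \<phi>: "test_on \<Omega> \<phi>"
  shows "(\<integral>x. Xop gm j \<phi> x \<partial>lborel) = 0"
proof -
  define g where "g i = (if i = j then \<phi> else (\<lambda>x. 0))" for i
  have t: "\<forall>i\<in>Hor deg. test_on UNIV (g i)"
    using test_on_mono[OF \<phi>, of UNIV] test_on_0 by (auto simp: g_def)
  have "divX gm deg g x = Xop gm j \<phi> x" for x
  proof -
    have "divX gm deg g x = (\<Sum>i\<in>Hor deg. if i = j then Xop gm j \<phi> x else 0)"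
      unfolding divX_def by (intro sum.cong) (auto simp: g_def Xop_const)
    then show ?thesis using j by simp
  qed
  moreover have "(LINT x:\<Omega>|lebesgue. divX gm deg g x) = - (\<integral>x. (\<Sum>j\<in>Hor deg. g j x * \<nu> x $ j) \<partial>Pper)"
    using per t unfolding perimeter_measure_def by blast
  moreover have "(\<integral>x. (\<Sum>j\<in>Hor deg. g j x * \<nu> x $ j) \<partial>Pper) = 0"
  proof (rule integral_eq_zero_AE)
    show "AE x in Pper. (\<Sum>j\<in>Hor deg. g j x * \<nu> x $ j) = 0"
      using frontier_AE
    proof eventually_elim
      case (elim x)
      then have "\<phi> x = 0" using test_on_eq_0[OF \<phi>] op by (auto simp: frontier_def interior_open)
      then have "g j x = 0" for j by (auto simp: g_def)
      then show ?case by simp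
    qed
  qed
  moreover have "(LINT x:\<Omega>|lebesgue. Xop gm j \<phi> x) = (\<integral>x. Xop gm j \<phi> x \<partial>lborel)"
    using test_on_Xop[OF \<phi>] by (intro set_integral_lebesgue_eq test_on_measurable) (auto intro: test_on_eq_0)
  ultimately show ?thesis by simp
qed

lemma integral_Xop_by_parts:
  assumes j: "j \<in> Hor deg" and w: "test_on \<Omega> w" and \<phi>: "C_inf \<phi>"
  shows "(\<integral>x. w x * Xop gm j \<phi> x \<partial>lborel) = - (\<integral>x. Xop gm j w x * \<phi> x \<partial>lborel)"
proof -
  have "(\<integral>x. Xop gm j (\<lambda>x. w x * \<phi> x) x \<partial>lborel) = 0"
    by (intro integral_Xop_eq_0 j test_on_mult w \<phi>)
  moreover have "Xop gm j (\<lambda>x. w x * \<phi> x) x = w x * Xop gm j \<phi> x + Xop gm j w x * \<phi> x" for x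
    using Xop_mult[OF test_on_C_inf[OF w] \<phi>] by simp
  moreover have "integrable lborel (\<lambda>x. w x * Xop gm j \<phi> x)" "integrable lborel (\<lambda>x. Xop gm j w x * \<phi> x)"
    using w \<phi> by (auto intro!: test_integrable[of \<Omega>] test_on_mult test_on_Xop Xop_C_inf)
  ultimately show ?thesis by simp
qed

text \<open>The distribution X_j u is tested with \<open>\<zeta> y * mol \<epsilon> (x - y)\<close>
  as a function of \<open>y\<close>, which is supported in \<open>\<Omega>\<close> for every
  \<open>x\<close>, even near or beyond the boundary. The product rule produces the last term and
  \<open>Xop_conv\<close> the first.\<close>

lemma Xop_conv_cutoff:
  assumes j: "j \<in> Hor deg" and \<zeta>: "test_on \<Omega> \<zeta>" and e: "\<epsilon> > 0"
  shows "Xop gm j (conv (mol \<epsilon>) (\<lambda>y. u y * \<zeta> y)) x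
    = (\<integral>y. comm_kernel j \<epsilon> x y * (u y * \<zeta> y) \<partial>lborel)
      + ((\<integral>y. mol \<epsilon> (x - y) * \<zeta> y \<partial>P j) - (\<integral>y. mol \<epsilon> (x - y) * \<zeta> y \<partial>N j))
      + conv (mol \<epsilon>) (\<lambda>y. u y * Xop gm j \<zeta> y) x"
proof -
  let ?m = "\<lambda>y. mol \<epsilon> (x - y)"
  have w: "integrable lborel (\<lambda>y. u y * \<zeta> y)" by (rule test_mult_integrable[OF u_int \<zeta>])
  have t: "test_on \<Omega> (\<lambda>y. \<zeta> y * ?m y)" by (intro test_on_mult \<zeta> mol_refl_C_inf)
  have i2: "integrable lborel (\<lambda>y. ?m y * (u y * Xop gm j \<zeta> y))"
    by (intro conv_mol_integrable e test_mult_integrable[OF u_int test_on_Xop[OF \<zeta>]])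
  have i1: "integrable lborel (\<lambda>y. u y * Xop gm j (\<lambda>y. \<zeta> y * ?m y) y)"
    by (rule test_mult_integrable[OF u_int test_on_Xop[OF t]])
  have "(\<integral>y. (u y * \<zeta> y) * Xop gm j ?m y \<partial>lborel)
    = (\<integral>y. u y * Xop gm j (\<lambda>y. \<zeta> y * ?m y) y - ?m y * (u y * Xop gm j \<zeta> y) \<partial>lborel)"
    by (intro Bochner_Integration.integral_cong refl) (simp add: Xop_mult[OF test_on_C_inf[OF \<zeta>] mol_refl_C_inf] algebra_simps)
  also have "\<dots> = (\<integral>y. u y * Xop gm j (\<lambda>y. \<zeta> y * ?m y) y \<partial>lborel) - conv (mol \<epsilon>) (\<lambda>y. u y * Xop gm j \<zeta> y) x"
    unfolding conv_def by (rule Bochner_Integration.integral_diff[OF i1 i2])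
  also have "(\<integral>y. u y * Xop gm j (\<lambda>y. \<zeta> y * ?m y) y \<partial>lborel) = - ((\<integral>y. \<zeta> y * ?m y \<partial>P j) - (\<integral>y. \<zeta> y * ?m y \<partial>N j))"
    by (rule Xu_distr[OF j t])
  finally show ?thesis
    unfolding Xop_conv(1)[OF e w] by (simp add: mult.commute[of "\<zeta> _"])
qed

end

section \<open>Termwise integration and the partition of unity\<close>

lemma sums_integral_mult:
  fixes f :: "nat \<Rightarrow> 'a \<Rightarrow> real"
  assumes [measurable]: "\<And>i. f i \<in> borel_measurable M" "\<psi> \<in> borel_measurable M"
    and s: "\<And>x. x \<in> space M \<Longrightarrow> summable (\<lambda>i. \<bar>f i x\<bar>)"
    and fin: "(\<Sum>i. \<integral>\<^sup>+x. ennreal \<bar>f i x\<bar> \<partial>M) < \<infinity>"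
    and B: "AE x in M. \<bar>\<psi> x\<bar> \<le> B"
  shows "integrable M (\<lambda>x. f i x * \<psi> x)" "integrable M (\<lambda>x. (\<Sum>i. f i x) * \<psi> x)"
    "(\<lambda>i. \<integral>x. f i x * \<psi> x \<partial>M) sums (\<integral>x. (\<Sum>i. f i x) * \<psi> x \<partial>M)"
proof -
  have s': "summable (\<lambda>i. \<bar>f i x * \<psi> x\<bar>)" if "x \<in> space M" for x
    using summable_mult2[OF s[OF that], of "\<bar>\<psi> x\<bar>"] by (simp add: abs_mult)
  have "(\<integral>\<^sup>+x. ennreal \<bar>f i x * \<psi> x\<bar> \<partial>M) \<le> (\<integral>\<^sup>+x. ennreal \<bar>f i x\<bar> \<partial>M) * ennreal \<bar>B\<bar>" for i
  proof -
    have "(\<integral>\<^sup>+x. ennreal \<bar>f i x * \<psi> x\<bar> \<partial>M) \<le> (\<integral>\<^sup>+x. ennreal \<bar>f i x\<bar> * ennreal \<bar>B\<bar> \<partial>M)"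
    proof (rule nn_integral_mono_AE, use B in eventually_elim)
      case (elim x)
      then have "\<bar>f i x * \<psi> x\<bar> \<le> \<bar>f i x\<bar> * \<bar>B\<bar>" by (auto simp: abs_mult intro!: mult_left_mono)
      then show ?case by (simp add: ennreal_mult[symmetric] ennreal_leI)
    qed
    then show ?thesis by (simp add: nn_integral_multc)
  qed
  then have "(\<Sum>i. \<integral>\<^sup>+x. ennreal \<bar>f i x * \<psi> x\<bar> \<partial>M) \<le> (\<Sum>i. (\<integral>\<^sup>+x. ennreal \<bar>f i x\<bar> \<partial>M) * ennreal \<bar>B\<bar>)"
    by (intro suminf_le) auto
  also have "\<dots> < \<infinity>" using fin by (simp add: ennreal_mult_less_top)
  finally have fin': "(\<Sum>i. \<integral>\<^sup>+x. ennreal \<bar>f i x * \<psi> x\<bar> \<partial>M) < \<infinity>" .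
  have eq: "(\<Sum>i. f i x * \<psi> x) = (\<Sum>i. f i x) * \<psi> x" if "x \<in> space M" for x
    using suminf_mult2[OF summable_rabs_cancel[OF s[OF that]]] by simp
  have "\<And>i. (\<lambda>x. f i x * \<psi> x) \<in> borel_measurable M" by measurable
  note r = sums_integral_nn[OF this s' fin']
  show "integrable M (\<lambda>x. f i x * \<psi> x)" by (rule r(1))
  show "integrable M (\<lambda>x. (\<Sum>i. f i x) * \<psi> x)"
    using r(2) by (subst Bochner_Integration.integrable_cong[OF refl eq[symmetric]]) auto
  show "(\<lambda>i. \<integral>x. f i x * \<psi> x \<partial>M) sums (\<integral>x. (\<Sum>i. f i x) * \<psi> x \<partial>M)"
    using r(3) by (subst Bochner_Integration.integral_cong[OF refl eq[symmetric]]) auto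
qed

text \<open>A partition of unity made of consecutive differences, so that its partial sums are again
  the cutoffs (\<open>sum_band\<close>) and are locally equal to 1.\<close>

definition band :: "(nat \<Rightarrow> 'a \<Rightarrow> real) \<Rightarrow> nat \<Rightarrow> 'a \<Rightarrow> real" where
  "band \<kappa> i x = \<kappa> i x - (if i = 0 then 0 else \<kappa> (i - 1) x)"

locale cutoff_setup = trace_setup gm deg \<Omega> Pper \<nu> u Tu P N
  for gm :: "real^'n \<Rightarrow> real^'n \<Rightarrow> real^'n" and deg \<Omega> Pper \<nu> u Tu P N +
  fixes C :: "nat \<Rightarrow> (real^'n) set" and \<kappa> :: "nat \<Rightarrow> real^'n \<Rightarrow> real" and U :: "nat \<Rightarrow> (real^'n) set"
  assumes C_compact: "\<And>i. compact (C i)" and C_sub: "\<And>i. C i \<subseteq> \<Omega>" and C_Suc: "\<And>i. C i \<subseteq> C (Suc i)"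
    and C_absorb: "\<And>K. compact K \<Longrightarrow> K \<subseteq> \<Omega> \<Longrightarrow> \<exists>N. \<forall>i\<ge>N. K \<subseteq> C i"
    and \<kappa>_test: "\<And>i. test_on (interior (C (Suc i))) (\<kappa> i)"
    and \<kappa>_nonneg: "\<And>i x. 0 \<le> \<kappa> i x" and \<kappa>_le: "\<And>i x. \<kappa> i x \<le> 1"
    and U_open: "\<And>i. open (U i)" and C_U: "\<And>i. C i \<subseteq> U i" and \<kappa>_1: "\<And>i x. x \<in> U i \<Longrightarrow> \<kappa> i x = 1"
begin

text \<open>The open set in which the i-th piece must stay, also after mollification. Removing the
  preceding compact set makes the family locally finite, which turns every series below into a
  finite sum at each point.\<close>

definition V :: "nat \<Rightarrow> (real^'n) set" where
  "V i = \<Omega> - (if i = 0 then {} else C (i - 1))"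

lemma V_open: "open (V i)"
  unfolding V_def using op C_compact by (auto intro: open_Diff compact_imp_closed)

lemma V_sub: "V i \<subseteq> \<Omega>"
  by (auto simp: V_def)

lemma C_mono: "i \<le> k \<Longrightarrow> C i \<subseteq> C k"
  using C_Suc by (rule lift_Suc_mono_le)

lemma not_in_V: "x \<in> C n \<Longrightarrow> n < i \<Longrightarrow> x \<notin> V i"
  using subsetD[OF C_mono[of n "i - 1"], of x] by (auto simp: V_def)

lemma ex_not_in_V: "\<exists>n. \<forall>i>n. x \<notin> V i"
proof (cases "x \<in> \<Omega>")
  case True
  then obtain n where "x \<in> C n" using C_absorb[of "{x}"] by auto
  then show ?thesis using not_in_V by blast
qed (use V_sub in blast)

lemma \<kappa>_test_\<Omega>: "test_on \<Omega> (\<kappa> i)"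
  by (rule test_on_mono[OF \<kappa>_test]) (meson C_sub interior_subset order_trans)

lemma \<kappa>_mono_Suc: "\<kappa> i x \<le> \<kappa> (Suc i) x"
proof (cases "\<kappa> i x = 0")
  case False
  then have "x \<in> C (Suc i)" using test_on_eq_0[OF \<kappa>_test] interior_subset by blast
  then have "\<kappa> (Suc i) x = 1" using C_U \<kappa>_1 by blast
  then show ?thesis using \<kappa>_le by simp
qed (use \<kappa>_nonneg in auto)

lemma band_test: "test_on (V i) (band \<kappa> i)"
proof (cases i)
  case 0
  then show ?thesis using \<kappa>_test_\<Omega>[of 0] by (simp add: band_def[abs_def] V_def)
next
  case (Suc m)
  obtain K K' where K: "compact K" "K \<subseteq> \<Omega>" "\<And>x. x \<notin> K \<Longrightarrow> \<kappa> i x = 0"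
    "compact K'" "K' \<subseteq> \<Omega>" "\<And>x. x \<notin> K' \<Longrightarrow> \<kappa> m x = 0" using \<kappa>_test_\<Omega> test_onE by metis
  show ?thesis
  \<comment> \<open>On the open set \<open>U m\<close> both cutoffs are 1 and the difference
    vanishes; removing it leaves a compact set that avoids \<open>C m\<close>.\<close>
  proof (rule test_onI[of _ "(K \<union> K') - U m"])
    show "C_inf (band \<kappa> i)"
      using C_inf_diff[OF test_on_C_inf[OF \<kappa>_test_\<Omega>[of i]] test_on_C_inf[OF \<kappa>_test_\<Omega>[of m]]] Suc
      by (simp add: band_def[abs_def])
    show "compact ((K \<union> K') - U m)" using K U_open by (intro compact_diff compact_Un) auto
    show "(K \<union> K') - U m \<subseteq> V i" using K C_U[of m] Suc by (auto simp: V_def)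
    fix x assume x: "x \<notin> (K \<union> K') - U m"
    show "band \<kappa> i x = 0"
    proof (cases "x \<in> U m")
      case True
      then have "\<kappa> m x = 1" by (rule \<kappa>_1)
      then show ?thesis using \<kappa>_mono_Suc[of m x] \<kappa>_le[of i x] Suc by (simp add: band_def)
    next
      case False
      then show ?thesis using x K Suc by (auto simp: band_def)
    qed
  qed
qed

lemma band_test_\<Omega>: "test_on \<Omega> (band \<kappa> i)"
  by (rule test_on_mono[OF band_test V_sub])

lemma band_measurable [measurable]: "band \<kappa> i \<in> borel_measurable borel"
  by (rule test_on_measurable[OF band_test])

lemma sum_band: "(\<Sum>i\<le>n. band \<kappa> i x) = \<kappa> n x"
  by (induction n) (auto simp: band_def)

lemma band_nonneg: "0 \<le> band \<kappa> i x"
  using \<kappa>_mono_Suc[of "i - 1" x] \<kappa>_nonneg by (cases i) (auto simp: band_def)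

lemma band_sums: "x \<in> \<Omega> \<Longrightarrow> (\<lambda>i. band \<kappa> i x) sums 1"
proof -
  assume "x \<in> \<Omega>"
  then obtain n where n: "x \<in> C n" using C_absorb[of "{x}"] by auto
  have "(\<lambda>i. band \<kappa> i x) sums (\<Sum>i\<le>n. band \<kappa> i x)"
    using test_on_eq_0[OF band_test] not_in_V[OF n] by (intro sums_finite) auto
  moreover have "\<kappa> n x = 1" using n C_U \<kappa>_1 by blast
  ultimately show ?thesis by (simp add: sum_band)
qed

lemma suminf_band_le: "(\<Sum>i. ennreal (band \<kappa> i x)) \<le> 1"
proof -
  have "(\<Sum>i<n. ennreal (band \<kappa> i x)) \<le> 1" for n
  proof -
    have "(\<Sum>i<n. band \<kappa> i x) \<le> 1"
      using sum_band[of x "n - 1"] \<kappa>_le[of "n - 1" x] by (cases n) (auto simp: lessThan_Suc_atMost)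
    then show ?thesis by (simp add: sum_ennreal band_nonneg)
  qed
  then show ?thesis by (simp add: suminf_eq_SUP SUP_le_iff)
qed

text \<open>Tonelli for series together with total weight at most 1. This is how estimates carrying
  a factor \<open>band \<kappa> i\<close> for each index become summable.\<close>

lemma suminf_nn_band_le:
  assumes "sets M = sets borel" and g: "g \<in> borel_measurable borel"
  shows "(\<Sum>i. \<integral>\<^sup>+x. g x * ennreal (band \<kappa> i x) \<partial>M) \<le> (\<integral>\<^sup>+x. g x \<partial>M)"
proof -
  note [measurable_cong] = assms(1) and [measurable] = g
  have "(\<Sum>i. \<integral>\<^sup>+x. g x * ennreal (band \<kappa> i x) \<partial>M) = (\<integral>\<^sup>+x. (\<Sum>i. g x * ennreal (band \<kappa> i x)) \<partial>M)"
    by (rule nn_integral_suminf[symmetric]) measurable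
  also have "\<dots> \<le> (\<integral>\<^sup>+x. g x \<partial>M)"
  proof (rule nn_integral_mono)
    fix x
    have "(\<Sum>i. g x * ennreal (band \<kappa> i x)) = g x * (\<Sum>i. ennreal (band \<kappa> i x))" by simp
    also have "\<dots> \<le> g x * 1" by (rule mult_left_mono[OF suminf_band_le]) simp
    finally show "(\<Sum>i. g x * ennreal (band \<kappa> i x)) \<le> g x" by simp
  qed
  finally show ?thesis .
qed

text \<open>The tolerances 2^-(i+1) have sum 1, so all mollification errors together remain
  bounded.\<close>

lemma exists_scales:
  "\<exists>\<epsilon>. \<forall>i::nat. 0 < \<epsilon> i \<and> \<epsilon> i \<le> 1 \<and> test_on (V i) (conv (mol (\<epsilon> i)) (\<lambda>y. u y * band \<kappa> i y)) \<and>
    (\<forall>x. \<bar>conv (mol (\<epsilon> i)) (band \<kappa> i) x - band \<kappa> i x\<bar> \<le> (1 / 2) ^ Suc i) \<and>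
    (\<forall>j. (\<integral>\<^sup>+x. ennreal \<bar>conv (mol (\<epsilon> i)) (\<lambda>y. u y * Xop gm j (band \<kappa> i) y) x - u x * Xop gm j (band \<kappa> i) x\<bar> \<partial>lborel)
       \<le> ennreal ((1 / 2) ^ Suc i))"
  by (intro choice allI exists_mollification_scale V_open band_test u_int) simp

end

text \<open>The construction of Meyers and Serrin for a function whose horizontal derivatives are
  measures. The scales are fixed once and for all, since one function with the right trace is sought
  and not an approximating family.\<close>

locale meyers_serrin = cutoff_setup gm deg \<Omega> Pper \<nu> u Tu P N C \<kappa> U
  for gm :: "real^'n \<Rightarrow> real^'n \<Rightarrow> real^'n" and deg \<Omega> Pper \<nu> u Tu P N C \<kappa> U +
  fixes \<epsilon> :: "nat \<Rightarrow> real"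
  assumes \<epsilon>_pos: "\<And>i. 0 < \<epsilon> i" and \<epsilon>_le: "\<And>i. \<epsilon> i \<le> 1"
    and w_test': "\<And>i. test_on (V i) (conv (mol (\<epsilon> i)) (\<lambda>y. u y * band \<kappa> i y))"
    and band_close: "\<And>i x. \<bar>conv (mol (\<epsilon> i)) (band \<kappa> i) x - band \<kappa> i x\<bar> \<le> (1 / 2) ^ Suc i"
    and uXband_close: "\<And>i j. (\<integral>\<^sup>+x. ennreal \<bar>conv (mol (\<epsilon> i)) (\<lambda>y. u y * Xop gm j (band \<kappa> i) y) x - u x * Xop gm j (band \<kappa> i) x\<bar> \<partial>lborel)
       \<le> ennreal ((1 / 2) ^ Suc i)"
begin

definition w :: "nat \<Rightarrow> real^'n \<Rightarrow> real" where
  "w i = conv (mol (\<epsilon> i)) (\<lambda>y. u y * band \<kappa> i y)"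

text \<open>The derivative of \<open>w i\<close> contains the mollification of u times X_j of the
  partition function, and these terms need not be summable over \<open>i\<close>. Subtracting the
  unmollified product leaves only the small error of \<open>uXband_close\<close>, while the
  subtracted terms add up to 0 near every point of \<open>\<Omega>\<close>.\<close>

definition a :: "'n \<Rightarrow> nat \<Rightarrow> real^'n \<Rightarrow> real" where
  "a j i x = Xop gm j (w i) x - u x * Xop gm j (band \<kappa> i) x"

definition v :: "real^'n \<Rightarrow> real" where
  "v x = (\<Sum>i. w i x)"

definition h :: "'n \<Rightarrow> real^'n \<Rightarrow> real" where
  "h j x = (\<Sum>i. a j i x)"

lemma w_test: "test_on (V i) (w i)"
  unfolding w_def by (rule w_test')

lemma w_test_\<Omega>: "test_on \<Omega> (w i)"
  by (rule test_on_mono[OF w_test V_sub])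

lemma w_measurable [measurable]: "w i \<in> borel_measurable borel"
  by (rule test_on_measurable[OF w_test])

lemma Xw_measurable [measurable]: "Xop gm j (w i) \<in> borel_measurable borel"
  by (rule test_on_measurable[OF test_on_Xop[OF w_test]])

lemma Xband_measurable [measurable]: "Xop gm j (band \<kappa> i) \<in> borel_measurable borel"
  by (rule test_on_measurable[OF test_on_Xop[OF band_test]])

lemma a_measurable [measurable]: "a j i \<in> borel_measurable borel"
  unfolding a_def[abs_def] by measurable

lemma v_measurable [measurable]: "v \<in> borel_measurable borel"
  unfolding v_def[abs_def] by measurable

lemma h_measurable [measurable]: "h j \<in> borel_measurable borel"
  unfolding h_def[abs_def] by measurable

lemma outside_V:
  assumes "x \<notin> V i"
  shows "w i x = 0" "a j i x = 0" "band \<kappa> i x = 0"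
  using test_on_eq_0[OF w_test assms] test_on_eq_0[OF test_on_Xop[OF w_test] assms]
    test_on_eq_0[OF band_test assms] test_on_eq_0[OF test_on_Xop[OF band_test] assms]
  by (auto simp: a_def)

lemma v_eq: "(\<And>i. n < i \<Longrightarrow> x \<notin> V i) \<Longrightarrow> v x = (\<Sum>i\<le>n. w i x)"
  unfolding v_def by (rule suminf_finite) (auto intro: outside_V)

lemma h_eq: "(\<And>i. n < i \<Longrightarrow> x \<notin> V i) \<Longrightarrow> h j x = (\<Sum>i\<le>n. a j i x)"
  unfolding h_def by (rule suminf_finite) (auto intro: outside_V)

lemma v_outside: "x \<notin> \<Omega> \<Longrightarrow> v x = 0" and h_outside: "x \<notin> \<Omega> \<Longrightarrow> h j x = 0"
proof -
  assume "x \<notin> \<Omega>"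
  then have "x \<notin> V i" for i using V_sub by blast
  then show "v x = 0" "h j x = 0" by (simp_all add: v_def h_def outside_V)
qed

lemma summable_w: "summable (\<lambda>i. \<bar>w i x\<bar>)" and summable_a: "summable (\<lambda>i. \<bar>a j i x\<bar>)"
  and summable_band: "summable (\<lambda>i. \<bar>band \<kappa> i x\<bar>)"
proof -
  obtain n where "\<forall>i>n. x \<notin> V i" using ex_not_in_V by blast
  then show "summable (\<lambda>i. \<bar>w i x\<bar>)" "summable (\<lambda>i. \<bar>a j i x\<bar>)" "summable (\<lambda>i. \<bar>band \<kappa> i x\<bar>)"
    by (auto intro!: summable_finite[of "{..n}"] outside_V simp: not_le)
qed

definition W :: "nat \<Rightarrow> real^'n \<Rightarrow> real" where
  "W n x = (\<Sum>i\<le>n. w i x)"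

lemma W_test: "test_on \<Omega> (W n)"
  unfolding W_def[abs_def] by (intro test_on_sum w_test_\<Omega>)

lemma v_eq_W: "x \<in> C n \<Longrightarrow> v x = W n x"
  unfolding W_def by (rule v_eq) (rule not_in_V)

text \<open>On \<open>C n\<close> the subtracted terms add up to u times X_j of the cutoff
  \<open>\<kappa> n\<close>, which is 1 on a neighbourhood; so \<open>h j\<close> is the classical
  derivative of the smooth function with which \<open>v\<close> agrees there.\<close>

lemma h_eq_XW:
  assumes "x \<in> C n" shows "h j x = Xop gm j (W n) x"
proof -
  have "h j x = (\<Sum>i\<le>n. a j i x)" by (rule h_eq) (rule not_in_V[OF assms])
  also have "\<dots> = (\<Sum>i\<le>n. Xop gm j (w i) x) - u x * (\<Sum>i\<le>n. Xop gm j (band \<kappa> i) x)"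
    by (simp add: a_def sum_subtractf sum_distrib_left)
  also have "(\<Sum>i\<le>n. Xop gm j (w i) x) = Xop gm j (W n) x"
    unfolding W_def[abs_def] by (rule Xop_sum[symmetric]) (rule test_on_C_inf[OF w_test])
  also have "(\<Sum>i\<le>n. Xop gm j (band \<kappa> i) x) = Xop gm j (\<lambda>x. \<Sum>i\<le>n. band \<kappa> i x) x"
    by (rule Xop_sum[symmetric]) (rule test_on_C_inf[OF band_test])
  also have "(\<lambda>x. \<Sum>i\<le>n. band \<kappa> i x) = \<kappa> n" by (simp add: sum_band)
  also have "Xop gm j (\<kappa> n) x = 0"
    by (rule Xop_eq_0[OF U_open[of n], where c=1]) (use assms C_U \<kappa>_1 test_on_C_inf[OF \<kappa>_test_\<Omega>] in auto)
  finally show ?thesis by simp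
qed

lemma v_continuous: "continuous_on \<Omega> v"
proof (subst continuous_on_eq_continuous_at[OF op], intro ballI)
  fix x assume x: "x \<in> \<Omega>"
  obtain r where r: "r > 0" "cball x r \<subseteq> \<Omega>" using op x open_contains_cball by metis
  obtain n where n: "cball x r \<subseteq> C n" using C_absorb[of "cball x r"] r by auto
  have "isCont (W n) x"
    using test_on_continuous[OF W_test] by (simp add: continuous_on_eq_continuous_at)
  moreover have "\<forall>\<^sub>F y in nhds x. W n y = v y"
    by (rule eventually_mono[OF eventually_nhds_in_open[of "ball x r"]])
      (use r n v_eq_W[of _ n] in \<open>auto simp: subset_iff\<close>)
  ultimately show "isCont v x" by (simp cong: isCont_cong)
qed

lemma suminf_nn_u_band: "(\<Sum>i. \<integral>\<^sup>+x. ennreal \<bar>u x * band \<kappa> i x\<bar> \<partial>lborel) \<le> (\<integral>\<^sup>+x. ennreal \<bar>u x\<bar> \<partial>lborel)"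
  using suminf_nn_band_le[of lborel "\<lambda>x. ennreal \<bar>u x\<bar>"]
  by (simp add: abs_mult band_nonneg ennreal_mult)

lemma nn_u_finite: "(\<integral>\<^sup>+x. ennreal \<bar>u x\<bar> \<partial>lborel) < \<infinity>"
  using u_int by (simp add: integrable_iff_bounded)

lemma suminf_nn_w: "(\<Sum>i. \<integral>\<^sup>+x. ennreal \<bar>w i x\<bar> \<partial>lborel) < \<infinity>"
proof -
  have "(\<Sum>i. \<integral>\<^sup>+x. ennreal \<bar>w i x\<bar> \<partial>lborel) \<le> (\<Sum>i. \<integral>\<^sup>+x. ennreal \<bar>u x * band \<kappa> i x\<bar> \<partial>lborel)"
    unfolding w_def by (intro suminf_le conv_mol_nn_integral_le \<epsilon>_pos) auto
  then show ?thesis using suminf_nn_u_band nn_u_finite by (meson order.strict_trans1)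
qed

lemma suminf_half: "(\<Sum>i. ennreal ((1 / 2) ^ Suc i)) = 1"
proof -
  have "(\<lambda>i. (1 / 2 :: real) ^ Suc i) sums 1" by (rule power_half_series)
  then show ?thesis by (subst suminf_ennreal_eq) auto
qed

lemma nn_kernel_measure_le:
  assumes M: "fin_meas_on \<Omega> M"
  shows "(\<integral>\<^sup>+x. ennreal \<bar>\<integral>y. mol (\<epsilon> i) (x - y) * band \<kappa> i y \<partial>M\<bar> \<partial>lborel) \<le> (\<integral>\<^sup>+y. ennreal (band \<kappa> i y) \<partial>M)"
    and "(\<lambda>x. \<integral>y. mol (\<epsilon> i) (x - y) * band \<kappa> i y \<partial>M) \<in> borel_measurable borel"
proof -
  have s[measurable_cong]: "sets M = sets borel" and f: "finite_measure M" using M by (auto simp: fin_meas_on_def)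
  interpret finite_measure M by (rule f)
  have sf: "sigma_finite_measure M" by unfold_locales
  have [measurable_cong]: "sets (lborel \<Otimes>\<^sub>M M) = sets (borel \<Otimes>\<^sub>M borel)"
    by (rule sets_pair_measure_cong) (auto simp: s)
  have "(\<integral>\<^sup>+x. ennreal \<bar>\<integral>y. mol (\<epsilon> i) (x - y) * band \<kappa> i y \<partial>M\<bar> \<partial>lborel) \<le> 1 * (\<integral>\<^sup>+y. ennreal \<bar>band \<kappa> i y\<bar> \<partial>M)"
  proof (rule nn_integral_kernel_le(2)[OF sigma_finite_lborel sf])
    show "(\<integral>\<^sup>+x. ennreal \<bar>mol (\<epsilon> i) (x - y)\<bar> \<partial>lborel) \<le> 1" for y :: "real^'n"
      using nn_integral_lborel_diff(1)[of "\<lambda>x. ennreal \<bar>mol (\<epsilon> i) x\<bar>" y] mol_nn_integral[OF \<epsilon>_pos, where 'a="real^'n"] by simp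
  qed measurable
  then show "(\<integral>\<^sup>+x. ennreal \<bar>\<integral>y. mol (\<epsilon> i) (x - y) * band \<kappa> i y \<partial>M\<bar> \<partial>lborel) \<le> (\<integral>\<^sup>+y. ennreal (band \<kappa> i y) \<partial>M)"
    by (simp add: band_nonneg)
  show "(\<lambda>x. \<integral>y. mol (\<epsilon> i) (x - y) * band \<kappa> i y \<partial>M) \<in> borel_measurable borel"
    by measurable
qed

lemma suminf_nn_measure_band:
  assumes M: "fin_meas_on \<Omega> M"
  shows "(\<Sum>i. \<integral>\<^sup>+y. ennreal (band \<kappa> i y) \<partial>M) < \<infinity>"
proof -
  have s: "sets M = sets borel" and f: "finite_measure M" using M by (auto simp: fin_meas_on_def)
  have "(\<Sum>i. \<integral>\<^sup>+y. ennreal (band \<kappa> i y) \<partial>M) \<le> (\<integral>\<^sup>+y. 1 \<partial>M)"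
    using suminf_nn_band_le[OF s, of "\<lambda>x. 1"] by simp
  also have "\<dots> < \<infinity>" using finite_measure.finite_emeasure_space[OF f] by (simp add: less_top)
  finally show ?thesis .
qed

text \<open>\<open>Xop_conv_cutoff\<close> splits each term into a commutator, bounded by
  \<open>D\<close> times the mass of u against the partition function, two mollified derivative
  measures, bounded by their masses against it, and a mollification error of at most 2^-(i+1). All
  four are summable. Boundedness of \<open>\<Omega>\<close> supplies the ball on which the
  commutator bound holds.\<close>

lemma suminf_nn_a:
  assumes j: "j \<in> Hor deg"
  shows "(\<Sum>i. \<integral>\<^sup>+x. ennreal \<bar>a j i x\<bar> \<partial>lborel) < \<infinity>"
proof -
  obtain R where R: "\<And>x. x \<in> \<Omega> \<Longrightarrow> norm x \<le> R" using bd bounded_iff by metis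
  obtain D where D: "D \<ge> 0" "\<And>\<epsilon> y j. 0 < \<epsilon> \<Longrightarrow> \<epsilon> \<le> 1 \<Longrightarrow> norm y \<le> R \<Longrightarrow>
    (\<integral>\<^sup>+x. ennreal \<bar>comm_kernel j \<epsilon> x y\<bar> \<partial>lborel) \<le> ennreal D"
    using comm_kernel_bound[of R] by blast
  define k1 where "k1 i x = (\<integral>y. comm_kernel j (\<epsilon> i) x y * (u y * band \<kappa> i y) \<partial>lborel)" for i x
  define k2 where "k2 i x = (\<integral>y. mol (\<epsilon> i) (x - y) * band \<kappa> i y \<partial>P j)" for i x
  define k3 where "k3 i x = (\<integral>y. mol (\<epsilon> i) (x - y) * band \<kappa> i y \<partial>N j)" for i x
  define k4 where "k4 i x = conv (mol (\<epsilon> i)) (\<lambda>y. u y * Xop gm j (band \<kappa> i) y) x - u x * Xop gm j (band \<kappa> i) x" for i x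
  have [measurable]: "k1 i \<in> borel_measurable borel" for i unfolding k1_def[abs_def] by measurable
  have [measurable]: "k2 i \<in> borel_measurable borel" "k3 i \<in> borel_measurable borel" for i
    unfolding k2_def[abs_def] k3_def[abs_def] using nn_kernel_measure_le(2)[OF P_fin[OF j]] nn_kernel_measure_le(2)[OF N_fin[OF j]] by auto
  have [measurable]: "conv (mol (\<epsilon> i)) (\<lambda>y. u y * Xop gm j (band \<kappa> i) y) \<in> borel_measurable borel" for i
    by (intro borel_measurable_continuous_onI C_inf_imp_continuous conv_mol_C_inf \<epsilon>_pos test_mult_integrable[OF u_int test_on_Xop[OF band_test]])
  have [measurable]: "k4 i \<in> borel_measurable borel" for i unfolding k4_def[abs_def] by measurable
  have a_eq: "a j i x = k1 i x + (k2 i x - k3 i x) + k4 i x" for i x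
    unfolding a_def w_def Xop_conv_cutoff[OF j band_test_\<Omega> \<epsilon>_pos] k1_def k2_def k3_def k4_def by simp
  have b1: "(\<integral>\<^sup>+x. ennreal \<bar>k1 i x\<bar> \<partial>lborel) \<le> ennreal D * (\<integral>\<^sup>+x. ennreal \<bar>u x * band \<kappa> i x\<bar> \<partial>lborel)" for i
    unfolding k1_def
  proof (rule nn_integral_kernel_le(2)[OF sigma_finite_lborel sigma_finite_lborel])
    fix y assume "u y * band \<kappa> i y \<noteq> 0"
    then have "norm y \<le> R" using u_0[of y] R[of y] by auto
    then show "(\<integral>\<^sup>+x. ennreal \<bar>comm_kernel j (\<epsilon> i) x y\<bar> \<partial>lborel) \<le> ennreal D"
      by (rule D(2)[OF \<epsilon>_pos \<epsilon>_le])
  qed measurable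
  have bound: "(\<integral>\<^sup>+x. ennreal \<bar>a j i x\<bar> \<partial>lborel) \<le> ennreal D * (\<integral>\<^sup>+x. ennreal \<bar>u x * band \<kappa> i x\<bar> \<partial>lborel)
      + ((\<integral>\<^sup>+y. ennreal (band \<kappa> i y) \<partial>P j) + (\<integral>\<^sup>+y. ennreal (band \<kappa> i y) \<partial>N j)) + ennreal ((1 / 2) ^ Suc i)" for i
  proof -
    have "(\<integral>\<^sup>+x. ennreal \<bar>a j i x\<bar> \<partial>lborel)
      \<le> (\<integral>\<^sup>+x. ennreal \<bar>k1 i x\<bar> + (ennreal \<bar>k2 i x\<bar> + ennreal \<bar>k3 i x\<bar>) + ennreal \<bar>k4 i x\<bar> \<partial>lborel)"
      unfolding a_eq by (intro nn_integral_mono) (auto simp: ennreal_plus[symmetric] intro!: ennreal_leI simp del: ennreal_plus)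
    also have "\<dots> = (\<integral>\<^sup>+x. ennreal \<bar>k1 i x\<bar> \<partial>lborel) + ((\<integral>\<^sup>+x. ennreal \<bar>k2 i x\<bar> \<partial>lborel) + (\<integral>\<^sup>+x. ennreal \<bar>k3 i x\<bar> \<partial>lborel)) + (\<integral>\<^sup>+x. ennreal \<bar>k4 i x\<bar> \<partial>lborel)"
      by (simp add: nn_integral_add)
    also have "\<dots> \<le> ennreal D * (\<integral>\<^sup>+x. ennreal \<bar>u x * band \<kappa> i x\<bar> \<partial>lborel)
      + ((\<integral>\<^sup>+y. ennreal (band \<kappa> i y) \<partial>P j) + (\<integral>\<^sup>+y. ennreal (band \<kappa> i y) \<partial>N j)) + ennreal ((1 / 2) ^ Suc i)"
      using b1 nn_kernel_measure_le(1)[OF P_fin[OF j]] nn_kernel_measure_le(1)[OF N_fin[OF j]] uXband_close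
      unfolding k2_def k3_def k4_def by (intro add_mono) auto
    finally show ?thesis .
  qed
  have "(\<Sum>i. \<integral>\<^sup>+x. ennreal \<bar>a j i x\<bar> \<partial>lborel) \<le> (\<Sum>i. ennreal D * (\<integral>\<^sup>+x. ennreal \<bar>u x * band \<kappa> i x\<bar> \<partial>lborel)
      + ((\<integral>\<^sup>+y. ennreal (band \<kappa> i y) \<partial>P j) + (\<integral>\<^sup>+y. ennreal (band \<kappa> i y) \<partial>N j)) + ennreal ((1 / 2) ^ Suc i))"
    by (intro suminf_le bound) auto
  also have "\<dots> = ennreal D * (\<Sum>i. \<integral>\<^sup>+x. ennreal \<bar>u x * band \<kappa> i x\<bar> \<partial>lborel)
      + ((\<Sum>i. \<integral>\<^sup>+y. ennreal (band \<kappa> i y) \<partial>P j) + (\<Sum>i. \<integral>\<^sup>+y. ennreal (band \<kappa> i y) \<partial>N j)) + (\<Sum>i. ennreal ((1 / 2) ^ Suc i))"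
    by (simp add: suminf_add[symmetric] del: power_Suc)
  also have "\<dots> < \<infinity>"
    unfolding suminf_half
    using suminf_nn_measure_band[OF P_fin[OF j]] suminf_nn_measure_band[OF N_fin[OF j]]
      order.strict_trans1[OF suminf_nn_u_band nn_u_finite]
    by (simp add: ennreal_mult_less_top)
  finally show ?thesis .
qed

end

text \<open>Together with \<open>posm (\<lambda>x. - f x)\<close> this represents the signed measure
  with density f as a difference of positive measures, the format of \<open>Xderiv_meas\<close> and
  \<open>divX_meas\<close>.\<close>

definition posm :: "(real^'n \<Rightarrow> real) \<Rightarrow> (real^'n) measure" where
  "posm f = density lborel (\<lambda>x. ennreal (max 0 (f x)))"

lemma posm_fin_meas_on:
  assumes f: "integrable lborel f" and op: "open \<Omega>" and z: "\<And>x. x \<notin> \<Omega> \<Longrightarrow> f x = 0"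
  shows "fin_meas_on \<Omega> (posm f)"
proof -
  have [measurable]: "f \<in> borel_measurable borel" "\<Omega> \<in> sets borel" using f op by auto
  show ?thesis
    unfolding fin_meas_on_def
  proof (intro conjI)
    show "sets (posm f) = sets borel" by (simp add: posm_def)
    show "finite_measure (posm f)"
    proof
      have "emeasure (posm f) UNIV = (\<integral>\<^sup>+x. ennreal (max 0 (f x)) \<partial>lborel)"
        by (simp add: posm_def emeasure_density)
      also have "\<dots> \<le> (\<integral>\<^sup>+x. ennreal (norm (f x)) \<partial>lborel)" by (intro nn_integral_mono ennreal_leI) auto
      also have "\<dots> < \<infinity>" using f by (simp add: integrable_iff_bounded)
      finally show "emeasure (posm f) (space (posm f)) \<noteq> \<infinity>" by (simp add: posm_def)
    qed
    have "emeasure (posm f) (UNIV - \<Omega>) = (\<integral>\<^sup>+x. ennreal (max 0 (f x)) * indicator (UNIV - \<Omega>) x \<partial>lborel)"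
      by (simp add: posm_def emeasure_density)
    also have "\<dots> = 0"
      by (subst nn_integral_0_iff_AE) (auto simp: indicator_def z)
    finally show "emeasure (posm f) (UNIV - \<Omega>) = 0" .
  qed
qed

lemma posm_integrable:
  assumes [measurable]: "f \<in> borel_measurable borel" "\<phi> \<in> borel_measurable borel"
    and i: "integrable lborel (\<lambda>x. f x * \<phi> x)"
  shows "integrable (posm f) \<phi>" "integrable (posm (\<lambda>x. - f x)) \<phi>"
    "(\<integral>x. \<phi> x \<partial>posm f) - (\<integral>x. \<phi> x \<partial>posm (\<lambda>x. - f x)) = (\<integral>x. f x * \<phi> x \<partial>lborel)"
proof -
  have i1: "integrable lborel (\<lambda>x. max 0 (f x) * \<phi> x)"
    by (rule Bochner_Integration.integrable_bound[OF i]) (auto simp: abs_mult intro!: mult_right_mono)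
  have i2: "integrable lborel (\<lambda>x. max 0 (- f x) * \<phi> x)"
    by (rule Bochner_Integration.integrable_bound[OF i]) (auto simp: abs_mult intro!: mult_right_mono)
  show "integrable (posm f) \<phi>" "integrable (posm (\<lambda>x. - f x)) \<phi>"
    unfolding posm_def using i1 i2 by (simp_all add: integrable_density)
  have "(\<integral>x. \<phi> x \<partial>posm f) - (\<integral>x. \<phi> x \<partial>posm (\<lambda>x. - f x))
    = (\<integral>x. max 0 (f x) * \<phi> x \<partial>lborel) - (\<integral>x. max 0 (- f x) * \<phi> x \<partial>lborel)"
    unfolding posm_def by (simp add: integral_density)
  also have "\<dots> = (\<integral>x. max 0 (f x) * \<phi> x - max 0 (- f x) * \<phi> x \<partial>lborel)"
    by (rule Bochner_Integration.integral_diff[OF i1 i2, symmetric])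
  also have "\<dots> = (\<integral>x. f x * \<phi> x \<partial>lborel)"
    by (intro Bochner_Integration.integral_cong refl) (auto simp: max_def algebra_simps)
  finally show "(\<integral>x. \<phi> x \<partial>posm f) - (\<integral>x. \<phi> x \<partial>posm (\<lambda>x. - f x)) = (\<integral>x. f x * \<phi> x \<partial>lborel)" .
qed

lemma integrable_lebesgue_on_eq:
  fixes F :: "real^'n \<Rightarrow> real"
  assumes "open \<Omega>" "\<And>x. x \<notin> \<Omega> \<Longrightarrow> F x = 0" "integrable lborel F"
  shows "integrable (lebesgue_on \<Omega>) F"
proof -
  have eq: "(\<lambda>x. indicator \<Omega> x *\<^sub>R F x) = F" using assms(2) by (auto simp: indicator_def fun_eq_iff)
  have "integrable lebesgue F" using assms(3) by (simp add: integrable_completion)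
  then show ?thesis using assms(1) eq by (subst integrable_restrict_space) auto
qed

section \<open>Weak derivatives and traces of functions with integrable densities\<close>

context trace_setup
begin

lemma \<nu>_bound: "AE x in Pper. \<bar>\<nu> x $ j\<bar> \<le> 1"
  using \<nu>_norm by eventually_elim (metis component_le_norm_cart)

lemma Pper_measurable: "f \<in> borel_measurable borel \<Longrightarrow> f \<in> borel_measurable Pper"
  by (simp add: measurable_cong_sets[OF Pper_sets refl])

lemma Pper_integrable:
  assumes t: "integrable Pper t" and \<phi>: "test_on A \<phi>"
  shows "integrable Pper (\<lambda>x. t x * (\<phi> x * \<nu> x $ j))"
proof -
  obtain B where B: "B \<ge> 0" "\<And>y. \<bar>\<phi> y\<bar> \<le> B" using test_on_bounded[OF \<phi>] by metis
  have [measurable]: "t \<in> borel_measurable Pper" "\<phi> \<in> borel_measurable Pper" "\<nu> \<in> borel_measurable Pper"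
    using t test_on_measurable[OF \<phi>] \<nu>_measurable by (auto intro: Pper_measurable)
  have [measurable]: "(\<lambda>x. \<nu> x $ j) \<in> borel_measurable Pper" by measurable
  show ?thesis
  proof (rule Bochner_Integration.integrable_bound[where f="\<lambda>y. B * t y"])
    show "AE x in Pper. norm (t x * (\<phi> x * \<nu> x $ j)) \<le> norm (B * t x)"
      using \<nu>_bound[of j]
    proof eventually_elim
      case (elim x)
      have "\<bar>\<phi> x\<bar> * \<bar>\<nu> x $ j\<bar> \<le> B * 1" using elim B by (intro mult_mono) auto
      then have "\<bar>t x\<bar> * (\<bar>\<phi> x\<bar> * \<bar>\<nu> x $ j\<bar>) \<le> \<bar>t x\<bar> * (B * 1)" by (intro mult_left_mono) auto
      then show ?case using B by (simp add: abs_mult mult.commute)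
    qed
  qed (use t in auto)
qed

lemma Pper_integral_eq_0:
  assumes \<phi>: "test_on \<Omega> \<phi>" shows "(\<integral>x. t x * (\<phi> x * c x) \<partial>Pper) = 0"
proof (rule integral_eq_zero_AE)
  show "AE x in Pper. t x * (\<phi> x * c x) = 0"
    using frontier_AE
  proof eventually_elim
    case (elim x)
    then have "\<phi> x = 0" using test_on_eq_0[OF \<phi>] op by (auto simp: frontier_def interior_open)
    then show ?case by simp
  qed
qed

text \<open>One identity against all test functions of the whole space contains everything: for a
  test function supported in \<open>\<Omega>\<close> the boundary term drops out and the weak
  derivative remains, while summation over \<open>j\<close> yields the trace identity for
  fields.\<close>

lemma W11_trace_intro:
  assumes v: "integrable lborel v" "\<And>x. x \<notin> \<Omega> \<Longrightarrow> v x = 0"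
    and h: "\<And>j. j \<in> Hor deg \<Longrightarrow> integrable lborel (h j)" "\<And>j x. j \<in> Hor deg \<Longrightarrow> x \<notin> \<Omega> \<Longrightarrow> h j x = 0"
    and t: "integrable Pper t"
    and tr: "\<And>j \<phi>. j \<in> Hor deg \<Longrightarrow> test_on UNIV \<phi> \<Longrightarrow> (\<integral>x. v x * Xop gm j \<phi> x \<partial>lborel)
       = - (\<integral>x. h j x * \<phi> x \<partial>lborel) - (\<integral>x. t x * (\<phi> x * \<nu> x $ j) \<partial>Pper)"
  shows "W11_X gm deg \<Omega> v h" "BV_X gm deg \<Omega> v" "is_trace gm deg \<Omega> Pper \<nu> v t"
proof -
  have [measurable]: "v \<in> borel_measurable borel" using v by auto
  have hm[measurable]: "h j \<in> borel_measurable borel" if "j \<in> Hor deg" for j using h(1)[OF that] by auto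
  have vi: "integrable (lebesgue_on \<Omega>) v" by (rule integrable_lebesgue_on_eq[OF op v(2,1)])
  have distr: "(LINT x:\<Omega>|lebesgue. v x * Xop gm j \<phi> x) = - (\<integral>x. h j x * \<phi> x \<partial>lborel)"
    if j: "j \<in> Hor deg" and \<phi>: "test_on \<Omega> \<phi>" for j \<phi>
  proof -
    have [measurable]: "Xop gm j \<phi> \<in> borel_measurable borel" using test_on_measurable[OF test_on_Xop[OF \<phi>]] .
    have "(LINT x:\<Omega>|lebesgue. v x * Xop gm j \<phi> x) = (\<integral>x. v x * Xop gm j \<phi> x \<partial>lborel)"
      by (rule set_integral_lebesgue_eq) (auto simp: v)
    also have "\<dots> = - (\<integral>x. h j x * \<phi> x \<partial>lborel)"
      using tr[OF j test_on_mono[OF \<phi>]] Pper_integral_eq_0[OF \<phi>] by simp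
    finally show ?thesis .
  qed
  show "W11_X gm deg \<Omega> v h"
    unfolding W11_X_def
  proof (intro conjI ballI allI impI vi)
    fix j assume j: "j \<in> Hor deg"
    show "integrable (lebesgue_on \<Omega>) (h j)" by (rule integrable_lebesgue_on_eq[OF op h(2)[OF j] h(1)[OF j]])
    fix \<phi> assume \<phi>: "test_on \<Omega> \<phi>"
    have [measurable]: "\<phi> \<in> borel_measurable borel" using test_on_measurable[OF \<phi>] .
    have "(LINT x:\<Omega>|lebesgue. h j x * \<phi> x) = (\<integral>x. h j x * \<phi> x \<partial>lborel)"
      using hm[OF j] h(2)[OF j] by (intro set_integral_lebesgue_eq) auto
    then show "(LINT x:\<Omega>|lebesgue. v x * Xop gm j \<phi> x) = - (LINT x:\<Omega>|lebesgue. h j x * \<phi> x)"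
      using distr[OF j \<phi>] by simp
  qed
  have fin: "fin_meas_on \<Omega> (posm (h j))" "fin_meas_on \<Omega> (posm (\<lambda>x. - h j x))" if "j \<in> Hor deg" for j
    using h that op by (auto intro!: posm_fin_meas_on)
  have posm: "(LINT x:\<Omega>|posm (h j). \<phi> x) - (LINT x:\<Omega>|posm (\<lambda>x. - h j x). \<phi> x) = (\<integral>x. h j x * \<phi> x \<partial>lborel)"
    if j: "j \<in> Hor deg" and \<phi>: "test_on A \<phi>" for j \<phi> A
    using posm_integrable(3)[OF hm[OF j] test_on_measurable[OF \<phi>] test_mult_integrable[OF h(1)[OF j] \<phi>]]
    by (simp add: fin_meas_on_set_integral[OF fin(1)[OF j] op test_on_measurable[OF \<phi>]]
        fin_meas_on_set_integral[OF fin(2)[OF j] op test_on_measurable[OF \<phi>]])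
  have Xd: "Xderiv_meas gm \<Omega> j v (posm (h j)) (posm (\<lambda>x. - h j x))" if j: "j \<in> Hor deg" for j
    unfolding Xderiv_meas_def using fin[OF j] distr[OF j] posm[OF j] by auto
  then show "BV_X gm deg \<Omega> v" unfolding BV_X_def using vi by blast
  show "is_trace gm deg \<Omega> Pper \<nu> v t"
    unfolding is_trace_def
  proof (intro conjI exI[of _ "\<lambda>j. (posm (h j), posm (\<lambda>x. - h j x))"] ballI allI impI; (simp only: fst_conv snd_conv)?)
    show "t \<in> borel_measurable Pper" "integrable Pper t" using t by auto
    show "Xderiv_meas gm \<Omega> j v (posm (h j)) (posm (\<lambda>x. - h j x))" if "j \<in> Hor deg" for j by (rule Xd[OF that])
    fix g :: "'n \<Rightarrow> real^'n \<Rightarrow> real" assume g: "\<forall>j\<in>Hor deg. test_on UNIV (g j)"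
    have Xgm: "Xop gm j (g j) \<in> borel_measurable borel" if "j \<in> Hor deg" for j
      using g that test_on_measurable[OF test_on_Xop] by blast
    have "(LINT x:\<Omega>|lebesgue. v x * divX gm deg g x) = (\<integral>x. v x * divX gm deg g x \<partial>lborel)"
      unfolding divX_def using Xgm v by (intro set_integral_lebesgue_eq) (auto intro!: borel_measurable_times borel_measurable_sum)
    also have "\<dots> = (\<Sum>j\<in>Hor deg. \<integral>x. v x * Xop gm j (g j) x \<partial>lborel)"
      unfolding divX_def sum_distrib_left using g
      by (intro Bochner_Integration.integral_sum test_mult_integrable[OF v(1) test_on_Xop]) auto
    also have "\<dots> = (\<Sum>j\<in>Hor deg. - (\<integral>x. h j x * g j x \<partial>lborel) - (\<integral>x. t x * (g j x * \<nu> x $ j) \<partial>Pper))"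
      using tr g by (intro sum.cong) auto
    also have "\<dots> = - (\<Sum>j\<in>Hor deg. (LINT x:\<Omega>|posm (h j). g j x) - (LINT x:\<Omega>|posm (\<lambda>x. - h j x). g j x)) - (\<Sum>j\<in>Hor deg. \<integral>x. t x * (g j x * \<nu> x $ j) \<partial>Pper)"
    proof -
      have "(\<Sum>j\<in>Hor deg. (LINT x:\<Omega>|posm (h j). g j x) - (LINT x:\<Omega>|posm (\<lambda>x. - h j x). g j x)) = (\<Sum>j\<in>Hor deg. \<integral>x. h j x * g j x \<partial>lborel)"
        using posm g by (intro sum.cong) auto
      then show ?thesis by (simp only: sum_subtractf sum_negf)
    qed
    also have "(\<Sum>j\<in>Hor deg. \<integral>x. t x * (g j x * \<nu> x $ j) \<partial>Pper) = (\<integral>x. t x * (\<Sum>j\<in>Hor deg. g j x * \<nu> x $ j) \<partial>Pper)"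
      unfolding sum_distrib_left using g
      by (intro Bochner_Integration.integral_sum[symmetric] Pper_integrable[OF t]) auto
    finally show "(LINT x:\<Omega>|lebesgue. v x * divX gm deg g x) =
      - (\<Sum>j\<in>Hor deg. (LINT x:\<Omega>|posm (h j). g j x) - (LINT x:\<Omega>|posm (\<lambda>x. - h j x). g j x))
      - (\<integral>x. t x * (\<Sum>j\<in>Hor deg. g j x * \<nu> x $ j) \<partial>Pper)" .
  qed
qed

end

section \<open>Integrability, trace and size of the smooth substitute\<close>

context meyers_serrin
begin

lemma v_integrable: "integrable lborel v"
  using sums_integral_nn(2)[of w lborel] suminf_nn_w summable_w by (simp add: v_def[abs_def])

lemma h_integrable: "j \<in> Hor deg \<Longrightarrow> integrable lborel (h j)"
  using sums_integral_nn(2)[of "a j" lborel] suminf_nn_a[of j] summable_a by (simp add: h_def[abs_def])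

lemma band_sum_mult: "(\<Sum>i. u x * band \<kappa> i x) = u x"
proof (cases "x \<in> \<Omega>")
  case True
  then show ?thesis using sums_mult[OF band_sums[OF True], of "u x"] by (simp add: sums_iff)
qed (simp add: u_0)

lemma sums_measure_band:
  assumes M: "fin_meas_on \<Omega> M" and [measurable]: "\<psi> \<in> borel_measurable borel" and B: "\<And>x. \<bar>\<psi> x\<bar> \<le> B"
  shows "(\<lambda>i. \<integral>x. band \<kappa> i x * \<psi> x \<partial>M) sums (\<integral>x. \<psi> x \<partial>M)"
proof -
  have s[measurable_cong]: "sets M = sets borel" using M by (auto simp: fin_meas_on_def)
  have "(\<lambda>i. \<integral>x. band \<kappa> i x * \<psi> x \<partial>M) sums (\<integral>x. (\<Sum>i. band \<kappa> i x) * \<psi> x \<partial>M)"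
    by (rule sums_integral_mult(3)[where B=B])
      (use B suminf_nn_measure_band[OF M] summable_band in \<open>auto simp: band_nonneg\<close>)
  also have "(\<integral>x. (\<Sum>i. band \<kappa> i x) * \<psi> x \<partial>M) = (\<integral>x. \<psi> x \<partial>M)"
  proof (rule integral_cong_AE)
    show "AE x in M. (\<Sum>i. band \<kappa> i x) * \<psi> x = \<psi> x"
      using fin_meas_on_AE[OF M op] by eventually_elim (auto dest!: band_sums simp: sums_iff)
  qed measurable
  finally show ?thesis .
qed

text \<open>For each index the functions \<open>w i\<close> and
  \<open>band \<kappa> i * \<phi>\<close> have compact support in \<open>\<Omega>\<close>, so
  integration by parts and the definition of X_j u apply without boundary terms. Summed over i, they
  show that the integrals of u and v against X_j of \<open>\<phi>\<close> differ by interior terms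
  only; hence the boundary term of u is that of v.\<close>

lemma v_trace:
  assumes j: "j \<in> Hor deg" and \<phi>: "test_on UNIV \<phi>"
  shows "(\<integral>x. v x * Xop gm j \<phi> x \<partial>lborel) = - (\<integral>x. h j x * \<phi> x \<partial>lborel) - (\<integral>x. Tu x * (\<phi> x * \<nu> x $ j) \<partial>Pper)"
proof -
  let ?X = "Xop gm j \<phi>"
  have tX: "test_on UNIV ?X" by (rule test_on_Xop[OF \<phi>])
  have [measurable]: "\<phi> \<in> borel_measurable borel" "?X \<in> borel_measurable borel"
    using test_on_measurable \<phi> tX by auto
  obtain B where B: "\<And>x. \<bar>\<phi> x\<bar> \<le> B" using test_on_bounded[OF \<phi>] by metis
  obtain B' where B': "\<And>x. \<bar>?X x\<bar> \<le> B'" using test_on_bounded[OF tX] by metis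
  have s1: "(\<lambda>i. \<integral>x. w i x * ?X x \<partial>lborel) sums (\<integral>x. v x * ?X x \<partial>lborel)"
    unfolding v_def by (rule sums_integral_mult(3)[where B=B']) (use B' suminf_nn_w summable_w in auto)
  have s2: "(\<lambda>i. \<integral>x. (u x * band \<kappa> i x) * ?X x \<partial>lborel) sums (\<integral>x. u x * ?X x \<partial>lborel)"
  proof -
    have "(\<lambda>i. \<integral>x. (u x * band \<kappa> i x) * ?X x \<partial>lborel) sums (\<integral>x. (\<Sum>i. u x * band \<kappa> i x) * ?X x \<partial>lborel)"
      by (rule sums_integral_mult(3)[where B=B'])
        (use B' order.strict_trans1[OF suminf_nn_u_band nn_u_finite] summable_mult[OF summable_band] in \<open>auto simp: abs_mult\<close>)
    then show ?thesis by (simp add: band_sum_mult)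
  qed
  have s3: "(\<lambda>i. \<integral>x. a j i x * \<phi> x \<partial>lborel) sums (\<integral>x. h j x * \<phi> x \<partial>lborel)"
    unfolding h_def by (rule sums_integral_mult(3)[where B=B]) (use B suminf_nn_a[OF j] summable_a in auto)
  note s4 = sums_measure_band[OF P_fin[OF j] _ B] and s5 = sums_measure_band[OF N_fin[OF j] _ B]
  \<comment> \<open>The integrals of u times X_j of the partition function times
    \<open>\<phi>\<close> cancel between \<open>e2\<close> and the definition of
    \<open>a\<close>.\<close>
  have "(\<integral>x. w i x * ?X x \<partial>lborel) - (\<integral>x. (u x * band \<kappa> i x) * ?X x \<partial>lborel)
    = - (\<integral>x. a j i x * \<phi> x \<partial>lborel) + ((\<integral>x. band \<kappa> i x * \<phi> x \<partial>P j) - (\<integral>x. band \<kappa> i x * \<phi> x \<partial>N j))" for i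
  proof -
    let ?z = "band \<kappa> i"
    have t: "test_on \<Omega> (\<lambda>x. ?z x * \<phi> x)" by (intro test_on_mult band_test_\<Omega> test_on_C_inf[OF \<phi>])
    have i1: "integrable lborel (\<lambda>x. u x * Xop gm j (\<lambda>x. ?z x * \<phi> x) x)"
      by (rule test_mult_integrable[OF u_int test_on_Xop[OF t]])
    have i2: "integrable lborel (\<lambda>x. u x * Xop gm j ?z x * \<phi> x)"
      by (intro test_mult_integrable[OF _ \<phi>] test_mult_integrable[OF u_int test_on_Xop[OF band_test]])
    have i3: "integrable lborel (\<lambda>x. Xop gm j (w i) x * \<phi> x)"
      by (intro test_mult_integrable[OF _ \<phi>] test_integrable[OF test_on_Xop[OF w_test]])
    have e1: "(\<integral>x. w i x * ?X x \<partial>lborel) = - (\<integral>x. Xop gm j (w i) x * \<phi> x \<partial>lborel)"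
      by (rule integral_Xop_by_parts[OF j w_test_\<Omega> test_on_C_inf[OF \<phi>]])
    have "(\<integral>x. (u x * ?z x) * ?X x \<partial>lborel) = (\<integral>x. u x * Xop gm j (\<lambda>x. ?z x * \<phi> x) x - u x * Xop gm j ?z x * \<phi> x \<partial>lborel)"
      by (intro Bochner_Integration.integral_cong refl, subst Xop_mult[OF test_on_C_inf[OF band_test] test_on_C_inf[OF \<phi>]])
        (simp add: algebra_simps)
    also have "\<dots> = (\<integral>x. u x * Xop gm j (\<lambda>x. ?z x * \<phi> x) x \<partial>lborel) - (\<integral>x. u x * Xop gm j ?z x * \<phi> x \<partial>lborel)"
      by (rule Bochner_Integration.integral_diff[OF i1 i2])
    also have "(\<integral>x. u x * Xop gm j (\<lambda>x. ?z x * \<phi> x) x \<partial>lborel) = - ((\<integral>x. ?z x * \<phi> x \<partial>P j) - (\<integral>x. ?z x * \<phi> x \<partial>N j))"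
      by (rule Xu_distr[OF j t])
    finally have e2: "(\<integral>x. (u x * ?z x) * ?X x \<partial>lborel) = - ((\<integral>x. ?z x * \<phi> x \<partial>P j) - (\<integral>x. ?z x * \<phi> x \<partial>N j)) - (\<integral>x. u x * Xop gm j ?z x * \<phi> x \<partial>lborel)" .
    have "(\<integral>x. a j i x * \<phi> x \<partial>lborel) = (\<integral>x. Xop gm j (w i) x * \<phi> x \<partial>lborel) - (\<integral>x. u x * Xop gm j ?z x * \<phi> x \<partial>lborel)"
      unfolding a_def left_diff_distrib by (rule Bochner_Integration.integral_diff[OF i3 i2])
    with e1 e2 show ?thesis by simp
  qed
  moreover have "(\<lambda>i. (\<integral>x. w i x * ?X x \<partial>lborel) - (\<integral>x. (u x * band \<kappa> i x) * ?X x \<partial>lborel)) sums ((\<integral>x. v x * ?X x \<partial>lborel) - (\<integral>x. u x * ?X x \<partial>lborel))"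
    by (rule sums_diff[OF s1 s2])
  moreover have "(\<lambda>i. - (\<integral>x. a j i x * \<phi> x \<partial>lborel) + ((\<integral>x. band \<kappa> i x * \<phi> x \<partial>P j) - (\<integral>x. band \<kappa> i x * \<phi> x \<partial>N j))) sums
     (- (\<integral>x. h j x * \<phi> x \<partial>lborel) + ((\<integral>x. \<phi> x \<partial>P j) - (\<integral>x. \<phi> x \<partial>N j)))"
    by (intro sums_add sums_minus s3 sums_diff s4 s5) auto
  ultimately have "(\<integral>x. v x * ?X x \<partial>lborel) - (\<integral>x. u x * ?X x \<partial>lborel)
    = - (\<integral>x. h j x * \<phi> x \<partial>lborel) + ((\<integral>x. \<phi> x \<partial>P j) - (\<integral>x. \<phi> x \<partial>N j))"
    by (simp add: sums_unique2)
  then show ?thesis using trace[OF j \<phi>] by simp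
qed

lemma conv_band_le: "conv (mol (\<epsilon> i)) (band \<kappa> i) x \<le> band \<kappa> i x + (1 / 2) ^ Suc i"
  using band_close[of i x] by linarith

lemma suminf_band_half: "(\<Sum>i. ennreal (band \<kappa> i x + (1 / 2) ^ Suc i)) \<le> 2"
proof -
  have "(\<Sum>i. ennreal (band \<kappa> i x + (1 / 2) ^ Suc i)) = (\<Sum>i. ennreal (band \<kappa> i x)) + (\<Sum>i. ennreal ((1 / 2) ^ Suc i))"
    by (subst suminf_add) (auto simp: band_nonneg simp del: power_Suc)
  also have "\<dots> \<le> 1 + 1" unfolding suminf_half by (intro add_mono suminf_band_le order_refl)
  finally show ?thesis by simp
qed

text \<open>Each term is at most \<open>M\<close> times the mollified partition function, which
  exceeds the partition function by at most 2^-(i+1); the two sums contribute \<open>M\<close> each.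
  The bound holds at every point although u is bounded only almost everywhere, and this makes it
  usable for measures that charge null sets.\<close>

lemma suminf_w_le:
  assumes M: "M \<ge> 0" "AE x in lborel. \<bar>u x\<bar> \<le> M"
  shows "(\<Sum>i. ennreal \<bar>w i x\<bar>) \<le> ennreal (2 * M)"
proof -
  have "\<bar>w i x\<bar> \<le> M * (band \<kappa> i x + (1 / 2) ^ Suc i)" for i
  proof -
    have bi: "integrable lborel (\<lambda>y. mol (\<epsilon> i) (x - y) * band \<kappa> i y)"
      by (intro conv_mol_integrable \<epsilon>_pos test_integrable[OF band_test])
    have "\<bar>w i x\<bar> \<le> (\<integral>y. \<bar>mol (\<epsilon> i) (x - y) * (u y * band \<kappa> i y)\<bar> \<partial>lborel)"
      unfolding w_def conv_def by (rule integral_abs_bound)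
    also have "\<dots> \<le> (\<integral>y. M * (mol (\<epsilon> i) (x - y) * band \<kappa> i y) \<partial>lborel)"
    proof (rule integral_mono_AE)
      show "integrable lborel (\<lambda>y. \<bar>mol (\<epsilon> i) (x - y) * (u y * band \<kappa> i y)\<bar>)"
        by (intro integrable_abs conv_mol_integrable \<epsilon>_pos test_mult_integrable[OF u_int band_test])
      show "integrable lborel (\<lambda>y. M * (mol (\<epsilon> i) (x - y) * band \<kappa> i y))" using bi by simp
      show "AE y in lborel. \<bar>mol (\<epsilon> i) (x - y) * (u y * band \<kappa> i y)\<bar> \<le> M * (mol (\<epsilon> i) (x - y) * band \<kappa> i y)"
        using M(2)
      proof eventually_elim
        case (elim y)
        have "\<bar>u y\<bar> * (mol (\<epsilon> i) (x - y) * band \<kappa> i y) \<le> M * (mol (\<epsilon> i) (x - y) * band \<kappa> i y)"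
          by (intro mult_right_mono elim mult_nonneg_nonneg mol_nonneg \<epsilon>_pos band_nonneg)
        then show ?case by (simp add: abs_mult mol_nonneg \<epsilon>_pos band_nonneg mult.left_commute)
      qed
    qed
    also have "\<dots> = M * conv (mol (\<epsilon> i)) (band \<kappa> i) x" by (simp add: conv_def)
    also have "\<dots> \<le> M * (band \<kappa> i x + (1 / 2) ^ Suc i)" using M by (intro mult_left_mono conv_band_le)
    finally show ?thesis .
  qed
  then have "(\<Sum>i. ennreal \<bar>w i x\<bar>) \<le> (\<Sum>i. ennreal M * ennreal (band \<kappa> i x + (1 / 2) ^ Suc i))"
    using M by (intro suminf_le) (auto simp: ennreal_mult'[symmetric] ennreal_leI simp del: power_Suc)
  also have "\<dots> = ennreal M * (\<Sum>i. ennreal (band \<kappa> i x + (1 / 2) ^ Suc i))" by (rule ennreal_suminf_cmult)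
  also have "\<dots> \<le> ennreal M * 2" by (intro mult_left_mono suminf_band_half) auto
  also have "\<dots> = ennreal (2 * M)" using M by (simp add: ennreal_mult mult.commute)
  finally show ?thesis .
qed

text \<open>Young's inequality makes this applicable to \<open>u \<in> L\<^sup>q\<close> and \<open>f \<in> L\<^sup>p\<close> without any
  convergence of mollifications in \<open>L\<^sup>q\<close>.\<close>

lemma suminf_nn_w_mult_le:
  assumes [measurable]: "f \<in> borel_measurable borel" "A \<in> borel_measurable borel" "B \<in> borel_measurable borel"
    and AB: "\<And>x y. \<bar>u y\<bar> * \<bar>f x\<bar> \<le> A y + B x" "\<And>y. 0 \<le> A y" "\<And>x. 0 \<le> B x"
  shows "(\<Sum>i. \<integral>\<^sup>+x. ennreal \<bar>w i x * f x\<bar> \<partial>lborel) \<le> (\<integral>\<^sup>+y. ennreal (A y) \<partial>lborel) + 2 * (\<integral>\<^sup>+x. ennreal (B x) \<partial>lborel)"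
proof -
  have termwise: "(\<integral>\<^sup>+x. ennreal \<bar>w i x * f x\<bar> \<partial>lborel) \<le> (\<integral>\<^sup>+y. ennreal (A y) * ennreal (band \<kappa> i y) \<partial>lborel)
      + (\<integral>\<^sup>+x. ennreal (B x) * ennreal (band \<kappa> i x + (1 / 2) ^ Suc i) \<partial>lborel)" for i
  proof -
    let ?m = "mol (\<epsilon> i) :: real^'n \<Rightarrow> real" and ?z = "band \<kappa> i"
    have mz: "0 \<le> ?m x" "0 \<le> ?z x" for x using mol_nonneg[OF \<epsilon>_pos] band_nonneg by auto
    have "(\<integral>\<^sup>+x. ennreal \<bar>w i x * f x\<bar> \<partial>lborel)
      \<le> (\<integral>\<^sup>+x. (\<integral>\<^sup>+y. ennreal \<bar>?m (x - y) * (?z y * A y)\<bar> \<partial>lborel) + ennreal (B x) * ennreal (?z x + (1 / 2) ^ Suc i) \<partial>lborel)"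
    proof (rule nn_integral_mono)
      fix x
      have bi: "integrable lborel (\<lambda>y. ?m (x - y) * ?z y)"
        by (intro conv_mol_integrable \<epsilon>_pos test_integrable[OF band_test])
      have "ennreal \<bar>w i x * f x\<bar> \<le> ennreal (\<integral>y. \<bar>?m (x - y) * (u y * ?z y)\<bar> * \<bar>f x\<bar> \<partial>lborel)"
        unfolding w_def conv_def using integral_abs_bound[of lborel "\<lambda>y. ?m (x - y) * (u y * ?z y)"]
        by (intro ennreal_leI) (simp add: abs_mult mult_right_mono)
      also have "\<dots> = (\<integral>\<^sup>+y. ennreal (\<bar>?m (x - y) * (u y * ?z y)\<bar> * \<bar>f x\<bar>) \<partial>lborel)"
        by (rule nn_integral_eq_integral[symmetric])
          (auto intro!: integrable_mult_left integrable_abs conv_mol_integrable \<epsilon>_pos test_mult_integrable[OF u_int band_test])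
      also have "\<dots> \<le> (\<integral>\<^sup>+y. ennreal \<bar>?m (x - y) * (?z y * A y)\<bar> + ennreal (B x) * ennreal (?m (x - y) * ?z y) \<partial>lborel)"
      proof (rule nn_integral_mono)
        fix y
        \<comment> \<open>The inequality is used at the two different points \<open>y\<close> and
          \<open>x\<close>: the part in \<open>A y\<close> is then transported by a kernel of mass
          1, and in the part with \<open>B x\<close> only the mollified partition function remains
          under the inner integral.\<close>
        have "(?m (x - y) * ?z y) * (\<bar>u y\<bar> * \<bar>f x\<bar>) \<le> (?m (x - y) * ?z y) * (A y + B x)"
          by (intro mult_left_mono AB mult_nonneg_nonneg mz)
        then show "ennreal (\<bar>?m (x - y) * (u y * ?z y)\<bar> * \<bar>f x\<bar>) \<le> ennreal \<bar>?m (x - y) * (?z y * A y)\<bar> + ennreal (B x) * ennreal (?m (x - y) * ?z y)"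
          using AB mz by (simp add: ennreal_mult[symmetric] ennreal_plus[symmetric] abs_mult algebra_simps ennreal_leI del: ennreal_plus)
      qed
      also have "\<dots> = (\<integral>\<^sup>+y. ennreal \<bar>?m (x - y) * (?z y * A y)\<bar> \<partial>lborel) + ennreal (B x) * (\<integral>\<^sup>+y. ennreal (?m (x - y) * ?z y) \<partial>lborel)"
        by (subst nn_integral_add) (auto simp: nn_integral_cmult)
      also have "(\<integral>\<^sup>+y. ennreal (?m (x - y) * ?z y) \<partial>lborel) = ennreal (conv ?m ?z x)"
        unfolding conv_def using mz by (intro nn_integral_eq_integral bi) auto
      also have "(\<integral>\<^sup>+y. ennreal \<bar>?m (x - y) * (?z y * A y)\<bar> \<partial>lborel) + ennreal (B x) * ennreal (conv ?m ?z x)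
        \<le> (\<integral>\<^sup>+y. ennreal \<bar>?m (x - y) * (?z y * A y)\<bar> \<partial>lborel) + ennreal (B x) * ennreal (?z x + (1 / 2) ^ Suc i)"
        by (intro add_left_mono mult_left_mono ennreal_leI conv_band_le) auto
      finally show "ennreal \<bar>w i x * f x\<bar> \<le> (\<integral>\<^sup>+y. ennreal \<bar>?m (x - y) * (?z y * A y)\<bar> \<partial>lborel) + ennreal (B x) * ennreal (?z x + (1 / 2) ^ Suc i)" .
    qed
    also have "\<dots> = (\<integral>\<^sup>+x. (\<integral>\<^sup>+y. ennreal \<bar>?m (x - y) * (?z y * A y)\<bar> \<partial>lborel) \<partial>lborel) + (\<integral>\<^sup>+x. ennreal (B x) * ennreal (?z x + (1 / 2) ^ Suc i) \<partial>lborel)"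
      by (rule nn_integral_add) measurable
    also have "(\<integral>\<^sup>+x. (\<integral>\<^sup>+y. ennreal \<bar>?m (x - y) * (?z y * A y)\<bar> \<partial>lborel) \<partial>lborel) \<le> 1 * (\<integral>\<^sup>+y. ennreal \<bar>?z y * A y\<bar> \<partial>lborel)"
    proof (rule nn_integral_kernel_le(1)[OF sigma_finite_lborel sigma_finite_lborel])
      show "(\<integral>\<^sup>+x. ennreal \<bar>?m (x - y)\<bar> \<partial>lborel) \<le> 1" for y :: "real^'n"
        using nn_integral_lborel_diff(1)[of "\<lambda>x. ennreal \<bar>mol (\<epsilon> i) x\<bar>" y] mol_nn_integral[OF \<epsilon>_pos, where 'a="real^'n"] by simp
    qed measurable
    finally show ?thesis
      using AB mz by (simp add: abs_mult ennreal_mult mult.commute add_right_mono del: power_Suc)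
  qed
  have "(\<Sum>i. \<integral>\<^sup>+x. ennreal \<bar>w i x * f x\<bar> \<partial>lborel) \<le> (\<Sum>i. (\<integral>\<^sup>+y. ennreal (A y) * ennreal (band \<kappa> i y) \<partial>lborel)
      + (\<integral>\<^sup>+x. ennreal (B x) * ennreal (band \<kappa> i x + (1 / 2) ^ Suc i) \<partial>lborel))"
    by (intro suminf_le termwise) auto
  also have "\<dots> = (\<Sum>i. \<integral>\<^sup>+y. ennreal (A y) * ennreal (band \<kappa> i y) \<partial>lborel)
      + (\<Sum>i. \<integral>\<^sup>+x. ennreal (B x) * ennreal (band \<kappa> i x + (1 / 2) ^ Suc i) \<partial>lborel)"
    by (rule suminf_add[symmetric]) auto
  also have "(\<Sum>i. \<integral>\<^sup>+x. ennreal (B x) * ennreal (band \<kappa> i x + (1 / 2) ^ Suc i) \<partial>lborel)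
      = (\<integral>\<^sup>+x. (\<Sum>i. ennreal (B x) * ennreal (band \<kappa> i x + (1 / 2) ^ Suc i)) \<partial>lborel)"
    by (rule nn_integral_suminf[symmetric]) measurable
  also have "\<dots> \<le> (\<integral>\<^sup>+x. ennreal (B x) * 2 \<partial>lborel)"
    by (intro nn_integral_mono) (simp only: ennreal_suminf_cmult, intro mult_left_mono suminf_band_half, simp)
  also have "\<dots> = 2 * (\<integral>\<^sup>+x. ennreal (B x) \<partial>lborel)"
    by (subst nn_integral_multc) (auto simp: mult.commute)
  also have "(\<Sum>i. \<integral>\<^sup>+y. ennreal (A y) * ennreal (band \<kappa> i y) \<partial>lborel) \<le> (\<integral>\<^sup>+y. ennreal (A y) \<partial>lborel)"
    by (rule suminf_nn_band_le) auto
  finally show ?thesis by (simp add: add_mono)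
qed

end

section \<open>Integration against bounded vector fields\<close>

lemma Linf_on_extend:
  fixes f :: "real^'n \<Rightarrow> real"
  assumes op: "open \<Omega>" and f: "Linf_on \<Omega> f"
  obtains B where "B \<ge> 0" "(\<lambda>x. indicator \<Omega> x * f x) \<in> borel_measurable lebesgue"
    "AE x in lebesgue. \<bar>indicator \<Omega> x * f x\<bar> \<le> B"
proof -
  have \<Omega>: "\<Omega> \<in> sets lebesgue" using op by simp
  obtain C where C: "AE x in lebesgue_on \<Omega>. \<bar>f x\<bar> \<le> C" and m: "f \<in> borel_measurable (lebesgue_on \<Omega>)"
    using f by (auto simp: Linf_on_def)
  show ?thesis
  proof (rule that[of "\<bar>C\<bar>"])
    show "(\<lambda>x. indicator \<Omega> x * f x) \<in> borel_measurable lebesgue"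
      using m \<Omega> by (subst (asm) borel_measurable_restrict_space_iff) (auto simp: mult.commute)
    have "AE x in lebesgue. x \<in> \<Omega> \<longrightarrow> \<bar>f x\<bar> \<le> C"
      using C \<Omega> by (subst (asm) AE_restrict_space_iff) auto
    then show "AE x in lebesgue. \<bar>indicator \<Omega> x * f x\<bar> \<le> \<bar>C\<bar>"
      by eventually_elim (auto simp: indicator_def)
  qed simp
qed

lemma integrable_mult_AE_bounded:
  fixes f g :: "'a \<Rightarrow> real"
  assumes f: "integrable M f" and g: "g \<in> borel_measurable M" "AE x in M. \<bar>g x\<bar> \<le> B"
  shows "integrable M (\<lambda>x. f x * g x)"
proof (rule Bochner_Integration.integrable_bound[where f="\<lambda>x. \<bar>B\<bar> * f x"])
  show "AE x in M. norm (f x * g x) \<le> norm (\<bar>B\<bar> * f x)"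
    using g(2)
  proof eventually_elim
    case (elim x)
    have "\<bar>f x\<bar> * \<bar>g x\<bar> \<le> \<bar>f x\<bar> * \<bar>B\<bar>" by (intro mult_left_mono) (use elim in auto)
    then show ?case by (simp add: abs_mult mult.commute)
  qed
qed (use f g in auto)

context trace_setup
begin

text \<open>The components of z are Lebesgue measurable and given only on \<open>\<Omega>\<close>.
  They are therefore carried as \<open>indicator \<Omega> x * z x $ j\<close> under
  \<open>lebesgue\<close>, while all other functions stay Borel.\<close>

lemma set_integral_z_sum:
  assumes z: "\<forall>j\<in>Hor deg. Linf_on \<Omega> (\<lambda>x. z x $ j)"
    and F: "\<And>j. j \<in> Hor deg \<Longrightarrow> integrable lborel (F j)"
  shows "(LINT x:\<Omega>|lebesgue. (\<Sum>j\<in>Hor deg. z x $ j * F j x)) = (\<Sum>j\<in>Hor deg. \<integral>x. F j x * (indicator \<Omega> x * z x $ j) \<partial>lebesgue)"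
    and "j \<in> Hor deg \<Longrightarrow> integrable lebesgue (\<lambda>x. F j x * (indicator \<Omega> x * z x $ j))"
proof -
  show i: "integrable lebesgue (\<lambda>x. F j x * (indicator \<Omega> x * z x $ j))" if j: "j \<in> Hor deg" for j
  proof -
    obtain B where "(\<lambda>x. indicator \<Omega> x * z x $ j) \<in> borel_measurable lebesgue" "AE x in lebesgue. \<bar>indicator \<Omega> x * z x $ j\<bar> \<le> B"
      using Linf_on_extend[OF op bspec[OF z j]] by blast
    moreover have "integrable lebesgue (F j)" using F[OF j] by (simp add: integrable_completion)
    ultimately show ?thesis by (intro integrable_mult_AE_bounded)
  qed
  have "(LINT x:\<Omega>|lebesgue. (\<Sum>j\<in>Hor deg. z x $ j * F j x)) = (\<integral>x. (\<Sum>j\<in>Hor deg. F j x * (indicator \<Omega> x * z x $ j)) \<partial>lebesgue)"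
    unfolding set_lebesgue_integral_def
    by (intro Bochner_Integration.integral_cong refl) (simp add: sum_distrib_left algebra_simps)
  also have "\<dots> = (\<Sum>j\<in>Hor deg. \<integral>x. F j x * (indicator \<Omega> x * z x $ j) \<partial>lebesgue)"
    by (intro Bochner_Integration.integral_sum i)
  finally show "(LINT x:\<Omega>|lebesgue. (\<Sum>j\<in>Hor deg. z x $ j * F j x)) = (\<Sum>j\<in>Hor deg. \<integral>x. F j x * (indicator \<Omega> x * z x $ j) \<partial>lebesgue)" .
qed

end

context meyers_serrin
begin

lemma sums_integral_w:
  assumes M: "fin_meas_on \<Omega> M" and fin: "(\<Sum>i. \<integral>\<^sup>+x. ennreal \<bar>w i x\<bar> \<partial>M) < \<infinity>"
  shows "integrable M v" "(\<lambda>i. \<integral>x. w i x \<partial>M) sums (\<integral>x. v x \<partial>M)"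
proof -
  have s[measurable_cong]: "sets M = sets borel" using M by (auto simp: fin_meas_on_def)
  have "\<And>i. w i \<in> borel_measurable M" by measurable
  from sums_integral_nn(2,3)[OF this summable_w fin]
  show "integrable M v" "(\<lambda>i. \<integral>x. w i x \<partial>M) sums (\<integral>x. v x \<partial>M)"
    by (simp_all add: v_def[abs_def])
qed

lemma sums_integral_u_band:
  assumes M: "fin_meas_on \<Omega> M" and u: "integrable M u"
  shows "(\<lambda>i. \<integral>x. u x * band \<kappa> i x \<partial>M) sums (\<integral>x. u x \<partial>M)"
proof -
  have s[measurable_cong]: "sets M = sets borel" using M by (auto simp: fin_meas_on_def)
  have m: "\<And>i. (\<lambda>x. u x * band \<kappa> i x) \<in> borel_measurable M" by measurable
  have "(\<Sum>i. \<integral>\<^sup>+x. ennreal \<bar>u x * band \<kappa> i x\<bar> \<partial>M) \<le> (\<integral>\<^sup>+x. ennreal \<bar>u x\<bar> \<partial>M)"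
    using suminf_nn_band_le[OF s, of "\<lambda>x. ennreal \<bar>u x\<bar>"] by (simp add: abs_mult band_nonneg ennreal_mult)
  also have "\<dots> < \<infinity>" using u by (simp add: integrable_iff_bounded)
  finally have fin: "(\<Sum>i. \<integral>\<^sup>+x. ennreal \<bar>u x * band \<kappa> i x\<bar> \<partial>M) < \<infinity>" .
  have sm: "summable (\<lambda>i. \<bar>u x * band \<kappa> i x\<bar>)" for x
    using summable_mult[OF summable_band, of "\<bar>u x\<bar>"] by (simp add: abs_mult)
  show ?thesis using sums_integral_nn(3)[OF m sm fin] by (simp add: band_sum_mult)
qed

lemma sums_integral_a:
  assumes j: "j \<in> Hor deg" and z: "\<forall>j\<in>Hor deg. Linf_on \<Omega> (\<lambda>x. z x $ j)"
  shows "(\<lambda>i. \<integral>x. a j i x * (indicator \<Omega> x * z x $ j) \<partial>lebesgue) sums (\<integral>x. h j x * (indicator \<Omega> x * z x $ j) \<partial>lebesgue)"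
proof -
  obtain B where B: "(\<lambda>x. indicator \<Omega> x * z x $ j) \<in> borel_measurable lebesgue" "AE x in lebesgue. \<bar>indicator \<Omega> x * z x $ j\<bar> \<le> B"
    using Linf_on_extend[OF op bspec[OF z j]] by blast
  have m: "\<And>i. a j i \<in> borel_measurable lebesgue" by (intro measurable_completion) simp
  have "(\<Sum>i. \<integral>\<^sup>+x. ennreal \<bar>a j i x\<bar> \<partial>lebesgue) < \<infinity>"
    using suminf_nn_a[OF j] by (simp add: nn_integral_completion)
  from sums_integral_mult(3)[OF m B(1) summable_a this B(2)] show ?thesis by (simp add: h_def)
qed

text \<open>Every term of the series \<open>v = \<Sum>i. w i\<close> is a test function, so the distributional definition of the
  divergence and the definition of the pairing, tested with the partition of unity, can be summed.\<close>

lemma pairing_identity: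
  assumes z: "\<forall>j\<in>Hor deg. Linf_on \<Omega> (\<lambda>x. z x $ j)"
    and dm: "divX_meas gm deg \<Omega> z Pd Nd"
    and pm: "pairing_meas gm deg \<Omega> u z (\<lambda>g. (LINT x:\<Omega>|Pd. g x) - (LINT x:\<Omega>|Nd. g x)) Pm Nm"
    and u: "integrable Pd u" "integrable Nd u"
    and w: "(\<Sum>i. \<integral>\<^sup>+x. ennreal \<bar>w i x\<bar> \<partial>Pd) < \<infinity>" "(\<Sum>i. \<integral>\<^sup>+x. ennreal \<bar>w i x\<bar> \<partial>Nd) < \<infinity>"
  shows "(\<integral>x. v x \<partial>Pd) - (\<integral>x. v x \<partial>Nd) + (LINT x:\<Omega>|lebesgue. (\<Sum>j\<in>Hor deg. z x $ j * h j x))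
    = (\<integral>x. u x \<partial>Pd) - (\<integral>x. u x \<partial>Nd) + (measure Pm \<Omega> - measure Nm \<Omega>)"
proof -
  have fin: "fin_meas_on \<Omega> Pd" "fin_meas_on \<Omega> Nd" "fin_meas_on \<Omega> Pm" "fin_meas_on \<Omega> Nm"
    using dm pm by (auto simp: divX_meas_def pairing_meas_def)
  note set_int = fin_meas_on_set_integral[OF fin(1) op] fin_meas_on_set_integral[OF fin(2) op]
    fin_meas_on_set_integral[OF fin(3) op] fin_meas_on_set_integral[OF fin(4) op]
  let ?z = "\<lambda>j x. indicator \<Omega> x * z x $ j"
  \<comment> \<open>The divergence is tested with \<open>w i\<close> and the pairing with
    \<open>band \<kappa> i\<close>; the integrals of z against \<open>a j i\<close> are precisely
    the difference of the two Lebesgue integrals that arise.\<close>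
  have e: "((\<integral>x. w i x \<partial>Pd) - (\<integral>x. w i x \<partial>Nd)) - ((\<integral>x. u x * band \<kappa> i x \<partial>Pd) - (\<integral>x. u x * band \<kappa> i x \<partial>Nd))
      + (\<Sum>j\<in>Hor deg. \<integral>x. a j i x * ?z j x \<partial>lebesgue) = (\<integral>x. band \<kappa> i x \<partial>Pm) - (\<integral>x. band \<kappa> i x \<partial>Nm)" for i
  proof -
    have i1: "integrable lborel (Xop gm j (w i))" for j
      by (rule test_integrable[OF test_on_Xop[OF w_test]])
    have i2: "integrable lborel (\<lambda>x. u x * Xop gm j (band \<kappa> i) x)" for j
      by (rule test_mult_integrable[OF u_int test_on_Xop[OF band_test]])
    have "(LINT x:\<Omega>|Pd. w i x) - (LINT x:\<Omega>|Nd. w i x) = - (LINT x:\<Omega>|lebesgue. (\<Sum>j\<in>Hor deg. z x $ j * Xop gm j (w i) x))"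
      using dm w_test_\<Omega> unfolding divX_meas_def by blast
    then have e1: "(\<integral>x. w i x \<partial>Pd) - (\<integral>x. w i x \<partial>Nd) = - (\<Sum>j\<in>Hor deg. \<integral>x. Xop gm j (w i) x * ?z j x \<partial>lebesgue)"
      using set_integral_z_sum(1)[OF z i1] by (simp add: set_int)
    have "(LINT x:\<Omega>|Pm. band \<kappa> i x) - (LINT x:\<Omega>|Nm. band \<kappa> i x)
      = - ((LINT x:\<Omega>|Pd. u x * band \<kappa> i x) - (LINT x:\<Omega>|Nd. u x * band \<kappa> i x))
        - (LINT x:\<Omega>|lebesgue. u x * (\<Sum>j\<in>Hor deg. z x $ j * Xop gm j (band \<kappa> i) x))"
      using pm band_test_\<Omega> unfolding pairing_meas_def by blast
    moreover have "(LINT x:\<Omega>|lebesgue. u x * (\<Sum>j\<in>Hor deg. z x $ j * Xop gm j (band \<kappa> i) x))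
      = (LINT x:\<Omega>|lebesgue. (\<Sum>j\<in>Hor deg. z x $ j * (u x * Xop gm j (band \<kappa> i) x)))"
      by (simp add: sum_distrib_left mult.left_commute)
    ultimately have e2: "(\<integral>x. band \<kappa> i x \<partial>Pm) - (\<integral>x. band \<kappa> i x \<partial>Nm)
      = - ((\<integral>x. u x * band \<kappa> i x \<partial>Pd) - (\<integral>x. u x * band \<kappa> i x \<partial>Nd))
        - (\<Sum>j\<in>Hor deg. \<integral>x. (u x * Xop gm j (band \<kappa> i) x) * ?z j x \<partial>lebesgue)"
      using set_integral_z_sum(1)[OF z i2] by (simp add: set_int)
    have "(\<integral>x. a j i x * ?z j x \<partial>lebesgue) = (\<integral>x. Xop gm j (w i) x * ?z j x \<partial>lebesgue) - (\<integral>x. (u x * Xop gm j (band \<kappa> i) x) * ?z j x \<partial>lebesgue)"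
      if "j \<in> Hor deg" for j
      unfolding a_def left_diff_distrib
      by (rule Bochner_Integration.integral_diff[OF set_integral_z_sum(2)[OF z i1 that] set_integral_z_sum(2)[OF z i2 that]])
    then have "(\<Sum>j\<in>Hor deg. \<integral>x. a j i x * ?z j x \<partial>lebesgue)
      = (\<Sum>j\<in>Hor deg. \<integral>x. Xop gm j (w i) x * ?z j x \<partial>lebesgue) - (\<Sum>j\<in>Hor deg. \<integral>x. (u x * Xop gm j (band \<kappa> i) x) * ?z j x \<partial>lebesgue)"
      by (simp add: sum_subtractf)
    with e1 e2 show ?thesis by simp
  qed
  \<comment> \<open>Testing the pairing with the whole partition of unity recovers the total mass of
    each of the two measures that represent it.\<close>
  have m1: "(\<lambda>i. \<integral>x. band \<kappa> i x \<partial>M) sums measure M \<Omega>" if M: "fin_meas_on \<Omega> M" for M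
  proof -
    have s: "sets M = sets borel" and f: "finite_measure M" using M by (auto simp: fin_meas_on_def)
    have sp: "space M = UNIV" using sets_eq_imp_space_eq[OF s] by simp
    have "(\<lambda>i. \<integral>x. band \<kappa> i x * 1 \<partial>M) sums (\<integral>x. 1 \<partial>M)" by (rule sums_measure_band[OF M, of _ 1]) auto
    also have "(\<integral>x. 1 \<partial>M) = measure M UNIV" using f by (simp add: sp)
    also have "\<dots> = measure M \<Omega>"
      using fin_meas_on_AE[OF M op] op by (intro finite_measure.finite_measure_eq_AE[OF f]) (auto simp: s)
    finally show ?thesis by simp
  qed
  have "(\<lambda>i. ((\<integral>x. w i x \<partial>Pd) - (\<integral>x. w i x \<partial>Nd)) - ((\<integral>x. u x * band \<kappa> i x \<partial>Pd) - (\<integral>x. u x * band \<kappa> i x \<partial>Nd))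
      + (\<Sum>j\<in>Hor deg. \<integral>x. a j i x * ?z j x \<partial>lebesgue)) sums
     (((\<integral>x. v x \<partial>Pd) - (\<integral>x. v x \<partial>Nd)) - ((\<integral>x. u x \<partial>Pd) - (\<integral>x. u x \<partial>Nd)) + (\<Sum>j\<in>Hor deg. \<integral>x. h j x * ?z j x \<partial>lebesgue))"
    by (intro sums_add sums_diff sums_sum sums_integral_w(2) sums_integral_u_band sums_integral_a fin u w z)
  moreover have "(\<lambda>i. (\<integral>x. band \<kappa> i x \<partial>Pm) - (\<integral>x. band \<kappa> i x \<partial>Nm)) sums (measure Pm \<Omega> - measure Nm \<Omega>)"
    by (intro sums_diff m1 fin)
  ultimately have "((\<integral>x. v x \<partial>Pd) - (\<integral>x. v x \<partial>Nd)) - ((\<integral>x. u x \<partial>Pd) - (\<integral>x. u x \<partial>Nd)) + (\<Sum>j\<in>Hor deg. \<integral>x. h j x * ?z j x \<partial>lebesgue)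
     = measure Pm \<Omega> - measure Nm \<Omega>"
    unfolding e by (rule sums_unique2)
  moreover have "(LINT x:\<Omega>|lebesgue. (\<Sum>j\<in>Hor deg. z x $ j * h j x)) = (\<Sum>j\<in>Hor deg. \<integral>x. h j x * ?z j x \<partial>lebesgue)"
    by (rule set_integral_z_sum(1)[OF z h_integrable])
  ultimately show ?thesis by simp
qed

end

section \<open>Functionals on a dense subset of an integral space\<close>

text \<open>Duality \<open>(L\<^sup>1)\<^sup>* = L\<^sup>\<infinity>\<close> for a functional given on a dense family: extend by density,
  then represent \<open>A \<mapsto> \<Lambda> (indicator A) + measure M A\<close> by Radon--Nikodym.\<close>

lemma L1_functional_density:
  fixes E :: "'g \<Rightarrow> 'a \<Rightarrow> real" and L :: "'g \<Rightarrow> real"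
  assumes M: "finite_measure M"
    and E: "\<And>g. g \<in> T \<Longrightarrow> integrable M (E g)"
    and lin: "\<And>g g' c. g \<in> T \<Longrightarrow> g' \<in> T \<Longrightarrow> \<exists>g''\<in>T. (\<forall>x. E g'' x = E g x + c * E g' x) \<and> L g'' = L g + c * L g'"
    and dense: "\<And>f e. integrable M f \<Longrightarrow> e > 0 \<Longrightarrow> \<exists>g\<in>T. (\<integral>x. \<bar>f x - E g x\<bar> \<partial>M) < (e::real)"
    and bound: "\<And>g. g \<in> T \<Longrightarrow> \<bar>L g\<bar> \<le> (\<integral>x. \<bar>E g x\<bar> \<partial>M)"
  shows "\<exists>d\<in>borel_measurable M. (AE x in M. \<bar>d x\<bar> \<le> 1) \<and> (\<forall>g\<in>T. L g = (\<integral>x. E g x * d x \<partial>M))"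
proof -
  interpret finite_measure M by fact
  \<comment> \<open>\<open>Q f r\<close> says that \<open>r\<close> is the value at \<open>f\<close>
    of the extension by continuity: it is approximated by \<open>L g\<close> along elements of
    \<open>T\<close> whose images approach \<open>f\<close> in L1.\<close>
  define Q where "Q f r \<longleftrightarrow> integrable M f \<and> (\<forall>e>0. \<exists>g\<in>T. (\<integral>x. \<bar>f x - E g x\<bar> \<partial>M) < e \<and> \<bar>L g - r\<bar> < e)" for f :: "'a \<Rightarrow> real" and r :: real
  have tri: "(\<integral>x. \<bar>f x - k x\<bar> \<partial>M) \<le> (\<integral>x. \<bar>f x - g x\<bar> \<partial>M) + (\<integral>x. \<bar>g x - k x\<bar> \<partial>M)"
    if "integrable M f" "integrable M g" "integrable M k" for f g k :: "'a \<Rightarrow> real"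
  proof -
    have "(\<integral>x. \<bar>f x - k x\<bar> \<partial>M) \<le> (\<integral>x. \<bar>f x - g x\<bar> + \<bar>g x - k x\<bar> \<partial>M)"
      using that by (intro integral_mono) auto
    then show ?thesis using that by simp
  qed
  have diff: "\<bar>L g - L g'\<bar> \<le> (\<integral>x. \<bar>E g x - E g' x\<bar> \<partial>M)" if g: "g \<in> T" "g' \<in> T" for g g'
  proof -
    obtain k where k: "k \<in> T" "\<And>x. E k x = E g x + (- 1) * E g' x" "L k = L g + (- 1) * L g'"
      using lin[OF g, of "- 1"] by blast
    then show ?thesis using bound[OF k(1)] by simp
  qed
  have Q_dist: "\<bar>r - r'\<bar> \<le> (\<integral>x. \<bar>f x - f' x\<bar> \<partial>M)" if q: "Q f r" "Q f' r'" for f f' r r'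
  proof (rule field_le_epsilon)
    fix e :: real assume e: "e > 0"
    obtain g where g: "g \<in> T" "(\<integral>x. \<bar>f x - E g x\<bar> \<partial>M) < e / 4" "\<bar>L g - r\<bar> < e / 4"
      using q(1) e unfolding Q_def by (meson divide_pos_pos zero_less_numeral)
    obtain g' where g': "g' \<in> T" "(\<integral>x. \<bar>f' x - E g' x\<bar> \<partial>M) < e / 4" "\<bar>L g' - r'\<bar> < e / 4"
      using q(2) e unfolding Q_def by (meson divide_pos_pos zero_less_numeral)
    have i: "integrable M f" "integrable M f'" using q by (auto simp: Q_def)
    have "\<bar>r - r'\<bar> \<le> \<bar>L g - L g'\<bar> + e / 2" using g(3) g'(3) by linarith
    also have "\<bar>L g - L g'\<bar> \<le> (\<integral>x. \<bar>E g x - f x\<bar> \<partial>M) + (\<integral>x. \<bar>f x - E g' x\<bar> \<partial>M)"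
      using diff[OF g(1) g'(1)] tri[OF E[OF g(1)] i(1) E[OF g'(1)]] by linarith
    also have "(\<integral>x. \<bar>f x - E g' x\<bar> \<partial>M) \<le> (\<integral>x. \<bar>f x - f' x\<bar> \<partial>M) + (\<integral>x. \<bar>f' x - E g' x\<bar> \<partial>M)"
      using tri[OF i E[OF g'(1)]] .
    finally show "\<bar>r - r'\<bar> \<le> (\<integral>x. \<bar>f x - f' x\<bar> \<partial>M) + e"
      using g(2) g'(2) by (simp add: abs_minus_commute[of "E _ _"])
  qed
  have Q_ex: "\<exists>r. Q f r" if f: "integrable M f" for f
  proof -
    define A where "A n g \<longleftrightarrow> g \<in> T \<and> (\<integral>x. \<bar>f x - E g x\<bar> \<partial>M) < 1 / real (Suc n)" for n g
    have "\<exists>g. A n g" for n using dense[OF f, of "1 / real (Suc n)"] by (auto simp: A_def)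
    then obtain G where "\<And>n. A n (G n)" by metis
    then have G: "\<And>n. G n \<in> T" "\<And>n. (\<integral>x. \<bar>f x - E (G n) x\<bar> \<partial>M) < 1 / real (Suc n)" by (auto simp: A_def)
    have "Cauchy (\<lambda>n. L (G n))"
    proof (rule CauchyI)
      fix e :: real assume e: "e > 0"
      obtain n0 where n0: "1 / real (Suc n0) < e / 2" using e nat_approx_posE[of "e / 2"] by auto
      show "\<exists>n0. \<forall>m\<ge>n0. \<forall>n\<ge>n0. norm (L (G m) - L (G n)) < e"
      proof (intro exI[of _ n0] allI impI)
        fix m n assume mn: "n0 \<le> m" "n0 \<le> n"
        have "1 / real (Suc m) \<le> 1 / real (Suc n0)" "1 / real (Suc n) \<le> 1 / real (Suc n0)"
          using mn by (auto simp: frac_le)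
        moreover have "\<bar>L (G m) - L (G n)\<bar> \<le> (\<integral>x. \<bar>E (G m) x - f x\<bar> \<partial>M) + (\<integral>x. \<bar>f x - E (G n) x\<bar> \<partial>M)"
          using diff[OF G(1) G(1), of m n] tri[OF E[OF G(1)] f E[OF G(1)], of m n] by linarith
        ultimately show "norm (L (G m) - L (G n)) < e"
          using G(2)[of m] G(2)[of n] n0 by (simp add: abs_minus_commute[of "E _ _"])
      qed
    qed
    then obtain r where r: "(\<lambda>n. L (G n)) \<longlonglongrightarrow> r" using Cauchy_convergent convergent_def by blast
    have "Q f r" unfolding Q_def
    proof (intro conjI allI impI f)
      fix e :: real assume e: "e > 0"
      obtain n1 where n1: "\<And>n. n \<ge> n1 \<Longrightarrow> \<bar>L (G n) - r\<bar> < e" using LIMSEQ_D[OF r e] by auto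
      obtain n2 where n2: "1 / real (Suc n2) < e" using e nat_approx_posE by auto
      have "1 / real (Suc (max n1 n2)) \<le> 1 / real (Suc n2)" by (auto simp: frac_le)
      then show "\<exists>g\<in>T. (\<integral>x. \<bar>f x - E g x\<bar> \<partial>M) < e \<and> \<bar>L g - r\<bar> < e"
        using G(1)[of "max n1 n2"] G(2)[of "max n1 n2"] n1[of "max n1 n2"] n2 by (intro bexI[of _ "G (max n1 n2)"]) auto
    qed
    then show ?thesis by blast
  qed
  have Q_lin: "Q (\<lambda>x. f x + c * f' x) (r + c * r')" if q: "Q f r" "Q f' r'" for f f' r r' c
    unfolding Q_def
  proof (intro conjI allI impI)
    have i: "integrable M f" "integrable M f'" using q by (auto simp: Q_def)
    show "integrable M (\<lambda>x. f x + c * f' x)" using i by auto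
    fix e :: real assume e: "e > 0"
    define e' where "e' = e / (2 * (\<bar>c\<bar> + 1))"
    have e': "e' > 0" "\<bar>c\<bar> * e' \<le> e / 2"
      using e by (auto simp: e'_def field_simps add_nonneg_pos)
    have "e / 2 > 0" using e by simp
    obtain g where g: "g \<in> T" "(\<integral>x. \<bar>f x - E g x\<bar> \<partial>M) < e / 2" "\<bar>L g - r\<bar> < e / 2"
      using q(1) \<open>e / 2 > 0\<close> unfolding Q_def by blast
    obtain g' where g': "g' \<in> T" "(\<integral>x. \<bar>f' x - E g' x\<bar> \<partial>M) < e'" "\<bar>L g' - r'\<bar> < e'"
      using q(2) e'(1) unfolding Q_def by blast
    obtain k where k: "k \<in> T" "\<And>x. E k x = E g x + c * E g' x" "L k = L g + c * L g'"
      using lin[OF g(1) g'(1), of c] by blast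
    have "(\<integral>x. \<bar>f x + c * f' x - E k x\<bar> \<partial>M) \<le> (\<integral>x. \<bar>f x - E g x\<bar> + \<bar>c\<bar> * \<bar>f' x - E g' x\<bar> \<partial>M)"
    proof (rule integral_mono)
      show "\<bar>f x + c * f' x - E k x\<bar> \<le> \<bar>f x - E g x\<bar> + \<bar>c\<bar> * \<bar>f' x - E g' x\<bar>" for x
        unfolding k abs_mult[symmetric] by (simp add: algebra_simps)
    qed (use i E[OF k(1)] E[OF g(1)] E[OF g'(1)] in auto)
    also have "\<dots> = (\<integral>x. \<bar>f x - E g x\<bar> \<partial>M) + \<bar>c\<bar> * (\<integral>x. \<bar>f' x - E g' x\<bar> \<partial>M)"
      using i E[OF g(1)] E[OF g'(1)] by simp
    also have "\<dots> < e / 2 + e / 2"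
    proof -
      have "\<bar>c\<bar> * (\<integral>x. \<bar>f' x - E g' x\<bar> \<partial>M) \<le> \<bar>c\<bar> * e'" using g'(2) by (intro mult_left_mono) auto
      then show ?thesis using g(2) e'(2) by linarith
    qed
    finally have 1: "(\<integral>x. \<bar>f x + c * f' x - E k x\<bar> \<partial>M) < e" by simp
    have "\<bar>L k - (r + c * r')\<bar> \<le> \<bar>L g - r\<bar> + \<bar>c\<bar> * \<bar>L g' - r'\<bar>"
      unfolding k abs_mult[symmetric] by (simp add: algebra_simps)
    also have "\<dots> < e / 2 + e / 2"
    proof -
      have "\<bar>c\<bar> * \<bar>L g' - r'\<bar> \<le> \<bar>c\<bar> * e'" using g'(3) by (intro mult_left_mono) auto
      then show ?thesis using g(3) e'(2) by linarith
    qed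
    finally have 2: "\<bar>L k - (r + c * r')\<bar> < e" by simp
    show "\<exists>g\<in>T. (\<integral>x. \<bar>f x + c * f' x - E g x\<bar> \<partial>M) < e \<and> \<bar>L g - (r + c * r')\<bar> < e"
      using k(1) 1 2 by blast
  qed
  define \<Lambda> where "\<Lambda> f = (SOME r. Q f r)" for f
  have \<Lambda>: "Q f (\<Lambda> f)" if "integrable M f" for f unfolding \<Lambda>_def using Q_ex[OF that] by (rule someI_ex)
  have \<Lambda>_eqI: "\<Lambda> f = r" if "Q f r" for f r
  proof -
    have "integrable M f" using that by (simp add: Q_def)
    from Q_dist[OF \<Lambda>[OF this] that] show ?thesis by simp
  qed
  have \<Lambda>_lin: "\<Lambda> (\<lambda>x. f x + c * f' x) = \<Lambda> f + c * \<Lambda> f'" if "integrable M f" "integrable M f'" for f f' c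
    by (intro \<Lambda>_eqI Q_lin \<Lambda> that)
  have \<Lambda>_dist: "\<bar>\<Lambda> f - \<Lambda> f'\<bar> \<le> (\<integral>x. \<bar>f x - f' x\<bar> \<partial>M)" if "integrable M f" "integrable M f'" for f f'
    by (intro Q_dist \<Lambda> that)
  have \<Lambda>_0: "\<Lambda> (\<lambda>x. 0) = 0" using \<Lambda>_lin[of "\<lambda>x. 0" "\<lambda>x. 0" 1] by simp
  have \<Lambda>_le: "\<bar>\<Lambda> f\<bar> \<le> (\<integral>x. \<bar>f x\<bar> \<partial>M)" if "integrable M f" for f
    using \<Lambda>_dist[OF that, of "\<lambda>x. 0"] by (simp add: \<Lambda>_0)
  have \<Lambda>_E: "\<Lambda> (E g) = L g" if "g \<in> T" for g
    by (rule \<Lambda>_eqI) (use that E in \<open>auto simp: Q_def intro!: bexI[of _ g]\<close>)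
  have ind_int: "integrable M (indicator A :: 'a \<Rightarrow> real)" if "A \<in> sets M" for A
    using that by (simp add: emeasure_finite less_top[symmetric])
  \<comment> \<open>Since the value of the functional at an indicator is at most
    \<open>measure M A\<close> in modulus, adding this measure gives a nonnegative set function
    below twice \<open>M\<close>. Its density lies between 0 and 2, and subtracting 1 from it
    represents the functional.\<close>
  define m where "m A = \<Lambda> (indicator A) + measure M A" for A
  have m_le: "0 \<le> m A" "m A \<le> 2 * measure M A" if A: "A \<in> sets M" for A
  proof -
    have "\<bar>\<Lambda> (indicator A)\<bar> \<le> measure M A" using \<Lambda>_le[OF ind_int[OF A]] A by simp
    then show "0 \<le> m A" "m A \<le> 2 * measure M A" by (auto simp: m_def)
  qed
  have m_sums: "(\<lambda>i. m (A i)) sums m (\<Union>i. A i)" if A: "range A \<subseteq> sets M" "disjoint_family A" for A :: "nat \<Rightarrow> 'a set"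
  proof -
    have Ai: "A i \<in> sets M" for i using A by auto
    have U: "(\<Union>i. A i) \<in> sets M" using A by auto
    have part: "\<Lambda> (indicator (\<Union>i<n. A i)) = (\<Sum>i<n. \<Lambda> (indicator (A i)))" for n
    proof (induction n)
      case 0
      have "(indicator (\<Union>i<(0::nat). A i) :: 'a \<Rightarrow> real) = (\<lambda>x. 0)" by auto
      then show ?case using \<Lambda>_0 by simp
    next
      case (Suc n)
      have "(indicator (\<Union>i<Suc n. A i) :: 'a \<Rightarrow> real) = (\<lambda>x. indicator (\<Union>i<n. A i) x + 1 * indicator (A n) x)"
      proof
        fix x
        have "A n \<inter> A i = {}" if "i < n" for i
          using that by (intro disjoint_family_onD[OF A(2)]) auto
        then have "x \<notin> A n \<or> x \<notin> (\<Union>i<n. A i)" by blast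
        then show "indicator (\<Union>i<Suc n. A i) x = (indicator (\<Union>i<n. A i) x + 1 * indicator (A n) x :: real)"
          by (auto simp: indicator_def lessThan_Suc)
      qed
      moreover have "\<Lambda> (\<lambda>x. indicator (\<Union>i<n. A i) x + 1 * indicator (A n) x) = \<Lambda> (indicator (\<Union>i<n. A i)) + 1 * \<Lambda> (indicator (A n))"
        using Ai by (intro \<Lambda>_lin ind_int) auto
      ultimately show ?case using Suc by simp
    qed
    have "(\<lambda>n. \<integral>x. \<bar>indicator (\<Union>i<n. A i) x - indicator (\<Union>i. A i) x\<bar> \<partial>M) \<longlonglongrightarrow> (\<integral>x. (0::real) \<partial>M)"
    proof (rule integral_dominated_convergence[where w="\<lambda>x. 1"])
      show "AE x in M. (\<lambda>n. \<bar>indicator (\<Union>i<n. A i) x - indicator (\<Union>i. A i) x\<bar>) \<longlonglongrightarrow> (0::real)"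
      proof (rule AE_I2)
        fix x
        have "\<forall>\<^sub>F n in sequentially. \<bar>indicator (\<Union>i<n. A i) x - indicator (\<Union>i. A i) x\<bar> = (0::real)"
        proof (cases "x \<in> (\<Union>i. A i)")
          case True
          then obtain i where "x \<in> A i" by auto
          then show ?thesis by (intro eventually_sequentiallyI[of "Suc i"]) (auto simp: indicator_def)
        qed (auto simp: indicator_def)
        then show "(\<lambda>n. \<bar>indicator (\<Union>i<n. A i) x - indicator (\<Union>i. A i) x\<bar>) \<longlonglongrightarrow> (0::real)"
          by (rule tendsto_eventually)
      qed
    qed (use Ai U in \<open>auto simp: indicator_def\<close>)
    then have t: "(\<lambda>n. \<integral>x. \<bar>indicator (\<Union>i<n. A i) x - indicator (\<Union>i. A i) x\<bar> \<partial>M) \<longlonglongrightarrow> (0::real)" by simp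
    have "(\<lambda>n. \<Lambda> (indicator (\<Union>i<n. A i)) - \<Lambda> (indicator (\<Union>i. A i))) \<longlonglongrightarrow> 0"
    proof (rule Lim_null_comparison[OF _ t], rule always_eventually, rule allI)
      fix n
      have "(\<Union>i<n. A i) \<in> sets M" using Ai by auto
      then show "norm (\<Lambda> (indicator (\<Union>i<n. A i)) - \<Lambda> (indicator (\<Union>i. A i))) \<le> (\<integral>x. \<bar>indicator (\<Union>i<n. A i) x - indicator (\<Union>i. A i) x\<bar> \<partial>M)"
        using \<Lambda>_dist[OF ind_int ind_int] U by simp
    qed
    then have "(\<lambda>i. \<Lambda> (indicator (A i))) sums \<Lambda> (indicator (\<Union>i. A i))"
      unfolding sums_def part[symmetric] by (simp add: LIM_zero_iff)
    moreover have "(\<lambda>i. measure M (A i)) sums measure M (\<Union>i. A i)"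
      by (rule finite_measure_UNION[OF A])
    ultimately show ?thesis unfolding m_def by (rule sums_add)
  qed
  define N where "N = measure_of (space M) (sets M) (\<lambda>A. ennreal (m A))"
  have sN: "sets N = sets M" "space N = space M" by (simp_all add: N_def sets.space_closed sets.sigma_sets_eq)
  have N: "emeasure N A = ennreal (m A)" if "A \<in> sets M" for A
  proof (rule emeasure_measure_of[OF N_def])
    show "sets M \<subseteq> Pow (space M)" by (rule sets.space_closed)
    show "A \<in> sets N" using that sN by simp
    show "positive (sets N) (\<lambda>A. ennreal (m A))"
    proof -
      have "(indicator {} :: 'a \<Rightarrow> real) = (\<lambda>x. 0)" by auto
      then show ?thesis using \<Lambda>_0 by (simp add: positive_def m_def)
    qed
    show "countably_additive (sets N) (\<lambda>A. ennreal (m A))"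
    proof (rule countably_additiveI)
      fix A :: "nat \<Rightarrow> 'a set" assume A: "range A \<subseteq> sets N" "disjoint_family A"
      then have A': "range A \<subseteq> sets M" using sN by simp
      have nn: "0 \<le> m (A i)" for i using A' by (intro m_le) auto
      show "(\<Sum>i. ennreal (m (A i))) = ennreal (m (\<Union> (range A)))"
        using suminf_ennreal_eq[OF nn m_sums[OF A' A(2)]] by simp
    qed
  qed
  have ac: "absolutely_continuous M N"
    unfolding absolutely_continuous_def
  proof
    fix A assume A: "A \<in> null_sets M"
    then have "measure M A = 0" "A \<in> sets M" by (auto simp: null_sets_def measure_def)
    then have "m A = 0" using m_le[of A] by simp
    then show "A \<in> null_sets N" using N[of A] \<open>A \<in> sets M\<close> sN by (auto simp: null_sets_def)
  qed
  obtain D where D: "D \<in> borel_measurable M" "density M D = N"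
    using Radon_Nikodym[OF ac sN(1)] by blast
  note [measurable] = D(1)
  \<comment> \<open>If the density exceeded 2 on \<open>A\<close>, then integrating \<open>D\<close>
    over \<open>A\<close> would contradict the bound by twice the mass of \<open>A\<close>. The
    comparison is made through \<open>D x - 2\<close> in the extended reals, where cancelling twice
    the mass of \<open>A\<close> is allowed because it is finite.\<close>
  have D2: "AE x in M. D x \<le> 2"
  proof -
    define A where "A = {x\<in>space M. 2 < D x}"
    have A[measurable]: "A \<in> sets M" unfolding A_def by measurable
    have "(\<integral>\<^sup>+x. D x * indicator A x \<partial>M) = emeasure N A"
      unfolding D(2)[symmetric] by (rule emeasure_density[symmetric]) measurable
    also have "\<dots> \<le> ennreal (2 * measure M A)" unfolding N[OF A] using m_le[OF A] by (intro ennreal_leI)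
    also have "\<dots> = 2 * emeasure M A" by (simp add: emeasure_eq_measure ennreal_mult)
    finally have le: "(\<integral>\<^sup>+x. D x * indicator A x \<partial>M) \<le> 2 * emeasure M A" .
    have "(\<integral>\<^sup>+x. (D x - 2) * indicator A x \<partial>M) + 2 * emeasure M A = (\<integral>\<^sup>+x. (D x - 2) * indicator A x \<partial>M) + (\<integral>\<^sup>+x. 2 * indicator A x \<partial>M)"
      by (simp add: nn_integral_cmult_indicator)
    also have "\<dots> = (\<integral>\<^sup>+x. (D x - 2) * indicator A x + 2 * indicator A x \<partial>M)"
      by (rule nn_integral_add[symmetric]) measurable
    also have "\<dots> = (\<integral>\<^sup>+x. D x * indicator A x \<partial>M)"
      by (intro nn_integral_cong) (auto simp: indicator_def A_def diff_add_cancel_ennreal less_imp_le)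
    also note le
    finally have "2 * emeasure M A + (\<integral>\<^sup>+x. (D x - 2) * indicator A x \<partial>M) \<le> 2 * emeasure M A + 0" by (simp add: add.commute)
    then have "(\<integral>\<^sup>+x. (D x - 2) * indicator A x \<partial>M) = 0"
      unfolding ennreal_add_left_cancel_le by (simp add: ennreal_mult_eq_top_iff)
    then have "AE x in M. (D x - 2) * indicator A x = 0"
      by (subst (asm) nn_integral_0_iff_AE) auto
    then show ?thesis
      using AE_space
    proof (eventually_elim)
      case (elim x)
      show ?case
      proof (cases "2 < D x")
        case True
        then show ?thesis using elim by (auto simp: A_def indicator_def diff_eq_0_iff_ennreal split: if_splits)
      qed simp
    qed
  qed
  define \<delta> where "\<delta> x = enn2real (D x)" for x
  have [measurable]: "\<delta> \<in> borel_measurable M" unfolding \<delta>_def[abs_def] by measurable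
  have D\<delta>: "AE x in M. D x = ennreal (\<delta> x) \<and> \<delta> x \<le> 2"
    using D2
  proof eventually_elim
    case (elim x)
    then have "D x < top" by (rule order.strict_trans1) simp
    moreover have "enn2real (D x) \<le> enn2real 2" using elim by (intro enn2real_mono) auto
    ultimately show ?case by (simp add: \<delta>_def)
  qed
  have \<delta>0: "0 \<le> \<delta> x" for x by (simp add: \<delta>_def)
  have \<delta>1: "AE x in M. \<bar>\<delta> x - 1\<bar> \<le> 1" using D\<delta> by eventually_elim (use \<delta>0 in \<open>auto simp: abs_le_iff\<close>)
  have \<delta>i: "integrable M (\<lambda>x. f x * (\<delta> x - 1))" if "integrable M f" for f
    by (rule integrable_mult_AE_bounded[OF that _ \<delta>1]) measurable
  have \<Lambda>_ind: "\<Lambda> (indicator A) = (\<integral>x. indicator A x * (\<delta> x - 1) \<partial>M)" if A[measurable]: "A \<in> sets M" for A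
  proof -
    have i: "integrable M (\<lambda>x. indicator A x * \<delta> x)"
      using Bochner_Integration.integrable_add[OF \<delta>i[OF ind_int[OF A]] ind_int[OF A]] by (simp add: algebra_simps)
    have "ennreal (m A) = (\<integral>\<^sup>+x. D x * indicator A x \<partial>M)"
      unfolding N[OF A, symmetric] D(2)[symmetric] by (rule emeasure_density) measurable
    also have "\<dots> = (\<integral>\<^sup>+x. ennreal (indicator A x * \<delta> x) \<partial>M)"
      by (rule nn_integral_cong_AE) (use D\<delta> in \<open>eventually_elim, auto simp: indicator_def\<close>)
    also have "\<dots> = ennreal (\<integral>x. indicator A x * \<delta> x \<partial>M)"
      using \<delta>0 by (intro nn_integral_eq_integral i) auto
    finally have "m A = (\<integral>x. indicator A x * \<delta> x \<partial>M)"
      using m_le[OF A] \<delta>0 by (subst (asm) ennreal_inj) (auto intro!: integral_nonneg_AE)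
    moreover have "(\<integral>x. indicator A x * (\<delta> x - 1) \<partial>M) = (\<integral>x. indicator A x * \<delta> x \<partial>M) - measure M A"
      using i ind_int[OF A] A by (simp add: right_diff_distrib)
    ultimately show ?thesis by (simp add: m_def)
  qed
  have rep: "\<Lambda> f = (\<integral>x. f x * (\<delta> x - 1) \<partial>M)" if "integrable M f" for f
    using that
  proof (induction f rule: integrable_induct)
    case (base A c)
    have "(\<lambda>x. indicator A x *\<^sub>R c) = (\<lambda>x. 0 + c * indicator A x)" by (auto simp: fun_eq_iff)
    then have "\<Lambda> (\<lambda>x. indicator A x *\<^sub>R c) = c * \<Lambda> (indicator A)"
      using \<Lambda>_lin[of "\<lambda>x. 0" "indicator A" c] ind_int[OF base(1)] \<Lambda>_0 by simp
    also have "\<dots> = (\<integral>x. c * (indicator A x * (\<delta> x - 1)) \<partial>M)" using \<Lambda>_ind[OF base(1)] by simp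
    finally show ?case by (simp add: mult.commute mult.left_commute)
  next
    case (add f g)
    have "\<Lambda> (\<lambda>x. f x + g x) = \<Lambda> f + \<Lambda> g" using \<Lambda>_lin[OF add(1,2), of 1] by simp
    also have "\<dots> = (\<integral>x. f x * (\<delta> x - 1) + g x * (\<delta> x - 1) \<partial>M)"
      using add \<delta>i by simp
    finally show ?case by (simp add: distrib_right)
  next
    case (lim f s)
    have t: "(\<lambda>i. \<integral>x. \<bar>s i x - f x\<bar> \<partial>M) \<longlonglongrightarrow> 0"
    proof -
      have "(\<lambda>i. \<integral>x. \<bar>s i x - f x\<bar> \<partial>M) \<longlonglongrightarrow> (\<integral>x. 0 \<partial>M)"
      proof (rule integral_dominated_convergence[where w="\<lambda>x. 3 * \<bar>f x\<bar>"])
        show "AE x in M. (\<lambda>i. \<bar>s i x - f x\<bar>) \<longlonglongrightarrow> 0"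
        proof (rule AE_I2)
          fix x assume "x \<in> space M"
          then have "(\<lambda>i. \<bar>s i x - f x\<bar>) \<longlonglongrightarrow> \<bar>f x - f x\<bar>" by (intro tendsto_intros lim)
          then show "(\<lambda>i. \<bar>s i x - f x\<bar>) \<longlonglongrightarrow> 0" by simp
        qed
        show "AE x in M. norm \<bar>s i x - f x\<bar> \<le> 3 * \<bar>f x\<bar>" for i
          using lim(3)[of _ i] by (intro AE_I2) fastforce
      qed (use lim in auto)
      then show ?thesis by simp
    qed
    have "(\<lambda>i. \<Lambda> (s i) - \<Lambda> f) \<longlonglongrightarrow> 0"
      by (rule Lim_null_comparison[OF _ t], rule always_eventually) (use \<Lambda>_dist[OF lim(1) lim(4)] in simp)
    then have 1: "(\<lambda>i. \<Lambda> (s i)) \<longlonglongrightarrow> \<Lambda> f" by (simp add: LIM_zero_iff)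
    have 2: "(\<lambda>i. \<integral>x. s i x * (\<delta> x - 1) \<partial>M) \<longlonglongrightarrow> (\<integral>x. f x * (\<delta> x - 1) \<partial>M)"
    proof (rule integral_dominated_convergence[where w="\<lambda>x. 2 * \<bar>f x\<bar>"])
      show "AE x in M. (\<lambda>i. s i x * (\<delta> x - 1)) \<longlonglongrightarrow> f x * (\<delta> x - 1)"
        by (rule AE_I2) (intro tendsto_intros lim)
      show "AE x in M. norm (s i x * (\<delta> x - 1)) \<le> 2 * \<bar>f x\<bar>" for i
        using \<delta>1 AE_space
      proof eventually_elim
        case (elim x)
        have "\<bar>s i x\<bar> * \<bar>\<delta> x - 1\<bar> \<le> (2 * \<bar>f x\<bar>) * 1" using lim(3)[OF elim(2), of i] elim(1) by (intro mult_mono) auto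
        then show ?case by (simp add: abs_mult)
      qed
    qed (use lim in auto)
    show ?case by (rule LIMSEQ_unique[OF 1]) (use 2 in \<open>simp only: lim.IH\<close>)
  qed
  show ?thesis
  proof (intro bexI[of _ "\<lambda>x. \<delta> x - 1"] conjI ballI)
    show "AE x in M. \<bar>\<delta> x - 1\<bar> \<le> 1" by (rule \<delta>1)
    show "L g = (\<integral>x. E g x * (\<delta> x - 1) \<partial>M)" if "g \<in> T" for g
      using rep[OF E[OF that]] \<Lambda>_E[OF that] by simp
  qed measurable
qed

section \<open>Traces of truncations\<close>

context carnot
begin

lemma pderiv_mult:
  assumes "C_inf f" "C_inf g" "b \<in> Basis"
  shows "pderiv_dir (\<lambda>x. f x * g x) b x = pderiv_dir f b x * g x + f x * pderiv_dir g b x"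
proof -
  have "((\<lambda>t. f (x + t *\<^sub>R b) * g (x + t *\<^sub>R b)) has_real_derivative pderiv_dir f b x * g x + f x * pderiv_dir g b x) (at 0)"
    using DERIV_mult[OF C_inf_imp_deriv[OF assms(1,3), of x] C_inf_imp_deriv[OF assms(2,3), of x]] by (simp add: mult.commute)
  then show ?thesis unfolding pderiv_dir_def[of "\<lambda>x. f x * g x"] by (rule DERIV_imp_deriv)
qed

text \<open>Convolving with the indicator of a large ball gives a function that is constant near \<open>0\<close>.\<close>

lemma integral_pderiv_eq_0:
  fixes F :: "real^'n \<Rightarrow> real"
  assumes F: "C_inf F" and R: "\<And>x. R < norm x \<Longrightarrow> F x = 0" and b: "b \<in> Basis"
  shows "(\<integral>x. pderiv_dir F b x \<partial>lborel) = 0"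
proof -
  \<comment> \<open>For |x| below 1 and |y| above \<open>R + 2\<close> the point x - y lies outside
    the ball of radius \<open>R\<close>, so the convolution at \<open>x\<close> integrates
    \<open>f\<close> over its whole support.\<close>
  let ?w = "indicator (cball 0 (R + 2)) :: real^'n \<Rightarrow> real"
  have w: "integrable lborel ?w"
    using emeasure_compact_finite[OF compact_cball, of "0::real^'n" "R + 2"] by (intro integrable_real_indicator) auto
  have dR: "pderiv_dir F b x = 0" if "R < norm x" for x
    by (rule pderiv_dir_eq_0[of "- cball 0 R" _ _ 0]) (use that R in auto)
  have shift: "conv f ?w x = (\<integral>y. f y \<partial>lborel)"
    if f: "\<And>x. R < norm x \<Longrightarrow> f x = 0" "f \<in> borel_measurable borel" and x: "norm x < 1" for f :: "real^'n \<Rightarrow> real" and x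
  proof -
    have "f (x - y) * ?w y = f (x - y)" for y
    proof (cases "norm y \<le> R + 2")
      case False
      then have "R < norm (x - y)" using norm_triangle_sub[of y x] x by (simp add: norm_minus_commute)
      then show ?thesis using f by simp
    qed simp
    then have "(\<lambda>y. f (x - y) * ?w y) = (\<lambda>y. f (x - y))" by (rule ext)
    then show ?thesis unfolding conv_def using integral_lborel_diff(2)[OF f(2), of x] by (simp only:)
  qed
  have [measurable]: "F \<in> borel_measurable borel" "pderiv_dir F b \<in> borel_measurable borel"
    by (intro borel_measurable_continuous_onI C_inf_imp_continuous C_inf_pderiv F b)+
  have "(\<integral>x. pderiv_dir F b x \<partial>lborel) = conv (pderiv_dir F b) ?w 0"
    by (rule shift[OF dR, symmetric]) auto
  also have "\<dots> = pderiv_dir (conv F ?w) b 0"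
    by (subst pderiv_conv[OF F R w b]) auto
  also have "\<dots> = 0"
    by (rule pderiv_dir_eq_0[of "ball 0 1"]) (auto intro: shift[OF R])
  finally show ?thesis .
qed

text \<open>Integration by parts in the coordinates moves the derivatives onto \<open>coef\<close>,
  whose divergence is bounded on the ball. In contrast to \<open>integral_Xop_eq_0\<close>, the
  support of \<open>\<psi>\<close> may cross the frontier of \<open>\<Omega>\<close>, as it does for
  the test fields of a trace.\<close>

lemma integral_Xop_bound:
  obtains B where "B \<ge> 0" "\<And>\<psi>. C_inf \<psi> \<Longrightarrow> (\<And>x. R < norm x \<Longrightarrow> \<psi> x = 0) \<Longrightarrow>
    \<bar>\<integral>x. Xop gm j \<psi> x \<partial>lborel\<bar> \<le> B * (\<integral>x. \<bar>\<psi> x\<bar> \<partial>lborel)"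
proof -
  define D where "D x = (\<Sum>k\<in>UNIV. pderiv_dir (coef j k) (axis k 1) x)" for x
  have Dc: "continuous_on UNIV D"
    unfolding D_def by (intro continuous_on_sum C_inf_imp_continuous C_inf_pderiv coef_C_inf axis_Basis)
  have "compact (D ` cball 0 R)" using Dc by (intro compact_continuous_image) (auto intro: continuous_on_subset)
  then obtain B where B: "\<And>x. x \<in> cball 0 R \<Longrightarrow> \<bar>D x\<bar> \<le> B"
    using compact_imp_bounded bounded_iff by (metis imageI real_norm_def)
  show ?thesis
  proof (rule that[of "\<bar>B\<bar>"])
    fix \<psi> :: "real^'n \<Rightarrow> real" assume \<psi>: "C_inf \<psi>" and R: "\<And>x. R < norm x \<Longrightarrow> \<psi> x = 0"
    have dR: "pderiv_dir \<psi> b x = 0" if "R < norm x" for x b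
      by (rule pderiv_dir_eq_0[of "- cball 0 R" _ _ 0]) (use that R in auto)
    have int: "integrable lborel (\<lambda>x. f x * \<psi> x)" if "continuous_on UNIV f" for f
      by (rule integrable_continuous_support[of _ R])
        (auto intro!: continuous_on_mult that C_inf_imp_continuous[OF \<psi>] simp: R)
    have int': "integrable lborel (\<lambda>x. coef j k x * pderiv_dir \<psi> (axis k 1) x)" for k
      by (rule integrable_continuous_support[of _ R])
        (auto intro!: C_inf_imp_continuous C_inf_mult coef_C_inf C_inf_pderiv \<psi> axis_Basis simp: dR)
    have "(\<integral>x. coef j k x * pderiv_dir \<psi> (axis k 1) x \<partial>lborel) = - (\<integral>x. pderiv_dir (coef j k) (axis k 1) x * \<psi> x \<partial>lborel)" for k
    proof -
      have "(\<integral>x. pderiv_dir (\<lambda>x. coef j k x * \<psi> x) (axis k 1) x \<partial>lborel) = 0"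
        by (rule integral_pderiv_eq_0[of _ R]) (auto intro!: C_inf_mult coef_C_inf \<psi> axis_Basis simp: R)
      moreover have "(\<integral>x. pderiv_dir (\<lambda>x. coef j k x * \<psi> x) (axis k 1) x \<partial>lborel)
         = (\<integral>x. pderiv_dir (coef j k) (axis k 1) x * \<psi> x + coef j k x * pderiv_dir \<psi> (axis k 1) x \<partial>lborel)"
        by (subst pderiv_mult[OF coef_C_inf \<psi> axis_Basis]) simp
      moreover have "\<dots> = (\<integral>x. pderiv_dir (coef j k) (axis k 1) x * \<psi> x \<partial>lborel) + (\<integral>x. coef j k x * pderiv_dir \<psi> (axis k 1) x \<partial>lborel)"
        by (intro Bochner_Integration.integral_add int' int C_inf_imp_continuous C_inf_pderiv coef_C_inf axis_Basis)
      ultimately show ?thesis by simp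
    qed
    then have "(\<integral>x. Xop gm j \<psi> x \<partial>lborel) = (\<Sum>k\<in>UNIV. - (\<integral>x. pderiv_dir (coef j k) (axis k 1) x * \<psi> x \<partial>lborel))"
      unfolding Xop_eq[OF \<psi>] by (subst Bochner_Integration.integral_sum[OF int']) simp
    also have "\<dots> = - (\<integral>x. D x * \<psi> x \<partial>lborel)"
      unfolding D_def sum_distrib_right sum_negf
      by (subst Bochner_Integration.integral_sum) (auto intro!: int C_inf_imp_continuous C_inf_pderiv coef_C_inf axis_Basis)
    finally have "\<bar>\<integral>x. Xop gm j \<psi> x \<partial>lborel\<bar> = \<bar>\<integral>x. D x * \<psi> x \<partial>lborel\<bar>" by simp
    also have "\<dots> \<le> (\<integral>x. \<bar>B\<bar> * \<bar>\<psi> x\<bar> \<partial>lborel)"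
    proof (rule integral_abs_bound_integral)
      show "integrable lborel (\<lambda>x. D x * \<psi> x)" by (rule int[OF Dc])
      show "integrable lborel (\<lambda>x. \<bar>B\<bar> * \<bar>\<psi> x\<bar>)" using int[of "\<lambda>x. 1"] by simp
      show "\<bar>D x * \<psi> x\<bar> \<le> \<bar>B\<bar> * \<bar>\<psi> x\<bar>" for x
      proof (cases "norm x \<le> R")
        case True
        then have "\<bar>D x\<bar> \<le> \<bar>B\<bar>" using B[of x] by simp
        then show ?thesis by (simp add: abs_mult mult_right_mono)
      qed (use R in simp)
    qed
    finally show "\<bar>\<integral>x. Xop gm j \<psi> x \<partial>lborel\<bar> \<le> \<bar>B\<bar> * (\<integral>x. \<bar>\<psi> x\<bar> \<partial>lborel)" by simp
  qed simp
qed

end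

section \<open>Simultaneous mollification of finitely many functions\<close>

lemma integrable_conv_mol:
  fixes w :: "real^'n \<Rightarrow> real"
  assumes "\<epsilon> > 0" "integrable lborel w"
  shows "integrable lborel (conv (mol \<epsilon>) w)"
proof -
  have "(\<integral>\<^sup>+x. ennreal \<bar>conv (mol \<epsilon>) w x\<bar> \<partial>lborel) \<le> (\<integral>\<^sup>+x. ennreal \<bar>w x\<bar> \<partial>lborel)"
    using assms by (intro conv_mol_nn_integral_le) auto
  also have "\<dots> < \<infinity>" using assms by (simp add: integrable_iff_bounded)
  finally show ?thesis
    using assms by (intro integrableI_bounded) (auto intro!: borel_measurable_continuous_onI C_inf_imp_continuous conv_mol_C_inf)
qed

text \<open>Scales below finitely many thresholds give convergence in L1 for all indices at once;
  almost everywhere convergence is then obtained by passing to a subsequence for one index after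
  another. A common sequence is needed because v and its derivatives occur in the same
  integral.\<close>

lemma mollify_seq:
  fixes F :: "'i::finite \<Rightarrow> real^'n \<Rightarrow> real"
  assumes F: "\<And>i. integrable lborel (F i)" and R: "\<And>i x. R \<le> norm x \<Longrightarrow> F i x = 0"
  obtains e where "\<And>m::nat. 0 < e m" "\<And>m. e m \<le> 1" "e \<longlonglongrightarrow> 0"
    "\<And>i. (\<lambda>m. \<integral>x. \<bar>conv (mol (e m)) (F i) x - F i x\<bar> \<partial>lborel) \<longlonglongrightarrow> 0"
    "\<And>i. AE x in lborel. (\<lambda>m. conv (mol (e m)) (F i) x) \<longlonglongrightarrow> F i x"
proof -
  define I where "I \<epsilon> i = (\<integral>x. \<bar>conv (mol \<epsilon>) (F i) x - F i x\<bar> \<partial>lborel)" for \<epsilon> i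
  have ex: "\<exists>\<delta>>0. \<forall>\<epsilon>. 0 < \<epsilon> \<longrightarrow> \<epsilon> < \<delta> \<longrightarrow> I \<epsilon> i \<le> c" if c: "c > 0" for i c
  proof -
    obtain \<delta> where \<delta>: "\<delta> > 0" "\<And>\<epsilon>. 0 < \<epsilon> \<Longrightarrow> \<epsilon> < \<delta> \<Longrightarrow> (\<integral>\<^sup>+x. ennreal \<bar>conv (mol \<epsilon>) (F i) x - F i x\<bar> \<partial>lborel) \<le> ennreal c"
      using conv_mol_L1[OF F R c] by blast
    have "I \<epsilon> i \<le> c" if \<epsilon>: "0 < \<epsilon>" "\<epsilon> < \<delta>" for \<epsilon>
    proof -
      have "integrable lborel (\<lambda>x. \<bar>conv (mol \<epsilon>) (F i) x - F i x\<bar>)"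
        by (intro integrable_abs Bochner_Integration.integrable_diff integrable_conv_mol F \<epsilon>)
      then have "ennreal (I \<epsilon> i) = (\<integral>\<^sup>+x. ennreal \<bar>conv (mol \<epsilon>) (F i) x - F i x\<bar> \<partial>lborel)"
        unfolding I_def by (intro nn_integral_eq_integral[symmetric]) auto
      then have "ennreal (I \<epsilon> i) \<le> ennreal c" using \<delta>(2)[OF \<epsilon>] by (simp only:)
      then show ?thesis using c by (simp add: ennreal_le_iff)
    qed
    with \<delta>(1) show ?thesis by blast
  qed
  define \<delta> where "\<delta> i c = (SOME \<delta>. \<delta> > 0 \<and> (\<forall>\<epsilon>. 0 < \<epsilon> \<longrightarrow> \<epsilon> < \<delta> \<longrightarrow> I \<epsilon> i \<le> c))" for i c
  have \<delta>: "\<delta> i c > 0" "0 < \<epsilon> \<Longrightarrow> \<epsilon> < \<delta> i c \<Longrightarrow> I \<epsilon> i \<le> c" if "c > 0" for i c \<epsilon>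
    using someI_ex[OF ex[OF that, of i]] unfolding \<delta>_def[symmetric] by blast+
  define q where "q m = (1 / real (Suc m))" for m
  have q: "q m > 0" "q m \<le> 1" for m by (auto simp: q_def)
  \<comment> \<open>Half of the least threshold for the tolerance 1/(m+1), taken over all indices
    and the tolerance itself, so that the scales also tend to 0.\<close>
  define e0 where "e0 m = Min (insert (q m) (range (\<lambda>i. \<delta> i (q m)))) / 2" for m
  have e0: "0 < e0 m" "e0 m < q m" "\<And>i. e0 m < \<delta> i (q m)" for m
  proof -
    let ?S = "insert (q m) (range (\<lambda>i. \<delta> i (q m)))"
    define M where "M = Min ?S"
    have eq: "e0 m = M / 2" by (simp only: e0_def M_def)
    have pos: "0 < M" unfolding M_def using q \<delta> by (subst Min_gr_iff) auto
    have le: "e0 m < s" if "s \<in> ?S" for s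
    proof -
      have "M \<le> s" unfolding M_def using that by (intro Min_le) auto
      then show ?thesis using pos eq by linarith
    qed
    show "0 < e0 m" using pos eq by simp
    show "e0 m < q m" "\<And>i. e0 m < \<delta> i (q m)" by (intro le; simp)+
  qed
  have q0: "q \<longlonglongrightarrow> 0" unfolding q_def using LIMSEQ_inverse_real_of_nat by (simp add: inverse_eq_divide)
  have I0: "(\<lambda>m. I (e0 m) i) \<longlonglongrightarrow> 0" for i
  proof (rule Lim_null_comparison[OF _ q0], rule always_eventually, rule allI)
    fix m
    have "0 \<le> I (e0 m) i" unfolding I_def by (intro integral_nonneg_AE) auto
    then show "norm (I (e0 m) i) \<le> q m" using \<delta>(2)[OF q(1) e0(1,3)] by simp
  qed
  have e0t: "e0 \<longlonglongrightarrow> 0"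
    by (rule Lim_null_comparison[OF _ q0]) (use e0 in \<open>auto intro!: always_eventually simp: less_imp_le abs_of_pos\<close>)
  \<comment> \<open>Induction on the index set: a further subsequence preserves the convergence
    already achieved for the earlier indices.\<close>
  have S: "\<exists>r::nat\<Rightarrow>nat. strict_mono r \<and> (\<forall>i\<in>J. AE x in lborel. (\<lambda>m. conv (mol (e0 (r m))) (F i) x) \<longlonglongrightarrow> F i x)" if "finite J" for J :: "'i set"
    using that
  proof (induction J)
    case empty
    then show ?case by (auto intro!: exI[of _ id] simp: strict_mono_def)
  next
    case (insert i J)
    then obtain r where r: "strict_mono (r::nat\<Rightarrow>nat)" "\<And>i. i \<in> J \<Longrightarrow> AE x in lborel. (\<lambda>m. conv (mol (e0 (r m))) (F i) x) \<longlonglongrightarrow> F i x" by auto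
    have "\<exists>s::nat\<Rightarrow>nat. strict_mono s \<and> (AE x in lborel. (\<lambda>n. conv (mol (e0 (r (s n)))) (F i) x - F i x) \<longlonglongrightarrow> 0)"
    proof (rule tendsto_L1_AE_subseq)
      show "integrable lborel (\<lambda>x. conv (mol (e0 (r n))) (F i) x - F i x)" for n
        by (intro Bochner_Integration.integrable_diff integrable_conv_mol F e0)
      show "(\<lambda>n. \<integral>x. norm (conv (mol (e0 (r n))) (F i) x - F i x) \<partial>lborel) \<longlonglongrightarrow> 0"
        using LIMSEQ_subseq_LIMSEQ[OF I0[of i] r(1)] by (simp add: I_def o_def)
    qed
    then obtain s where s: "strict_mono (s::nat\<Rightarrow>nat)" "AE x in lborel. (\<lambda>n. conv (mol (e0 (r (s n)))) (F i) x - F i x) \<longlonglongrightarrow> 0" by blast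
    show ?case
    proof (intro exI[of _ "r \<circ> s"] conjI ballI)
      show "strict_mono (r \<circ> s)" by (rule strict_mono_o[OF r(1) s(1)])
      fix i' assume "i' \<in> insert i J"
      then consider "i' = i" | "i' \<in> J" by auto
      then show "AE x in lborel. (\<lambda>m. conv (mol (e0 ((r \<circ> s) m))) (F i') x) \<longlonglongrightarrow> F i' x"
      proof cases
        case 1
        then show ?thesis using s(2) by (simp add: LIM_zero_iff)
      next
        case 2
        from r(2)[OF this] show ?thesis
        proof eventually_elim
          case (elim x)
          from LIMSEQ_subseq_LIMSEQ[OF elim s(1)] show ?case by (simp add: o_def)
        qed
      qed
    qed
  qed
  obtain r where r: "strict_mono (r::nat\<Rightarrow>nat)" "\<And>i. AE x in lborel. (\<lambda>m. conv (mol (e0 (r m))) (F i) x) \<longlonglongrightarrow> F i x"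
    using S[OF finite_class.finite_UNIV] by auto
  show ?thesis
  proof (rule that[of "\<lambda>m. e0 (r m)"])
    show "0 < e0 (r m)" "e0 (r m) \<le> 1" for m using e0[of "r m"] q[of "r m"] by auto
    show "(\<lambda>m. e0 (r m)) \<longlonglongrightarrow> 0" using LIMSEQ_subseq_LIMSEQ[OF e0t r(1)] by (simp add: o_def)
    show "(\<lambda>m. \<integral>x. \<bar>conv (mol (e0 (r m))) (F i) x - F i x\<bar> \<partial>lborel) \<longlonglongrightarrow> 0" for i
      using LIMSEQ_subseq_LIMSEQ[OF I0[of i] r(1)] by (simp add: o_def I_def)
    show "AE x in lborel. (\<lambda>m. conv (mol (e0 (r m))) (F i) x) \<longlonglongrightarrow> F i x" for i by (rule r(2))
  qed
qed

section \<open>Truncations and their boundary functional\<close>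

context meyers_serrin
begin

text \<open>The sine is a truncation that keeps smooth functions smooth: k sin(s/k) is bounded by
  both k and |s|, and its derivative cos(s/k) is at most 1 in modulus, so truncation never increases
  the density of the derivative.\<close>

definition tv :: "real \<Rightarrow> real^'n \<Rightarrow> real" where
  "tv k x = k * sin (v x / k)"

definition th :: "real \<Rightarrow> 'n \<Rightarrow> real^'n \<Rightarrow> real" where
  "th k j x = cos (v x / k) * h j x"

lemma tv_measurable [measurable]: "tv k \<in> borel_measurable borel"
  and th_measurable [measurable]: "th k j \<in> borel_measurable borel"
  unfolding tv_def[abs_def] th_def[abs_def] by measurable

lemma tv_outside: "x \<notin> \<Omega> \<Longrightarrow> tv k x = 0" and th_outside: "x \<notin> \<Omega> \<Longrightarrow> th k j x = 0"
  by (simp_all add: tv_def th_def v_outside h_outside)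

lemma tv_abs_le:
  assumes "k > 0" shows "\<bar>tv k x\<bar> \<le> \<bar>v x\<bar>" "\<bar>tv k x\<bar> \<le> k"
proof -
  have "\<bar>sin (v x / k)\<bar> \<le> \<bar>v x / k\<bar>" by (rule abs_sin_x_le_abs_x)
  then show "\<bar>tv k x\<bar> \<le> \<bar>v x\<bar>" using assms by (simp add: tv_def abs_mult field_simps)
  show "\<bar>tv k x\<bar> \<le> k" using assms abs_sin_le_one[of "v x / k"] by (simp add: tv_def abs_mult mult_left_le)
qed

lemma th_abs_le: "\<bar>th k j x\<bar> \<le> \<bar>h j x\<bar>"
  using abs_cos_le_one[of "v x / k"] by (simp add: th_def abs_mult mult_left_le_one_le)

lemma tv_integrable: "k > 0 \<Longrightarrow> integrable lborel (tv k)"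
  by (rule Bochner_Integration.integrable_bound[OF v_integrable]) (auto simp: tv_abs_le)

lemma th_integrable: "j \<in> Hor deg \<Longrightarrow> integrable lborel (th k j)"
  by (rule Bochner_Integration.integrable_bound[OF h_integrable[of j]]) (auto simp: th_abs_le)

lemma tv_continuous: "k > 0 \<Longrightarrow> continuous_on \<Omega> (tv k)"
  unfolding tv_def[abs_def] by (intro continuous_intros v_continuous) auto

lemma C_inf_trunc: "C_inf f \<Longrightarrow> C_inf (\<lambda>x. k * sin (f x / k))"
  using C_inf_mult[OF C_inf_const C_inf_sin_cos(1)[OF C_inf_mult[OF _ C_inf_const]], of f k "1 / k"] by simp

lemma Xop_trunc:
  assumes "C_inf f" "k > 0" shows "Xop gm j (\<lambda>x. k * sin (f x / k)) p = cos (f p / k) * Xop gm j f p"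
proof (rule Xop_compose[OF assms(1), of "\<lambda>s. k * sin (s / k)"])
  show "((\<lambda>s. k * sin (s / k)) has_real_derivative cos (f p / k)) (at (f p))"
    using assms(2) by (auto intro!: derivative_eq_intros)
qed

text \<open>On the compact support of \<open>\<phi>\<close> the function \<open>v\<close> agrees
  with the test function \<open>W n\<close> for large \<open>n\<close>, so that the truncation is
  classical there and integration by parts applies.\<close>

lemma tv_distr:
  assumes j: "j \<in> Hor deg" and \<phi>: "test_on \<Omega> \<phi>" and k: "k > 0"
  shows "(\<integral>x. tv k x * Xop gm j \<phi> x \<partial>lborel) = - (\<integral>x. th k j x * \<phi> x \<partial>lborel)"
proof -
  obtain K where K: "compact K" "K \<subseteq> \<Omega>" "\<And>x. x \<notin> K \<Longrightarrow> \<phi> x = 0" using test_onE[OF \<phi>] by metis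
  obtain n where n: "K \<subseteq> C n" using C_absorb[OF K(1,2)] by auto
  let ?F = "\<lambda>x. k * sin (W n x / k)"
  have W: "C_inf (W n)" by (rule test_on_C_inf[OF W_test])
  have X0: "Xop gm j \<phi> x = 0" if "x \<notin> K" for x
    by (rule Xop_eq_0[of "- K"]) (use that K \<phi> in \<open>auto intro: compact_imp_closed test_on_C_inf\<close>)
  have "(\<integral>x. \<phi> x * Xop gm j ?F x \<partial>lborel) = - (\<integral>x. Xop gm j \<phi> x * ?F x \<partial>lborel)"
    by (rule integral_Xop_by_parts[OF j \<phi> C_inf_trunc[OF W]])
  moreover have "\<phi> x * Xop gm j ?F x = th k j x * \<phi> x" for x
  proof (cases "x \<in> K")
    case True
    then have "x \<in> C n" using n by auto
    then show ?thesis unfolding Xop_trunc[OF W k] th_def by (simp add: v_eq_W h_eq_XW)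
  qed (use K in simp)
  moreover have "Xop gm j \<phi> x * ?F x = tv k x * Xop gm j \<phi> x" for x
  proof (cases "x \<in> K")
    case True
    then have "x \<in> C n" using n by auto
    then show ?thesis unfolding tv_def by (simp add: v_eq_W)
  qed (use X0 in simp)
  ultimately show ?thesis by simp
qed

text \<open>The trace identity of \<open>v\<close> is tested with the reflected mollifier at
  \<open>x\<close>. This function need not have its support in \<open>\<Omega>\<close>, so the
  boundary integral remains: it is the mollified jump of the extension of \<open>v\<close> by
  zero.\<close>

lemma Xop_conv_v:
  assumes j: "j \<in> Hor deg" and e: "e > 0"
  shows "Xop gm j (conv (mol e) v) x = (\<integral>y. comm_kernel j e x y * v y \<partial>lborel) + conv (mol e) (h j) x
    + (\<integral>y. Tu y * (mol e (x - y) * \<nu> y $ j) \<partial>Pper)"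
  using Xop_conv(1)[OF e v_integrable, of j x] v_trace[OF j test_on_mol_refl[OF e, of x]]
  by (simp add: conv_def mult.commute)

text \<open>The mollification of the boundary measure with density \<open>Tu y * \<nu> y $ j\<close>
  with respect to \<open>Pper\<close>, that is, of the singular part of X_j applied to
  \<open>v\<close> extended by zero.\<close>

definition bpot :: "real \<Rightarrow> 'n \<Rightarrow> real^'n \<Rightarrow> real" where
  "bpot e j x = (\<integral>y. Tu y * (mol e (x - y) * \<nu> y $ j) \<partial>Pper)"

lemma Pper_pair_sets: "sets (lborel \<Otimes>\<^sub>M Pper) = sets (borel \<Otimes>\<^sub>M borel)"
  by (rule sets_pair_measure_cong) (auto simp: Pper_sets)

lemma Tu_measurable: "Tu \<in> borel_measurable borel"
  using borel_measurable_integrable[OF Tu_int] by (simp add: measurable_cong_sets[OF Pper_sets refl])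

lemma nn_mol_shift: "e > 0 \<Longrightarrow> (\<integral>\<^sup>+x. ennreal \<bar>mol e (x - y)\<bar> \<partial>lborel) = 1" for y :: "real^'n"
  using nn_integral_lborel_diff(1)[of "\<lambda>x. ennreal \<bar>mol e x\<bar>" y] mol_nn_integral[of e, where 'a="real^'n"] by simp

lemma bpot_measurable: "bpot e j \<in> borel_measurable borel"
proof -
  note [measurable] = Tu_measurable and [measurable_cong] = Pper_sets Pper_pair_sets
  interpret finite_measure Pper by (rule Pper_finite)
  show ?thesis unfolding bpot_def[abs_def] by measurable
qed

lemma bpot_integrable:
  assumes e: "e > 0" shows "integrable lborel (bpot e j)"
proof (rule integrableI_bounded)
  show "bpot e j \<in> borel_measurable lborel" using bpot_measurable by simp
  note [measurable] = Tu_measurable and [measurable_cong] = Pper_sets Pper_pair_sets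
  interpret finite_measure Pper by (rule Pper_finite)
  have sf: "sigma_finite_measure Pper" by unfold_locales
  have i: "integrable Pper (\<lambda>y. Tu y * \<nu> y $ j)"
    by (rule integrable_mult_AE_bounded[OF Tu_int _ \<nu>_bound]) measurable
  have "(\<integral>\<^sup>+x. ennreal \<bar>\<integral>y. mol e (x - y) * (Tu y * \<nu> y $ j) \<partial>Pper\<bar> \<partial>lborel) \<le> 1 * (\<integral>\<^sup>+y. ennreal \<bar>Tu y * \<nu> y $ j\<bar> \<partial>Pper)"
  proof (rule nn_integral_kernel_le(2)[OF sigma_finite_lborel sf])
    show "(\<integral>\<^sup>+x. ennreal \<bar>mol e (x - y)\<bar> \<partial>lborel) \<le> 1" for y :: "real^'n"
      by (simp add: nn_mol_shift[OF e])
  qed measurable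
  also have "\<dots> < \<infinity>" using i by (simp add: integrable_iff_bounded)
  finally show "(\<integral>\<^sup>+x. ennreal (norm (bpot e j x)) \<partial>lborel) < \<infinity>"
    by (simp add: bpot_def mult.left_commute)
qed

text \<open>The sum over \<open>j\<close> stays inside the modulus, so that the normal component of
  \<open>\<psi>\<close> appears and not the moduli of its components separately. Replacing
  \<open>\<psi> j x\<close> by \<open>\<psi> j y\<close> costs at most \<open>d\<close> per
  component on the support of the mollifier. The factor \<open>q\<close> stands for the cosine of
  the chain rule.\<close>

lemma bpot_sum_bound:
  assumes e: "e > 0" and \<psi>: "\<And>j. j \<in> Hor deg \<Longrightarrow> test_on UNIV (\<psi> j)"
    and q: "q \<in> borel_measurable borel" "\<And>x. \<bar>q x\<bar> \<le> 1"
    and d: "\<And>j x y. j \<in> Hor deg \<Longrightarrow> norm (x - y) < e \<Longrightarrow> \<bar>\<psi> j x - \<psi> j y\<bar> \<le> d"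
  shows "\<bar>\<Sum>j\<in>Hor deg. \<integral>x. (\<psi> j x * q x) * bpot e j x \<partial>lborel\<bar>
    \<le> (\<integral>y. \<bar>Tu y\<bar> * (\<bar>\<Sum>j\<in>Hor deg. \<psi> j y * \<nu> y $ j\<bar> + real (card (Hor deg)) * d) \<partial>Pper)"
proof -
  note [measurable] = Tu_measurable q(1) and [measurable_cong] = Pper_sets Pper_pair_sets
  interpret finite_measure Pper by (rule Pper_finite)
  have sf: "sigma_finite_measure Pper" by unfold_locales
  let ?n = "real (card (Hor deg))"
  have \<psi>m: "\<psi> j \<in> borel_measurable borel" if "j \<in> Hor deg" for j using test_on_measurable[OF \<psi>[OF that]] .
  define S where "S y = (\<Sum>j\<in>Hor deg. \<psi> j y * \<nu> y $ j)" for y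
  have [measurable]: "S \<in> borel_measurable borel"
    unfolding S_def[abs_def] by (intro borel_measurable_sum borel_measurable_times \<psi>m) measurable
  define W where "W y = \<bar>Tu y\<bar> * (\<bar>S y\<bar> + ?n * d)" for y
  have [measurable]: "W \<in> borel_measurable borel" unfolding W_def[abs_def] by measurable
  have int_q: "integrable lborel (\<lambda>x. (\<psi> j x * q x) * bpot e j x)" if j: "j \<in> Hor deg" for j
  proof -
    obtain B where B: "B \<ge> 0" "\<And>x. \<bar>\<psi> j x\<bar> \<le> B" using test_on_bounded[OF \<psi>[OF j]] by metis
    have "\<bar>\<psi> j x * q x\<bar> \<le> B * 1" for x unfolding abs_mult using B q by (intro mult_mono) auto
    then have "integrable lborel (\<lambda>x. bpot e j x * (\<psi> j x * q x))"
      using \<psi>m[OF j] by (intro integrable_mult_AE_bounded[OF bpot_integrable[OF e], of _ B]) auto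
    then show ?thesis by (simp add: mult.commute)
  qed
  have d0: "0 \<le> ?n * d"
  proof (cases "Hor deg = {}")
    case False
    then obtain j where "j \<in> Hor deg" by auto
    then have "0 \<le> d" using d[of j 0 0] e by simp
    then show ?thesis by simp
  qed simp
  have \<psi>b: "\<exists>B. \<forall>y. \<bar>\<psi> j y\<bar> \<le> B" if "j \<in> Hor deg" for j using test_on_bounded[OF \<psi>[OF that]] by metis
  have Wint: "integrable Pper W"
  proof -
    have "AE y in Pper. \<bar>S y\<bar> \<le> (\<Sum>j\<in>Hor deg. SUP y. \<bar>\<psi> j y\<bar>)"
      using \<nu>_norm
    proof eventually_elim
      case (elim y)
      have "\<bar>\<nu> y $ j\<bar> \<le> 1" for j using component_le_norm_cart[of "\<nu> y" j] elim by simp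
      then have "\<bar>\<psi> j y * \<nu> y $ j\<bar> \<le> (SUP y. \<bar>\<psi> j y\<bar>)" if "j \<in> Hor deg" for j
      proof -
        have "\<bar>\<psi> j y\<bar> \<le> (SUP y. \<bar>\<psi> j y\<bar>)" using \<psi>b[OF that] by (intro cSUP_upper) (auto simp: bdd_above_def)
        moreover have "\<bar>\<psi> j y\<bar> * \<bar>\<nu> y $ j\<bar> \<le> \<bar>\<psi> j y\<bar>" using \<open>\<And>j. \<bar>\<nu> y $ j\<bar> \<le> 1\<close> by (intro mult_left_le) auto
        ultimately show ?thesis by (simp add: abs_mult)
      qed
      then show ?case unfolding S_def by (intro order_trans[OF sum_abs] sum_mono)
    qed
    then have "AE y in Pper. \<bar>\<bar>S y\<bar> + ?n * d\<bar> \<le> (\<Sum>j\<in>Hor deg. SUP y. \<bar>\<psi> j y\<bar>) + ?n * d"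
      by eventually_elim (use d0 in simp)
    then show ?thesis unfolding W_def
      by (intro integrable_mult_AE_bounded[OF integrable_abs[OF Tu_int]]) measurable
  qed
  have "\<bar>\<Sum>j\<in>Hor deg. \<integral>x. (\<psi> j x * q x) * bpot e j x \<partial>lborel\<bar> = \<bar>\<integral>x. (\<Sum>j\<in>Hor deg. (\<psi> j x * q x) * bpot e j x) \<partial>lborel\<bar>"
    by (subst Bochner_Integration.integral_sum[OF int_q]) auto
  also have "ennreal \<dots> \<le> (\<integral>\<^sup>+x. ennreal \<bar>\<Sum>j\<in>Hor deg. (\<psi> j x * q x) * bpot e j x\<bar> \<partial>lborel)"
    using integral_norm_bound_ennreal[OF Bochner_Integration.integrable_sum[OF int_q]] by simp
  also have "\<dots> \<le> (\<integral>\<^sup>+x. (\<integral>\<^sup>+y. ennreal \<bar>mol e (x - y) * W y\<bar> \<partial>Pper) \<partial>lborel)"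
  proof (rule nn_integral_mono)
    fix x :: "real^'n"
    let ?f = "\<lambda>y. (\<Sum>j\<in>Hor deg. \<psi> j x * (Tu y * (mol e (x - y) * \<nu> y $ j)))"
    have i: "integrable Pper (\<lambda>y. Tu y * (mol e (x - y) * \<nu> y $ j))" for j
      by (rule Pper_integrable[OF Tu_int test_on_mol_refl[OF e]])
    then have fi: "integrable Pper ?f" by auto
    have "(\<Sum>j\<in>Hor deg. (\<psi> j x * q x) * bpot e j x) = q x * (\<Sum>j\<in>Hor deg. \<psi> j x * bpot e j x)"
      by (simp add: sum_distrib_left mult.assoc mult.left_commute)
    also have "(\<Sum>j\<in>Hor deg. \<psi> j x * bpot e j x) = (\<integral>y. ?f y \<partial>Pper)"
      unfolding bpot_def by (subst Bochner_Integration.integral_sum) (use i in auto)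
    finally have "\<bar>\<Sum>j\<in>Hor deg. (\<psi> j x * q x) * bpot e j x\<bar> \<le> \<bar>\<integral>y. ?f y \<partial>Pper\<bar>"
      using q(2)[of x] by (simp add: abs_mult mult_left_le_one_le)
    then have "ennreal \<bar>\<Sum>j\<in>Hor deg. (\<psi> j x * q x) * bpot e j x\<bar> \<le> (\<integral>\<^sup>+y. ennreal \<bar>?f y\<bar> \<partial>Pper)"
      using integral_norm_bound_ennreal[OF fi] by (simp add: order_trans[OF ennreal_leI])
    also have "\<dots> \<le> (\<integral>\<^sup>+y. ennreal \<bar>mol e (x - y) * W y\<bar> \<partial>Pper)"
    proof (rule nn_integral_mono_AE, use \<nu>_norm in eventually_elim)
      case (elim y)
      have \<nu>1: "\<bar>\<nu> y $ j\<bar> \<le> 1" for j using component_le_norm_cart[of "\<nu> y" j] elim by simp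
      have f: "?f y = mol e (x - y) * (Tu y * (\<Sum>j\<in>Hor deg. \<psi> j x * \<nu> y $ j))"
        by (simp add: sum_distrib_left algebra_simps)
      show "ennreal \<bar>?f y\<bar> \<le> ennreal \<bar>mol e (x - y) * W y\<bar>"
      proof (cases "norm (x - y) < e")
        case True
        \<comment> \<open>Passage from the field at \<open>x\<close> to the field at the boundary
          point \<open>y\<close>, where the normal is evaluated.\<close>
        have "\<bar>\<Sum>j\<in>Hor deg. \<psi> j x * \<nu> y $ j\<bar> = \<bar>S y + (\<Sum>j\<in>Hor deg. (\<psi> j x - \<psi> j y) * \<nu> y $ j)\<bar>"
          by (simp add: S_def sum.distrib[symmetric] algebra_simps)
        also have "\<dots> \<le> \<bar>S y\<bar> + (\<Sum>j\<in>Hor deg. \<bar>(\<psi> j x - \<psi> j y) * \<nu> y $ j\<bar>)"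
          by (intro order_trans[OF abs_triangle_ineq] add_left_mono sum_abs)
        also have "(\<Sum>j\<in>Hor deg. \<bar>(\<psi> j x - \<psi> j y) * \<nu> y $ j\<bar>) \<le> (\<Sum>j\<in>Hor deg. d)"
        proof (rule sum_mono)
          fix j assume j: "j \<in> Hor deg"
          have "\<bar>\<psi> j x - \<psi> j y\<bar> * \<bar>\<nu> y $ j\<bar> \<le> \<bar>\<psi> j x - \<psi> j y\<bar>" using \<nu>1 by (intro mult_left_le) auto
          then show "\<bar>(\<psi> j x - \<psi> j y) * \<nu> y $ j\<bar> \<le> d" using d[OF j True] by (simp add: abs_mult)
        qed
        finally have "\<bar>\<Sum>j\<in>Hor deg. \<psi> j x * \<nu> y $ j\<bar> \<le> \<bar>S y\<bar> + ?n * d" by simp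
        then have "\<bar>mol e (x - y)\<bar> * (\<bar>Tu y\<bar> * \<bar>\<Sum>j\<in>Hor deg. \<psi> j x * \<nu> y $ j\<bar>) \<le> \<bar>mol e (x - y)\<bar> * (\<bar>Tu y\<bar> * (\<bar>S y\<bar> + ?n * d))"
          by (intro mult_left_mono) auto
        then show ?thesis unfolding f W_def using d0 by (intro ennreal_leI) (simp add: abs_mult)
      next
        case False
        then have "mol e (x - y) = 0" using e by (intro mol_eq_0) auto
        then show ?thesis unfolding f by simp
      qed
    qed
    finally show "ennreal \<bar>\<Sum>j\<in>Hor deg. (\<psi> j x * q x) * bpot e j x\<bar> \<le> (\<integral>\<^sup>+y. ennreal \<bar>mol e (x - y) * W y\<bar> \<partial>Pper)" .
  qed
  also have "\<dots> \<le> 1 * (\<integral>\<^sup>+y. ennreal \<bar>W y\<bar> \<partial>Pper)"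
  proof (rule nn_integral_kernel_le(1)[OF sigma_finite_lborel sf])
    show "(\<integral>\<^sup>+x. ennreal \<bar>mol e (x - y)\<bar> \<partial>lborel) \<le> 1" for y :: "real^'n"
      by (simp add: nn_mol_shift[OF e])
  qed measurable
  also have "\<dots> = ennreal (\<integral>y. W y \<partial>Pper)"
  proof -
    have "\<bar>W y\<bar> = W y" for y unfolding W_def using d0 by simp
    then show ?thesis using d0 by (simp, intro nn_integral_eq_integral[OF Wint]) (auto simp: W_def)
  qed
  finally have "ennreal \<bar>\<Sum>j\<in>Hor deg. \<integral>x. (\<psi> j x * q x) * bpot e j x \<partial>lborel\<bar> \<le> ennreal (\<integral>y. W y \<partial>Pper)" .
  moreover have "0 \<le> (\<integral>y. W y \<partial>Pper)" using d0 by (intro integral_nonneg_AE) (auto simp: W_def)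
  ultimately show ?thesis unfolding W_def S_def by (simp add: ennreal_le_iff)
qed

text \<open>The part of \<open>v\<close> near the boundary. Its L1 norm is the only error that the
  bound for the boundary functional leaves after mollification, and it tends to 0 with
  \<open>n\<close>.\<close>

definition vtail :: "nat \<Rightarrow> real^'n \<Rightarrow> real" where
  "vtail n y = v y * indicator (- C n) y"

lemma vtail_integrable: "integrable lborel (vtail n)"
proof -
  have "- C n \<in> sets borel" using C_compact by (intro borel_open open_Compl compact_imp_closed)
  then have "(indicator (- C n) :: real^'n \<Rightarrow> real) \<in> borel_measurable lborel" by (auto intro: borel_measurable_indicator)
  then show ?thesis unfolding vtail_def[abs_def]
    by (rule integrable_mult_AE_bounded[OF v_integrable, of _ 1]) (auto simp: indicator_def)
qed

text \<open>Where \<open>\<psi>\<close> is not 0, the condition \<open>sep\<close> keeps the kernels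
  from seeing \<open>C n\<close>, so \<open>v\<close> may be replaced by \<open>vtail n\<close> both
  in the commutator and in the truncated mollification. The first replacement contributes the
  constant \<open>D\<close>; the second contributes \<open>B\<close>, through the integral of the
  complete derivative of the product.\<close>

lemma Xop_step:
  assumes j: "j \<in> Hor deg" and e: "e > 0" "e \<le> 1" and k: "k > 0"
    and \<psi>: "test_on UNIV \<psi>" "\<And>x. \<bar>\<psi> x\<bar> \<le> G" "\<And>x. x \<in> U n \<Longrightarrow> \<psi> x = 0"
    and sep: "\<And>x y. x \<notin> U n \<Longrightarrow> y \<in> C n \<Longrightarrow> e < norm (x - y)"
    and D: "D \<ge> 0" "\<And>y. y \<in> \<Omega> \<Longrightarrow> (\<integral>\<^sup>+x. ennreal \<bar>comm_kernel j e x y\<bar> \<partial>lborel) \<le> ennreal D"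
    and B: "B \<ge> 0" "\<And>\<phi>. C_inf \<phi> \<Longrightarrow> (\<And>x. \<psi> x = 0 \<Longrightarrow> \<phi> x = 0) \<Longrightarrow> \<bar>\<integral>x. Xop gm j \<phi> x \<partial>lborel\<bar> \<le> B * (\<integral>x. \<bar>\<phi> x\<bar> \<partial>lborel)"
  defines "q \<equiv> \<lambda>x. cos (conv (mol e) v x / k)"
  shows "\<bar>- (\<integral>x. (k * sin (conv (mol e) v x / k)) * Xop gm j \<psi> x \<partial>lborel) - (\<integral>x. (\<psi> x * q x) * conv (mol e) (h j) x \<partial>lborel)
     - (\<integral>x. (\<psi> x * q x) * bpot e j x \<partial>lborel)\<bar> \<le> G * (D + B) * (\<integral>x. \<bar>vtail n x\<bar> \<partial>lborel)"
proof -
  let ?v = "conv (mol e) v" and ?V = "\<integral>x. \<bar>vtail n x\<bar> \<partial>lborel"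
  let ?F = "\<lambda>x. k * sin (?v x / k)"
  have vC: "C_inf ?v" by (rule conv_mol_C_inf[OF e(1) v_integrable])
  have FC: "C_inf ?F" by (rule C_inf_trunc[OF vC])
  have [measurable]: "?v \<in> borel_measurable borel" "\<psi> \<in> borel_measurable borel"
    using C_inf_imp_continuous[OF vC] test_on_measurable[OF \<psi>(1)] by (auto intro: borel_measurable_continuous_onI)
  have qm[measurable]: "q \<in> borel_measurable borel" unfolding q_def by measurable
  have G: "G \<ge> 0" using \<psi>(2)[of 0] by linarith
  have pq: "\<bar>\<psi> x * q x\<bar> \<le> G" for x
    using mult_mono[OF \<psi>(2)[of x] abs_cos_le_one[of "?v x / k"]] G by (simp add: q_def abs_mult)
  define c where "c x = (\<integral>y. comm_kernel j e x y * v y \<partial>lborel)" for x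
  define c' where "c' x = (\<integral>y. comm_kernel j e x y * vtail n y \<partial>lborel)" for x
  have [measurable]: "vtail n \<in> borel_measurable borel" using vtail_integrable by auto
  have [measurable]: "c \<in> borel_measurable borel" "c' \<in> borel_measurable borel"
    unfolding c_def[abs_def] c'_def[abs_def] by measurable
  have nn: "(\<integral>\<^sup>+x. ennreal \<bar>\<integral>y. comm_kernel j e x y * w y \<partial>lborel\<bar> \<partial>lborel) \<le> ennreal D * (\<integral>\<^sup>+y. ennreal \<bar>w y\<bar> \<partial>lborel)"
    if [measurable]: "w \<in> borel_measurable borel" and w0: "\<And>y. y \<notin> \<Omega> \<Longrightarrow> w y = 0" for w
    by (rule nn_integral_kernel_le(2)[OF sigma_finite_lborel sigma_finite_lborel]) (use D(2) w0 in \<open>measurable, auto\<close>)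
  have kint: "integrable lborel (\<lambda>x. \<integral>y. comm_kernel j e x y * w y \<partial>lborel)"
    if w: "integrable lborel w" "\<And>y. y \<notin> \<Omega> \<Longrightarrow> w y = 0" for w
  proof (rule integrableI_bounded)
    have [measurable]: "w \<in> borel_measurable borel" using w by auto
    show "(\<lambda>x. \<integral>y. comm_kernel j e x y * w y \<partial>lborel) \<in> borel_measurable lborel" by measurable
    have "(\<integral>\<^sup>+x. ennreal \<bar>\<integral>y. comm_kernel j e x y * w y \<partial>lborel\<bar> \<partial>lborel) \<le> ennreal D * (\<integral>\<^sup>+y. ennreal \<bar>w y\<bar> \<partial>lborel)"
      using w by (intro nn) auto
    also have "\<dots> < \<infinity>" using w(1) by (simp add: integrable_iff_bounded ennreal_mult_less_top)
    finally show "(\<integral>\<^sup>+x. ennreal (norm (\<integral>y. comm_kernel j e x y * w y \<partial>lborel)) \<partial>lborel) < \<infinity>" by simp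
  qed
  have vt0: "vtail n y = 0" if "y \<notin> \<Omega>" for y using v_outside[OF that] by (simp add: vtail_def)
  have ci: "integrable lborel c" "integrable lborel c'"
    unfolding c_def[abs_def] c'_def[abs_def] by (intro kint v_integrable v_outside vtail_integrable vt0; assumption)+
  have c'V: "(\<integral>x. \<bar>c' x\<bar> \<partial>lborel) \<le> D * ?V"
  proof -
    have "ennreal (\<integral>x. \<bar>c' x\<bar> \<partial>lborel) = (\<integral>\<^sup>+x. ennreal \<bar>c' x\<bar> \<partial>lborel)"
      using ci by (intro nn_integral_eq_integral[symmetric]) auto
    also have "\<dots> \<le> ennreal D * (\<integral>\<^sup>+y. ennreal \<bar>vtail n y\<bar> \<partial>lborel)" unfolding c'_def using vt0 by (intro nn) auto
    also have "(\<integral>\<^sup>+y. ennreal \<bar>vtail n y\<bar> \<partial>lborel) = ennreal ?V"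
      using vtail_integrable by (intro nn_integral_eq_integral) auto
    finally show ?thesis using D by (simp add: ennreal_mult[symmetric] ennreal_le_iff)
  qed
  have pint: "integrable lborel (\<lambda>x. (\<psi> x * q x) * f x)" if "integrable lborel f" for f
    using integrable_mult_AE_bounded[OF that, of "\<lambda>x. \<psi> x * q x" G] pq by (simp add: mult.commute)
  note i_c = pint[OF ci(1)] and i_h = pint[OF integrable_conv_mol[OF e(1) h_integrable[OF j]]] and i_b = pint[OF bpot_integrable[OF e(1)]]
  \<comment> \<open>The mollification is smooth across the frontier, so the chain rule for the sine
    holds everywhere and multiplies commutator, density and boundary term by the same
    cosine.\<close>
  have XF: "\<psi> x * Xop gm j ?F x = (\<psi> x * q x) * c x + (\<psi> x * q x) * conv (mol e) (h j) x + (\<psi> x * q x) * bpot e j x" for x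
    unfolding Xop_trunc[OF vC k] Xop_conv_v[OF j e(1)] q_def c_def bpot_def by (simp add: algebra_simps)
  have t: "test_on UNIV (\<lambda>x. \<psi> x * ?F x)" by (rule test_on_mult[OF \<psi>(1) FC])
  have "(\<integral>x. Xop gm j (\<lambda>x. \<psi> x * ?F x) x \<partial>lborel) = (\<integral>x. \<psi> x * Xop gm j ?F x + ?F x * Xop gm j \<psi> x \<partial>lborel)"
    by (subst Xop_mult[OF test_on_C_inf[OF \<psi>(1)] FC]) simp
  also have "\<dots> = (\<integral>x. \<psi> x * Xop gm j ?F x \<partial>lborel) + (\<integral>x. ?F x * Xop gm j \<psi> x \<partial>lborel)"
  proof (rule Bochner_Integration.integral_add)
    show "integrable lborel (\<lambda>x. \<psi> x * Xop gm j ?F x)"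
      by (rule test_integrable[OF test_on_mult[OF \<psi>(1) Xop_C_inf[OF FC]]])
    show "integrable lborel (\<lambda>x. ?F x * Xop gm j \<psi> x)"
      using test_integrable[OF test_on_mult[OF test_on_Xop[OF \<psi>(1)] FC]] by (simp only: mult.commute)
  qed
  also have "(\<integral>x. \<psi> x * Xop gm j ?F x \<partial>lborel) = (\<integral>x. (\<psi> x * q x) * c x \<partial>lborel) + (\<integral>x. (\<psi> x * q x) * conv (mol e) (h j) x \<partial>lborel) + (\<integral>x. (\<psi> x * q x) * bpot e j x \<partial>lborel)"
    unfolding XF using i_c i_h i_b by (simp only: Bochner_Integration.integral_add Bochner_Integration.integrable_add)
  finally have eq: "- (\<integral>x. ?F x * Xop gm j \<psi> x \<partial>lborel) - (\<integral>x. (\<psi> x * q x) * conv (mol e) (h j) x \<partial>lborel) - (\<integral>x. (\<psi> x * q x) * bpot e j x \<partial>lborel)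
    = (\<integral>x. (\<psi> x * q x) * c x \<partial>lborel) - (\<integral>x. Xop gm j (\<lambda>x. \<psi> x * ?F x) x \<partial>lborel)" by simp
  \<comment> \<open>For x in \<open>U n\<close> the factor \<open>\<psi>\<close> vanishes; for all
    other x the kernel vanishes at every y in \<open>C n\<close>.\<close>
  have cc: "\<bar>(\<psi> x * q x) * c x\<bar> \<le> G * \<bar>c' x\<bar>" for x
  proof (cases "x \<in> U n")
    case False
    have "comm_kernel j e x y * v y = comm_kernel j e x y * vtail n y" for y
      using comm_kernel_eq_0[OF e(1) sep[OF False, of y]] by (cases "y \<in> C n") (auto simp: vtail_def)
    then have "c x = c' x" unfolding c_def c'_def by (simp only:)
    then show ?thesis using mult_right_mono[OF pq[of x], of "\<bar>c' x\<bar>"] by (simp add: abs_mult)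
  qed (use \<psi>(3) G in simp)
  have "\<bar>\<integral>x. (\<psi> x * q x) * c x \<partial>lborel\<bar> \<le> (\<integral>x. G * \<bar>c' x\<bar> \<partial>lborel)"
    using ci by (intro integral_abs_bound_integral i_c cc) auto
  also have "\<dots> \<le> G * (D * ?V)" using mult_left_mono[OF c'V G] by simp
  finally have b1: "\<bar>\<integral>x. (\<psi> x * q x) * c x \<partial>lborel\<bar> \<le> G * D * ?V" by simp
  have vti: "integrable lborel (conv (mol e) (vtail n))" by (rule integrable_conv_mol[OF e(1) vtail_integrable])
  have FF: "\<bar>\<psi> x * ?F x\<bar> \<le> G * \<bar>conv (mol e) (vtail n) x\<bar>" for x
  proof (cases "x \<in> U n")
    case False
    have "mol e (x - y) * v y = mol e (x - y) * vtail n y" for y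
    proof (cases "y \<in> C n")
      case True
      then have "mol e (x - y) = 0" using sep[OF False True] e by (intro mol_eq_0) auto
      then show ?thesis by simp
    qed (simp add: vtail_def)
    then have "?v x = conv (mol e) (vtail n) x" unfolding conv_def by (simp only:)
    moreover have "\<bar>?F x\<bar> \<le> \<bar>?v x\<bar>"
      using abs_sin_x_le_abs_x[of "?v x / k"] k by (simp add: abs_mult field_simps)
    ultimately show ?thesis using mult_mono[OF \<psi>(2)[of x], of "\<bar>?F x\<bar>" "\<bar>?v x\<bar>"] G by (simp add: abs_mult)
  qed (use \<psi>(3) G in simp)
  have "\<bar>\<integral>x. Xop gm j (\<lambda>x. \<psi> x * ?F x) x \<partial>lborel\<bar> \<le> B * (\<integral>x. \<bar>\<psi> x * ?F x\<bar> \<partial>lborel)"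
    by (rule B(2)[OF test_on_C_inf[OF t]]) simp
  also have "(\<integral>x. \<bar>\<psi> x * ?F x\<bar> \<partial>lborel) \<le> (\<integral>x. G * \<bar>conv (mol e) (vtail n) x\<bar> \<partial>lborel)"
    using vti test_integrable[OF t] FF by (intro integral_mono) auto
  also have "\<dots> = G * (\<integral>x. \<bar>conv (mol e) (vtail n) x\<bar> \<partial>lborel)" by simp
  also have "(\<integral>x. \<bar>conv (mol e) (vtail n) x\<bar> \<partial>lborel) \<le> ?V"
  proof -
    have "ennreal (\<integral>x. \<bar>conv (mol e) (vtail n) x\<bar> \<partial>lborel) = (\<integral>\<^sup>+x. ennreal \<bar>conv (mol e) (vtail n) x\<bar> \<partial>lborel)"
      using vti by (intro nn_integral_eq_integral[symmetric]) auto
    also have "\<dots> \<le> (\<integral>\<^sup>+x. ennreal \<bar>vtail n x\<bar> \<partial>lborel)" by (rule conv_mol_nn_integral_le[OF e(1)]) simp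
    also have "\<dots> = ennreal ?V" using vtail_integrable by (intro nn_integral_eq_integral) auto
    finally show ?thesis by (simp add: ennreal_le_iff)
  qed
  finally have b2: "\<bar>\<integral>x. Xop gm j (\<lambda>x. \<psi> x * ?F x) x \<partial>lborel\<bar> \<le> B * (G * ?V)"
    using B(1) G by (simp add: mult_left_mono)
  show ?thesis unfolding eq using b1 b2 by (simp add: algebra_simps abs_le_iff)
qed

definition test_fields :: "('n \<Rightarrow> real^'n \<Rightarrow> real) set" where
  "test_fields = {g. \<forall>j\<in>Hor deg. test_on UNIV (g j)}"

definition nflux :: "('n \<Rightarrow> real^'n \<Rightarrow> real) \<Rightarrow> real^'n \<Rightarrow> real" where
  "nflux g x = (\<Sum>j\<in>Hor deg. g j x * \<nu> x $ j)"

text \<open>What is left of the trace identity for \<open>tv k\<close> once the interior terms are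
  moved to one side. It becomes the integral of a trace against the normal component of
  \<open>g\<close> as soon as such a trace is known to exist.\<close>

definition tflux :: "real \<Rightarrow> ('n \<Rightarrow> real^'n \<Rightarrow> real) \<Rightarrow> real" where
  "tflux k g = (\<Sum>j\<in>Hor deg. - (\<integral>x. tv k x * Xop gm j (g j) x \<partial>lborel) - (\<integral>x. th k j x * g j x \<partial>lborel))"

text \<open>A field with compact support in \<open>\<Omega>\<close> has boundary functional 0 by
  \<open>tv_distr\<close>. The test field may therefore be made to vanish on \<open>U n\<close>,
  which is the hypothesis on \<open>\<psi>\<close> in \<open>Xop_step\<close>.\<close>

lemma tflux_cutoff:
  assumes g: "g \<in> test_fields" and k: "k > 0"
  shows "tflux k (\<lambda>j x. g j x - \<kappa> n x * g j x) = tflux k g"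
  unfolding tflux_def
proof (rule sum.cong[OF refl])
  fix j assume j: "j \<in> Hor deg"
  have gj: "test_on UNIV (g j)" using g j by (simp add: test_fields_def)
  have t: "test_on \<Omega> (\<lambda>x. \<kappa> n x * g j x)" by (intro test_on_mult \<kappa>_test_\<Omega> test_on_C_inf[OF gj])
  have i: "integrable lborel (\<lambda>x. tv k x * Xop gm j (g j) x)" "integrable lborel (\<lambda>x. tv k x * Xop gm j (\<lambda>x. \<kappa> n x * g j x) x)"
    by (rule test_mult_integrable[OF tv_integrable[OF k] test_on_Xop[OF gj]],
        rule test_mult_integrable[OF tv_integrable[OF k] test_on_Xop[OF t]])
  have i': "integrable lborel (\<lambda>x. th k j x * g j x)" "integrable lborel (\<lambda>x. th k j x * (\<kappa> n x * g j x))"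
    by (rule test_mult_integrable[OF th_integrable[OF j] gj], rule test_mult_integrable[OF th_integrable[OF j] t])
  show "- (\<integral>x. tv k x * Xop gm j (\<lambda>x. g j x - \<kappa> n x * g j x) x \<partial>lborel) - (\<integral>x. th k j x * (g j x - \<kappa> n x * g j x) \<partial>lborel)
    = - (\<integral>x. tv k x * Xop gm j (g j) x \<partial>lborel) - (\<integral>x. th k j x * g j x \<partial>lborel)"
    using tv_distr[OF j t k]
    unfolding Xop_diff[OF test_on_C_inf[OF gj] test_on_C_inf[OF t]] right_diff_distrib
      Bochner_Integration.integral_diff[OF i] Bochner_Integration.integral_diff[OF i'] by simp
qed

lemma vtail_tendsto: "(\<lambda>n. \<integral>x. \<bar>vtail n x\<bar> \<partial>lborel) \<longlonglongrightarrow> 0"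
proof -
  have "(\<lambda>n. \<integral>x. \<bar>vtail n x\<bar> \<partial>lborel) \<longlonglongrightarrow> (\<integral>x. 0 \<partial>(lborel :: (real^'n) measure))"
  proof (rule integral_dominated_convergence[where w="\<lambda>x. \<bar>v x\<bar>"])
    show "(\<lambda>x. \<bar>vtail n x\<bar>) \<in> borel_measurable lborel" for n using vtail_integrable[of n] by auto
    show "AE x in lborel. (\<lambda>n. \<bar>vtail n x\<bar>) \<longlonglongrightarrow> 0"
    proof (rule AE_I2)
      fix x
      have "\<forall>\<^sub>F n in sequentially. \<bar>vtail n x\<bar> = 0"
      proof (cases "x \<in> \<Omega>")
        case True
        then obtain m where "x \<in> C m" using C_absorb[of "{x}"] by auto
        then have "x \<in> C n" if "n \<ge> m" for n using C_mono[OF that] by auto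
        then show ?thesis by (intro eventually_sequentiallyI[of m]) (simp add: vtail_def)
      qed (simp add: vtail_def v_outside)
      then show "(\<lambda>n. \<bar>vtail n x\<bar>) \<longlonglongrightarrow> 0" by (rule tendsto_eventually)
    qed
  qed (use v_integrable in \<open>auto simp: vtail_def indicator_def\<close>)
  then show ?thesis by simp
qed

lemma nflux_measurable: "g \<in> test_fields \<Longrightarrow> nflux g \<in> borel_measurable borel"
  unfolding nflux_def[abs_def] test_fields_def
  by (intro borel_measurable_sum borel_measurable_times) (auto intro: test_on_measurable)

lemma Tu_nflux_integrable: "g \<in> test_fields \<Longrightarrow> integrable Pper (\<lambda>x. Tu x * nflux g x)"
  unfolding nflux_def sum_distrib_left
  by (intro Bochner_Integration.integrable_sum Pper_integrable[OF Tu_int]) (auto simp: test_fields_def)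

text \<open>The field is cut off to live near the frontier, the functional is computed as a limit of
  mollifications, and each mollification is split by \<open>Xop_step\<close> into the boundary term,
  estimated by \<open>bpot_sum_bound\<close>, and an error. The constant \<open>K\<close> is
  independent of \<open>n\<close>, since the cutoff enlarges neither the bound nor the support of
  the field; this permits \<open>n\<close> to tend to infinity afterwards.\<close>

lemma tflux_bound_tail:
  assumes g: "g \<in> test_fields" and k: "k > 0"
  obtains K where "\<And>n. \<bar>tflux k g\<bar> \<le> (\<integral>x. \<bar>Tu x\<bar> * \<bar>nflux g x\<bar> \<partial>Pper) + K * (\<integral>x. \<bar>vtail n x\<bar> \<partial>lborel)"
proof -
  have gj: "test_on UNIV (g j)" if "j \<in> Hor deg" for j using g that by (simp add: test_fields_def)
  have "\<exists>R. \<forall>x. R < norm x \<longrightarrow> g j x = 0" if "j \<in> Hor deg" for j using test_on_support[OF gj[OF that]] by metis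
  then obtain R0 where R0: "\<And>j x. j \<in> Hor deg \<Longrightarrow> R0 j < norm x \<Longrightarrow> g j x = 0" by metis
  have "\<exists>B. \<forall>x. \<bar>g j x\<bar> \<le> B" if "j \<in> Hor deg" for j using test_on_bounded[OF gj[OF that]] by metis
  then obtain G0 where G0: "\<And>j x. j \<in> Hor deg \<Longrightarrow> \<bar>g j x\<bar> \<le> G0 j" by metis
  define G where "G = (\<Sum>j\<in>Hor deg. \<bar>G0 j\<bar>)"
  have G: "\<bar>g j x\<bar> \<le> G" if "j \<in> Hor deg" for j x
  proof -
    have "\<bar>G0 j\<bar> \<le> G" unfolding G_def using that by (intro member_le_sum) auto
    then show ?thesis using G0[OF that, of x] by linarith
  qed
  obtain RO where RO: "\<And>x. x \<in> \<Omega> \<Longrightarrow> norm x \<le> RO" using bd bounded_iff by metis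
  obtain D where D: "D \<ge> 0" "\<And>\<epsilon> y j. 0 < \<epsilon> \<Longrightarrow> \<epsilon> \<le> 1 \<Longrightarrow> norm y \<le> RO \<Longrightarrow>
    (\<integral>\<^sup>+x. ennreal \<bar>comm_kernel j \<epsilon> x y\<bar> \<partial>lborel) \<le> ennreal D"
    using comm_kernel_bound[of RO] by blast
  define QB where "QB j B \<longleftrightarrow> B \<ge> 0 \<and> (\<forall>\<phi>. C_inf \<phi> \<longrightarrow> (\<forall>x. R0 j < norm x \<longrightarrow> \<phi> x = 0) \<longrightarrow>
    \<bar>\<integral>x. Xop gm j \<phi> x \<partial>lborel\<bar> \<le> B * (\<integral>x. \<bar>\<phi> x\<bar> \<partial>lborel))" for j B
  have "\<exists>B. QB j B" for j
  proof (rule integral_Xop_bound[of "R0 j" j])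
    fix B assume "B \<ge> 0" and B: "\<And>\<phi>. C_inf \<phi> \<Longrightarrow> (\<And>x. R0 j < norm x \<Longrightarrow> \<phi> x = 0) \<Longrightarrow>
      \<bar>\<integral>x. Xop gm j \<phi> x \<partial>lborel\<bar> \<le> B * (\<integral>x. \<bar>\<phi> x\<bar> \<partial>lborel)"
    then have "QB j B" unfolding QB_def by simp
    then show ?thesis by blast
  qed
  then obtain B where B: "\<And>j. QB j (B j)" by metis
  define K where "K = (\<Sum>j\<in>Hor deg. G * (D + B j))"
  define T where "T = (\<integral>x. \<bar>Tu x\<bar> * \<bar>nflux g x\<bar> \<partial>Pper)"
  obtain e where e: "\<And>m::nat. 0 < e m" "\<And>m. e m \<le> 1" "e \<longlonglongrightarrow> 0"
    and eL: "\<And>j. j \<in> Hor deg \<Longrightarrow> (\<lambda>m. \<integral>x. \<bar>conv (mol (e m)) (h j) x - h j x\<bar> \<partial>lborel) \<longlonglongrightarrow> 0"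
    and eA: "AE x in lborel. (\<lambda>m. conv (mol (e m)) v x) \<longlonglongrightarrow> v x"
  proof -
    \<comment> \<open>An option type as index set collects \<open>v\<close> and all its derivatives
      into one finite family, so that they share their scales.\<close>
    define F where "F i = (case i of None \<Rightarrow> v | Some j \<Rightarrow> (if j \<in> Hor deg then h j else (\<lambda>x. 0)))" for i
    have Fi: "integrable lborel (F i)" for i unfolding F_def using v_integrable h_integrable by (auto split: option.split)
    have F0: "F i x = 0" if "RO + 1 \<le> norm x" for i x
    proof -
      have "x \<notin> \<Omega>" using RO[of x] that by auto
      then show ?thesis unfolding F_def using v_outside h_outside by (auto split: option.split)
    qed
    show ?thesis
    proof (rule mollify_seq[where F=F and R="RO + 1", OF Fi F0])
      fix e assume e: "\<And>m::nat. 0 < e m" "\<And>m. e m \<le> 1" "e \<longlonglongrightarrow> 0"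
        "\<And>i. (\<lambda>m. \<integral>x. \<bar>conv (mol (e m)) (F i) x - F i x\<bar> \<partial>lborel) \<longlonglongrightarrow> 0"
        "\<And>i. AE x in lborel. (\<lambda>m. conv (mol (e m)) (F i) x) \<longlonglongrightarrow> F i x"
      have "(\<lambda>m. \<integral>x. \<bar>conv (mol (e m)) (h j) x - h j x\<bar> \<partial>lborel) \<longlonglongrightarrow> 0" if "j \<in> Hor deg" for j
        using e(4)[of "Some j"] that by (simp add: F_def)
      moreover have "AE x in lborel. (\<lambda>m. conv (mol (e m)) v x) \<longlonglongrightarrow> v x" using e(5)[of None] by (simp add: F_def)
      ultimately show ?thesis by (rule that[OF e(1,2,3)])
    qed
  qed
  have bound: "\<bar>tflux k g\<bar> \<le> T + K * (\<integral>x. \<bar>vtail n x\<bar> \<partial>lborel)" for n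
  proof -
    define V where "V = (\<integral>x. \<bar>vtail n x\<bar> \<partial>lborel)"
    define \<psi> where "\<psi> j x = g j x - \<kappa> n x * g j x" for j x
    have \<psi>t: "test_on UNIV (\<psi> j)" if "j \<in> Hor deg" for j
      unfolding \<psi>_def[abs_def] using gj[OF that] test_on_mono[OF \<kappa>_test_\<Omega>, of UNIV]
      by (intro test_on_diff test_on_mult test_on_C_inf[OF gj[OF that]]) auto
    have \<psi>eq: "\<psi> j x = (1 - \<kappa> n x) * g j x" for j x by (simp add: \<psi>_def algebra_simps)
    have \<psi>G: "\<bar>\<psi> j x\<bar> \<le> G" if "j \<in> Hor deg" for j x
    proof -
      have "\<bar>\<psi> j x\<bar> \<le> \<bar>g j x\<bar>" unfolding \<psi>eq abs_mult
        using \<kappa>_nonneg[of n x] \<kappa>_le[of n x] by (intro mult_left_le_one_le) auto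
      then show ?thesis using G[OF that, of x] by linarith
    qed
    have \<psi>U: "\<psi> j x = 0" if "x \<in> U n" for j x using \<kappa>_1[OF that] by (simp add: \<psi>_def)
    have \<psi>\<nu>: "AE x in Pper. nflux \<psi> x = nflux g x"
      using frontier_AE
    proof eventually_elim
      case (elim x)
      then have "\<kappa> n x = 0" using test_on_eq_0[OF \<kappa>_test_\<Omega>] op by (auto simp: frontier_def interior_open)
      then show ?case by (simp add: nflux_def \<psi>_def)
    qed
    have \<psi>T: "\<psi> \<in> test_fields" using \<psi>t by (simp add: test_fields_def)
    obtain d where d: "d > 0" "\<And>x y. y \<in> C n \<Longrightarrow> norm (x - y) \<le> d \<Longrightarrow> x \<in> U n"
      using compact_open_thicken[OF C_compact U_open C_U] by metis
    \<comment> \<open>The boundary functional with \<open>v\<close> and \<open>h j\<close> replaced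
      by their mollifications.\<close>
    define A where "A m = (\<Sum>j\<in>Hor deg. - (\<integral>x. (k * sin (conv (mol (e m)) v x / k)) * Xop gm j (\<psi> j) x \<partial>lborel)
       - (\<integral>x. (\<psi> j x * cos (conv (mol (e m)) v x / k)) * conv (mol (e m)) (h j) x \<partial>lborel))" for m
    have vm[measurable]: "conv (mol (e m)) v \<in> borel_measurable borel" for m
      using integrable_conv_mol[OF e(1) v_integrable] by auto
    have Alim: "A \<longlonglongrightarrow> tflux k \<psi>"
      unfolding A_def tflux_def
    proof (intro tendsto_sum tendsto_diff tendsto_minus)
      fix j assume j: "j \<in> Hor deg"
      have [measurable]: "Xop gm j (\<psi> j) \<in> borel_measurable borel" "\<psi> j \<in> borel_measurable borel"
        using test_on_measurable[OF test_on_Xop[OF \<psi>t[OF j]]] test_on_measurable[OF \<psi>t[OF j]] by auto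
      show "(\<lambda>m. \<integral>x. (k * sin (conv (mol (e m)) v x / k)) * Xop gm j (\<psi> j) x \<partial>lborel) \<longlonglongrightarrow> (\<integral>x. tv k x * Xop gm j (\<psi> j) x \<partial>lborel)"
      proof (rule integral_dominated_convergence[where w="\<lambda>x. k * \<bar>Xop gm j (\<psi> j) x\<bar>"])
        show "integrable lborel (\<lambda>x. k * \<bar>Xop gm j (\<psi> j) x\<bar>)"
          using test_integrable[OF test_on_Xop[OF \<psi>t[OF j]]] by auto
        show "AE x in lborel. (\<lambda>m. (k * sin (conv (mol (e m)) v x / k)) * Xop gm j (\<psi> j) x) \<longlonglongrightarrow> tv k x * Xop gm j (\<psi> j) x"
          using eA unfolding tv_def by eventually_elim (intro tendsto_intros, use k in auto)
        show "AE x in lborel. norm ((k * sin (conv (mol (e m)) v x / k)) * Xop gm j (\<psi> j) x) \<le> k * \<bar>Xop gm j (\<psi> j) x\<bar>" for m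
        proof (rule AE_I2)
          fix x
          have "\<bar>sin (conv (mol (e m)) v x / k)\<bar> * \<bar>Xop gm j (\<psi> j) x\<bar> \<le> \<bar>Xop gm j (\<psi> j) x\<bar>"
            by (intro mult_left_le_one_le) auto
          then show "norm ((k * sin (conv (mol (e m)) v x / k)) * Xop gm j (\<psi> j) x) \<le> k * \<bar>Xop gm j (\<psi> j) x\<bar>"
            using k by (simp add: abs_mult mult.assoc)
        qed
      qed auto
      have hm[measurable]: "conv (mol (e m)) (h j) \<in> borel_measurable borel" for m
        using integrable_conv_mol[OF e(1) h_integrable[OF j]] by auto
      have q: "\<bar>\<psi> j x * cos (conv (mol (e m)) v x / k)\<bar> \<le> G" for m x
        using mult_mono[OF \<psi>G[OF j, of x] abs_cos_le_one[of "conv (mol (e m)) v x / k"]] \<psi>G[OF j, of x] by (simp add: abs_mult)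
      have G0: "0 \<le> G" using \<psi>G[OF j, of 0] by linarith
      have L1: "(\<lambda>m. \<integral>x. (\<psi> j x * cos (conv (mol (e m)) v x / k)) * h j x \<partial>lborel) \<longlonglongrightarrow> (\<integral>x. th k j x * \<psi> j x \<partial>lborel)"
      proof (rule integral_dominated_convergence[where w="\<lambda>x. G * \<bar>h j x\<bar>"])
        show "integrable lborel (\<lambda>x. G * \<bar>h j x\<bar>)" using h_integrable[OF j] by auto
        show "AE x in lborel. (\<lambda>m. (\<psi> j x * cos (conv (mol (e m)) v x / k)) * h j x) \<longlonglongrightarrow> th k j x * \<psi> j x"
          using eA
        proof eventually_elim
          case (elim x)
          have "(\<lambda>m. (\<psi> j x * cos (conv (mol (e m)) v x / k)) * h j x) \<longlonglongrightarrow> (\<psi> j x * cos (v x / k)) * h j x"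
            by (intro tendsto_intros elim) (use k in auto)
          then show ?case by (simp add: th_def mult_ac)
        qed
        show "AE x in lborel. norm ((\<psi> j x * cos (conv (mol (e m)) v x / k)) * h j x) \<le> G * \<bar>h j x\<bar>" for m
          by (rule AE_I2) (metis abs_ge_zero abs_mult mult_right_mono q real_norm_def)
      qed auto
      \<comment> \<open>Inside the cosine almost everywhere convergence suffices, whereas the
        mollified densities converge in L1; the product is therefore split into a dominated part and
        this remainder.\<close>
      have L2: "(\<lambda>m. \<integral>x. (\<psi> j x * cos (conv (mol (e m)) v x / k)) * (conv (mol (e m)) (h j) x - h j x) \<partial>lborel) \<longlonglongrightarrow> 0"
      proof (rule Lim_null_comparison)
        show "(\<lambda>m. G * (\<integral>x. \<bar>conv (mol (e m)) (h j) x - h j x\<bar> \<partial>lborel)) \<longlonglongrightarrow> 0"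
          using tendsto_mult_right_zero[OF eL[OF j], of G] by simp
        show "\<forall>\<^sub>F m in sequentially. norm (\<integral>x. (\<psi> j x * cos (conv (mol (e m)) v x / k)) * (conv (mol (e m)) (h j) x - h j x) \<partial>lborel)
          \<le> G * (\<integral>x. \<bar>conv (mol (e m)) (h j) x - h j x\<bar> \<partial>lborel)"
        proof (rule always_eventually, rule allI)
          fix m
          have di: "integrable lborel (\<lambda>x. conv (mol (e m)) (h j) x - h j x)"
            by (intro Bochner_Integration.integrable_diff integrable_conv_mol e h_integrable j)
          have "\<bar>\<integral>x. (\<psi> j x * cos (conv (mol (e m)) v x / k)) * (conv (mol (e m)) (h j) x - h j x) \<partial>lborel\<bar>
            \<le> (\<integral>x. G * \<bar>conv (mol (e m)) (h j) x - h j x\<bar> \<partial>lborel)"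
          proof (rule integral_abs_bound_integral)
            show "integrable lborel (\<lambda>x. (\<psi> j x * cos (conv (mol (e m)) v x / k)) * (conv (mol (e m)) (h j) x - h j x))"
              using integrable_mult_AE_bounded[OF di, of "\<lambda>x. \<psi> j x * cos (conv (mol (e m)) v x / k)" G] q by (simp add: mult.commute)
            show "\<bar>(\<psi> j x * cos (conv (mol (e m)) v x / k)) * (conv (mol (e m)) (h j) x - h j x)\<bar> \<le> G * \<bar>conv (mol (e m)) (h j) x - h j x\<bar>" for x
              by (metis abs_ge_zero abs_mult mult_right_mono q)
          qed (use di in auto)
          then show "norm (\<integral>x. (\<psi> j x * cos (conv (mol (e m)) v x / k)) * (conv (mol (e m)) (h j) x - h j x) \<partial>lborel)
            \<le> G * (\<integral>x. \<bar>conv (mol (e m)) (h j) x - h j x\<bar> \<partial>lborel)" by simp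
        qed
      qed
      have "(\<integral>x. (\<psi> j x * cos (conv (mol (e m)) v x / k)) * conv (mol (e m)) (h j) x \<partial>lborel)
        = (\<integral>x. (\<psi> j x * cos (conv (mol (e m)) v x / k)) * h j x \<partial>lborel)
        + (\<integral>x. (\<psi> j x * cos (conv (mol (e m)) v x / k)) * (conv (mol (e m)) (h j) x - h j x) \<partial>lborel)" for m
      proof -
        have i: "integrable lborel (\<lambda>x. (\<psi> j x * cos (conv (mol (e m)) v x / k)) * f x)" if "integrable lborel f" for f
          using integrable_mult_AE_bounded[OF that, of "\<lambda>x. \<psi> j x * cos (conv (mol (e m)) v x / k)" G] q by (simp add: mult.commute)
        have di: "integrable lborel (\<lambda>x. conv (mol (e m)) (h j) x - h j x)"
          by (intro Bochner_Integration.integrable_diff integrable_conv_mol e h_integrable j)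
        show ?thesis
          by (subst Bochner_Integration.integral_add[OF i[OF h_integrable[OF j]] i[OF di], symmetric]) (simp add: algebra_simps)
      qed
      then show "(\<lambda>m. \<integral>x. (\<psi> j x * cos (conv (mol (e m)) v x / k)) * conv (mol (e m)) (h j) x \<partial>lborel) \<longlonglongrightarrow> (\<integral>x. th k j x * \<psi> j x \<partial>lborel)"
        using tendsto_add[OF L1 L2] by simp
    qed
    \<comment> \<open>For large m the scale is smaller than the gap between \<open>C n\<close> and
      the complement of \<open>U n\<close> and smaller than the moduli of continuity of all
      components of \<open>\<psi>\<close> for the tolerance \<open>\<delta>\<close>.\<close>
    have A_bound: "\<forall>\<^sub>F m in sequentially. \<bar>A m\<bar> \<le> (T + real (card (Hor deg)) * \<delta> * (\<integral>x. \<bar>Tu x\<bar> \<partial>Pper)) + K * V" if \<delta>: "\<delta> > 0" for \<delta>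
    proof -
      have "\<exists>r>0. \<forall>x y. norm (x - y) < r \<longrightarrow> \<bar>\<psi> j x - \<psi> j y\<bar> \<le> \<delta>" if j: "j \<in> Hor deg" for j
      proof -
        obtain R where "\<And>x. R < norm x \<Longrightarrow> \<psi> j x = 0" using test_on_support[OF \<psi>t[OF j]] by metis
        then show ?thesis using uniformly_continuous_support[OF test_on_continuous[OF \<psi>t[OF j]] _ \<delta>] by metis
      qed
      then obtain r where r: "\<And>j. j \<in> Hor deg \<Longrightarrow> r j > 0" "\<And>j x y. j \<in> Hor deg \<Longrightarrow> norm (x - y) < r j \<Longrightarrow> \<bar>\<psi> j x - \<psi> j y\<bar> \<le> \<delta>"
        by metis
      have "\<forall>\<^sub>F m in sequentially. \<forall>j\<in>Hor deg. e m < r j"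
        using r(1) order_tendstoD(2)[OF e(3)] by (intro eventually_ball_finite) auto
      moreover have "\<forall>\<^sub>F m in sequentially. e m < d" using d(1) by (rule order_tendstoD(2)[OF e(3)])
      ultimately show ?thesis
      proof eventually_elim
        case (elim m)
        let ?q = "\<lambda>x. cos (conv (mol (e m)) v x / k)"
        let ?a = "\<lambda>j. - (\<integral>x. (k * sin (conv (mol (e m)) v x / k)) * Xop gm j (\<psi> j) x \<partial>lborel) - (\<integral>x. (\<psi> j x * ?q x) * conv (mol (e m)) (h j) x \<partial>lborel)"
        let ?b = "\<lambda>j. \<integral>x. (\<psi> j x * ?q x) * bpot (e m) j x \<partial>lborel"
        have sep: "e m < norm (x - y)" if "x \<notin> U n" "y \<in> C n" for x y
          using d(2)[OF that(2), of x] that(1) elim by linarith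
        have s1: "\<bar>?a j - ?b j\<bar> \<le> G * (D + B j) * V" if j: "j \<in> Hor deg" for j
          unfolding V_def
        proof (rule Xop_step[OF j e(1,2) k \<psi>t[OF j] \<psi>G[OF j] \<psi>U sep D(1)])
          show "(\<integral>\<^sup>+x. ennreal \<bar>comm_kernel j (e m) x y\<bar> \<partial>lborel) \<le> ennreal D" if "y \<in> \<Omega>" for y
            by (rule D(2)[OF e(1,2) RO[OF that]])
          show "0 \<le> B j" using B[of j] by (simp add: QB_def)
          fix \<phi> assume \<phi>: "C_inf \<phi>" "\<And>x. \<psi> j x = 0 \<Longrightarrow> \<phi> x = 0"
          have "\<forall>x. R0 j < norm x \<longrightarrow> \<phi> x = 0" using R0[OF j] \<phi>(2) by (simp add: \<psi>_def)
          then show "\<bar>\<integral>x. Xop gm j \<phi> x \<partial>lborel\<bar> \<le> B j * (\<integral>x. \<bar>\<phi> x\<bar> \<partial>lborel)"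
            using B[of j] \<phi>(1) by (simp add: QB_def)
        qed
        have s2: "\<bar>\<Sum>j\<in>Hor deg. ?b j\<bar> \<le> (\<integral>y. \<bar>Tu y\<bar> * (\<bar>\<Sum>j\<in>Hor deg. \<psi> j y * \<nu> y $ j\<bar> + real (card (Hor deg)) * \<delta>) \<partial>Pper)"
        proof (rule bpot_sum_bound[OF e(1) \<psi>t])
          show "?q \<in> borel_measurable borel" by measurable
          show "\<bar>\<psi> j x - \<psi> j y\<bar> \<le> \<delta>" if "j \<in> Hor deg" "norm (x - y) < e m" for j x y
            using r(2)[OF that(1), of x y] elim(1) that by force
        qed auto
        have i1: "integrable Pper (\<lambda>y. \<bar>Tu y\<bar> * \<bar>nflux g y\<bar>)"
          using integrable_abs[OF Tu_nflux_integrable[OF g]] by (simp add: abs_mult)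
        have "(\<integral>y. \<bar>Tu y\<bar> * (\<bar>\<Sum>j\<in>Hor deg. \<psi> j y * \<nu> y $ j\<bar> + real (card (Hor deg)) * \<delta>) \<partial>Pper)
          = (\<integral>y. \<bar>Tu y\<bar> * \<bar>nflux g y\<bar> + (real (card (Hor deg)) * \<delta>) * \<bar>Tu y\<bar> \<partial>Pper)"
        proof (rule integral_cong_AE)
          have [measurable]: "Tu \<in> borel_measurable Pper" "nflux g \<in> borel_measurable Pper" "nflux \<psi> \<in> borel_measurable Pper"
            using Tu_int Pper_measurable[OF nflux_measurable[OF g]] Pper_measurable[OF nflux_measurable[OF \<psi>T]] by auto
          show "(\<lambda>y. \<bar>Tu y\<bar> * (\<bar>\<Sum>j\<in>Hor deg. \<psi> j y * \<nu> y $ j\<bar> + real (card (Hor deg)) * \<delta>)) \<in> borel_measurable Pper"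
            unfolding nflux_def[of \<psi>, symmetric] by measurable
          show "(\<lambda>y. \<bar>Tu y\<bar> * \<bar>nflux g y\<bar> + (real (card (Hor deg)) * \<delta>) * \<bar>Tu y\<bar>) \<in> borel_measurable Pper" by measurable
          show "AE y in Pper. \<bar>Tu y\<bar> * (\<bar>\<Sum>j\<in>Hor deg. \<psi> j y * \<nu> y $ j\<bar> + real (card (Hor deg)) * \<delta>) = \<bar>Tu y\<bar> * \<bar>nflux g y\<bar> + (real (card (Hor deg)) * \<delta>) * \<bar>Tu y\<bar>"
            using \<psi>\<nu> by eventually_elim (simp add: nflux_def algebra_simps)
        qed
        also have "\<dots> = T + real (card (Hor deg)) * \<delta> * (\<integral>x. \<bar>Tu x\<bar> \<partial>Pper)"
          unfolding T_def using i1 Tu_int by simp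
        finally have s3: "\<bar>\<Sum>j\<in>Hor deg. ?b j\<bar> \<le> T + real (card (Hor deg)) * \<delta> * (\<integral>x. \<bar>Tu x\<bar> \<partial>Pper)" using s2 by simp
        have "A m = (\<Sum>j\<in>Hor deg. ?b j) + (\<Sum>j\<in>Hor deg. ?a j - ?b j)"
          unfolding A_def by (simp add: sum_subtractf)
        moreover have "\<bar>\<Sum>j\<in>Hor deg. ?a j - ?b j\<bar> \<le> K * V"
          unfolding K_def sum_distrib_right by (intro order_trans[OF sum_abs] sum_mono s1)
        ultimately show ?case using s3 by linarith
      qed
    qed
    have "\<bar>tflux k \<psi>\<bar> \<le> T + K * V"
    proof (rule field_le_epsilon)
      fix c :: real assume c: "c > 0"
      let ?I = "\<integral>x. \<bar>Tu x\<bar> \<partial>Pper"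
      have I: "?I \<ge> 0" by (intro integral_nonneg_AE) auto
      \<comment> \<open>Chosen so that the continuity error is at most \<open>c\<close>; the added 1
        excludes a zero denominator.\<close>
      define \<delta> where "\<delta> = c / (real (card (Hor deg)) * ?I + 1)"
      have den: "real (card (Hor deg)) * ?I + 1 > 0" using I by (simp add: add_nonneg_pos)
      have "\<bar>tflux k \<psi>\<bar> \<le> (T + real (card (Hor deg)) * \<delta> * ?I) + K * V"
        by (rule tendsto_upperbound[OF tendsto_rabs[OF Alim] A_bound]) (use c den in \<open>auto simp: \<delta>_def\<close>)
      also have "real (card (Hor deg)) * \<delta> * ?I \<le> c"
      proof -
        have "real (card (Hor deg)) * \<delta> * ?I = c * ((real (card (Hor deg)) * ?I) / (real (card (Hor deg)) * ?I + 1))"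
          by (simp add: \<delta>_def)
        also have "\<dots> \<le> c * 1" using c den by (intro mult_left_mono) (auto simp: divide_le_eq)
        finally show ?thesis by simp
      qed
      finally show "\<bar>tflux k \<psi>\<bar> \<le> T + K * V + c" by simp
    qed
    moreover have "tflux k \<psi> = tflux k g" unfolding \<psi>_def[abs_def] by (rule tflux_cutoff[OF g k])
    ultimately show ?thesis by (simp add: V_def)
  qed
  show ?thesis using that[of K] bound unfolding T_def by blast
qed

lemma tflux_bound:
  assumes g: "g \<in> test_fields" and k: "k > 0"
  shows "\<bar>tflux k g\<bar> \<le> (\<integral>x. \<bar>Tu x\<bar> * \<bar>nflux g x\<bar> \<partial>Pper)"
proof -
  obtain K where K: "\<And>n. \<bar>tflux k g\<bar> \<le> (\<integral>x. \<bar>Tu x\<bar> * \<bar>nflux g x\<bar> \<partial>Pper) + K * (\<integral>x. \<bar>vtail n x\<bar> \<partial>lborel)"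
    using tflux_bound_tail[OF g k] by blast
  have "(\<lambda>n. (\<integral>x. \<bar>Tu x\<bar> * \<bar>nflux g x\<bar> \<partial>Pper) + K * (\<integral>x. \<bar>vtail n x\<bar> \<partial>lborel)) \<longlonglongrightarrow> (\<integral>x. \<bar>Tu x\<bar> * \<bar>nflux g x\<bar> \<partial>Pper) + K * 0"
    by (intro tendsto_intros vtail_tendsto)
  then show ?thesis using LIMSEQ_le_const[of _ "(\<integral>x. \<bar>Tu x\<bar> * \<bar>nflux g x\<bar> \<partial>Pper)" "\<bar>tflux k g\<bar>"] K by auto
qed

end

section \<open>Letting the truncation level tend to infinity\<close>

lemma mult_sin_div_tendsto: "(\<lambda>i. real (Suc i) * sin (x / real (Suc i))) \<longlonglongrightarrow> x"
proof -
  have "((\<lambda>t. sin (x * t)) has_real_derivative x) (at 0)"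
    by (auto intro!: derivative_eq_intros)
  then have "((\<lambda>t. sin (x * t) / t) \<longlongrightarrow> x) (at 0)" by (simp add: DERIV_def)
  moreover have "filterlim (\<lambda>i. inverse (real (Suc i))) (at 0) sequentially"
    unfolding filterlim_at using LIMSEQ_inverse_real_of_nat by auto
  ultimately have "(\<lambda>i. sin (x * inverse (real (Suc i))) / inverse (real (Suc i))) \<longlonglongrightarrow> x"
    by (rule filterlim_compose)
  then show ?thesis by (simp add: divide_inverse mult.commute)
qed

lemma cos_div_tendsto: "(\<lambda>i. cos (x / real (Suc i))) \<longlonglongrightarrow> 1"
proof -
  have "(\<lambda>i. x * inverse (real (Suc i))) \<longlonglongrightarrow> x * 0" by (intro tendsto_intros LIMSEQ_inverse_real_of_nat)
  then have "(\<lambda>i. cos (x * inverse (real (Suc i)))) \<longlonglongrightarrow> cos (x * 0)" by (rule tendsto_cos)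
  then show ?thesis by (simp add: divide_inverse)
qed

context meyers_serrin
begin

text \<open>With |Tu| as a weight, \<open>tflux_bound\<close> becomes a bound by the L1 norm of the
  normal component. A density of modulus at most 1 with respect to this measure is, after
  multiplication by |Tu|, a candidate trace dominated by |Tu|.\<close>

definition tmeas :: "(real^'n) measure" where
  "tmeas = density Pper (\<lambda>x. ennreal \<bar>Tu x\<bar>)"

lemma tmeas_sets: "sets tmeas = sets borel"
  by (simp add: tmeas_def Pper_sets)

lemma Tu_measurable_Pper: "Tu \<in> borel_measurable Pper"
  using Tu_int by auto

lemma tmeas_fin: "fin_meas_on UNIV tmeas"
proof -
  have "emeasure tmeas (space tmeas) = (\<integral>\<^sup>+x. ennreal \<bar>Tu x\<bar> \<partial>Pper)"
    unfolding tmeas_def using Tu_measurable_Pper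
    by (subst emeasure_density) (auto intro!: nn_integral_cong simp: indicator_def)
  also have "\<dots> < \<infinity>" using Tu_int by (simp add: integrable_iff_bounded)
  finally show ?thesis unfolding fin_meas_on_def using tmeas_sets by (auto intro!: finite_measureI)
qed

lemma tmeas_integral:
  assumes "f \<in> borel_measurable Pper"
  shows "(\<integral>x. f x \<partial>tmeas) = (\<integral>x. \<bar>Tu x\<bar> * f x \<partial>Pper)" "integrable tmeas f \<longleftrightarrow> integrable Pper (\<lambda>x. \<bar>Tu x\<bar> * f x)"
  unfolding tmeas_def using Tu_measurable_Pper assms by (auto simp: integral_density integrable_density)

lemma tmeas_measurable: "f \<in> borel_measurable tmeas \<longleftrightarrow> f \<in> borel_measurable Pper"
  by (simp add: tmeas_def)

lemma tmeas_AE: "AE x in Pper. Q x \<Longrightarrow> AE x in tmeas. Q x"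
  unfolding tmeas_def using Tu_measurable_Pper by (subst AE_density) auto

lemma \<nu>_sum_sq: "AE x in Pper. (\<Sum>j\<in>Hor deg. \<nu> x $ j * \<nu> x $ j) = 1"
  using \<nu>_norm
proof eventually_elim
  case (elim x)
  have z: "\<nu> x $ i = 0" if "i \<notin> Hor deg" for i
    using per that by (auto simp: perimeter_measure_def Hor_def)
  have "(\<Sum>j\<in>Hor deg. \<nu> x $ j * \<nu> x $ j) = (\<Sum>j\<in>UNIV. \<nu> x $ j * \<nu> x $ j)"
    by (rule sum.mono_neutral_left) (use z in auto)
  also have "\<dots> = \<nu> x \<bullet> \<nu> x" by (simp add: inner_vec_def)
  also have "\<dots> = 1" using elim by (simp add: dot_square_norm)
  finally show ?case .
qed

text \<open>As \<open>\<nu>\<close> is a horizontal unit vector, \<open>f\<close> is the normal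
  component of the field with components \<open>f x * \<nu> x $ j\<close>. Approximating each
  component by a test function in L1 approximates \<open>f\<close>, because the components of
  \<open>\<nu>\<close> are at most 1 in modulus.\<close>

lemma test_fields_dense:
  assumes f: "integrable tmeas f" and e: "e > 0"
  shows "\<exists>g\<in>test_fields. (\<integral>x. \<bar>f x - nflux g x\<bar> \<partial>tmeas) < e"
proof -
  have fm: "f \<in> borel_measurable tmeas" using f by auto
  have \<nu>m: "(\<lambda>x. \<nu> x $ j) \<in> borel_measurable tmeas" for j
    unfolding measurable_cong_sets[OF tmeas_sets refl] by measurable
  have \<nu>1: "AE x in tmeas. \<bar>\<nu> x $ j\<bar> \<le> 1" for j by (rule tmeas_AE[OF \<nu>_bound])
  have f\<nu>: "integrable tmeas (\<lambda>x. f x * \<nu> x $ j)" for j by (rule integrable_mult_AE_bounded[OF f \<nu>m \<nu>1])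
  define c where "c = e / (real (card (Hor deg)) + 1)"
  have c: "c > 0" using e by (simp add: c_def)
  have "\<exists>\<phi>. test_on UNIV \<phi> \<and> (\<integral>x. \<bar>f x * \<nu> x $ j - \<phi> x\<bar> \<partial>tmeas) < c" for j
    by (rule test_dense_L1[OF tmeas_fin open_UNIV f\<nu> c])
  then obtain g where g: "\<And>j. test_on UNIV (g j) \<and> (\<integral>x. \<bar>f x * \<nu> x $ j - g j x\<bar> \<partial>tmeas) < c"
    using choice[of "\<lambda>j \<phi>. test_on UNIV \<phi> \<and> (\<integral>x. \<bar>f x * \<nu> x $ j - \<phi> x\<bar> \<partial>tmeas) < c"] by blast
  have gi: "integrable tmeas (g j)" for j
    using test_on_integrable[of UNIV "g j" tmeas] g tmeas_fin tmeas_sets by (auto simp: fin_meas_on_def)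
  have di: "integrable tmeas (\<lambda>x. \<bar>f x * \<nu> x $ j - g j x\<bar>)" for j using f\<nu> gi by auto
  have gT: "g \<in> test_fields" using g by (simp add: test_fields_def)
  have "(\<integral>x. \<bar>f x - nflux g x\<bar> \<partial>tmeas) \<le> (\<integral>x. (\<Sum>j\<in>Hor deg. \<bar>f x * \<nu> x $ j - g j x\<bar>) \<partial>tmeas)"
  proof (rule integral_mono_AE)
    have "integrable tmeas (nflux g)"
      unfolding nflux_def[abs_def] by (intro Bochner_Integration.integrable_sum integrable_mult_AE_bounded[OF gi \<nu>m \<nu>1])
    then show "integrable tmeas (\<lambda>x. \<bar>f x - nflux g x\<bar>)" using f by auto
    show "integrable tmeas (\<lambda>x. \<Sum>j\<in>Hor deg. \<bar>f x * \<nu> x $ j - g j x\<bar>)" using di by auto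
    show "AE x in tmeas. \<bar>f x - nflux g x\<bar> \<le> (\<Sum>j\<in>Hor deg. \<bar>f x * \<nu> x $ j - g j x\<bar>)"
      using tmeas_AE[OF \<nu>_sum_sq] tmeas_AE[OF \<nu>_norm]
    proof eventually_elim
      case (elim x)
      have "f x - nflux g x = f x * (\<Sum>j\<in>Hor deg. \<nu> x $ j * \<nu> x $ j) - nflux g x" using elim(1) by simp
      also have "\<dots> = (\<Sum>j\<in>Hor deg. (f x * \<nu> x $ j - g j x) * \<nu> x $ j)"
        by (simp add: nflux_def sum_distrib_left sum_subtractf[symmetric] algebra_simps)
      also have "\<bar>\<dots>\<bar> \<le> (\<Sum>j\<in>Hor deg. \<bar>f x * \<nu> x $ j - g j x\<bar>)"
      proof (intro order_trans[OF sum_abs] sum_mono)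
        fix j
        have "\<bar>\<nu> x $ j\<bar> \<le> 1" using component_le_norm_cart[of "\<nu> x" j] elim(2) by simp
        then show "\<bar>(f x * \<nu> x $ j - g j x) * \<nu> x $ j\<bar> \<le> \<bar>f x * \<nu> x $ j - g j x\<bar>"
          unfolding abs_mult by (intro mult_left_le) auto
      qed
      finally show ?case .
    qed
  qed
  also have "\<dots> = (\<Sum>j\<in>Hor deg. \<integral>x. \<bar>f x * \<nu> x $ j - g j x\<bar> \<partial>tmeas)"
    by (rule Bochner_Integration.integral_sum) (use di in auto)
  also have "\<dots> \<le> (\<Sum>j\<in>Hor deg. c)" using g by (intro sum_mono less_imp_le) auto
  also have "\<dots> < e" using e by (simp add: c_def field_simps)
  finally show ?thesis using gT by blast
qed

text \<open>The boundary functional depends linearly on the field and is bounded by the L1 norm of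
  its normal component, and such components are dense. Duality therefore gives a density of modulus
  at most 1, and the factor |Tu| turns it into the trace of the truncation.\<close>

lemma trunc_trace:
  assumes k: "k > 0"
  shows "\<exists>s. integrable Pper s \<and> (AE x in Pper. \<bar>s x\<bar> \<le> \<bar>Tu x\<bar>) \<and>
    (\<forall>g\<in>test_fields. tflux k g = (\<integral>x. s x * nflux g x \<partial>Pper))"
proof -
  have nm: "nflux g \<in> borel_measurable Pper" if "g \<in> test_fields" for g
    by (rule Pper_measurable[OF nflux_measurable[OF that]])
  have ni: "integrable tmeas (nflux g)" if "g \<in> test_fields" for g
  proof -
    have "integrable Pper (\<lambda>x. \<bar>Tu x\<bar> * nflux g x)"
      by (rule Bochner_Integration.integrable_bound[OF Tu_nflux_integrable[OF that]])
        (use nm[OF that] Tu_measurable_Pper in \<open>auto simp: abs_mult\<close>)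
    then show ?thesis by (simp add: tmeas_integral[OF nm[OF that]])
  qed
  have "\<exists>d\<in>borel_measurable tmeas. (AE x in tmeas. \<bar>d x\<bar> \<le> 1) \<and> (\<forall>g\<in>test_fields. tflux k g = (\<integral>x. nflux g x * d x \<partial>tmeas))"
  proof (rule L1_functional_density)
    show "finite_measure tmeas" using tmeas_fin by (simp add: fin_meas_on_def)
    show "integrable tmeas (nflux g)" if "g \<in> test_fields" for g by (rule ni[OF that])
    show "\<exists>g\<in>test_fields. (\<integral>x. \<bar>f x - nflux g x\<bar> \<partial>tmeas) < e" if "integrable tmeas f" "e > 0" for f e
      by (rule test_fields_dense[OF that])
    show "\<bar>tflux k g\<bar> \<le> (\<integral>x. \<bar>nflux g x\<bar> \<partial>tmeas)" if g: "g \<in> test_fields" for g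
      using tflux_bound[OF g k] nm[OF g] by (simp add: tmeas_integral)
    fix g g' c assume g: "g \<in> test_fields" "g' \<in> test_fields"
    let ?g = "\<lambda>j x. g j x + c * g' j x"
    have t: "test_on UNIV (g j)" "test_on UNIV (g' j)" "test_on UNIV (\<lambda>x. c * g' j x)" if "j \<in> Hor deg" for j
      using g that by (auto simp: test_fields_def intro: test_on_cmult)
    have gT: "?g \<in> test_fields" using t by (auto simp: test_fields_def intro!: test_on_add)
    have n: "nflux ?g x = nflux g x + c * nflux g' x" for x
      by (simp add: nflux_def sum.distrib sum_distrib_left algebra_simps)
    have "tflux k ?g = tflux k g + c * tflux k g'"
      unfolding tflux_def sum_distrib_left sum.distrib[symmetric]
    proof (rule sum.cong[OF refl])
      fix j assume j: "j \<in> Hor deg"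
      have X: "Xop gm j (\<lambda>x. g j x + c * g' j x) x = Xop gm j (g j) x + c * Xop gm j (g' j) x" for x
      proof -
        have "((\<lambda>t. g j (gm x (t *\<^sub>R axis j 1)) + c * g' j (gm x (t *\<^sub>R axis j 1))) has_real_derivative Xop gm j (g j) x + c * Xop gm j (g' j) x) (at 0)"
          by (intro DERIV_add DERIV_cmult Xop_has_deriv test_on_C_inf[OF t(1)[OF j]] test_on_C_inf[OF t(2)[OF j]])
        then show ?thesis unfolding Xop_def[of gm j "\<lambda>x. g j x + c * g' j x"] by (rule DERIV_imp_deriv)
      qed
      have i: "integrable lborel (\<lambda>x. tv k x * Xop gm j (g j) x)" "integrable lborel (\<lambda>x. tv k x * Xop gm j (g' j) x)"
        by (rule test_mult_integrable[OF tv_integrable[OF k] test_on_Xop[OF t(1)[OF j]]],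
            rule test_mult_integrable[OF tv_integrable[OF k] test_on_Xop[OF t(2)[OF j]]])
      have i': "integrable lborel (\<lambda>x. th k j x * g j x)" "integrable lborel (\<lambda>x. th k j x * g' j x)"
        by (rule test_mult_integrable[OF th_integrable[OF j] t(1)[OF j]], rule test_mult_integrable[OF th_integrable[OF j] t(2)[OF j]])
      have "(\<integral>x. tv k x * (Xop gm j (g j) x + c * Xop gm j (g' j) x) \<partial>lborel) = (\<integral>x. tv k x * Xop gm j (g j) x \<partial>lborel) + c * (\<integral>x. tv k x * Xop gm j (g' j) x \<partial>lborel)"
        using i by (simp add: distrib_left mult.left_commute)
      moreover have "(\<integral>x. th k j x * (g j x + c * g' j x) \<partial>lborel) = (\<integral>x. th k j x * g j x \<partial>lborel) + c * (\<integral>x. th k j x * g' j x \<partial>lborel)"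
        using i' by (simp add: distrib_left mult.left_commute)
      ultimately show "- (\<integral>x. tv k x * Xop gm j (\<lambda>x. g j x + c * g' j x) x \<partial>lborel) - (\<integral>x. th k j x * (g j x + c * g' j x) \<partial>lborel)
        = - (\<integral>x. tv k x * Xop gm j (g j) x \<partial>lborel) - (\<integral>x. th k j x * g j x \<partial>lborel)
          + c * (- (\<integral>x. tv k x * Xop gm j (g' j) x \<partial>lborel) - (\<integral>x. th k j x * g' j x \<partial>lborel))"
        unfolding X by (simp add: algebra_simps)
    qed
    with gT n show "\<exists>g''\<in>test_fields. (\<forall>x. nflux g'' x = nflux g x + c * nflux g' x) \<and> tflux k g'' = tflux k g + c * tflux k g'"
      by blast
  qed
  then obtain d where d: "d \<in> borel_measurable tmeas" "AE x in tmeas. \<bar>d x\<bar> \<le> 1"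
    "\<And>g. g \<in> test_fields \<Longrightarrow> tflux k g = (\<integral>x. nflux g x * d x \<partial>tmeas)" by blast
  have dm: "d \<in> borel_measurable Pper" using d(1) by (simp add: tmeas_measurable)
  define s where "s x = \<bar>Tu x\<bar> * d x" for x
  have sm: "s \<in> borel_measurable Pper" unfolding s_def[abs_def] using dm Tu_measurable_Pper by simp
  have "AE x in Pper. 0 < ennreal \<bar>Tu x\<bar> \<longrightarrow> \<bar>d x\<bar> \<le> 1"
    using d(2) Tu_measurable_Pper unfolding tmeas_def by (subst (asm) AE_density) auto
  then have sT: "AE x in Pper. \<bar>s x\<bar> \<le> \<bar>Tu x\<bar>"
  proof eventually_elim
    case (elim x)
    then show ?case by (cases "Tu x = 0") (auto simp: s_def abs_mult intro!: mult_left_le)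
  qed
  show ?thesis
  proof (intro exI[of _ s] conjI ballI)
    show "integrable Pper s" by (rule Bochner_Integration.integrable_bound[OF Tu_int sm]) (use sT in auto)
    show "AE x in Pper. \<bar>s x\<bar> \<le> \<bar>Tu x\<bar>" by (rule sT)
    fix g assume g: "g \<in> test_fields"
    have "tflux k g = (\<integral>x. \<bar>Tu x\<bar> * (nflux g x * d x) \<partial>Pper)"
      using d(3)[OF g] nm[OF g] dm by (simp add: tmeas_integral)
    then show "tflux k g = (\<integral>x. s x * nflux g x \<partial>Pper)" by (simp add: s_def mult_ac)
  qed
qed

text \<open>The interior integrals converge by domination with those of \<open>v\<close> and
  \<open>h j\<close>, and \<open>v_trace\<close> identifies the limit. This amounts to convergence
  of the truncated traces to \<open>Tu\<close> when tested with normal components only.\<close>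

lemma tflux_tendsto:
  assumes g: "g \<in> test_fields"
  shows "(\<lambda>i. tflux (real (Suc i)) g) \<longlonglongrightarrow> (\<integral>x. Tu x * nflux g x \<partial>Pper)"
proof -
  have t: "test_on UNIV (g j)" if "j \<in> Hor deg" for j using g that by (auto simp: test_fields_def)
  have "(\<lambda>i. tflux (real (Suc i)) g) \<longlonglongrightarrow> (\<Sum>j\<in>Hor deg. - (\<integral>x. v x * Xop gm j (g j) x \<partial>lborel) - (\<integral>x. h j x * g j x \<partial>lborel))"
    unfolding tflux_def
  proof (intro tendsto_sum tendsto_diff tendsto_minus)
    fix j assume j: "j \<in> Hor deg"
    have [measurable]: "Xop gm j (g j) \<in> borel_measurable borel" "g j \<in> borel_measurable borel"
      using test_on_measurable[OF test_on_Xop[OF t[OF j]]] test_on_measurable[OF t[OF j]] by auto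
    show "(\<lambda>i. \<integral>x. tv (real (Suc i)) x * Xop gm j (g j) x \<partial>lborel) \<longlonglongrightarrow> (\<integral>x. v x * Xop gm j (g j) x \<partial>lborel)"
    proof (rule integral_dominated_convergence[where w="\<lambda>x. \<bar>v x * Xop gm j (g j) x\<bar>"])
      show "integrable lborel (\<lambda>x. \<bar>v x * Xop gm j (g j) x\<bar>)"
        by (intro integrable_abs test_mult_integrable[OF v_integrable test_on_Xop[OF t[OF j]]])
      show "AE x in lborel. (\<lambda>i. tv (real (Suc i)) x * Xop gm j (g j) x) \<longlonglongrightarrow> v x * Xop gm j (g j) x"
        unfolding tv_def by (intro AE_I2 tendsto_mult_right mult_sin_div_tendsto)
      show "AE x in lborel. norm (tv (real (Suc i)) x * Xop gm j (g j) x) \<le> \<bar>v x * Xop gm j (g j) x\<bar>" for i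
        using tv_abs_le(1)[of "real (Suc i)"] by (intro AE_I2) (simp add: abs_mult mult_right_mono del: of_nat_Suc)
    qed auto
    show "(\<lambda>i. \<integral>x. th (real (Suc i)) j x * g j x \<partial>lborel) \<longlonglongrightarrow> (\<integral>x. h j x * g j x \<partial>lborel)"
    proof (rule integral_dominated_convergence[where w="\<lambda>x. \<bar>h j x * g j x\<bar>"])
      show "integrable lborel (\<lambda>x. \<bar>h j x * g j x\<bar>)"
        by (intro integrable_abs test_mult_integrable[OF h_integrable[OF j] t[OF j]])
      show "AE x in lborel. (\<lambda>i. th (real (Suc i)) j x * g j x) \<longlonglongrightarrow> h j x * g j x"
      proof (rule AE_I2)
        fix x
        have "(\<lambda>i. cos (v x / real (Suc i)) * h j x * g j x) \<longlonglongrightarrow> 1 * h j x * g j x"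
          by (intro tendsto_mult_right cos_div_tendsto)
        then show "(\<lambda>i. th (real (Suc i)) j x * g j x) \<longlonglongrightarrow> h j x * g j x" by (simp add: th_def)
      qed
      show "AE x in lborel. norm (th (real (Suc i)) j x * g j x) \<le> \<bar>h j x * g j x\<bar>" for i
        using th_abs_le by (intro AE_I2) (simp add: abs_mult mult_right_mono del: of_nat_Suc)
    qed auto
  qed
  also have "(\<Sum>j\<in>Hor deg. - (\<integral>x. v x * Xop gm j (g j) x \<partial>lborel) - (\<integral>x. h j x * g j x \<partial>lborel)) = (\<Sum>j\<in>Hor deg. \<integral>x. Tu x * (g j x * \<nu> x $ j) \<partial>Pper)"
    using v_trace t by (intro sum.cong) auto
  also have "\<dots> = (\<integral>x. Tu x * nflux g x \<partial>Pper)"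
    unfolding nflux_def sum_distrib_left using t
    by (intro Bochner_Integration.integral_sum[symmetric] Pper_integrable[OF Tu_int]) auto
  finally show ?thesis .
qed

end

section \<open>The Gauss--Green formula for Borel representatives\<close>

context meyers_serrin
begin

text \<open>The definition of the normal trace is applied to the bounded truncations. The interior
  terms converge by domination; the traces converge only weakly, but their common bound |Tu| and the
  density of normal components allow \<open>\<theta>\<close> as a test function.
  \<open>pairing_identity\<close> finally exchanges \<open>v\<close> for \<open>u\<close>.\<close>

theorem gauss_green:
  assumes z: "\<forall>j\<in>Hor deg. Linf_on \<Omega> (\<lambda>x. z x $ j)"
    and dm: "divX_meas gm deg \<Omega> z Pd Nd"
    and pm: "pairing_meas gm deg \<Omega> u z (\<lambda>g. (LINT x:\<Omega>|Pd. g x) - (LINT x:\<Omega>|Nd. g x)) Pm Nm"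
    and u: "integrable Pd u" "integrable Nd u"
    and w: "(\<Sum>i. \<integral>\<^sup>+x. ennreal \<bar>w i x\<bar> \<partial>Pd) < \<infinity>" "(\<Sum>i. \<integral>\<^sup>+x. ennreal \<bar>w i x\<bar> \<partial>Nd) < \<infinity>"
    and nt: "weak_normal_trace gm deg \<Omega> Pper \<nu> z \<theta>"
  shows "(\<integral>x. u x \<partial>Pd) - (\<integral>x. u x \<partial>Nd) + (measure Pm \<Omega> - measure Nm \<Omega>) = (\<integral>x. \<theta> x * Tu x \<partial>Pper)"
proof -
  have fin: "fin_meas_on \<Omega> Pd" "fin_meas_on \<Omega> Nd" using dm by (auto simp: divX_meas_def)
  note set_int = fin_meas_on_set_integral[OF fin(1) op] fin_meas_on_set_integral[OF fin(2) op]
  have \<theta>m: "\<theta> \<in> borel_measurable Pper" using nt by (simp add: weak_normal_trace_def)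
  obtain C\<theta> where C\<theta>: "AE x in Pper. \<bar>\<theta> x\<bar> \<le> C\<theta>" using nt by (auto simp: weak_normal_trace_def)
  have \<theta>i: "integrable tmeas \<theta>"
  proof -
    have "integrable Pper (\<lambda>x. \<bar>Tu x\<bar> * \<theta> x)" by (rule integrable_mult_AE_bounded[OF integrable_abs[OF Tu_int] \<theta>m C\<theta>])
    then show ?thesis by (simp add: tmeas_integral[OF \<theta>m])
  qed
  let ?S = "\<lambda>i s. integrable Pper s \<and> (AE x in Pper. \<bar>s x\<bar> \<le> \<bar>Tu x\<bar>) \<and> (\<forall>g\<in>test_fields. tflux (real (Suc i)) g = (\<integral>x. s x * nflux g x \<partial>Pper))"
  have "\<exists>s. \<forall>i. ?S i (s i)" by (intro choice allI trunc_trace) simp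
  then obtain s where s: "\<And>i. integrable Pper (s i)" "\<And>i. AE x in Pper. \<bar>s i x\<bar> \<le> \<bar>Tu x\<bar>"
    "\<And>i g. g \<in> test_fields \<Longrightarrow> tflux (real (Suc i)) g = (\<integral>x. s i x * nflux g x \<partial>Pper)" by blast
  \<comment> \<open>A field with a single nonzero component turns the representation of the boundary
    functional into the scalar identity of \<open>W11_trace_intro\<close>.\<close>
  have tr: "(\<integral>x. tv (real (Suc i)) x * Xop gm j \<phi> x \<partial>lborel) = - (\<integral>x. th (real (Suc i)) j x * \<phi> x \<partial>lborel) - (\<integral>x. s i x * (\<phi> x * \<nu> x $ j) \<partial>Pper)"
    if j: "j \<in> Hor deg" and \<phi>: "test_on UNIV \<phi>" for i j \<phi>
  proof -
    define g where "g l = (if l = j then \<phi> else (\<lambda>x. 0))" for l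
    have "g \<in> test_fields" using \<phi> test_on_0 by (auto simp: g_def test_fields_def)
    moreover have "nflux g x = \<phi> x * \<nu> x $ j" for x
    proof -
      have "nflux g x = (\<Sum>l\<in>Hor deg. if l = j then \<phi> x * \<nu> x $ j else 0)"
        unfolding nflux_def by (intro sum.cong) (auto simp: g_def)
      then show ?thesis using j by simp
    qed
    moreover have "tflux (real (Suc i)) g = - (\<integral>x. tv (real (Suc i)) x * Xop gm j \<phi> x \<partial>lborel) - (\<integral>x. th (real (Suc i)) j x * \<phi> x \<partial>lborel)"
    proof -
      have "tflux (real (Suc i)) g = (\<Sum>l\<in>Hor deg. if l = j then - (\<integral>x. tv (real (Suc i)) x * Xop gm j \<phi> x \<partial>lborel) - (\<integral>x. th (real (Suc i)) j x * \<phi> x \<partial>lborel) else 0)"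
        unfolding tflux_def by (intro sum.cong) (auto simp: g_def Xop_const)
      then show ?thesis using j by simp
    qed
    ultimately show ?thesis using s(3)[of g i] by simp
  qed
  have nt_i: "(\<integral>x. tv (real (Suc i)) x \<partial>Pd) - (\<integral>x. tv (real (Suc i)) x \<partial>Nd)
      + (\<Sum>j\<in>Hor deg. \<integral>x. th (real (Suc i)) j x * (indicator \<Omega> x * z x $ j) \<partial>lebesgue) = (\<integral>x. s i x * \<theta> x \<partial>Pper)" for i
  proof -
    have k: "real (Suc i) > 0" by simp
    note W = W11_trace_intro[OF tv_integrable[OF k] tv_outside th_integrable th_outside s(1) tr]
    have "Linf_on \<Omega> (tv (real (Suc i)))"
      unfolding Linf_on_def
      using integrable_lebesgue_on_eq[OF op tv_outside tv_integrable[OF k]] tv_abs_le(2)[OF k]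
      by (auto intro!: exI[of _ "real (Suc i)"] simp del: of_nat_Suc)
    then have "BVc_X gm deg \<Omega> (tv (real (Suc i)))"
      unfolding BVc_X_def using W(2) tv_continuous[OF k] by simp
    with nt dm W(1,3)
    have "(LINT x:\<Omega>|Pd. tv (real (Suc i)) x) - (LINT x:\<Omega>|Nd. tv (real (Suc i)) x)
      + (LINT x:\<Omega>|lebesgue. (\<Sum>j\<in>Hor deg. z x $ j * th (real (Suc i)) j x)) = (\<integral>x. s i x * \<theta> x \<partial>Pper)"
      unfolding weak_normal_trace_def by blast
    then show ?thesis using set_integral_z_sum(1)[OF z th_integrable] by (simp add: set_int)
  qed
  have tv_lim: "(\<lambda>i. \<integral>x. tv (real (Suc i)) x \<partial>M) \<longlonglongrightarrow> (\<integral>x. v x \<partial>M)" if M: "fin_meas_on \<Omega> M" "integrable M v" for M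
  proof -
    have [measurable_cong]: "sets M = sets borel" using M by (simp add: fin_meas_on_def)
    show ?thesis
    proof (rule integral_dominated_convergence[where w="\<lambda>x. \<bar>v x\<bar>"])
      show "AE x in M. (\<lambda>i. tv (real (Suc i)) x) \<longlonglongrightarrow> v x"
        unfolding tv_def by (intro AE_I2 mult_sin_div_tendsto)
      show "AE x in M. norm (tv (real (Suc i)) x) \<le> \<bar>v x\<bar>" for i
        using tv_abs_le(1)[of "real (Suc i)"] by (intro AE_I2) (simp del: of_nat_Suc)
    qed (use M in auto)
  qed
  have th_lim: "(\<lambda>i. \<integral>x. th (real (Suc i)) j x * (indicator \<Omega> x * z x $ j) \<partial>lebesgue) \<longlonglongrightarrow> (\<integral>x. h j x * (indicator \<Omega> x * z x $ j) \<partial>lebesgue)"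
    if j: "j \<in> Hor deg" for j
  proof (rule integral_dominated_convergence[where w="\<lambda>x. \<bar>h j x * (indicator \<Omega> x * z x $ j)\<bar>"])
    show "integrable lebesgue (\<lambda>x. \<bar>h j x * (indicator \<Omega> x * z x $ j)\<bar>)"
      by (intro integrable_abs set_integral_z_sum(2)[OF z h_integrable j])
    show "(\<lambda>x. h j x * (indicator \<Omega> x * z x $ j)) \<in> borel_measurable lebesgue"
      using set_integral_z_sum(2)[OF z h_integrable j] by auto
    show "(\<lambda>x. th (real (Suc i)) j x * (indicator \<Omega> x * z x $ j)) \<in> borel_measurable lebesgue" for i
      using set_integral_z_sum(2)[OF z th_integrable j] by auto
    show "AE x in lebesgue. (\<lambda>i. th (real (Suc i)) j x * (indicator \<Omega> x * z x $ j)) \<longlonglongrightarrow> h j x * (indicator \<Omega> x * z x $ j)"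
    proof (rule AE_I2)
      fix x
      have "(\<lambda>i. cos (v x / real (Suc i)) * h j x * (indicator \<Omega> x * z x $ j)) \<longlonglongrightarrow> 1 * h j x * (indicator \<Omega> x * z x $ j)"
        by (intro tendsto_mult_right cos_div_tendsto)
      then show "(\<lambda>i. th (real (Suc i)) j x * (indicator \<Omega> x * z x $ j)) \<longlonglongrightarrow> h j x * (indicator \<Omega> x * z x $ j)"
        by (simp add: th_def)
    qed
    show "AE x in lebesgue. norm (th (real (Suc i)) j x * (indicator \<Omega> x * z x $ j)) \<le> \<bar>h j x * (indicator \<Omega> x * z x $ j)\<bar>" for i
      unfolding real_norm_def abs_mult[of "th _ _ _"] abs_mult[of "h _ _"] using th_abs_le by (intro AE_I2 mult_right_mono) auto
  qed
  \<comment> \<open>Convergence against the divergence measures uses the integrability of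
    \<open>v\<close> there, the consequence of the two hypotheses on the sums over
    \<open>w i\<close>.\<close>
  have lhs: "(\<lambda>i. \<integral>x. s i x * \<theta> x \<partial>Pper) \<longlonglongrightarrow> (\<integral>x. v x \<partial>Pd) - (\<integral>x. v x \<partial>Nd)
      + (\<Sum>j\<in>Hor deg. \<integral>x. h j x * (indicator \<Omega> x * z x $ j) \<partial>lebesgue)"
    unfolding nt_i[symmetric]
    by (intro tendsto_add tendsto_diff tendsto_sum tv_lim th_lim fin sums_integral_w(1) w)
  have s\<theta>: "integrable Pper (\<lambda>x. s i x * \<theta> x)" "integrable Pper (\<lambda>x. Tu x * \<theta> x)" for i
    by (rule integrable_mult_AE_bounded[OF s(1) \<theta>m C\<theta>], rule integrable_mult_AE_bounded[OF Tu_int \<theta>m C\<theta>])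
  have rhs: "(\<lambda>i. \<integral>x. s i x * \<theta> x \<partial>Pper) \<longlonglongrightarrow> (\<integral>x. Tu x * \<theta> x \<partial>Pper)"
  proof (rule LIMSEQ_I)
    fix c :: real assume c: "c > 0"
    obtain g where g: "g \<in> test_fields" "(\<integral>x. \<bar>\<theta> x - nflux g x\<bar> \<partial>tmeas) < c / 4"
      using test_fields_dense[OF \<theta>i, of "c / 4"] c by auto
    have nm: "nflux g \<in> borel_measurable Pper" by (rule Pper_measurable[OF nflux_measurable[OF g(1)]])
    have Tg: "integrable Pper (\<lambda>x. Tu x * nflux g x)" by (rule Tu_nflux_integrable[OF g(1)])
    have sg: "integrable Pper (\<lambda>x. s i x * nflux g x)" for i
    proof (rule Bochner_Integration.integrable_bound[OF Tg])
      show "(\<lambda>x. s i x * nflux g x) \<in> borel_measurable Pper" using s(1)[of i] nm by auto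
      show "AE x in Pper. norm (s i x * nflux g x) \<le> norm (Tu x * nflux g x)"
        using s(2)[of i] by eventually_elim (simp add: abs_mult mult_right_mono)
    qed
    \<comment> \<open>The cost of replacing \<open>\<theta>\<close> by the normal component of
      \<open>g\<close>, measured with the weight |Tu|. By domination it is the same for
      \<open>Tu\<close> and for every \<open>s i\<close>, hence uniform in \<open>i\<close>.\<close>
    define J where "J = (\<integral>x. \<bar>Tu x\<bar> * \<bar>\<theta> x - nflux g x\<bar> \<partial>Pper)"
    have J: "J < c / 4" unfolding J_def using g(2) nm \<theta>m by (simp add: tmeas_integral)
    have Ji: "integrable Pper (\<lambda>x. \<bar>Tu x\<bar> * \<bar>\<theta> x - nflux g x\<bar>)"
      using integrable_abs[OF Bochner_Integration.integrable_diff[OF s\<theta>(2) Tg]]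
      by (simp add: right_diff_distrib[symmetric] abs_mult)
    have est: "\<bar>(\<integral>x. r x * \<theta> x \<partial>Pper) - (\<integral>x. r x * nflux g x \<partial>Pper)\<bar> \<le> J"
      if r: "integrable Pper (\<lambda>x. r x * \<theta> x)" "integrable Pper (\<lambda>x. r x * nflux g x)" "AE x in Pper. \<bar>r x\<bar> \<le> \<bar>Tu x\<bar>" for r
    proof -
      have "\<bar>(\<integral>x. r x * \<theta> x \<partial>Pper) - (\<integral>x. r x * nflux g x \<partial>Pper)\<bar> = \<bar>\<integral>x. r x * \<theta> x - r x * nflux g x \<partial>Pper\<bar>"
        using r by simp
      also have "\<dots> \<le> (\<integral>x. \<bar>r x * \<theta> x - r x * nflux g x\<bar> \<partial>Pper)" by (rule integral_abs_bound)
      also have "\<dots> \<le> J" unfolding J_def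
      proof (rule integral_mono_AE)
        show "AE x in Pper. \<bar>r x * \<theta> x - r x * nflux g x\<bar> \<le> \<bar>Tu x\<bar> * \<bar>\<theta> x - nflux g x\<bar>"
          using r(3) by eventually_elim (simp add: right_diff_distrib[symmetric] abs_mult mult_right_mono)
      qed (use r Ji in auto)
      finally show ?thesis .
    qed
    have lim: "(\<lambda>i. \<integral>x. s i x * nflux g x \<partial>Pper) \<longlonglongrightarrow> (\<integral>x. Tu x * nflux g x \<partial>Pper)"
      using tflux_tendsto[OF g(1)] by (simp only: s(3)[OF g(1)])
    have "c / 4 > 0" using c by simp
    from LIMSEQ_D[OF lim this]
    obtain n0 where n0: "\<And>i. i \<ge> n0 \<Longrightarrow> \<bar>(\<integral>x. s i x * nflux g x \<partial>Pper) - (\<integral>x. Tu x * nflux g x \<partial>Pper)\<bar> < c / 4"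
      unfolding real_norm_def by blast
    show "\<exists>n0. \<forall>i\<ge>n0. norm ((\<integral>x. s i x * \<theta> x \<partial>Pper) - (\<integral>x. Tu x * \<theta> x \<partial>Pper)) < c"
    proof (intro exI[of _ n0] allI impI)
      fix i assume i: "n0 \<le> i"
      have "\<bar>(\<integral>x. s i x * \<theta> x \<partial>Pper) - (\<integral>x. s i x * nflux g x \<partial>Pper)\<bar> \<le> J"
        by (rule est[OF s\<theta>(1) sg s(2)])
      moreover have "\<bar>(\<integral>x. Tu x * \<theta> x \<partial>Pper) - (\<integral>x. Tu x * nflux g x \<partial>Pper)\<bar> \<le> J"
        by (rule est[OF s\<theta>(2) Tg]) simp
      ultimately show "norm ((\<integral>x. s i x * \<theta> x \<partial>Pper) - (\<integral>x. Tu x * \<theta> x \<partial>Pper)) < c"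
        unfolding real_norm_def using n0[OF i] J by linarith
    qed
  qed
  have "(\<integral>x. v x \<partial>Pd) - (\<integral>x. v x \<partial>Nd) + (\<Sum>j\<in>Hor deg. \<integral>x. h j x * (indicator \<Omega> x * z x $ j) \<partial>lebesgue) = (\<integral>x. Tu x * \<theta> x \<partial>Pper)"
    by (rule LIMSEQ_unique[OF lhs rhs])
  then show ?thesis
    using pairing_identity[OF z dm pm u w] set_integral_z_sum(1)[OF z h_integrable] by (simp add: mult.commute)
qed

text \<open>The pointwise bound \<open>suminf_w_le\<close> is integrable for every finite measure,
  in particular for a divergence measure singular to Lebesgue measure.\<close>

lemma suminf_nn_w_finite_bounded:
  assumes M: "M \<ge> 0" "AE x in lborel. \<bar>u x\<bar> \<le> M" and Q: "fin_meas_on \<Omega> Q"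
  shows "(\<Sum>i. \<integral>\<^sup>+x. ennreal \<bar>w i x\<bar> \<partial>Q) < \<infinity>"
proof -
  have s[measurable_cong]: "sets Q = sets borel" and f: "finite_measure Q" using Q by (auto simp: fin_meas_on_def)
  have "(\<Sum>i. \<integral>\<^sup>+x. ennreal \<bar>w i x\<bar> \<partial>Q) = (\<integral>\<^sup>+x. (\<Sum>i. ennreal \<bar>w i x\<bar>) \<partial>Q)"
    by (rule nn_integral_suminf[symmetric]) measurable
  also have "\<dots> \<le> (\<integral>\<^sup>+x. ennreal (2 * M) \<partial>Q)" by (intro nn_integral_mono suminf_w_le M)
  also have "\<dots> < \<infinity>"
    using finite_measure.finite_emeasure_space[OF f] by (simp add: ennreal_mult_less_top less_top)
  finally show ?thesis .
qed

lemma suminf_nn_w_finite_Young: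
  assumes f: "f \<in> borel_measurable borel" and AB: "A \<in> borel_measurable borel" "B \<in> borel_measurable borel"
    "\<And>x y. \<bar>u y\<bar> * \<bar>f x\<bar> \<le> A y + B x" "\<And>y. 0 \<le> A y" "\<And>x. 0 \<le> B x"
    "(\<integral>\<^sup>+y. ennreal (A y) \<partial>lborel) < \<infinity>" "(\<integral>\<^sup>+y. ennreal (B y) \<partial>lborel) < \<infinity>"
  shows "(\<Sum>i. \<integral>\<^sup>+x. ennreal \<bar>w i x\<bar> \<partial>posm f) < \<infinity>"
proof -
  note [measurable] = f AB(1,2)
  have "(\<integral>\<^sup>+x. ennreal \<bar>w i x\<bar> \<partial>posm f) \<le> (\<integral>\<^sup>+x. ennreal \<bar>w i x * f x\<bar> \<partial>lborel)" for i
  proof -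
    have "(\<integral>\<^sup>+x. ennreal \<bar>w i x\<bar> \<partial>posm f) = (\<integral>\<^sup>+x. ennreal (max 0 (f x)) * ennreal \<bar>w i x\<bar> \<partial>lborel)"
      unfolding posm_def by (subst nn_integral_density) auto
    also have "\<dots> \<le> (\<integral>\<^sup>+x. ennreal \<bar>w i x * f x\<bar> \<partial>lborel)"
      by (intro nn_integral_mono) (auto simp: ennreal_mult[symmetric] abs_mult mult.commute intro!: ennreal_leI mult_right_mono)
    finally show ?thesis .
  qed
  then have "(\<Sum>i. \<integral>\<^sup>+x. ennreal \<bar>w i x\<bar> \<partial>posm f) \<le> (\<Sum>i. \<integral>\<^sup>+x. ennreal \<bar>w i x * f x\<bar> \<partial>lborel)"
    by (intro suminf_le) auto
  also have "\<dots> \<le> (\<integral>\<^sup>+y. ennreal (A y) \<partial>lborel) + 2 * (\<integral>\<^sup>+x. ennreal (B x) \<partial>lborel)"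
    by (rule suminf_nn_w_mult_le) (use AB in auto)
  also have "\<dots> < \<infinity>" using AB(6,7) by (simp add: ennreal_mult_less_top)
  finally show ?thesis .
qed

end

text \<open>The two alternatives in \<open>bound\<close> are the two ways of making the series of
  the \<open>w i\<close> absolutely integrable for the divergence: bounded \<open>u\<close>, as
  under (a) and (c), or a divergence with a density linked to \<open>u\<close> by a Young type
  inequality, as under (b).\<close>

lemma gauss_green_borel:
  fixes gm :: "real^'n \<Rightarrow> real^'n \<Rightarrow> real^'n"
  assumes G: "carnot_group gm deg"
    and op: "open \<Omega>" and bd: "bounded \<Omega>"
    and per: "perimeter_measure gm deg \<Omega> Pper \<nu>"
    and tr: "is_trace gm deg \<Omega> Pper \<nu> u Tu"
    and nt: "weak_normal_trace gm deg \<Omega> Pper \<nu> z \<theta>"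
    and u_int: "integrable lborel u" and u_0: "\<And>x. x \<notin> \<Omega> \<Longrightarrow> u x = 0"
    and z: "\<forall>j\<in>Hor deg. Linf_on \<Omega> (\<lambda>x. z x $ j)"
    and dm: "divX_meas gm deg \<Omega> z Pd Nd"
    and pm: "pairing_meas gm deg \<Omega> u z (\<lambda>g. (LINT x:\<Omega>|Pd. g x) - (LINT x:\<Omega>|Nd. g x)) Pm Nm"
    and u: "integrable Pd u" "integrable Nd u"
    and bound: "(\<exists>M\<ge>0. AE x in lborel. \<bar>u x\<bar> \<le> M) \<or>
      (\<exists>f A B. Pd = posm f \<and> Nd = posm (\<lambda>x. - f x) \<and> f \<in> borel_measurable borel \<and>
         A \<in> borel_measurable borel \<and> B \<in> borel_measurable borel \<and>
         (\<forall>x y. \<bar>u y\<bar> * \<bar>f x\<bar> \<le> A y + B x) \<and> (\<forall>y. 0 \<le> A y) \<and> (\<forall>x. 0 \<le> B x) \<and>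
         (\<integral>\<^sup>+y. ennreal (A y) \<partial>lborel) < \<infinity> \<and> (\<integral>\<^sup>+y. ennreal (B y) \<partial>lborel) < \<infinity>)"
  shows "(\<integral>x. u x \<partial>Pd) - (\<integral>x. u x \<partial>Nd) + (measure Pm \<Omega> - measure Nm \<Omega>) = (\<integral>x. \<theta> x * Tu x \<partial>Pper)"
proof -
  interpret carnot gm deg by standard (rule G)
  obtain PN where PN: "\<And>j. j \<in> Hor deg \<Longrightarrow> Xderiv_meas gm \<Omega> j u (fst (PN j)) (snd (PN j))"
    and PNt: "\<And>g. (\<forall>j\<in>Hor deg. test_on UNIV (g j)) \<Longrightarrow> (LINT x:\<Omega>|lebesgue. u x * divX gm deg g x)
             = - (\<Sum>j\<in>Hor deg. (LINT x:\<Omega>|fst (PN j). g j x) - (LINT x:\<Omega>|snd (PN j). g j x))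
               - (LINT x|Pper. Tu x * (\<Sum>j\<in>Hor deg. g j x * \<nu> x $ j))"
    using tr unfolding is_trace_def by blast
  have um: "u \<in> borel_measurable borel" using u_int by auto
  have "trace_setup gm deg \<Omega> Pper \<nu> u Tu (\<lambda>j. fst (PN j)) (\<lambda>j. snd (PN j))"
  proof (unfold_locales, fact op, fact bd, fact per, fact u_int, fact u_0)
    show "integrable Pper Tu" using tr by (simp add: is_trace_def)
    show "Xderiv_meas gm \<Omega> j u (fst (PN j)) (snd (PN j))" if "j \<in> Hor deg" for j by (rule PN[OF that])
    fix j and \<phi> :: "real^'n \<Rightarrow> real" assume j: "j \<in> Hor deg" and \<phi>: "test_on UNIV \<phi>"
    have fin: "fin_meas_on \<Omega> (fst (PN j))" "fin_meas_on \<Omega> (snd (PN j))"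
      using PN[OF j] by (auto simp: Xderiv_meas_def)
    define g where "g l = (if l = j then \<phi> else (\<lambda>x. 0))" for l
    have gt: "\<forall>l\<in>Hor deg. test_on UNIV (g l)" using \<phi> test_on_0 by (auto simp: g_def)
    \<comment> \<open>Fields with one nonzero component reduce the identities for fields to those
      for a scalar test function that \<open>trace_setup\<close> expects.\<close>
    have single: "(\<Sum>l\<in>Hor deg. F l) = F j" if "\<And>l. l \<in> Hor deg \<Longrightarrow> l \<noteq> j \<Longrightarrow> F l = 0" for F :: "'n \<Rightarrow> real"
    proof -
      have "(\<Sum>l\<in>Hor deg. F l) = (\<Sum>l\<in>Hor deg. if l = j then F j else 0)" by (intro sum.cong) (auto simp: that)
      then show ?thesis using j by simp
    qed
    have e1: "divX gm deg g x = Xop gm j \<phi> x" for x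
      unfolding divX_def by (subst single) (auto simp: g_def Xop_const)
    have e2: "(\<Sum>l\<in>Hor deg. g l x * \<nu> x $ l) = \<phi> x * \<nu> x $ j" for x
      by (subst single) (auto simp: g_def)
    have e3: "(\<Sum>l\<in>Hor deg. (LINT x:\<Omega>|fst (PN l). g l x) - (LINT x:\<Omega>|snd (PN l). g l x)) = (LINT x:\<Omega>|fst (PN j). \<phi> x) - (LINT x:\<Omega>|snd (PN j). \<phi> x)"
      by (subst single) (auto simp: g_def set_lebesgue_integral_def)
    have "(LINT x:\<Omega>|lebesgue. u x * Xop gm j \<phi> x) = (\<integral>x. u x * Xop gm j \<phi> x \<partial>lborel)"
      using um test_on_measurable[OF test_on_Xop[OF \<phi>]] by (intro set_integral_lebesgue_eq) (auto simp: u_0)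
    then show "(\<integral>x. u x * Xop gm j \<phi> x \<partial>lborel) = - ((\<integral>x. \<phi> x \<partial>fst (PN j)) - (\<integral>x. \<phi> x \<partial>snd (PN j))) - (\<integral>x. Tu x * (\<phi> x * \<nu> x $ j) \<partial>Pper)"
      using PNt[OF gt] unfolding e1 e2 e3
      by (simp add: fin_meas_on_set_integral[OF fin(1) op test_on_measurable[OF \<phi>]] fin_meas_on_set_integral[OF fin(2) op test_on_measurable[OF \<phi>]])
  qed
  then interpret trace_setup gm deg \<Omega> Pper \<nu> u Tu "\<lambda>j. fst (PN j)" "\<lambda>j. snd (PN j)" .
  obtain C \<kappa> U where "cutoff_setup gm deg \<Omega> Pper \<nu> u Tu (\<lambda>j. fst (PN j)) (\<lambda>j. snd (PN j)) C \<kappa> U"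
  proof (rule test_cutoffs[OF op])
    fix C \<kappa> U
    assume "\<And>i::nat. compact (C i)" "\<And>i. C i \<subseteq> \<Omega>" "\<And>i. C i \<subseteq> C (Suc i)"
      "\<And>K. compact K \<Longrightarrow> K \<subseteq> \<Omega> \<Longrightarrow> \<exists>N. \<forall>i\<ge>N. K \<subseteq> C i"
      "\<And>i. test_on (interior (C (Suc i))) (\<kappa> i)" "\<And>i x. 0 \<le> \<kappa> i x" "\<And>i x. \<kappa> i x \<le> 1"
      "\<And>i. open (U i)" "\<And>i. C i \<subseteq> U i" "\<And>i x. x \<in> U i \<Longrightarrow> \<kappa> i x = 1"
    then have "cutoff_setup gm deg \<Omega> Pper \<nu> u Tu (\<lambda>j. fst (PN j)) (\<lambda>j. snd (PN j)) C \<kappa> U"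
      by unfold_locales
    then show ?thesis by (rule that)
  qed
  then interpret cutoff_setup gm deg \<Omega> Pper \<nu> u Tu "\<lambda>j. fst (PN j)" "\<lambda>j. snd (PN j)" C \<kappa> U .
  obtain \<epsilon> where "meyers_serrin gm deg \<Omega> Pper \<nu> u Tu (\<lambda>j. fst (PN j)) (\<lambda>j. snd (PN j)) C \<kappa> U \<epsilon>"
  proof -
    obtain \<epsilon> where \<epsilon>: "\<forall>i::nat. 0 < \<epsilon> i \<and> \<epsilon> i \<le> 1 \<and> test_on (V i) (conv (mol (\<epsilon> i)) (\<lambda>y. u y * band \<kappa> i y)) \<and>
      (\<forall>x. \<bar>conv (mol (\<epsilon> i)) (band \<kappa> i) x - band \<kappa> i x\<bar> \<le> (1 / 2) ^ Suc i) \<and>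
      (\<forall>j. (\<integral>\<^sup>+x. ennreal \<bar>conv (mol (\<epsilon> i)) (\<lambda>y. u y * Xop gm j (band \<kappa> i) y) x - u x * Xop gm j (band \<kappa> i) x\<bar> \<partial>lborel)
         \<le> ennreal ((1 / 2) ^ Suc i))"
      using exists_scales by (rule exE)
    have "meyers_serrin gm deg \<Omega> Pper \<nu> u Tu (\<lambda>j. fst (PN j)) (\<lambda>j. snd (PN j)) C \<kappa> U \<epsilon>"
      by unfold_locales (use \<epsilon> in \<open>simp_all del: power_Suc\<close>)
    then show ?thesis by (rule that)
  qed
  then interpret meyers_serrin gm deg \<Omega> Pper \<nu> u Tu "\<lambda>j. fst (PN j)" "\<lambda>j. snd (PN j)" C \<kappa> U \<epsilon> .
  have fin: "fin_meas_on \<Omega> Pd" "fin_meas_on \<Omega> Nd" using dm by (auto simp: divX_meas_def)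
  \<comment> \<open>Both representing measures need the estimate. In the second case the same
    \<open>A\<close> and \<open>B\<close> serve for the negated density, since only the modulus of
    the density enters.\<close>
  from bound have "(\<Sum>i. \<integral>\<^sup>+x. ennreal \<bar>w i x\<bar> \<partial>Pd) < \<infinity> \<and> (\<Sum>i. \<integral>\<^sup>+x. ennreal \<bar>w i x\<bar> \<partial>Nd) < \<infinity>"
  proof (elim disjE exE conjE)
    fix M :: real assume M: "M \<ge> 0" "AE x in lborel. \<bar>u x\<bar> \<le> M"
    show ?thesis using suminf_nn_w_finite_bounded[OF M fin(1)] suminf_nn_w_finite_bounded[OF M fin(2)] by simp
  next
    fix f A B assume eq: "Pd = posm f" "Nd = posm (\<lambda>x. - f x)" and f: "f \<in> borel_measurable borel"
      and AB: "A \<in> borel_measurable borel" "B \<in> borel_measurable borel" "\<forall>x y. \<bar>u y\<bar> * \<bar>f x\<bar> \<le> A y + B x" "\<forall>y. 0 \<le> A y" "\<forall>x. 0 \<le> B x"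
        "(\<integral>\<^sup>+y. ennreal (A y) \<partial>lborel) < \<infinity>" "(\<integral>\<^sup>+y. ennreal (B y) \<partial>lborel) < \<infinity>"
    have "(\<Sum>i. \<integral>\<^sup>+x. ennreal \<bar>w i x\<bar> \<partial>posm f) < \<infinity>"
      by (rule suminf_nn_w_finite_Young[of _ A B]) (use f AB in auto)
    moreover have "(\<Sum>i. \<integral>\<^sup>+x. ennreal \<bar>w i x\<bar> \<partial>posm (\<lambda>x. - f x)) < \<infinity>"
      by (rule suminf_nn_w_finite_Young[of _ A B]) (use f AB in auto)
    ultimately show ?thesis unfolding eq by simp
  qed
  then show ?thesis using gauss_green[OF z dm pm u _ _ nt] by blast
qed

section \<open>Passage to Borel representatives vanishing outside the domain\<close>

lemma borel_version:
  fixes f :: "real^'n \<Rightarrow> real"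
  assumes op: "open \<Omega>" and f: "f \<in> borel_measurable (lebesgue_on \<Omega>)"
  obtains f0 where "f0 \<in> borel_measurable borel" "\<And>x. x \<notin> \<Omega> \<Longrightarrow> f0 x = 0" "AE x in lebesgue. x \<in> \<Omega> \<longrightarrow> f x = f0 x"
proof -
  have "(\<lambda>x. indicator \<Omega> x * f x) \<in> borel_measurable lebesgue"
    using f op by (subst (asm) borel_measurable_restrict_space_iff) (auto simp: mult.commute)
  then obtain g where g: "g \<in> borel_measurable lborel" "AE x in lborel. indicator \<Omega> x * f x = g x"
    using completion_ex_borel_measurable_real[of "\<lambda>x. indicator \<Omega> x * f x" lborel] by blast
  show ?thesis
  proof (rule that[of "\<lambda>x. indicator \<Omega> x * g x"])
    show "(\<lambda>x. indicator \<Omega> x * g x) \<in> borel_measurable borel" using g(1) op by simp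
    show "AE x in lebesgue. x \<in> \<Omega> \<longrightarrow> f x = indicator \<Omega> x * g x"
      using AE_completion[OF g(2)] by eventually_elim auto
  qed simp
qed

lemma integrable_borel_version:
  fixes f :: "real^'n \<Rightarrow> real"
  assumes op: "open \<Omega>" and f: "integrable (lebesgue_on \<Omega>) f"
    and f0: "f0 \<in> borel_measurable borel" "\<And>x. x \<notin> \<Omega> \<Longrightarrow> f0 x = 0" "AE x in lebesgue. x \<in> \<Omega> \<longrightarrow> f x = f0 x"
  shows "integrable lborel f0"
proof -
  have "integrable lebesgue (\<lambda>x. indicator \<Omega> x *\<^sub>R f x)"
    using f op by (subst (asm) integrable_restrict_space) auto
  moreover have "f0 \<in> borel_measurable lebesgue" using f0(1) by (intro measurable_completion) simp
  moreover have "AE x in lebesgue. indicator \<Omega> x *\<^sub>R f x = f0 x"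
    using f0(3) by eventually_elim (auto simp: f0(2) indicator_def)
  ultimately have "integrable lebesgue f0"
    using integrable_cong_AE by (metis borel_measurable_integrable)
  then show ?thesis using f0(1) by (simp add: integrable_completion)
qed

lemma set_integral_borel_version:
  fixes f :: "real^'n \<Rightarrow> real"
  assumes op: "open \<Omega>" and f: "f \<in> borel_measurable (lebesgue_on \<Omega>)"
    and f0: "f0 \<in> borel_measurable borel" "AE x in lebesgue. x \<in> \<Omega> \<longrightarrow> f x = f0 x"
    and F: "(\<lambda>x. indicator \<Omega> x * F x) \<in> borel_measurable lebesgue"
  shows "(LINT x:\<Omega>|lebesgue. f x * F x) = (LINT x:\<Omega>|lebesgue. f0 x * F x)"
  unfolding set_lebesgue_integral_def
proof (rule integral_cong_AE)
  have fm: "(\<lambda>x. indicator \<Omega> x * f x) \<in> borel_measurable lebesgue"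
    using f op by (subst (asm) borel_measurable_restrict_space_iff) (auto simp: mult.commute)
  have f0m: "f0 \<in> borel_measurable lebesgue" using f0(1) by (intro measurable_completion) simp
  have "(\<lambda>x. indicator \<Omega> x *\<^sub>R (f x * F x)) = (\<lambda>x. (indicator \<Omega> x * f x) * (indicator \<Omega> x * F x))"
    by (auto simp: indicator_def)
  then show "(\<lambda>x. indicator \<Omega> x *\<^sub>R (f x * F x)) \<in> borel_measurable lebesgue"
    using borel_measurable_times[OF fm F] by (simp only:)
  have "(\<lambda>x. indicator \<Omega> x *\<^sub>R (f0 x * F x)) = (\<lambda>x. f0 x * (indicator \<Omega> x * F x))"
    by (auto simp: indicator_def)
  then show "(\<lambda>x. indicator \<Omega> x *\<^sub>R (f0 x * F x)) \<in> borel_measurable lebesgue"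
    using borel_measurable_times[OF f0m F] by (simp only:)
  show "AE x in lebesgue. indicator \<Omega> x *\<^sub>R (f x * F x) = indicator \<Omega> x *\<^sub>R (f0 x * F x)"
    using f0(2) by eventually_elim (auto simp: indicator_def)
qed

lemma indicator_mult_measurable:
  fixes F :: "real^'n \<Rightarrow> real"
  assumes "open \<Omega>" "F \<in> borel_measurable borel" shows "(\<lambda>x. indicator \<Omega> x * F x) \<in> borel_measurable lebesgue"
  using assms by (intro measurable_completion) simp

context carnot
begin

lemma divX_measurable:
  assumes "\<forall>j\<in>Hor deg. test_on A (g j)" shows "divX gm deg g \<in> borel_measurable borel"
  unfolding divX_def[abs_def] using assms by (intro borel_measurable_sum test_on_measurable[OF test_on_Xop]) blast

lemma z_sum_measurable:
  assumes op: "open \<Omega>" and z: "\<forall>j\<in>Hor deg. Linf_on \<Omega> (\<lambda>x. z x $ j)" and \<phi>: "test_on A \<phi>"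
  shows "(\<lambda>x. indicator \<Omega> x * (\<Sum>j\<in>Hor deg. z x $ j * Xop gm j \<phi> x)) \<in> borel_measurable lebesgue"
proof -
  have "(\<lambda>x. \<Sum>j\<in>Hor deg. (indicator \<Omega> x * z x $ j) * Xop gm j \<phi> x) \<in> borel_measurable lebesgue"
  proof (rule borel_measurable_sum, rule borel_measurable_times)
    fix j assume "j \<in> Hor deg"
    then show "(\<lambda>x. indicator \<Omega> x * z x $ j) \<in> borel_measurable lebesgue"
      using Linf_on_extend[OF op bspec[OF z]] by blast
    show "Xop gm j \<phi> \<in> borel_measurable lebesgue"
      using test_on_measurable[OF test_on_Xop[OF \<phi>]] by (intro measurable_completion) simp
  qed
  then show ?thesis by (simp add: sum_distrib_left mult.assoc)
qed

text \<open>The function enters the definition only through integrals over \<open>\<Omega>\<close>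
  with respect to Lebesgue measure, and these ignore a change on a null set; derivative measures and
  trace can be kept.\<close>

lemma is_trace_borel_version:
  assumes op: "open \<Omega>" and u: "u \<in> borel_measurable (lebesgue_on \<Omega>)"
    and u0: "u0 \<in> borel_measurable borel" "AE x in lebesgue. x \<in> \<Omega> \<longrightarrow> u x = u0 x"
    and tr: "is_trace gm deg \<Omega> Pper \<nu> u t"
  shows "is_trace gm deg \<Omega> Pper \<nu> u0 t"
proof -
  note V = set_integral_borel_version[OF op u u0]
  have X: "(LINT x:\<Omega>|lebesgue. u x * Xop gm j \<phi> x) = (LINT x:\<Omega>|lebesgue. u0 x * Xop gm j \<phi> x)" if "test_on \<Omega> \<phi>" for j \<phi>
    by (rule V) (intro indicator_mult_measurable op test_on_measurable[OF test_on_Xop[OF that]])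
  have D: "(LINT x:\<Omega>|lebesgue. u x * divX gm deg g x) = (LINT x:\<Omega>|lebesgue. u0 x * divX gm deg g x)"
    if "\<forall>j\<in>Hor deg. test_on UNIV (g j)" for g
    by (rule V) (intro indicator_mult_measurable op divX_measurable[OF that])
  have Xd: "Xderiv_meas gm \<Omega> j u0 P N" if "Xderiv_meas gm \<Omega> j u P N" for j P N
    using that unfolding Xderiv_meas_def by (simp add: X)
  obtain PN where PN: "\<forall>j\<in>Hor deg. Xderiv_meas gm \<Omega> j u (fst (PN j)) (snd (PN j))"
    "\<forall>g. (\<forall>j\<in>Hor deg. test_on UNIV (g j)) \<longrightarrow> (LINT x:\<Omega>|lebesgue. u x * divX gm deg g x)
             = - (\<Sum>j\<in>Hor deg. (LINT x:\<Omega>|fst (PN j). g j x) - (LINT x:\<Omega>|snd (PN j). g j x))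
               - (LINT x|Pper. t x * (\<Sum>j\<in>Hor deg. g j x * \<nu> x $ j))"
    using tr unfolding is_trace_def by blast
  show ?thesis
    unfolding is_trace_def
  proof (intro conjI exI[of _ PN] ballI allI impI)
    show "t \<in> borel_measurable Pper" "integrable Pper t" using tr by (simp_all add: is_trace_def)
    show "Xderiv_meas gm \<Omega> j u0 (fst (PN j)) (snd (PN j))" if "j \<in> Hor deg" for j using PN(1) that Xd by blast
    fix g :: "'n \<Rightarrow> real^'n \<Rightarrow> real" assume g: "\<forall>j\<in>Hor deg. test_on UNIV (g j)"
    show "(LINT x:\<Omega>|lebesgue. u0 x * divX gm deg g x)
             = - (\<Sum>j\<in>Hor deg. (LINT x:\<Omega>|fst (PN j). g j x) - (LINT x:\<Omega>|snd (PN j). g j x))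
               - (LINT x|Pper. t x * (\<Sum>j\<in>Hor deg. g j x * \<nu> x $ j))"
      using PN(2) g unfolding D[OF g, symmetric] by blast
  qed
qed

end

theorem theorem3p6:
  fixes gm :: "real^'n \<Rightarrow> real^'n \<Rightarrow> real^'n" and deg :: "'n \<Rightarrow> nat"
    and \<Omega> :: "(real^'n) set" and u :: "real^'n \<Rightarrow> real" and z :: "real^'n \<Rightarrow> real^'n"
    and Pper :: "(real^'n) measure" and \<nu> :: "real^'n \<Rightarrow> real^'n"
    and Tu :: "real^'n \<Rightarrow> real" and \<theta> :: "real^'n \<Rightarrow> real"
  assumes G: "carnot_group gm deg"
    and op: "open \<Omega>" and bd: "bounded \<Omega>" and lip: "X_lipschitz_domain gm deg \<Omega>"
    and per: "perimeter_measure gm deg \<Omega> Pper \<nu>"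
    and tr: "is_trace gm deg \<Omega> Pper \<nu> u Tu"
    and nt: "weak_normal_trace gm deg \<Omega> Pper \<nu> z \<theta>"
  shows
    "(\<forall>f. DM_X gm deg \<Omega> z \<and> divX_density gm deg \<Omega> z f \<and>
          ((BV_X gm deg \<Omega> u \<and> Linf_on \<Omega> u \<and> integrable (lebesgue_on \<Omega>) f)
           \<or> (\<exists>p q::real. 1 < p \<and> p \<le> real CARD('n) \<and> 1 / p + 1 / q = 1 \<and>
                BV_X gm deg \<Omega> u \<and> Lp_on \<Omega> q u \<and> Lp_on \<Omega> p f))
        \<longrightarrow> (\<forall>Pm Nm. pairing_meas gm deg \<Omega> u z (\<lambda>g. LINT x:\<Omega>|lebesgue. g x * f x) Pm Nm \<longrightarrow>
              (LINT x:\<Omega>|lebesgue. u x * f x) + (measure Pm \<Omega> - measure Nm \<Omega>)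
                = (LINT x|Pper. \<theta> x * Tu x)))
     \<and> (\<forall>Pd Nd. BVc_X gm deg \<Omega> u \<and> DM_X gm deg \<Omega> z \<and> divX_meas gm deg \<Omega> z Pd Nd
        \<longrightarrow> (\<forall>Pm Nm. pairing_meas gm deg \<Omega> u z
                 (\<lambda>g. (LINT x:\<Omega>|Pd. g x) - (LINT x:\<Omega>|Nd. g x)) Pm Nm \<longrightarrow>
              ((LINT x:\<Omega>|Pd. u x) - (LINT x:\<Omega>|Nd. u x)) + (measure Pm \<Omega> - measure Nm \<Omega>)
                = (LINT x|Pper. \<theta> x * Tu x)))"
  proof (intro conjI allI impI)
  interpret carnot gm deg by standard (rule G)
  {
    fix f Pm Nm
    assume asm: "DM_X gm deg \<Omega> z \<and> divX_density gm deg \<Omega> z f \<and>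
          ((BV_X gm deg \<Omega> u \<and> Linf_on \<Omega> u \<and> integrable (lebesgue_on \<Omega>) f)
           \<or> (\<exists>p q::real. 1 < p \<and> p \<le> real CARD('n) \<and> 1 / p + 1 / q = 1 \<and>
                BV_X gm deg \<Omega> u \<and> Lp_on \<Omega> q u \<and> Lp_on \<Omega> p f))"
      and pm: "pairing_meas gm deg \<Omega> u z (\<lambda>g. LINT x:\<Omega>|lebesgue. g x * f x) Pm Nm"
    have z: "\<forall>j\<in>Hor deg. Linf_on \<Omega> (\<lambda>x. z x $ j)" using asm by (simp add: DM_X_def)
    have uL: "integrable (lebesgue_on \<Omega>) u" using asm by (auto simp: BV_X_def)
    then have um: "u \<in> borel_measurable (lebesgue_on \<Omega>)" by auto
    have fm: "f \<in> borel_measurable (lebesgue_on \<Omega>)" using asm by (simp add: divX_density_def)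
    obtain u0 where u0: "u0 \<in> borel_measurable borel" "\<And>x. x \<notin> \<Omega> \<Longrightarrow> u0 x = 0" "AE x in lebesgue. x \<in> \<Omega> \<longrightarrow> u x = u0 x"
      using borel_version[OF op um] by blast
    obtain f0 where f0: "f0 \<in> borel_measurable borel" "\<And>x. x \<notin> \<Omega> \<Longrightarrow> f0 x = 0" "AE x in lebesgue. x \<in> \<Omega> \<longrightarrow> f x = f0 x"
      using borel_version[OF op fm] by blast
    note [measurable] = u0(1) f0(1)
    note uV = set_integral_borel_version[OF op um u0(1,3)] and fV = set_integral_borel_version[OF op fm f0(1,3)]
    have u0i: "integrable lborel u0" by (rule integrable_borel_version[OF op uL u0])
    \<comment> \<open>Conditions (a) and (b) are brought into the form of \<open>bound\<close> in
      \<open>gauss_green_borel\<close>, together with the integrability of the density and of its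
      product with \<open>u0\<close>.\<close>
    have key: "integrable lborel f0 \<and> integrable lborel (\<lambda>x. f0 x * u0 x) \<and>
      ((\<exists>M\<ge>0. AE x in lborel. \<bar>u0 x\<bar> \<le> M) \<or>
      (\<exists>A B. A \<in> borel_measurable borel \<and> B \<in> borel_measurable borel \<and>
         (\<forall>x y. \<bar>u0 y\<bar> * \<bar>f0 x\<bar> \<le> A y + B x) \<and> (\<forall>y. 0 \<le> A y) \<and> (\<forall>x. 0 \<le> B x) \<and>
         (\<integral>\<^sup>+y. ennreal (A y) \<partial>lborel) < \<infinity> \<and> (\<integral>\<^sup>+y. ennreal (B y) \<partial>lborel) < \<infinity>))"
    proof (cases "Linf_on \<Omega> u \<and> integrable (lebesgue_on \<Omega>) f")
      case True
      then obtain C where "AE x in lebesgue_on \<Omega>. \<bar>u x\<bar> \<le> C" by (auto simp: Linf_on_def)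
      then have "AE x in lebesgue. x \<in> \<Omega> \<longrightarrow> \<bar>u x\<bar> \<le> C"
        using op by (subst (asm) AE_restrict_space_iff) auto
      with u0(3) have "AE x in lebesgue. \<bar>u0 x\<bar> \<le> \<bar>C\<bar>"
      proof eventually_elim
        case (elim x)
        then show ?case by (cases "x \<in> \<Omega>") (auto simp: u0(2))
      qed
      then have b: "AE x in lborel. \<bar>u0 x\<bar> \<le> \<bar>C\<bar>" by (simp add: AE_completion_iff)
      have f0i: "integrable lborel f0" by (rule integrable_borel_version[OF op _ f0]) (use True in simp)
      have "integrable lborel (\<lambda>x. f0 x * u0 x)" by (rule integrable_mult_AE_bounded[OF f0i _ b]) simp
      then show ?thesis using f0i b by (intro conjI disjI1 exI[of _ "\<bar>C\<bar>"]) auto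
    next
      case False
      then obtain p q :: real where p: "1 < p" "1 / p + 1 / q = 1" and L: "Lp_on \<Omega> q u" "Lp_on \<Omega> p f"
        using asm by blast
      have "1 / q = 1 - 1 / p" using p by simp
      moreover have "0 < 1 - 1 / p" "1 - 1 / p < 1" using p by auto
      ultimately have "0 < 1 / q" "1 / q < 1" by simp_all
      then have q: "q > 1" by (metis divide_less_eq_1_pos zero_less_divide_1_iff)
      \<comment> \<open>Young's inequality bounds the product by A/q + B/p, and both exponents
        exceed 1.\<close>
      define A where "A y = \<bar>u0 y\<bar> powr q" for y
      define B where "B x = \<bar>f0 x\<bar> powr p" for x
      have [measurable]: "A \<in> borel_measurable borel" "B \<in> borel_measurable borel"
        unfolding A_def[abs_def] B_def[abs_def] by measurable
      have "AE x in lebesgue. x \<in> \<Omega> \<longrightarrow> \<bar>u x\<bar> powr q = A x" using u0(3) by eventually_elim (simp add: A_def)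
      then have Ai: "integrable lborel A"
        by (intro integrable_borel_version[OF op, of "\<lambda>x. \<bar>u x\<bar> powr q"]) (use L u0 in \<open>auto simp: Lp_on_def A_def\<close>)
      have "AE x in lebesgue. x \<in> \<Omega> \<longrightarrow> \<bar>f x\<bar> powr p = B x" using f0(3) by eventually_elim (simp add: B_def)
      then have Bi: "integrable lborel B"
        by (intro integrable_borel_version[OF op, of "\<lambda>x. \<bar>f x\<bar> powr p"]) (use L f0 in \<open>auto simp: Lp_on_def B_def\<close>)
      have AB: "0 \<le> A y" "0 \<le> B y" for y by (auto simp: A_def B_def)
      have Y: "\<bar>u0 y\<bar> * \<bar>f0 x\<bar> \<le> A y + B x" for x y
      proof -
        have "\<bar>u0 y\<bar> * \<bar>f0 x\<bar> \<le> A y / q + B x / p"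
          unfolding A_def B_def using p q by (intro Youngs_inequality) auto
        moreover have "A y * 1 \<le> A y * q" "B x * 1 \<le> B x * p"
          using p q by (intro mult_left_mono AB; simp)+
        then have "A y / q \<le> A y" "B x / p \<le> B x" using p q by (simp_all add: divide_le_eq)
        ultimately show ?thesis by linarith
      qed
      have i\<Omega>: "integrable lborel (indicator \<Omega> :: real^'n \<Rightarrow> real)"
        using emeasure_bounded_finite[OF bd] op by (intro integrable_real_indicator) auto
      \<comment> \<open>The modulus is at most 1 on \<open>\<Omega>\<close> or at most its p-th
        power, and the bounded set \<open>\<Omega>\<close> has finite measure.\<close>
      have f0i: "integrable lborel f0"
      proof (rule Bochner_Integration.integrable_bound[OF Bochner_Integration.integrable_add[OF i\<Omega> Bi]])
        show "AE x in lborel. norm (f0 x) \<le> norm (indicator \<Omega> x + B x)"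
        proof (rule AE_I2)
          fix x
          show "norm (f0 x) \<le> norm (indicator \<Omega> x + B x)"
          proof (cases "x \<in> \<Omega> \<and> 1 < \<bar>f0 x\<bar>")
            case True
            then have "\<bar>f0 x\<bar> powr 1 \<le> \<bar>f0 x\<bar> powr p" using p by (intro powr_mono) auto
            then show ?thesis using True AB(2)[of x] by (simp add: B_def)
          next
            case False
            then show ?thesis using AB(2)[of x] f0(2)[of x] by (cases "x \<in> \<Omega>") auto
          qed
        qed
      qed simp
      have "integrable lborel (\<lambda>x. f0 x * u0 x)"
      proof (rule Bochner_Integration.integrable_bound[OF Bochner_Integration.integrable_add[OF Ai Bi]])
        show "AE x in lborel. norm (f0 x * u0 x) \<le> norm (A x + B x)"
          using Y AB by (intro AE_I2) (simp add: abs_mult mult.commute)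
      qed simp
      moreover have "(\<integral>\<^sup>+y. ennreal (A y) \<partial>lborel) < \<infinity>" "(\<integral>\<^sup>+y. ennreal (B y) \<partial>lborel) < \<infinity>"
        using Ai Bi AB by (auto simp: integrable_iff_bounded)
      ultimately show ?thesis using f0i Y AB by (intro conjI disjI2 exI[of _ A] exI[of _ B]) auto
    qed
    then have f0i: "integrable lborel f0" and fu: "integrable lborel (\<lambda>x. f0 x * u0 x)" by auto
    have fin: "fin_meas_on \<Omega> (posm f0)" "fin_meas_on \<Omega> (posm (\<lambda>x. - f0 x))"
      using f0i f0(2) op by (auto intro!: posm_fin_meas_on)
    have D: "(LINT x:\<Omega>|posm f0. g x) - (LINT x:\<Omega>|posm (\<lambda>x. - f0 x). g x) = (LINT x:\<Omega>|lebesgue. f x * g x)"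
      if [measurable]: "g \<in> borel_measurable borel" and "integrable lborel (\<lambda>x. f0 x * g x)" for g
    proof -
      have "(LINT x:\<Omega>|lebesgue. f x * g x) = (LINT x:\<Omega>|lebesgue. f0 x * g x)"
        by (intro fV indicator_mult_measurable op that)
      also have "\<dots> = (\<integral>x. f0 x * g x \<partial>lborel)" by (rule set_integral_lebesgue_eq) (auto simp: f0(2))
      finally show ?thesis
        using posm_integrable(3)[OF f0(1) that]
        by (simp add: fin_meas_on_set_integral[OF fin(1) op that(1)] fin_meas_on_set_integral[OF fin(2) op that(1)])
    qed
    \<comment> \<open>\<open>weak_normal_trace\<close> quantifies over all pairs of measures
      representing the divergence, so the pair built from the density may be used.\<close>
    have dm: "divX_meas gm deg \<Omega> z (posm f0) (posm (\<lambda>x. - f0 x))"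
      unfolding divX_meas_def
    proof (intro conjI fin allI impI)
      fix \<phi> assume \<phi>: "test_on \<Omega> \<phi>"
      show "(LINT x:\<Omega>|posm f0. \<phi> x) - (LINT x:\<Omega>|posm (\<lambda>x. - f0 x). \<phi> x) = - (LINT x:\<Omega>|lebesgue. (\<Sum>j\<in>Hor deg. z x $ j * Xop gm j \<phi> x))"
        using D[OF test_on_measurable[OF \<phi>] test_mult_integrable[OF f0i \<phi>]] asm \<phi> unfolding divX_density_def by simp
    qed
    have pm0: "pairing_meas gm deg \<Omega> u0 z (\<lambda>g. (LINT x:\<Omega>|posm f0. g x) - (LINT x:\<Omega>|posm (\<lambda>x. - f0 x). g x)) Pm Nm"
      unfolding pairing_meas_def
    proof (intro conjI allI impI)
      show "fin_meas_on \<Omega> Pm" "fin_meas_on \<Omega> Nm" using pm by (auto simp: pairing_meas_def)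
      fix \<phi> assume \<phi>: "test_on \<Omega> \<phi>"
      have \<phi>m[measurable]: "\<phi> \<in> borel_measurable borel" by (rule test_on_measurable[OF \<phi>])
      have i: "integrable lborel (\<lambda>x. f0 x * (u0 x * \<phi> x))"
        using test_mult_integrable[OF fu \<phi>] by (simp add: mult.assoc)
      have "(\<lambda>x. \<phi> x * (indicator \<Omega> x * f x)) \<in> borel_measurable lebesgue"
        using fm op measurable_completion[of \<phi> lborel borel]
        by (subst (asm) borel_measurable_restrict_space_iff) (auto simp: mult.commute)
      then have m: "(\<lambda>x. indicator \<Omega> x * (\<phi> x * f x)) \<in> borel_measurable lebesgue" by (simp add: mult.left_commute)
      have "(LINT x:\<Omega>|lebesgue. (u x * \<phi> x) * f x) = (LINT x:\<Omega>|lebesgue. u x * (\<phi> x * f x))" by (simp add: mult.assoc)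
      also have "\<dots> = (LINT x:\<Omega>|lebesgue. u0 x * (\<phi> x * f x))" by (rule uV[OF m])
      also have "\<dots> = (LINT x:\<Omega>|lebesgue. f x * (u0 x * \<phi> x))" by (simp add: mult_ac)
      also have "\<dots> = (LINT x:\<Omega>|posm f0. u0 x * \<phi> x) - (LINT x:\<Omega>|posm (\<lambda>x. - f0 x). u0 x * \<phi> x)"
        by (rule D[OF _ i, symmetric]) simp
      finally have e1: "(LINT x:\<Omega>|lebesgue. (u x * \<phi> x) * f x) = (LINT x:\<Omega>|posm f0. u0 x * \<phi> x) - (LINT x:\<Omega>|posm (\<lambda>x. - f0 x). u0 x * \<phi> x)" .
      have e2: "(LINT x:\<Omega>|lebesgue. u x * (\<Sum>j\<in>Hor deg. z x $ j * Xop gm j \<phi> x)) = (LINT x:\<Omega>|lebesgue. u0 x * (\<Sum>j\<in>Hor deg. z x $ j * Xop gm j \<phi> x))"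
        by (rule uV[OF z_sum_measurable[OF op z \<phi>]])
      show "(LINT x:\<Omega>|Pm. \<phi> x) - (LINT x:\<Omega>|Nm. \<phi> x) =
        - ((LINT x:\<Omega>|posm f0. u0 x * \<phi> x) - (LINT x:\<Omega>|posm (\<lambda>x. - f0 x). u0 x * \<phi> x))
        - (LINT x:\<Omega>|lebesgue. u0 x * (\<Sum>j\<in>Hor deg. z x $ j * Xop gm j \<phi> x))"
        using pm \<phi> unfolding pairing_meas_def e1[symmetric] e2[symmetric] by blast
    qed
    have "(\<integral>x. u0 x \<partial>posm f0) - (\<integral>x. u0 x \<partial>posm (\<lambda>x. - f0 x)) + (measure Pm \<Omega> - measure Nm \<Omega>) = (\<integral>x. \<theta> x * Tu x \<partial>Pper)"
    proof (rule gauss_green_borel[OF G op bd per is_trace_borel_version[OF op um u0(1,3) tr] nt u0i u0(2) z dm pm0])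
      show "integrable (posm f0) u0" "integrable (posm (\<lambda>x. - f0 x)) u0"
        by (rule posm_integrable[OF f0(1) u0(1) fu])+
      show "(\<exists>M\<ge>0. AE x in lborel. \<bar>u0 x\<bar> \<le> M) \<or>
      (\<exists>f A B. posm f0 = posm f \<and> posm (\<lambda>x. - f0 x) = posm (\<lambda>x. - f x) \<and> f \<in> borel_measurable borel \<and>
         A \<in> borel_measurable borel \<and> B \<in> borel_measurable borel \<and>
         (\<forall>x y. \<bar>u0 y\<bar> * \<bar>f x\<bar> \<le> A y + B x) \<and> (\<forall>y. 0 \<le> A y) \<and> (\<forall>x. 0 \<le> B x) \<and>
         (\<integral>\<^sup>+y. ennreal (A y) \<partial>lborel) < \<infinity> \<and> (\<integral>\<^sup>+y. ennreal (B y) \<partial>lborel) < \<infinity>)"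
        using key f0(1) by blast
    qed
    moreover have "(\<integral>x. u0 x \<partial>posm f0) - (\<integral>x. u0 x \<partial>posm (\<lambda>x. - f0 x)) = (LINT x:\<Omega>|lebesgue. u x * f x)"
    proof -
      have "(LINT x:\<Omega>|lebesgue. u x * f x) = (LINT x:\<Omega>|lebesgue. u0 x * f x)"
        using fm op by (intro uV, subst (asm) borel_measurable_restrict_space_iff) (auto simp: mult.commute)
      also have "\<dots> = (LINT x:\<Omega>|lebesgue. f x * u0 x)" by (simp add: mult.commute)
      also have "\<dots> = (LINT x:\<Omega>|posm f0. u0 x) - (LINT x:\<Omega>|posm (\<lambda>x. - f0 x). u0 x)" by (rule D[OF u0(1) fu, symmetric])
      finally show ?thesis
        by (simp add: fin_meas_on_set_integral[OF fin(1) op u0(1)] fin_meas_on_set_integral[OF fin(2) op u0(1)])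
    qed
    ultimately show "(LINT x:\<Omega>|lebesgue. u x * f x) + (measure Pm \<Omega> - measure Nm \<Omega>) = (LINT x|Pper. \<theta> x * Tu x)" by simp
  next
    fix Pd Nd Pm Nm
    assume asm: "BVc_X gm deg \<Omega> u \<and> DM_X gm deg \<Omega> z \<and> divX_meas gm deg \<Omega> z Pd Nd"
      and pm: "pairing_meas gm deg \<Omega> u z (\<lambda>g. (LINT x:\<Omega>|Pd. g x) - (LINT x:\<Omega>|Nd. g x)) Pm Nm"
    have z: "\<forall>j\<in>Hor deg. Linf_on \<Omega> (\<lambda>x. z x $ j)" using asm by (simp add: DM_X_def)
    have dm: "divX_meas gm deg \<Omega> z Pd Nd" using asm by simp
    then have fin: "fin_meas_on \<Omega> Pd" "fin_meas_on \<Omega> Nd" by (auto simp: divX_meas_def)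
    have uL: "integrable (lebesgue_on \<Omega>) u" and uc: "continuous_on \<Omega> u" using asm by (auto simp: BVc_X_def BV_X_def)
    then have um: "u \<in> borel_measurable (lebesgue_on \<Omega>)" by auto
    \<comment> \<open>Under (c) the divergence may charge null sets, so the representative must
      agree with \<open>u\<close> everywhere on \<open>\<Omega>\<close>; continuity makes this
      extension by zero Borel.\<close>
    define u0 where "u0 x = indicator \<Omega> x * u x" for x
    have u0m[measurable]: "u0 \<in> borel_measurable borel"
      using borel_measurable_continuous_on_indicator[OF _ uc] op by (simp add: u0_def[abs_def])
    have u0z: "u0 x = 0" if "x \<notin> \<Omega>" for x using that by (simp add: u0_def)
    have u0e: "AE x in lebesgue. x \<in> \<Omega> \<longrightarrow> u x = u0 x" by (simp add: u0_def)
    have u0i: "integrable lborel u0" by (rule integrable_borel_version[OF op uL u0m u0z u0e])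
    \<comment> \<open>For a continuous function the essential bound holds at every point: the set
      where it fails is open and Lebesgue null, hence empty. The pointwise bound is needed for
      integrability against the divergence measures.\<close>
    obtain M where M: "\<And>x. \<bar>u0 x\<bar> \<le> M"
    proof -
      obtain C where "AE x in lebesgue_on \<Omega>. \<bar>u x\<bar> \<le> C" using asm by (auto simp: BVc_X_def Linf_on_def)
      then have ae: "AE x in lebesgue. x \<in> \<Omega> \<longrightarrow> \<bar>u x\<bar> \<le> C"
        using op by (subst (asm) AE_restrict_space_iff) auto
      define S where "S = {x\<in>\<Omega>. C < \<bar>u x\<bar>}"
      have "S = \<Omega> \<inter> (\<lambda>x. \<bar>u x\<bar>) -` {C<..}" by (auto simp: S_def)
      then have So: "open S" using uc op by (simp add: continuous_open_preimage continuous_on_rabs)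
      have "S = {}"
      proof (rule ccontr)
        assume "S \<noteq> {}"
        then have "\<not> negligible S" by (rule open_not_negligible[OF So])
        moreover have "S \<in> null_sets lebesgue"
          using ae So by (subst (asm) AE_iff_null[symmetric, THEN sym]) (auto simp: S_def not_le)
        ultimately show False by (simp add: negligible_iff_null_sets)
      qed
      then have "\<bar>u0 x\<bar> \<le> \<bar>C\<bar>" for x by (force simp: u0_def S_def indicator_def)
      then show ?thesis by (rule that)
    qed
    have ui: "integrable Q u0" if Q: "fin_meas_on \<Omega> Q" for Q
    proof -
      have s: "sets Q = sets borel" and f: "finite_measure Q" using Q by (auto simp: fin_meas_on_def)
      have "u0 \<in> borel_measurable Q" unfolding measurable_cong_sets[OF s refl] by (rule u0m)
      then show ?thesis by (rule finite_measure.integrable_const_bound[OF f, where B=M, rotated]) (use M in simp)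
    qed
    have set_eq: "(LINT x:\<Omega>|Q. u x * F x) = (LINT x:\<Omega>|Q. u0 x * F x)" for Q F
      unfolding set_lebesgue_integral_def by (intro Bochner_Integration.integral_cong refl) (simp add: u0_def indicator_def)
    have set_eq1: "(LINT x:\<Omega>|Q. u x) = (\<integral>x. u0 x \<partial>Q)" for Q
      unfolding set_lebesgue_integral_def by (simp add: u0_def)
    have pm0: "pairing_meas gm deg \<Omega> u0 z (\<lambda>g. (LINT x:\<Omega>|Pd. g x) - (LINT x:\<Omega>|Nd. g x)) Pm Nm"
      using pm unfolding pairing_meas_def set_eq .
    have "(\<integral>x. u0 x \<partial>Pd) - (\<integral>x. u0 x \<partial>Nd) + (measure Pm \<Omega> - measure Nm \<Omega>) = (\<integral>x. \<theta> x * Tu x \<partial>Pper)"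
    proof (rule gauss_green_borel[OF G op bd per is_trace_borel_version[OF op um u0m u0e tr] nt u0i u0z z dm pm0 ui[OF fin(1)] ui[OF fin(2)]])
      have "0 \<le> M" using M[of 0] by linarith
      then have "\<exists>M\<ge>0. AE x in lborel. \<bar>u0 x\<bar> \<le> M" using M by auto
      then show "(\<exists>M\<ge>0. AE x in lborel. \<bar>u0 x\<bar> \<le> M) \<or>
      (\<exists>f A B. Pd = posm f \<and> Nd = posm (\<lambda>x. - f x) \<and> f \<in> borel_measurable borel \<and>
         A \<in> borel_measurable borel \<and> B \<in> borel_measurable borel \<and>
         (\<forall>x y. \<bar>u0 y\<bar> * \<bar>f x\<bar> \<le> A y + B x) \<and> (\<forall>y. 0 \<le> A y) \<and> (\<forall>x. 0 \<le> B x) \<and>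
         (\<integral>\<^sup>+y. ennreal (A y) \<partial>lborel) < \<infinity> \<and> (\<integral>\<^sup>+y. ennreal (B y) \<partial>lborel) < \<infinity>)" by (rule disjI1)
    qed
    then show "(LINT x:\<Omega>|Pd. u x) - (LINT x:\<Omega>|Nd. u x) + (measure Pm \<Omega> - measure Nm \<Omega>) = (LINT x|Pper. \<theta> x * Tu x)"
      by (simp add: set_eq1)
  }
qed

end
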